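(* There is an absolute constant $\bar\varepsilon_7>0$ such that the following holds for $0<\varepsilon=\frac13-\alpha\le\bar\varepsilon_7$. Suppose that $\omega$ (odd in $z$) satisfies $\|\omega\|_{L^\infty_\Gamma}+\|\omega\|_{\dot{\mathcal W}^{1,\infty}_{r,\Gamma}}+\|\omega\|_{\dot{\mathcal W}^{1,\infty}_{z,\Gamma}}\le\varepsilon^{\frac{1+\kappa}2}$, let $\mathbf Q=(Q^r,Q^z)$ be the vector field associated with $\omega$, and let $X(s,\mathbf x)$ be its flow map, $\frac d{ds}X(s,\mathbf x)=\mathbf Q(X(s,\mathbf x))$, $X(0,\mathbf x)=\mathbf x$. Suppose $f,g$ are functions such that $$g\in C^1(D),\qquad f,\ \tfrac1rg,\ r^{-1}z\,\partial_zg\in C^0(D),\qquad\tfrac d{ds}f(X(s,\mathbf x))\in C^0([-T,T]\times D),\qquad g(0,z)=0,$$ for any compact domain $D\subset(\mathbb R_+\times\mathbb R)\setminus\{z=0\}$ and any $T>0$. Then for $\mathbf x=(r,z)$ with $z\ne0$ and any $\tau>0$, writing $X_s=X(s,\mathbf x)$, $$\int_{-\tau}^0(\partial_rg\cdot f)\circ X_s\,ds=-\int_{-\tau}^0\Big[\Big(\frac{Q^z}{Q^r}\,\partial_zg\cdot f\Big)\circ X_s+g\circ X_s\cdot\frac d{ds}\Big(\frac f{Q^r}\circ X_s\Big)\Big]ds+\frac{fg}{Q^r}\circ X_s\Big|_{s=-\tau}^{s=0}.$$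
   Context: Notation: $\mathbf x=(r,z)\in\mathbb R_+\times\mathbb R$ ($r\ge0$), $\langle x\rangle=(1+|x|^2)^{1/2}$, $\log_+x=\log(x+2)$. Constants: $\kappa=\frac14(2^{4/3}-\frac23+2)<1$, $\kappa_1=\frac{1-\kappa}{1000}$, $\kappa_{ag}=\frac1{1000}$, $\kappa_{\mathsf O}=1.2$. $\lesssim,\asymp$ have constants independent of $\alpha,\varepsilon$. 1D profiles (given, fixed objects). An $\alpha$-profile is a nontrivial odd smooth $W$ on $\mathbb R$ solving $2VW'=(3-\alpha-(1-\alpha)V')W$, $V(x)=x+\int_0^\infty(|x+y|^\alpha-|x-y|^\alpha-2\alpha xy^{\alpha-1})W(y)dy$. $\bar W_{1/3}$ is a fixed $C^\infty$ $\frac13$-profile with $\bar W_{1/3}\le0$ and $|\bar W_{1/3}|\asymp\min(|x|,\langle x\rangle^{-1/3})$ on $x\ge0$. For $\varepsilon$ small there are an exponent $\beta=\beta(\alpha)=-\frac\varepsilon8+O(\varepsilon^{4/3})\in[-\frac\varepsilon2,0]$, an absolute constant $c_W>0$, and a fixed $C^\infty$ $\alpha$-profile $\bar W_\alpha$ with $\bar W_\alpha<0$ on $x>0$, $\bar W'_\alpha(0)=\bar W_{1/3}'(0)$, $\min(|x|,|x|^{-\hat\alpha_u})\lesssim|\bar W_\alpha|\lesssim\min(|x|,|x|^{-\hat\alpha_l})$, $|\partial_x^k\bar W_\alpha|\lesssim_k\langle x\rangle^{-k-\hat\alpha_l}$, and $\|(\bar W_\alpha-\langle x\rangle^\beta\bar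 W_{1/3})(|x|^{-1.2}+|x|^{1/3-\beta-\kappa_1\varepsilon}\langle J\rangle^{-\kappa})\|_{L^\infty}\lesssim\varepsilon$, where $\hat\alpha_l=\frac13+\frac\varepsilon8-c_W\varepsilon^{2-\kappa}$, $\hat\alpha_u=\frac13+\frac\varepsilon8+c_W\varepsilon^{2-\kappa}$, $J(x)=\int_0^xy^{\alpha-1}\langle y\rangle^\beta\bar W_{1/3}(y)dy$, $\langle J\rangle=(1+J^2)^{1/2}\asymp\min(\log_+x,\varepsilon^{-1})$. Put $\varepsilon_2=\kappa_1\varepsilon-c_W\varepsilon^{2-\kappa}$. Biot–Savart: $\psi=\mathsf{BS}(\omega)$ solves $-(\partial_{rr}+\partial_{zz})(r\psi)-\partial_r\psi=\kappa_\psi\omega r^\alpha$, given by $\psi(r,z)=\frac{2\kappa_{\psi,1}}\pi\lim_{L\to\infty}\int_{|(\tilde r,\tilde z)|<L}\int_0^\pi\frac{\tilde r^{2+\alpha}\omega(\tilde r,\tilde z)\sin^2\vartheta}{(r^2+\tilde r^2-2r\tilde r\cos\vartheta+|z-\tilde z|^2)^{3/2}}d\vartheta d\tilde rd\tilde z$, $\kappa_{\psi,1}=\frac\alpha3\big(\int_0^\infty\frac{s^{2+\alpha}}{(s^2+1)^{5/2}}ds\big)^{-1}$, $\kappa_\psi=8\kappa_{\psi,1}$. Vector field: $\bar\Omega(r,z)=\bar W_\alpha(z)$, $\bar\Psi=\mathsf{BS}(\bar\Omega)$, $\psi=\mathsf{BS}(\omega)$, $\Psi=\bar\Psi+\psi$,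 $c_l=2-4\alpha\int_0^\infty y^{\alpha-1}\bar W_\alpha(y)dy-2\psi_z(0)$, and $\mathbf Q=(Q^r,Q^z)=(c_lr-r\Psi_z,\ c_lz+2\Psi+r\Psi_r)$. Weights and norms: $\Gamma(\mathbf x)=(|\mathbf x|^{-\kappa_{\mathsf O}+1}+1)\langle\mathbf x\rangle^{-\varepsilon_2}\langle J\rangle(|\mathbf x|)^{-\kappa}$, $\Gamma_{ag}=\big(\frac{\langle z\rangle}{r+\langle z\rangle}\big)^{\kappa_{ag}}$; $\|f\|_{L^\infty_\Gamma}=\|\Gamma\Gamma_{ag}\max(|\mathbf x|^{-1},1)\langle z\rangle^{\hat\alpha_l}f\|_{L^\infty}$, $\|f\|_{\dot{\mathcal W}^{1,\infty}_{r,\Gamma}}=\|\Gamma\Gamma_{ag}\langle z\rangle^{\hat\alpha_l}\langle\mathbf x\rangle\partial_rf\|_{L^\infty}$, $\|f\|_{\dot{\mathcal W}^{1,\infty}_{z,\Gamma}}=\|\Gamma\Gamma_{ag}\langle z\rangle^{\hat\alpha_l+1}\partial_zf\|_{L^\infty}$. *)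

theory Defs
  imports "HOL-Analysis.Analysis" "HOL-Probability.Essential_Supremum"
begin

definition kappa :: real where "kappa = (1/4) * (2 powr (4/3) - 2/3 + 2)"
definition kappa1 :: real where "kappa1 = (1 - kappa) / 1000"
definition kappa_ag :: real where "kappa_ag = 1 / 1000"
definition kappa_O :: real where "kappa_O = 12 / 10"

definition jap :: "real \<Rightarrow> real" where "jap x = sqrt (1 + x\<^sup>2)"

text \<open>Throughout, \<open>\<epsilon> = 1/3 - \<alpha>\<close>. The parameter \<open>b\<close> stands for the exponent \<open>\<beta>(\<alpha>)\<close>, and
  \<open>cW\<close>, \<open>W13\<close>, \<open>W\<close> for the constant and the two one-dimensional profiles.\<close>

definition alpha_l :: "real \<Rightarrow> real \<Rightarrow> real" where
  "alpha_l cW \<epsilon> = 1/3 + \<epsilon>/8 - cW * \<epsilon> powr (2 - kappa)"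

definition alpha_u :: "real \<Rightarrow> real \<Rightarrow> real" where
  "alpha_u cW \<epsilon> = 1/3 + \<epsilon>/8 + cW * \<epsilon> powr (2 - kappa)"

definition eps2 :: "real \<Rightarrow> real \<Rightarrow> real" where
  "eps2 cW \<epsilon> = kappa1 * \<epsilon> - cW * \<epsilon> powr (2 - kappa)"

section \<open>One-dimensional profiles\<close>

definition profile_kernel :: "real \<Rightarrow> real \<Rightarrow> real \<Rightarrow> real" where
  "profile_kernel \<alpha> x y =
     \<bar>x + y\<bar> powr \<alpha> - \<bar>x - y\<bar> powr \<alpha> - 2 * \<alpha> * x * y powr (\<alpha> - 1)"

definition profile_V :: "real \<Rightarrow> (real \<Rightarrow> real) \<Rightarrow> real \<Rightarrow> real" where
  "profile_V \<alpha> W x = x + (LBINT y:{0..}. profile_kernel \<alpha> x y * W y)"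

definition smooth1 :: "(real \<Rightarrow> real) \<Rightarrow> bool" where
  "smooth1 W \<longleftrightarrow> (\<forall>k x. (deriv ^^ k) W field_differentiable (at x))"

text \<open>The integrability and differentiability clauses say that the velocity \<open>V\<close> and its derivative
  in the profile equation are well defined.\<close>

definition is_profile :: "real \<Rightarrow> (real \<Rightarrow> real) \<Rightarrow> bool" where
  "is_profile \<alpha> W \<longleftrightarrow>
     (\<exists>x. W x \<noteq> 0) \<and> (\<forall>x. W (- x) = - W x) \<and> smooth1 W \<and>
     (\<forall>x. set_integrable lborel {0..} (\<lambda>y. profile_kernel \<alpha> x y * W y)) \<and>
     (\<forall>x. profile_V \<alpha> W field_differentiable (at x)) \<and>
     (\<forall>x. 2 * profile_V \<alpha> W x * deriv W x
            = (3 - \<alpha> - (1 - \<alpha>) * deriv (profile_V \<alpha> W) x) * W x)"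

text \<open>Only used for \<open>x \<ge> 0\<close>.\<close>

definition Jfun :: "real \<Rightarrow> real \<Rightarrow> (real \<Rightarrow> real) \<Rightarrow> real \<Rightarrow> real" where
  "Jfun \<alpha> b W13 x = (LBINT y:{0..x}. y powr (\<alpha> - 1) * jap y powr b * W13 y)"

text \<open>The data \<open>W13\<close> (a \<open>1/3\<close>-profile), \<open>\<beta>\<close>, \<open>cW\<close> and \<open>Wb \<alpha>\<close> (an \<open>\<alpha>\<close>-profile for each \<open>\<alpha>\<close> slightly
  below \<open>1/3\<close>). All constants (\<open>c\<close>, \<open>C\<close>, \<open>C' k\<close>) are uniform in \<open>\<alpha>\<close>. Two-sided weighted bounds are
  written for \<open>x > 0\<close>, which suffices since profiles are odd.\<close>

definition profile_family ::
  "(real \<Rightarrow> real) \<Rightarrow> (real \<Rightarrow> real) \<Rightarrow> real \<Rightarrow> (real \<Rightarrow> real \<Rightarrow> real) \<Rightarrow> bool" where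
  "profile_family W13 \<beta> cW Wb \<longleftrightarrow>
     is_profile (1/3) W13 \<and>
     (\<forall>x\<ge>0. W13 x \<le> 0) \<and>
     (\<exists>c>0. \<exists>C. \<forall>x\<ge>0. c * min x (jap x powr (-1/3)) \<le> \<bar>W13 x\<bar> \<and>
                        \<bar>W13 x\<bar> \<le> C * min x (jap x powr (-1/3))) \<and>
     cW > 0 \<and>
     (\<exists>\<epsilon>0>0. \<exists>c>0. \<exists>C. \<exists>C'::nat \<Rightarrow> real. \<forall>\<epsilon> \<alpha>. 0 < \<epsilon> \<and> \<epsilon> \<le> \<epsilon>0 \<and> \<alpha> = 1/3 - \<epsilon> \<longrightarrow>
        \<bar>\<beta> \<alpha> + \<epsilon>/8\<bar> \<le> C * \<epsilon> powr (4/3) \<and> - \<epsilon>/2 \<le> \<beta> \<alpha> \<and> \<beta> \<alpha> \<le> 0 \<and>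
        is_profile \<alpha> (Wb \<alpha>) \<and>
        (\<forall>x>0. Wb \<alpha> x < 0) \<and>
        deriv (Wb \<alpha>) 0 = deriv W13 0 \<and>
        (\<forall>x>0. c * min x (x powr (- alpha_u cW \<epsilon>)) \<le> \<bar>Wb \<alpha> x\<bar> \<and>
               \<bar>Wb \<alpha> x\<bar> \<le> C * min x (x powr (- alpha_l cW \<epsilon>))) \<and>
        (\<forall>k x. \<bar>(deriv ^^ k) (Wb \<alpha>) x\<bar> \<le> C' k * jap x powr (- real k - alpha_l cW \<epsilon>)) \<and>
        (\<forall>x>0. \<bar>(Wb \<alpha> x - jap x powr \<beta> \<alpha> * W13 x) *
                (x powr (-12/10) + x powr (1/3 - \<beta> \<alpha> - kappa1 * \<epsilon>)
                                   * jap (Jfun \<alpha> (\<beta> \<alpha>) W13 x) powr (- kappa))\<bar> \<le> C * \<epsilon>))"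

section \<open>The half plane, derivatives and regularity classes\<close>

text \<open>A point \<open>(r, z)\<close> is a pair of reals; the product norm is the Euclidean norm. Derivatives are
  one-sided in \<open>r\<close> at \<open>r = 0\<close>.\<close>

definition half_plane :: "(real \<times> real) set" where "half_plane = {p. 0 \<le> fst p}"
definition open_half_plane :: "(real \<times> real) set" where "open_half_plane = {p. 0 < fst p}"
definition off_axis :: "(real \<times> real) set" where "off_axis = {p \<in> half_plane. snd p \<noteq> 0}"

definition dr :: "(real \<times> real \<Rightarrow> real) \<Rightarrow> real \<times> real \<Rightarrow> real" where
  "dr f p = vector_derivative (\<lambda>r. f (r, snd p)) (at (fst p) within {0..})"

definition dz :: "(real \<times> real \<Rightarrow> real) \<Rightarrow> real \<times> real \<Rightarrow> real" where
  "dz f p = vector_derivative (\<lambda>z. f (fst p, z)) (at (snd p))"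

primrec Ck_on :: "nat \<Rightarrow> (real \<times> real) set \<Rightarrow> (real \<times> real \<Rightarrow> real) \<Rightarrow> bool" where
  "Ck_on 0 D f \<longleftrightarrow> continuous_on D f"
| "Ck_on (Suc k) D f \<longleftrightarrow>
     (\<forall>p\<in>D. f differentiable (at p within half_plane)) \<and> Ck_on k D (dr f) \<and> Ck_on k D (dz f)"

text \<open>Continuity up to the boundary of an expression, such as \<open>g / r\<close>, that is literally defined
  only for \<open>r > 0\<close>.\<close>

definition C0_upto_boundary :: "(real \<times> real) set \<Rightarrow> (real \<times> real \<Rightarrow> real) \<Rightarrow> bool" where
  "C0_upto_boundary D u \<longleftrightarrow>
     (\<exists>h. continuous_on D h \<and> (\<forall>p\<in>D. 0 < fst p \<longrightarrow> h p = u p))"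

text \<open>The value at \<open>p\<close> of an expression that is literally defined only for \<open>r > 0\<close>; at \<open>r = 0\<close> it is
  read as the limit \<open>r \<rightarrow> 0+\<close> (and not by means of the convention \<open>x / 0 = 0\<close>).\<close>

definition bdry_value :: "(real \<times> real \<Rightarrow> real) \<Rightarrow> real \<times> real \<Rightarrow> real" where
  "bdry_value u p =
     (if fst p = 0 then Lim (at_right 0) (\<lambda>\<rho>. u (\<rho>, snd p)) else u p)"

section \<open>Weak derivatives and weighted norms\<close>

definition loc_integrable :: "(real \<times> real \<Rightarrow> real) \<Rightarrow> bool" where
  "loc_integrable u \<longleftrightarrow>
     (\<forall>K. compact K \<and> K \<subseteq> open_half_plane \<longrightarrow> set_integrable lebesgue K u)"

definition test_function :: "(real \<times> real \<Rightarrow> real) \<Rightarrow> bool" where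
  "test_function \<phi> \<longleftrightarrow> (\<forall>k. Ck_on k open_half_plane \<phi>) \<and>
     (\<exists>K. compact K \<and> K \<subseteq> open_half_plane \<and> (\<forall>p. p \<notin> K \<longrightarrow> \<phi> p = 0))"

text \<open>\<open>h\<close> is the weak derivative of \<open>f\<close> on the open half plane, where \<open>d\<close> is \<open>dr\<close> or \<open>dz\<close>.\<close>

definition is_weak_deriv ::
  "((real \<times> real \<Rightarrow> real) \<Rightarrow> real \<times> real \<Rightarrow> real) \<Rightarrow>
   (real \<times> real \<Rightarrow> real) \<Rightarrow> (real \<times> real \<Rightarrow> real) \<Rightarrow> bool" where
  "is_weak_deriv d f h \<longleftrightarrow> loc_integrable f \<and> loc_integrable h \<and>
     (\<forall>\<phi>. test_function \<phi> \<longrightarrow>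
        (LINT p:open_half_plane|lebesgue. f p * d \<phi> p)
          = - (LINT p:open_half_plane|lebesgue. h p * \<phi> p))"

definition Linf_norm :: "(real \<times> real \<Rightarrow> real) \<Rightarrow> ereal" where
  "Linf_norm f = esssup (lebesgue_on half_plane) (\<lambda>p. ereal \<bar>f p\<bar>)"

definition Gamma_w ::
  "real \<Rightarrow> real \<Rightarrow> real \<Rightarrow> (real \<Rightarrow> real) \<Rightarrow> real \<times> real \<Rightarrow> real" where
  "Gamma_w \<alpha> b cW W13 p =
     (norm p powr (- kappa_O + 1) + 1) * jap (norm p) powr (- eps2 cW (1/3 - \<alpha>))
       * jap (Jfun \<alpha> b W13 (norm p)) powr (- kappa)"

definition Gamma_ag :: "real \<times> real \<Rightarrow> real" where
  "Gamma_ag p = (jap (snd p) / (fst p + jap (snd p))) powr kappa_ag"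

definition norm_Linf_Gamma ::
  "real \<Rightarrow> real \<Rightarrow> real \<Rightarrow> (real \<Rightarrow> real) \<Rightarrow> (real \<times> real \<Rightarrow> real) \<Rightarrow> ereal" where
  "norm_Linf_Gamma \<alpha> b cW W13 f = Linf_norm (\<lambda>p.
     Gamma_w \<alpha> b cW W13 p * Gamma_ag p * max (1 / norm p) 1
       * jap (snd p) powr alpha_l cW (1/3 - \<alpha>) * f p)"

text \<open>In the next two seminorms the weak derivative \<open>h\<close> is unique up to null sets, so the infimum is
  over a single value; it is \<open>\<infinity>\<close> if there is no weak derivative.\<close>

definition norm_W1r_Gamma ::
  "real \<Rightarrow> real \<Rightarrow> real \<Rightarrow> (real \<Rightarrow> real) \<Rightarrow> (real \<times> real \<Rightarrow> real) \<Rightarrow> ereal" where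
  "norm_W1r_Gamma \<alpha> b cW W13 f = (INF h\<in>{h. is_weak_deriv dr f h}. Linf_norm (\<lambda>p.
     Gamma_w \<alpha> b cW W13 p * Gamma_ag p * jap (snd p) powr alpha_l cW (1/3 - \<alpha>)
       * jap (norm p) * h p))"

definition norm_W1z_Gamma ::
  "real \<Rightarrow> real \<Rightarrow> real \<Rightarrow> (real \<Rightarrow> real) \<Rightarrow> (real \<times> real \<Rightarrow> real) \<Rightarrow> ereal" where
  "norm_W1z_Gamma \<alpha> b cW W13 f = (INF h\<in>{h. is_weak_deriv dz f h}. Linf_norm (\<lambda>p.
     Gamma_w \<alpha> b cW W13 p * Gamma_ag p * jap (snd p) powr (alpha_l cW (1/3 - \<alpha>) + 1) * h p))"

section \<open>Biot--Savart law and the vector field\<close>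

definition kappa_psi1 :: "real \<Rightarrow> real" where
  "kappa_psi1 \<alpha> =
     \<alpha> / 3 * inverse (LBINT s:{0..}. s powr (2 + \<alpha>) / (s\<^sup>2 + 1) powr (5/2))"

definition BS :: "real \<Rightarrow> (real \<times> real \<Rightarrow> real) \<Rightarrow> real \<times> real \<Rightarrow> real" where
  "BS \<alpha> \<omega> p = 2 * kappa_psi1 \<alpha> / pi * Lim at_top (\<lambda>L.
     LINT q:{q \<in> half_plane. norm q < L}|lebesgue. (LBINT \<theta>:{0..pi}.
       fst q powr (2 + \<alpha>) * \<omega> q * (sin \<theta>)\<^sup>2
         / ((fst p)\<^sup>2 + (fst q)\<^sup>2 - 2 * fst p * fst q * cos \<theta> + (snd p - snd q)\<^sup>2) powr (3/2)))"

definition Psi_total :: "real \<Rightarrow> (real \<Rightarrow> real) \<Rightarrow> (real \<times> real \<Rightarrow> real) \<Rightarrow> real \<times> real \<Rightarrow> real" where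
  "Psi_total \<alpha> W \<omega> p = BS \<alpha> (\<lambda>q. W (snd q)) p + BS \<alpha> \<omega> p"

definition c_l :: "real \<Rightarrow> (real \<Rightarrow> real) \<Rightarrow> (real \<times> real \<Rightarrow> real) \<Rightarrow> real" where
  "c_l \<alpha> W \<omega> = 2 - 4 * \<alpha> * (LBINT y:{0..}. y powr (\<alpha> - 1) * W y) - 2 * dz (BS \<alpha> \<omega>) (0, 0)"

definition Qr :: "real \<Rightarrow> (real \<Rightarrow> real) \<Rightarrow> (real \<times> real \<Rightarrow> real) \<Rightarrow> real \<times> real \<Rightarrow> real" where
  "Qr \<alpha> W \<omega> p = c_l \<alpha> W \<omega> * fst p - fst p * dz (Psi_total \<alpha> W \<omega>) p"

definition Qz :: "real \<Rightarrow> (real \<Rightarrow> real) \<Rightarrow> (real \<times> real \<Rightarrow> real) \<Rightarrow> real \<times> real \<Rightarrow> real" where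
  "Qz \<alpha> W \<omega> p =
     c_l \<alpha> W \<omega> * snd p + 2 * Psi_total \<alpha> W \<omega> p + fst p * dr (Psi_total \<alpha> W \<omega>) p"

text \<open>A (global) flow map of the vector field \<open>Q\<close> on the closed half plane.\<close>

definition is_flow ::
  "(real \<times> real \<Rightarrow> real \<times> real) \<Rightarrow> (real \<Rightarrow> real \<times> real \<Rightarrow> real \<times> real) \<Rightarrow> bool" where
  "is_flow Q X \<longleftrightarrow> (\<forall>x\<in>half_plane. X 0 x = x \<and>
     (\<forall>s. X s x \<in> half_plane \<and> ((\<lambda>s. X s x) has_vector_derivative Q (X s x)) (at s)))"

end

theory Submission
  imports Defs "HOL-Computational_Algebra.Polynomial"
begin

text \<open>One has \<open>Q\<^sup>r = r a\<close> with \<open>a = c\<^sub>l - \<Psi>\<^sub>z\<close>. Where \<open>r > 0\<close>, the identity is the integral of the derivative of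
  \<open>f g / Q\<^sup>r\<close> along a trajectory. On the axis it is the limit \<open>r \<rightarrow> 0+\<close>, taken by dominated
  convergence: every integrand is \<open>g / r\<close> or \<open>z g\<^sub>z / r\<close> times a continuous function, since \<open>Q\<^sup>z\<close> and \<open>1 / a\<close>
  are continuous there. It remains to show that \<open>a\<close> is positive and of class \<open>C\<^sup>1\<close> up to the axis.

  Regularity: \<open>\<Psi>\<^sub>z\<close> is an integral of the vorticity against a kernel with an integrable
  singularity. Near the singularity the derivative in \<open>z\<close> is moved to the vorticity, so that no singular
  integral appears; far away the kernel is smooth. All that is used of the vorticity is a pointwise bound
  and the identity \<open>\<omega> (r, z + h) - \<omega> (r, z) = \<integral> \<omega>\<^sub>z\<close> almost everywhere.

  Positivity: \<open>- \<integral> y\<^bsup>\<alpha>-1\<^esup> W\<close> is at least of order \<open>1 / (\<alpha>\<^sub>u - \<alpha>) \<sim> 1 / \<epsilon>\<close>. The strain of the profile is bounded above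
  independently of \<open>\<epsilon>\<close> because of the sign of \<open>W\<close>, and that of the perturbation is
  \<open>O(\<epsilon>\<^bsup>(1+\<kappa>)/2\<^esup> \<epsilon>\<^bsup>-\<kappa>\<^esup> / \<epsilon>) = o(1 / \<epsilon>)\<close> because \<open>\<kappa> < 1\<close>.\<close>

section \<open>Integrals of powers\<close>

text \<open>The bounds on the vorticity do not make the Biot-Savart integral of the stream function
  absolutely convergent, whereas the kernel of its z derivative decays by one more power. Everything
  is therefore derived from the strain. Oddness makes the truncated integrals vanish at z = 0, so
  their limit is the integral in z of the strain; even the r derivative of the stream function,
  which enters \<open>Qz\<close>, is the integral in z of the r derivative of the strain. Keeping
  the angle as a third integration variable avoids elliptic integrals: one inequality, interpolating
  between two lower bounds of the squared distance, gives both the integrable singularity and the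
  balance of powers at infinity. The flow map is given as one solution for each starting point, so
  its continuity at the axis has to be proved, by a Gronwall estimate. The bound \<epsilon> \<le>
  1/30 keeps \<alpha> at least 3/10; since the growth exponent \<mu> of the vorticity is at most
  1/10, all exponents a = \<alpha> + \<mu> lie in [3/10, 1/2], where the constants are explicit
  numbers.\<close>

lemma integral_tendsto_moving_bound:
  fixes f :: "nat \<Rightarrow> 'a \<Rightarrow> real"
  assumes [measurable]: "\<And>n. f n \<in> borel_measurable M" "F \<in> borel_measurable M"
    and g: "\<And>n. integrable M (g n)" "integrable M G"
    and f_lim: "AE x in M. (\<lambda>n. f n x) \<longlonglongrightarrow> F x"
    and g_lim: "AE x in M. (\<lambda>n. g n x) \<longlonglongrightarrow> G x"
    and bound: "\<And>n. AE x in M. \<bar>f n x\<bar> \<le> g n x"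
    and int_lim: "(\<lambda>n. \<integral>x. g n x \<partial>M) \<longlonglongrightarrow> (\<integral>x. G x \<partial>M)"
  shows "(\<lambda>n. \<integral>x. f n x \<partial>M) \<longlonglongrightarrow> (\<integral>x. F x \<partial>M)" and "integrable M F"
proof -
  have [measurable]: "\<And>n. g n \<in> borel_measurable M" "G \<in> borel_measurable M"
    using g by auto
  have bound_all: "AE x in M. \<forall>n. \<bar>f n x\<bar> \<le> g n x"
    using bound by (simp add: AE_all_countable)
  have FG: "AE x in M. \<bar>F x\<bar> \<le> G x"
    using bound_all f_lim g_lim
  proof eventually_elim
    case (elim x)
    have "(\<lambda>n. \<bar>f n x\<bar>) \<longlonglongrightarrow> \<bar>F x\<bar>" using elim(2) by (intro tendsto_intros)
    then show ?case using elim by (intro LIMSEQ_le[of "\<lambda>n. \<bar>f n x\<bar>" _ "\<lambda>n. g n x"]) auto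
  qed
  show F_int: "integrable M F"
    by (rule Bochner_Integration.integrable_bound[OF g(2)]) (use FG in auto)
  have f_int: "integrable M (f n)" for n
    by (rule Bochner_Integration.integrable_bound[OF g(1)[of n]]) (use bound[of n] in auto)
  have gpos: "AE x in M. 0 \<le> g n x" for n using bound[of n] by eventually_elim auto
  have Gpos: "AE x in M. 0 \<le> G x" using FG by eventually_elim auto
  have n1: "(\<integral>\<^sup>+ x. norm (g n x) \<partial>M) = ennreal (\<integral>x. g n x \<partial>M)" for n
  proof -
    have "(\<integral>\<^sup>+ x. norm (g n x) \<partial>M) = (\<integral>\<^sup>+ x. g n x \<partial>M)"
      using gpos[of n] by (intro nn_integral_cong_AE) auto
    then show ?thesis using nn_integral_eq_integral[OF g(1) gpos] by simp
  qed
  have n2: "(\<integral>\<^sup>+ x. norm (G x) \<partial>M) = ennreal (\<integral>x. G x \<partial>M)"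
  proof -
    have "(\<integral>\<^sup>+ x. norm (G x) \<partial>M) = (\<integral>\<^sup>+ x. G x \<partial>M)"
      using Gpos by (intro nn_integral_cong_AE) auto
    then show ?thesis using nn_integral_eq_integral[OF g(2) Gpos] by simp
  qed
  \<comment> \<open>Scheffe's lemma: almost everywhere convergence together with convergence of the
    integrals yields convergence of the majorants in L1. In the application the majorants are
    translates of one function, following a singularity that moves with the evaluation
    point.\<close>
  have "limsup (\<lambda>n. \<integral>\<^sup>+ x. norm (g n x) \<partial>M) = (\<integral>\<^sup>+ x. norm (G x) \<partial>M)"
    unfolding n1 n2 using int_lim by (intro lim_imp_Limsup tendsto_ennrealI) auto
  then have "(\<lambda>n. \<integral>\<^sup>+ x. norm (g n x - G x) \<partial>M) \<longlonglongrightarrow> 0"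
    by (intro Scheffe_lemma1 g g_lim) simp
  moreover have eq: "(\<integral>\<^sup>+ x. norm (g n x - G x) \<partial>M) = ennreal (\<integral>x. \<bar>g n x - G x\<bar> \<partial>M)" for n
    by (subst nn_integral_eq_integral) (use g in auto)
  ultimately have gG: "(\<lambda>n. \<integral>x. \<bar>g n x - G x\<bar> \<partial>M) \<longlonglongrightarrow> 0"
    unfolding eq ennreal_0[symmetric] by (subst (asm) tendsto_ennreal_iff) auto
  \<comment> \<open>The clamped functions lie between \<open>- G\<close> and \<open>G\<close>, so
    ordinary dominated convergence applies to them; clamping changes \<open>f n\<close> by at most
    \<open>g n - G\<close> in absolute value, which is small in L1.\<close>
  define c where "c n x = max (- G x) (min (f n x) (G x))" for n x
  have [measurable]: "c n \<in> borel_measurable M" for n unfolding c_def by measurable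
  have c_lim: "AE x in M. (\<lambda>n. c n x) \<longlonglongrightarrow> F x"
    using f_lim FG
  proof eventually_elim
    case (elim x)
    have "(\<lambda>n. c n x) \<longlonglongrightarrow> max (- G x) (min (F x) (G x))"
      unfolding c_def using elim by (intro tendsto_intros)
    then show ?case using elim by (auto simp: min_def max_def split: if_splits)
  qed
  have c_bd: "AE x in M. norm (c n x) \<le> G x" for n
    using Gpos unfolding c_def by eventually_elim auto
  have lim_c: "(\<lambda>n. \<integral>x. c n x \<partial>M) \<longlonglongrightarrow> (\<integral>x. F x \<partial>M)"
    by (rule integral_dominated_convergence[OF _ _ g(2) c_lim c_bd]) auto
  have c_int: "integrable M (c n)" for n
    by (rule Bochner_Integration.integrable_bound[OF g(2)]) (use c_bd[of n] in auto)
  have "(\<lambda>n. (\<integral>x. f n x \<partial>M) - (\<integral>x. c n x \<partial>M)) \<longlonglongrightarrow> 0"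
  proof (rule Lim_null_comparison[OF _ gG], rule always_eventually, intro allI)
    fix n
    have "norm ((\<integral>x. f n x \<partial>M) - (\<integral>x. c n x \<partial>M)) = norm (\<integral>x. f n x - c n x \<partial>M)"
      using f_int c_int by simp
    also have "\<dots> \<le> (\<integral>x. norm (f n x - c n x) \<partial>M)" by (rule integral_norm_bound)
    also have "\<dots> \<le> (\<integral>x. \<bar>g n x - G x\<bar> \<partial>M)"
    proof (rule integral_mono_AE)
      show "AE x in M. norm (f n x - c n x) \<le> \<bar>g n x - G x\<bar>"
        using bound[of n] Gpos
        by eventually_elim (auto simp: c_def min_def max_def abs_if split: if_splits)
    qed (use f_int c_int g in auto)
    finally show "norm ((\<integral>x. f n x \<partial>M) - (\<integral>x. c n x \<partial>M)) \<le> (\<integral>x. \<bar>g n x - G x\<bar> \<partial>M)" .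
  qed
  from tendsto_add[OF this lim_c] show "(\<lambda>n. \<integral>x. f n x \<partial>M) \<longlonglongrightarrow> (\<integral>x. F x \<partial>M)" by simp
qed

lemma nn_integral_powr_near_0:
  fixes b m :: real
  assumes "-1 < b" "0 \<le> m"
  shows "(\<integral>\<^sup>+x. ennreal (indicator {0..m} x * x powr b) \<partial>lborel) = ennreal (m powr (b+1) / (b+1))"
proof (rule nn_integral_has_integral_lborel)
  have "((\<lambda>x. if x \<in> {0..m} then x powr b else 0) has_integral (m powr (b+1) / (b+1))) UNIV"
    using has_integral_powr_from_0[OF assms] by (simp only: has_integral_restrict_UNIV)
  moreover have "(\<lambda>x. if x \<in> {0..m} then x powr b else 0) = (\<lambda>x. indicator {0..m} x * x powr b)"
    by (auto simp: fun_eq_iff)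
  ultimately show "((\<lambda>x. indicator {0..m} x * x powr b) has_integral (m powr (b+1) / (b+1))) UNIV"
    by simp
qed auto

lemma nn_integral_powr_at_infinity:
  fixes c a :: real
  assumes "0 < c" "0 < a"
  shows "(\<integral>\<^sup>+x. ennreal (indicator {a..} x * x powr (-1-c)) \<partial>lborel) = ennreal (a powr (-c) / c)"
proof (rule nn_integral_has_integral_lborel)
  have "((\<lambda>x. if x \<in> {a..} then x powr (-1-c) else 0) has_integral (a powr (-c) / c)) UNIV"
    using has_integral_powr_to_inf[of "-1-c" a] assms
    by (simp only: has_integral_restrict_UNIV) simp
  moreover have "(\<lambda>x. if x \<in> {a..} then x powr (-1-c) else 0) = (\<lambda>x. indicator {a..} x * x powr (-1-c))"
    by (auto simp: fun_eq_iff)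
  ultimately show "((\<lambda>x. indicator {a..} x * x powr (-1-c)) has_integral (a powr (-c) / c)) UNIV"
    by simp
qed auto

lemma nn_integral_even_le:
  fixes f :: "real \<Rightarrow> real"
  assumes [measurable]: "f \<in> borel_measurable borel"
  shows "(\<integral>\<^sup>+x. ennreal (f \<bar>x\<bar>) \<partial>lborel) \<le> 2 * (\<integral>\<^sup>+x. ennreal (indicator {0..} x * f x) \<partial>lborel)"
proof -
  have "(\<integral>\<^sup>+x. ennreal (f \<bar>x\<bar>) \<partial>lborel)
      \<le> (\<integral>\<^sup>+x. ennreal (indicator {0..} x * f x) + ennreal (indicator {0..} (-x) * f (-x)) \<partial>lborel)"
    by (intro nn_integral_mono) (auto split: split_indicator simp: abs_if)
  also have "\<dots> = (\<integral>\<^sup>+x. ennreal (indicator {0..} x * f x) \<partial>lborel)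
       + (\<integral>\<^sup>+x. ennreal (indicator {0..} (-x) * f (-x)) \<partial>lborel)"
    by (intro nn_integral_add) auto
  also have "(\<integral>\<^sup>+x. ennreal (indicator {0..} (-x) * f (-x)) \<partial>lborel)
        = (\<integral>\<^sup>+x. ennreal (indicator {0..} x * f x) \<partial>lborel)"
    by (subst nn_integral_real_affine[where c="-1" and t=0]) auto
  finally show ?thesis by (simp add: mult_2)
qed

lemma nn_integral_abs_powr_near_0:
  fixes b m :: real
  assumes "-1 < b" "0 \<le> m"
  shows "(\<integral>\<^sup>+x. ennreal (indicator {x. \<bar>x\<bar> \<le> m} x * \<bar>x\<bar> powr b) \<partial>lborel) \<le> ennreal (2 * m powr (b+1) / (b+1))"
proof -
  have "(\<integral>\<^sup>+x. ennreal (indicator {x. \<bar>x\<bar> \<le> m} x * \<bar>x\<bar> powr b) \<partial>lborel)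
     = (\<integral>\<^sup>+x. ennreal ((\<lambda>x. indicator {..m} x * x powr b) \<bar>x\<bar>) \<partial>lborel)"
    by (intro nn_integral_cong) (auto split: split_indicator)
  also have "\<dots> \<le> 2 * (\<integral>\<^sup>+x. ennreal (indicator {0..} x * (indicator {..m} x * x powr b)) \<partial>lborel)"
    by (rule nn_integral_even_le) auto
  also have "(\<integral>\<^sup>+x. ennreal (indicator {0..} x * (indicator {..m} x * x powr b)) \<partial>lborel)
     = (\<integral>\<^sup>+x. ennreal (indicator {0..m} x * x powr b) \<partial>lborel)"
    by (intro nn_integral_cong) (auto split: split_indicator)
  also have "2 * \<dots> = ennreal (2 * m powr (b+1) / (b+1))"
    unfolding nn_integral_powr_near_0[OF assms] using assms
    by (simp flip: ennreal_numeral ennreal_mult)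
  finally show ?thesis .
qed

lemma nn_integral_translate_real:
  fixes f :: "real \<Rightarrow> real"
  assumes [measurable]: "f \<in> borel_measurable borel"
  shows "(\<integral>\<^sup>+x. ennreal (f (a - x)) \<partial>lborel) = (\<integral>\<^sup>+x. ennreal (f x) \<partial>lborel)"
  using nn_integral_real_affine[of "\<lambda>x. ennreal (f x)" "-1" a] by simp

lemma jap_ge: "1 \<le> jap x" "\<bar>x\<bar> \<le> jap x" and jap_le: "jap x \<le> 1 + \<bar>x\<bar>" and jap_pos: "0 < jap x"
proof -
  show 1: "1 \<le> jap x" by (simp add: jap_def)
  then show "0 < jap x" by simp
  show "\<bar>x\<bar> \<le> jap x" unfolding jap_def by (rule real_le_rsqrt) auto
  show "jap x \<le> 1 + \<bar>x\<bar>" unfolding jap_def by (rule real_le_lsqrt) (auto simp: power2_sum)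
qed

lemma jap_measurable[measurable]: "jap \<in> borel_measurable borel"
  unfolding jap_def by measurable

lemma nn_integral_jap_powr:
  assumes "0 < c"
  shows "(\<integral>\<^sup>+w. ennreal (jap w powr (-1-c)) \<partial>lborel) \<le> ennreal (2 + 2/c)"
proof -
  have pt: "jap w powr (-1-c) \<le> indicator {-1..1} w + (\<lambda>w. indicator {1..} w * w powr (-1-c)) \<bar>w\<bar>" for w
  proof (cases "\<bar>w\<bar> \<le> 1")
    case True
    have "jap w powr (-1-c) \<le> 1 powr (-1-c)"
      by (rule powr_mono2') (use assms jap_ge in auto)
    then show ?thesis using True by (auto split: split_indicator)
  next
    case False
    have "jap w powr (-1-c) \<le> \<bar>w\<bar> powr (-1-c)"
      by (rule powr_mono2') (use assms jap_ge[of w] False in auto)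
    then show ?thesis using False by (auto split: split_indicator)
  qed
  have "(\<integral>\<^sup>+w. ennreal (jap w powr (-1-c)) \<partial>lborel)
     \<le> (\<integral>\<^sup>+w. ennreal (indicator {-1..1} w) + ennreal ((\<lambda>w. indicator {1..} w * w powr (-1-c)) \<bar>w\<bar>) \<partial>lborel)"
    by (intro nn_integral_mono) (use pt in \<open>auto simp flip: ennreal_plus intro!: ennreal_leI\<close>)
  also have "\<dots> = (\<integral>\<^sup>+w. ennreal (indicator {-1..1::real} w) \<partial>lborel)
     + (\<integral>\<^sup>+w. ennreal ((\<lambda>w. indicator {1..} w * w powr (-1-c)) \<bar>w\<bar>) \<partial>lborel)"
    by (rule nn_integral_add) measurable
  also have "(\<integral>\<^sup>+w. ennreal (indicator {-1..1::real} w) \<partial>lborel) = ennreal 2"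
    by (simp add: ennreal_indicator)
  also have "(\<integral>\<^sup>+w. ennreal ((\<lambda>w. indicator {1..} w * w powr (-1-c)) \<bar>w\<bar>) \<partial>lborel) \<le> ennreal (2/c)"
  proof -
    have "(\<integral>\<^sup>+w. ennreal ((\<lambda>w. indicator {1..} w * w powr (-1-c)) \<bar>w\<bar>) \<partial>lborel)
      \<le> 2 * (\<integral>\<^sup>+w. ennreal (indicator {0..} w * (indicator {1..} w * w powr (-1-c))) \<partial>lborel)"
      by (rule nn_integral_even_le) auto
    also have "(\<integral>\<^sup>+w. ennreal (indicator {0..} w * (indicator {1..} w * w powr (-1-c))) \<partial>lborel)
        = (\<integral>\<^sup>+w. ennreal (indicator {1..} w * w powr (-1-c)) \<partial>lborel)"
      by (intro nn_integral_cong) (auto split: split_indicator)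
    also have "2 * \<dots> = ennreal (2/c)"
      using nn_integral_powr_at_infinity[OF assms, of 1] assms by (simp flip: ennreal_numeral ennreal_mult)
    finally show ?thesis .
  qed
  finally show ?thesis using assms ennreal_plus[of 2 "2/c"] by (simp add: add_left_mono)
qed

text \<open>A Riesz potential of order a on the line, bounded uniformly in z by cutting the line in
  three. At distance at most 1 from z the decaying factor is at most 1. At distances between 1 and
  |z|/2 the weight is controlled by the value |z|/2 and the integral is scale invariant. Farther
  away \<open>jap w\<close> is at most 4 |z - w|, so only the tail \<open>jap w powr (-1-c)\<close>
  remains; this tail alone produces the factor 1/c.\<close>

lemma nn_integral_riesz_le:
  assumes "3/10 \<le> a" "a \<le> 1/2" "0 < c" "c \<le> 1"
  shows "(\<integral>\<^sup>+w. ennreal (\<bar>z - w\<bar> powr (a-1) * jap w powr (-a-c)) \<partial>lborel) \<le> ennreal (32/c)"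
proof -
  define g1 where "g1 w = indicator {x. \<bar>x\<bar> \<le> 1} (z-w) * \<bar>z - w\<bar> powr (a-1)" for w
  define g2 where "g2 w = (\<bar>z\<bar>/2) powr (-a) * (indicator {x. \<bar>x\<bar> \<le> \<bar>z\<bar>/2} (z-w) * \<bar>z - w\<bar> powr (a-1))" for w
  define g3 where "g3 w = 4 * jap w powr (-1-c)" for w
  have [measurable]: "g1 \<in> borel_measurable borel" "g2 \<in> borel_measurable borel" "g3 \<in> borel_measurable borel"
    unfolding g1_def g2_def g3_def by measurable
  have pos: "0 \<le> g1 w" "0 \<le> g2 w" "0 \<le> g3 w" for w
    unfolding g1_def g2_def g3_def by auto
  have pt: "\<bar>z - w\<bar> powr (a-1) * jap w powr (-a-c) \<le> g1 w + g2 w + g3 w" for w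
  proof -
    consider "\<bar>z-w\<bar> \<le> 1" | "\<bar>z-w\<bar> \<le> \<bar>z\<bar>/2" "1 < \<bar>z-w\<bar>" | "\<bar>z\<bar>/2 < \<bar>z-w\<bar>" "1 < \<bar>z-w\<bar>"
      by linarith
    then show ?thesis
    proof cases
      case 1
      have "jap w powr (-a-c) \<le> 1 powr (-a-c)"
        by (rule powr_mono2') (use assms jap_ge in auto)
      then have "\<bar>z - w\<bar> powr (a-1) * jap w powr (-a-c) \<le> g1 w"
        unfolding g1_def using 1 by (auto intro: mult_left_le)
      then show ?thesis using pos[of w] by simp
    next
      case 2
      have zw: "\<bar>z\<bar>/2 \<le> jap w" using 2 jap_ge(2)[of w] by linarith
      have "jap w powr (-a-c) \<le> jap w powr (-a)"
        by (rule powr_mono) (use assms jap_ge in auto)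
      also have "\<dots> \<le> (\<bar>z\<bar>/2) powr (-a)"
        by (rule powr_mono2') (use assms 2 zw in auto)
      finally have "\<bar>z - w\<bar> powr (a-1) * jap w powr (-a-c) \<le> g2 w"
        unfolding g2_def using 2
          mult_left_mono[of "jap w powr (-a-c)" "(\<bar>z\<bar>/2) powr (-a)" "\<bar>z-w\<bar> powr (a-1)"]
        by (simp add: mult.commute)
      then show ?thesis using pos[of w] by simp
    next
      case 3
      have "jap w \<le> 4 * \<bar>z-w\<bar>" using 3 jap_le[of w] abs_triangle_ineq4[of z "z-w"] by simp
      then have "\<bar>z-w\<bar> powr (a-1) \<le> (jap w / 4) powr (a-1)"
        by (intro powr_mono2') (use assms 3 jap_pos in auto)
      also have "\<dots> = jap w powr (a-1) * 4 powr (1-a)"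
        using jap_pos[of w] by (simp add: powr_divide powr_diff divide_simps powr_minus)
      also have "4 powr (1-a) \<le> (4::real) powr 1" by (rule powr_mono) (use assms in auto)
      finally have "\<bar>z-w\<bar> powr (a-1) \<le> jap w powr (a-1) * 4" by (simp add: mult_left_mono)
      then have "\<bar>z - w\<bar> powr (a-1) * jap w powr (-a-c) \<le> jap w powr (a-1) * 4 * jap w powr (-a-c)"
        by (intro mult_right_mono) auto
      also have "\<dots> = g3 w" unfolding g3_def by (simp add: powr_add[symmetric])
      finally show ?thesis using pos[of w] by simp
    qed
  qed
  have "(\<integral>\<^sup>+w. ennreal (\<bar>z - w\<bar> powr (a-1) * jap w powr (-a-c)) \<partial>lborel)
     \<le> (\<integral>\<^sup>+w. ennreal (g1 w) + ennreal (g2 w) + ennreal (g3 w) \<partial>lborel)"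
    by (intro nn_integral_mono) (use pt pos in \<open>auto simp flip: ennreal_plus intro!: ennreal_leI\<close>)
  also have "\<dots> = (\<integral>\<^sup>+w. ennreal (g1 w) \<partial>lborel) + (\<integral>\<^sup>+w. ennreal (g2 w) \<partial>lborel) + (\<integral>\<^sup>+w. ennreal (g3 w) \<partial>lborel)"
    by (simp add: nn_integral_add)
  also have "(\<integral>\<^sup>+w. ennreal (g1 w) \<partial>lborel) \<le> ennreal 7"
  proof -
    have "(\<integral>\<^sup>+w. ennreal (g1 w) \<partial>lborel) = (\<integral>\<^sup>+x. ennreal (indicator {x. \<bar>x\<bar> \<le> 1} x * \<bar>x\<bar> powr (a-1)) \<partial>lborel)"
      unfolding g1_def by (rule nn_integral_translate_real) auto
    also have "\<dots> \<le> ennreal (2 * 1 powr (a-1+1) / (a-1+1))"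
      by (rule nn_integral_abs_powr_near_0) (use assms in auto)
    also have "\<dots> \<le> ennreal 7" using assms by (intro ennreal_leI) (simp add: field_simps)
    finally show ?thesis .
  qed
  also have "(\<integral>\<^sup>+w. ennreal (g2 w) \<partial>lborel) \<le> ennreal 7"
  proof -
    have "(\<integral>\<^sup>+w. ennreal (g2 w) \<partial>lborel)
       = (\<integral>\<^sup>+x. ennreal ((\<bar>z\<bar>/2) powr (-a)) * ennreal (indicator {x. \<bar>x\<bar> \<le> \<bar>z\<bar>/2} x * \<bar>x\<bar> powr (a-1)) \<partial>lborel)"
      unfolding g2_def
      by (subst nn_integral_translate_real[of "\<lambda>x. (\<bar>z\<bar>/2) powr (-a) * (indicator {x. \<bar>x\<bar> \<le> \<bar>z\<bar>/2} x * \<bar>x\<bar> powr (a-1))" z])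
         (auto simp: ennreal_mult)
    also have "\<dots> = ennreal ((\<bar>z\<bar>/2) powr (-a)) * (\<integral>\<^sup>+x. ennreal (indicator {x. \<bar>x\<bar> \<le> \<bar>z\<bar>/2} x * \<bar>x\<bar> powr (a-1)) \<partial>lborel)"
      by (rule nn_integral_cmult) auto
    also have "\<dots> \<le> ennreal ((\<bar>z\<bar>/2) powr (-a)) * ennreal (2 * (\<bar>z\<bar>/2) powr (a-1+1) / (a-1+1))"
      by (intro mult_left_mono nn_integral_abs_powr_near_0) (use assms in auto)
    also have "\<dots> = ennreal ((\<bar>z\<bar>/2) powr (-a) * (2 * (\<bar>z\<bar>/2) powr (a-1+1) / (a-1+1)))"
      using assms by (subst ennreal_mult[symmetric]) auto
    also have "\<dots> \<le> ennreal 7"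
      using assms by (intro ennreal_leI) (cases "z = 0", auto simp: field_simps powr_minus)
    finally show ?thesis .
  qed
  also have "(\<integral>\<^sup>+w. ennreal (g3 w) \<partial>lborel) \<le> ennreal (4 * (2 + 2/c))"
  proof -
    have "(\<integral>\<^sup>+w. ennreal (g3 w) \<partial>lborel) = 4 * (\<integral>\<^sup>+w. ennreal (jap w powr (-1-c)) \<partial>lborel)"
      unfolding g3_def by (simp add: ennreal_mult nn_integral_cmult)
    also have "\<dots> \<le> ennreal 4 * ennreal (2 + 2/c)"
      using nn_integral_jap_powr[OF assms(3)] by (auto intro!: mult_left_mono)
    also have "\<dots> = ennreal (4 * (2 + 2/c))" using assms by (subst ennreal_mult[symmetric]) auto
    finally show ?thesis .
  qed
  finally have "(\<integral>\<^sup>+w. ennreal (\<bar>z - w\<bar> powr (a-1) * jap w powr (-a-c)) \<partial>lborel) \<le> ennreal 7 + ennreal 7 + ennreal (4 * (2 + 2/c))"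
    by (simp add: add_mono)
  also have "\<dots> = ennreal (7 + 7 + 4 * (2 + 2/c))"
    using assms by (metis (no_types, opaque_lifting) add_nonneg_nonneg divide_nonneg_pos ennreal_plus
        mult_nonneg_nonneg zero_le_numeral)
  also have "\<dots> \<le> ennreal (32/c)"
    using assms by (intro ennreal_leI) (simp add: field_simps)
  finally show ?thesis .
qed

section \<open>The Biot--Savart kernels\<close>

text \<open>A triple \<open>((\<rho>, w), \<theta>)\<close> is an integration point of the Biot--Savart integral. The weight \<open>wt\<close> vanishes
  unless \<open>\<rho> > 0\<close> and \<open>0 < \<theta> < \<pi>\<close>, and then the squared distance \<open>D2\<close> is positive even at \<open>(\<rho>, w) = (r, z)\<close>: for every
  fixed integration point the kernels are smooth in \<open>(r, z)\<close>. The letters after \<open>k\<close> denote derivatives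
  of \<open>k0\<close>, and \<open>kmaj\<close> dominates \<open>kz\<close> and \<open>kr\<close>.\<close>

type_synonym triple = "(real \<times> real) \<times> real"

definition rho :: "triple \<Rightarrow> real" where "rho y = fst (fst y)"
definition wz :: "triple \<Rightarrow> real" where "wz y = snd (fst y)"
definition th :: "triple \<Rightarrow> real" where "th y = snd y"
definition good :: "triple set" where "good = {y. 0 < rho y \<and> 0 < th y \<and> th y < pi}"

definition wt :: "real \<Rightarrow> triple \<Rightarrow> real" where
  "wt \<alpha> y = indicator good y * (rho y powr (2 + \<alpha>) * (sin (th y))\<^sup>2)"
definition D2 :: "real \<Rightarrow> real \<Rightarrow> triple \<Rightarrow> real" where
  "D2 r z y = r\<^sup>2 + (rho y)\<^sup>2 - 2 * r * rho y * cos (th y) + (z - wz y)\<^sup>2"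
definition k0 where "k0 \<alpha> r z y = wt \<alpha> y * D2 r z y powr (-3/2)"
definition kz where "kz \<alpha> r z y = wt \<alpha> y * (-3 * (z - wz y)) * D2 r z y powr (-5/2)"
definition kr where "kr \<alpha> r z y = wt \<alpha> y * (-3 * (r - rho y * cos (th y))) * D2 r z y powr (-5/2)"
definition kzz where "kzz \<alpha> r z y = wt \<alpha> y * (-3 * D2 r z y powr (-5/2) + 15 * (z - wz y)\<^sup>2 * D2 r z y powr (-7/2))"
definition kzr where "kzr \<alpha> r z y = wt \<alpha> y * (15 * (z - wz y) * (r - rho y * cos (th y)) * D2 r z y powr (-7/2))"
definition kmaj where "kmaj \<alpha> r z y = wt \<alpha> y * D2 r z y powr (-2)"

section \<open>Elementary properties of the squared distance and of the kernels\<close>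

lemma coord_simps[simp]: "rho ((a,b),c) = a" "wz ((a,b),c) = b" "th ((a,b),c) = c"
  by (auto simp: rho_def wz_def th_def)

lemma coord_measurable[measurable]:
  "rho \<in> borel_measurable borel" "wz \<in> borel_measurable borel" "th \<in> borel_measurable borel"
  unfolding rho_def wz_def th_def
  by (auto intro!: borel_measurable_continuous_onI continuous_intros)

lemma good_measurable[measurable]: "good \<in> sets borel" "Measurable.pred borel (\<lambda>y. y \<in> good)"
  unfolding good_def by measurable

lemma kernel_measurable[measurable]:
  assumes [measurable]: "f \<in> borel_measurable M" "g \<in> borel_measurable M" "h \<in> M \<rightarrow>\<^sub>M borel"
  shows "(\<lambda>x. wt \<alpha> (h x)) \<in> borel_measurable M"
    "(\<lambda>x. D2 (f x) (g x) (h x)) \<in> borel_measurable M"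
    "(\<lambda>x. k0 \<alpha> (f x) (g x) (h x)) \<in> borel_measurable M"
    "(\<lambda>x. kz \<alpha> (f x) (g x) (h x)) \<in> borel_measurable M"
    "(\<lambda>x. kr \<alpha> (f x) (g x) (h x)) \<in> borel_measurable M"
    "(\<lambda>x. kzz \<alpha> (f x) (g x) (h x)) \<in> borel_measurable M"
    "(\<lambda>x. kzr \<alpha> (f x) (g x) (h x)) \<in> borel_measurable M"
    "(\<lambda>x. kmaj \<alpha> (f x) (g x) (h x)) \<in> borel_measurable M"
proof -
  show 1[measurable]: "(\<lambda>x. wt \<alpha> (h x)) \<in> borel_measurable M" unfolding wt_def by measurable
  show 2[measurable]: "(\<lambda>x. D2 (f x) (g x) (h x)) \<in> borel_measurable M" unfolding D2_def by measurable
  show "(\<lambda>x. k0 \<alpha> (f x) (g x) (h x)) \<in> borel_measurable M" unfolding k0_def by measurable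
  show "(\<lambda>x. kz \<alpha> (f x) (g x) (h x)) \<in> borel_measurable M" unfolding kz_def by measurable
  show "(\<lambda>x. kr \<alpha> (f x) (g x) (h x)) \<in> borel_measurable M" unfolding kr_def by measurable
  show "(\<lambda>x. kzz \<alpha> (f x) (g x) (h x)) \<in> borel_measurable M" unfolding kzz_def by measurable
  show "(\<lambda>x. kzr \<alpha> (f x) (g x) (h x)) \<in> borel_measurable M" unfolding kzr_def by measurable
  show "(\<lambda>x. kmaj \<alpha> (f x) (g x) (h x)) \<in> borel_measurable M" unfolding kmaj_def by measurable
qed

lemma D2_sum: "D2 r z y = (r - rho y * cos (th y))\<^sup>2 + (rho y * sin (th y))\<^sup>2 + (z - wz y)\<^sup>2"
proof -
  have "(r - rho y * cos (th y))\<^sup>2 + (rho y * sin (th y))\<^sup>2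
     = r\<^sup>2 - 2 * r * rho y * cos (th y) + (rho y)\<^sup>2 * ((sin (th y))\<^sup>2 + (cos (th y))\<^sup>2)"
    by algebra
  then show ?thesis by (simp add: D2_def)
qed

lemma D2_nonneg: "0 \<le> D2 r z y" by (simp add: D2_sum)

lemma sin_good: "y \<in> good \<Longrightarrow> 0 < sin (th y)"
  by (auto simp: good_def intro: sin_gt_zero)

lemma D2_ge:
  shows "(z - wz y)\<^sup>2 \<le> D2 r z y" "(r - rho y * cos (th y))\<^sup>2 \<le> D2 r z y" "(rho y * sin (th y))\<^sup>2 \<le> D2 r z y"
  by (auto simp: D2_sum)

lemma D2_ge_dist:
  assumes "y \<in> good" "0 \<le> r"
  shows "(r - rho y)\<^sup>2 + (z - wz y)\<^sup>2 \<le> D2 r z y"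
proof -
  have "r * rho y * cos (th y) \<le> r * rho y * 1"
    using assms by (intro mult_left_mono) (auto simp: good_def)
  then show ?thesis by (simp add: D2_def power2_diff)
qed

lemma D2_pos: "y \<in> good \<Longrightarrow> 0 < D2 r z y"
  using D2_ge(3)[of y r z] sin_good[of y]
  by (smt (verit) good_def mem_Collect_eq mult_pos_pos zero_less_power)

lemma wt_nonneg: "0 \<le> wt \<alpha> y" by (simp add: wt_def)
lemma wt_bad: "y \<notin> good \<Longrightarrow> wt \<alpha> y = 0" by (simp add: wt_def)
lemma kmaj_nonneg: "0 \<le> kmaj \<alpha> r z y" by (simp add: kmaj_def wt_nonneg)
lemma k0_nonneg: "0 \<le> k0 \<alpha> r z y" by (simp add: k0_def wt_nonneg)

lemma sqrt_D2_ge: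
  "\<bar>z - wz y\<bar> \<le> D2 r z y powr (1/2)" "\<bar>r - rho y * cos (th y)\<bar> \<le> D2 r z y powr (1/2)"
  unfolding powr_half_sqrt[OF D2_nonneg] by (rule real_le_rsqrt, simp add: D2_ge)+

lemma square_powr: "0 \<le> x \<Longrightarrow> (x\<^sup>2) powr e = x powr (2 * e)" for x :: real
  by (cases "x = 0") (simp_all add: powr_powr flip: powr_numeral)

text \<open>Each differentiation costs one factor \<open>D2 r z y powr (-1/2)\<close>, because |z -
  w| and |r - rho cos th| are both at most the square root of \<open>D2\<close>. The constant 18 = 3
  + 15 is the sum of the coefficients in \<open>kzz\<close>.\<close>

lemma kernel_bounds:
  shows "\<bar>kz \<alpha> r z y\<bar> \<le> 3 * kmaj \<alpha> r z y" "\<bar>kr \<alpha> r z y\<bar> \<le> 3 * kmaj \<alpha> r z y"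
    "k0 \<alpha> r z y = kmaj \<alpha> r z y * D2 r z y powr (1/2)"
    "\<bar>kzz \<alpha> r z y\<bar> \<le> 18 * kmaj \<alpha> r z y * D2 r z y powr (-1/2)"
    "\<bar>kzr \<alpha> r z y\<bar> \<le> 18 * kmaj \<alpha> r z y * D2 r z y powr (-1/2)"
proof -
  define D where "D = D2 r z y"
  define u where "u = z - wz y"
  define v where "v = r - rho y * cos (th y)"
  have w: "0 \<le> wt \<alpha> y" by (rule wt_nonneg)
  have u: "\<bar>u\<bar> \<le> D powr (1/2)" and v: "\<bar>v\<bar> \<le> D powr (1/2)"
    using sqrt_D2_ge by (auto simp: u_def v_def D_def)
  have e1: "D powr (1/2) * D powr (-5/2) = D powr (-2)" by (simp add: powr_add[symmetric])
  have e2: "D powr (1/2) * D powr (1/2) * D powr (-7/2) = D powr (-5/2)"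
    by (simp only: powr_add[symmetric]) simp
  have e3: "D powr (-2) * D powr (-1/2) = D powr (-5/2)" by (simp add: powr_add[symmetric])
  have "\<bar>u\<bar> * D powr (-5/2) \<le> D powr (-2)" "\<bar>v\<bar> * D powr (-5/2) \<le> D powr (-2)"
    unfolding e1[symmetric] using u v by (auto intro: mult_right_mono)
  then have "wt \<alpha> y * (3 * (\<bar>u\<bar> * D powr (-5/2))) \<le> wt \<alpha> y * (3 * D powr (-2))"
     "wt \<alpha> y * (3 * (\<bar>v\<bar> * D powr (-5/2))) \<le> wt \<alpha> y * (3 * D powr (-2))"
    by (intro mult_left_mono w; simp)+
  moreover have "\<bar>kz \<alpha> r z y\<bar> = wt \<alpha> y * (3 * (\<bar>u\<bar> * D powr (-5/2)))"
      "\<bar>kr \<alpha> r z y\<bar> = wt \<alpha> y * (3 * (\<bar>v\<bar> * D powr (-5/2)))"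
      and T3: "3 * kmaj \<alpha> r z y = wt \<alpha> y * (3 * D powr (-2))"
    unfolding kz_def kr_def kmaj_def u_def[symmetric] v_def[symmetric] D_def[symmetric]
    using w by (simp_all add: abs_mult)
  ultimately show "\<bar>kz \<alpha> r z y\<bar> \<le> 3 * kmaj \<alpha> r z y" "\<bar>kr \<alpha> r z y\<bar> \<le> 3 * kmaj \<alpha> r z y"
    by (simp_all only:)
  show "k0 \<alpha> r z y = kmaj \<alpha> r z y * D2 r z y powr (1/2)"
    by (simp add: k0_def kmaj_def powr_add[symmetric] mult.assoc)
  have uv: "\<bar>u\<bar> * \<bar>v\<bar> * D powr (-7/2) \<le> D powr (-5/2)" "\<bar>u\<bar> * \<bar>u\<bar> * D powr (-7/2) \<le> D powr (-5/2)"
    unfolding e2[symmetric] by (intro mult_right_mono mult_mono u v; simp)+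
  have "\<bar>- 3 * D powr (-5/2) + 15 * u\<^sup>2 * D powr (-7/2)\<bar> \<le> 18 * D powr (-5/2)"
  proof -
    have "\<bar>- 3 * b + 15 * a\<bar> \<le> 18 * b" if "0 \<le> a" "a \<le> b" for a b :: real
      using that by linarith
    from this[of "u\<^sup>2 * D powr (-7/2)" "D powr (-5/2)"] uv(2) show ?thesis
      by (simp add: power2_eq_square flip: mult.assoc)
  qed
  then have "wt \<alpha> y * \<bar>- 3 * D powr (-5/2) + 15 * u\<^sup>2 * D powr (-7/2)\<bar> \<le> wt \<alpha> y * (18 * D powr (-5/2))"
    using w by (rule mult_left_mono)
  moreover have "wt \<alpha> y * \<bar>15 * u * v * D powr (-7/2)\<bar> \<le> wt \<alpha> y * (18 * D powr (-5/2))"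
  proof (rule mult_left_mono[OF _ w])
    have "\<bar>15 * u * v * D powr (-7/2)\<bar> = 15 * (\<bar>u\<bar> * \<bar>v\<bar> * D powr (-7/2))" by (simp add: abs_mult)
    then show "\<bar>15 * u * v * D powr (-7/2)\<bar> \<le> 18 * D powr (-5/2)"
      using uv(1) powr_ge_zero[of D "-5/2"] by linarith
  qed
  moreover have "\<bar>kzz \<alpha> r z y\<bar> = wt \<alpha> y * \<bar>- 3 * D powr (-5/2) + 15 * u\<^sup>2 * D powr (-7/2)\<bar>"
    "\<bar>kzr \<alpha> r z y\<bar> = wt \<alpha> y * \<bar>15 * u * v * D powr (-7/2)\<bar>"
    "18 * kmaj \<alpha> r z y * D2 r z y powr (-1/2) = wt \<alpha> y * (18 * D powr (-5/2))"
    unfolding kzz_def kzr_def kmaj_def u_def[symmetric] v_def[symmetric] D_def[symmetric] e3[symmetric]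
    using w by (simp_all add: abs_mult)
  ultimately show "\<bar>kzz \<alpha> r z y\<bar> \<le> 18 * kmaj \<alpha> r z y * D2 r z y powr (-1/2)"
    "\<bar>kzr \<alpha> r z y\<bar> \<le> 18 * kmaj \<alpha> r z y * D2 r z y powr (-1/2)"
    by (simp_all only:)
qed

lemma D2_deriv:
  "((\<lambda>z. D2 r z y) has_real_derivative 2 * (z - wz y)) (at z within S)"
  "((\<lambda>r. D2 r z y) has_real_derivative 2 * (r - rho y * cos (th y))) (at r within S)"
  unfolding D2_def by (auto intro!: derivative_eq_intros simp: algebra_simps)

lemma kernel_deriv:
  "((\<lambda>z. k0 \<alpha> r z y) has_real_derivative kz \<alpha> r z y) (at z within S)"
  "((\<lambda>r. k0 \<alpha> r z y) has_real_derivative kr \<alpha> r z y) (at r within S)"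
  "((\<lambda>z. kz \<alpha> r z y) has_real_derivative kzz \<alpha> r z y) (at z within S)"
  "((\<lambda>r. kz \<alpha> r z y) has_real_derivative kzr \<alpha> r z y) (at r within S)"
proof -
  have p: "((\<lambda>z. D2 r z y powr e) has_real_derivative e * D2 r z y powr (e - 1) * (2 * (z - wz y))) (at z within S)"
   "((\<lambda>r. D2 r z y powr e) has_real_derivative e * D2 r z y powr (e - 1) * (2 * (r - rho y * cos (th y)))) (at r within S)"
    if "y \<in> good" for e
    using D2_pos[OF that, of r z]
    by (auto intro!: derivative_eq_intros D2_deriv simp: powr_diff field_simps)
  have p1: "((\<lambda>z. D2 r z y powr (-3/2)) has_real_derivative -3 * (z - wz y) * D2 r z y powr (-5/2)) (at z within S)"
   "((\<lambda>r. D2 r z y powr (-3/2)) has_real_derivative -3 * (r - rho y * cos (th y)) * D2 r z y powr (-5/2)) (at r within S)"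
    if "y \<in> good"
    by (rule DERIV_cong[OF p(1)[OF that]] DERIV_cong[OF p(2)[OF that]], simp add: field_simps)+
  have p2: "((\<lambda>z. D2 r z y powr (-5/2)) has_real_derivative -5 * (z - wz y) * D2 r z y powr (-7/2)) (at z within S)"
   "((\<lambda>r. D2 r z y powr (-5/2)) has_real_derivative -5 * (r - rho y * cos (th y)) * D2 r z y powr (-7/2)) (at r within S)"
    if "y \<in> good"
    by (rule DERIV_cong[OF p(1)[OF that]] DERIV_cong[OF p(2)[OF that]], simp add: field_simps)+
  show "((\<lambda>z. k0 \<alpha> r z y) has_real_derivative kz \<alpha> r z y) (at z within S)"
    unfolding k0_def kz_def
    by (cases "y \<in> good", rule DERIV_cong[OF DERIV_cmult[OF p1(1)]]) (auto simp: wt_bad)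
  show "((\<lambda>r. k0 \<alpha> r z y) has_real_derivative kr \<alpha> r z y) (at r within S)"
    unfolding k0_def kr_def
    by (cases "y \<in> good", rule DERIV_cong[OF DERIV_cmult[OF p1(2)]]) (auto simp: wt_bad)
  have lin: "((\<lambda>z. wt \<alpha> y * (-3 * (z - wz y))) has_real_derivative wt \<alpha> y * (-3)) (at z within S)"
    by (auto intro!: derivative_eq_intros)
  show "((\<lambda>z. kz \<alpha> r z y) has_real_derivative kzz \<alpha> r z y) (at z within S)"
    unfolding kz_def kzz_def
    by (cases "y \<in> good", rule DERIV_cong[OF DERIV_mult[OF lin p2(1)]])
       (auto simp: wt_bad power2_eq_square algebra_simps)
  show "((\<lambda>r. kz \<alpha> r z y) has_real_derivative kzr \<alpha> r z y) (at r within S)"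
    unfolding kz_def kzr_def
    by (cases "y \<in> good", rule DERIV_cong[OF DERIV_cmult[OF p2(2)]])
       (auto simp: wt_bad algebra_simps)
qed

lemma kernel_continuous:
  shows "continuous_on S (\<lambda>p. k0 \<alpha> (fst p) (snd p) y)"
    "continuous_on S (\<lambda>p. kz \<alpha> (fst p) (snd p) y)"
    "continuous_on S (\<lambda>p. kr \<alpha> (fst p) (snd p) y)"
    "continuous_on S (\<lambda>p. kzz \<alpha> (fst p) (snd p) y)"
    "continuous_on S (\<lambda>p. kzr \<alpha> (fst p) (snd p) y)"
proof -
  have D: "continuous_on S (\<lambda>p. D2 (fst p) (snd p) y)"
    unfolding D2_def by (intro continuous_intros)
  have P: "continuous_on S (\<lambda>p. D2 (fst p) (snd p) y powr e)" if "y \<in> good" for e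
    using D2_pos[OF that] by (intro continuous_on_powr D continuous_intros) (auto simp: less_le)
  show "continuous_on S (\<lambda>p. k0 \<alpha> (fst p) (snd p) y)" unfolding k0_def
    by (cases "y \<in> good") (auto intro!: continuous_intros P simp: wt_bad)
  show "continuous_on S (\<lambda>p. kz \<alpha> (fst p) (snd p) y)" unfolding kz_def
    by (cases "y \<in> good") (auto intro!: continuous_intros P simp: wt_bad)
  show "continuous_on S (\<lambda>p. kr \<alpha> (fst p) (snd p) y)" unfolding kr_def
    by (cases "y \<in> good") (auto intro!: continuous_intros P simp: wt_bad)
  show "continuous_on S (\<lambda>p. kzz \<alpha> (fst p) (snd p) y)" unfolding kzz_def
    by (cases "y \<in> good") (auto intro!: continuous_intros P simp: wt_bad)
  show "continuous_on S (\<lambda>p. kzr \<alpha> (fst p) (snd p) y)" unfolding kzr_def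
    by (cases "y \<in> good") (auto intro!: continuous_intros P simp: wt_bad)
qed

text \<open>Interpolation between two lower bounds of \<open>D2\<close>, the square of rho sin th
  and the squared planar distance, with exponents (2+a)/2 and (2-a)/2 that add up to the exponent 2
  of \<open>kmaj\<close>. The first absorbs the weight except for
  \<open>rho y powr (\<alpha> - a)\<close> and a mild angular factor; the second leaves a planar
  singularity of order 2 - a, integrable when a > 0. The parameter a is free, to be matched with the
  growth of the density in rho.\<close>

lemma kmaj_le:
  assumes y: "y \<in> good" and r: "0 \<le> r" and ne: "rho y \<noteq> r \<or> wz y \<noteq> z" and a: "0 \<le> a" "a \<le> 2"
  shows "kmaj \<alpha> r z y \<le> rho y powr (\<alpha> - a) * sin (th y) powr (-a) * ((r - rho y)\<^sup>2 + (z - wz y)\<^sup>2) powr (-(2-a)/2)"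
proof -
  define D where "D = D2 r z y"
  define d where "d = (r - rho y)\<^sup>2 + (z - wz y)\<^sup>2"
  define s where "s = sin (th y)"
  define p where "p = rho y"
  have s: "0 < s" and p: "0 < p" using y sin_good by (auto simp: s_def p_def good_def)
  have d: "0 < d" using ne by (auto simp: d_def sum_power2_gt_zero_iff)
  have D: "d \<le> D" "(p * s)\<^sup>2 \<le> D" using D2_ge_dist[OF y r] D2_ge(3) by (auto simp: D_def d_def p_def s_def)
  have "D powr (-2) = D powr (-(2+a)/2) * D powr (-(2-a)/2)"
    by (simp add: powr_add[symmetric] field_simps)
  also have "\<dots> \<le> ((p * s)\<^sup>2) powr (-(2+a)/2) * d powr (-(2-a)/2)"
    using a D d s p by (intro mult_mono powr_mono2') auto
  also have "((p * s)\<^sup>2) powr (-(2+a)/2) = (p * s) powr (-(2+a))"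
    using s p by (simp add: square_powr add_divide_distrib diff_divide_distrib)
  also have "\<dots> = p powr (-(2+a)) * s powr (-(2+a))" using s p by (simp add: powr_mult)
  finally have "kmaj \<alpha> r z y \<le> (p powr (2+\<alpha>) * s\<^sup>2) * (p powr (-(2+a)) * s powr (-(2+a)) * d powr (-(2-a)/2))"
    unfolding kmaj_def wt_def D_def[symmetric] s_def[symmetric] p_def[symmetric]
    using y by (simp add: mult_left_mono)
  also have "\<dots> = (p powr (2+\<alpha>) * p powr (-(2+a))) * (s powr 2 * s powr (-(2+a))) * d powr (-(2-a)/2)"
    using s by simp
  also have "\<dots> = p powr (\<alpha> - a) * s powr (-a) * d powr (-(2-a)/2)"
    unfolding powr_add[symmetric] by simp
  finally show ?thesis unfolding p_def s_def d_def .
qed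

section \<open>Integrating out the angle and the radius\<close>

lemma nn_integral_triple:
  assumes [measurable]: "F \<in> borel_measurable borel"
  shows "(\<integral>\<^sup>+y. F y \<partial>(lborel :: triple measure)) = (\<integral>\<^sup>+w. \<integral>\<^sup>+\<rho>. \<integral>\<^sup>+\<theta>. F ((\<rho>,w),\<theta>) \<partial>lborel \<partial>lborel \<partial>lborel)"
proof -
  have "(\<integral>\<^sup>+y. F y \<partial>(lborel :: triple measure)) = (\<integral>\<^sup>+y. F y \<partial>(lborel \<Otimes>\<^sub>M lborel))"
    by (simp add: lborel_prod)
  also have "\<dots> = (\<integral>\<^sup>+q. \<integral>\<^sup>+\<theta>. F (q,\<theta>) \<partial>lborel \<partial>lborel)"
    by (subst lborel.nn_integral_fst[symmetric]) (auto simp: lborel_prod)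
  also have "\<dots> = (\<integral>\<^sup>+q. \<integral>\<^sup>+\<theta>. F (q,\<theta>) \<partial>lborel \<partial>(lborel \<Otimes>\<^sub>M lborel))"
    by (simp add: lborel_prod)
  also have "\<dots> = (\<integral>\<^sup>+w. \<integral>\<^sup>+\<rho>. \<integral>\<^sup>+\<theta>. F ((\<rho>,w),\<theta>) \<partial>lborel \<partial>lborel \<partial>lborel)"
  proof (subst lborel_pair.nn_integral_snd[symmetric])
    have "(\<lambda>q::real\<times>real. \<integral>\<^sup>+\<theta>. F (q,\<theta>) \<partial>lborel) \<in> borel_measurable borel"
      by measurable
    then show "(\<lambda>q. \<integral>\<^sup>+\<theta>. F (q,\<theta>) \<partial>lborel) \<in> borel_measurable (lborel \<Otimes>\<^sub>M lborel)"
      by (simp add: lborel_prod)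
  qed auto
  finally show ?thesis .
qed

text \<open>Writing sin x = 2 sin t cos t with t = x/2 \<le> pi/4: there the cosine is at least sqrt
  2 / 2, and by the mean value theorem sin t is at least t times the same number.\<close>

lemma sin_ge_half:
  assumes "0 \<le> x" "x \<le> pi/2"
  shows "x / 2 \<le> sin x"
proof -
  define t where "t = x/2"
  have t: "0 \<le> t" "t \<le> pi/4" using assms by (auto simp: t_def)
  have c: "sqrt 2 / 2 \<le> cos u" if "0 \<le> u" "u \<le> pi/4" for u
    using cos_monotone_0_pi_le[of u "pi/4"] that cos_45 by auto
  have s: "t * (sqrt 2 / 2) \<le> sin t"
  proof (cases "t = 0")
    case False
    then obtain u where u: "0 < u" "u < t" "sin t - sin 0 = (t - 0) * cos u"
      using MVT2[of 0 t sin cos] t by auto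
    then show ?thesis using c[of u] t by (simp add: mult_left_mono)
  qed simp
  have "x / 2 = 2 * (t * (sqrt 2 / 2)) * (sqrt 2 / 2)" by (simp add: t_def)
  also have "\<dots> \<le> 2 * sin t * cos t"
    using s c[OF t] t by (intro mult_mono) (auto intro: order_trans[OF _ s])
  also have "\<dots> = sin x" using sin_double[of t] by (simp add: t_def)
  finally show ?thesis .
qed

text \<open>The power -1/2 of the sine is integrable on (0, pi) and dominates its powers -a for all
  a \<le> 1/2, so a single angular weight serves every exponent in use.\<close>

definition sinw :: "real \<Rightarrow> real" where
  "sinw \<theta> = indicator {0<..<pi} \<theta> * sin \<theta> powr (-1/2)"

lemma sinw_measurable[measurable]: "sinw \<in> borel_measurable borel"
  unfolding sinw_def by measurable

lemma nn_integral_sinw: "(\<integral>\<^sup>+\<theta>. ennreal (sinw \<theta>) \<partial>lborel) \<le> ennreal 16"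
proof -
  \<comment> \<open>The two endpoint singularities are exchanged by the reflection of \<theta> to pi
    - \<theta>, so one function g treats both. The interval {0..4} merely contains {0..pi/2} and
    makes the integral of g the integer 8.\<close>
  define g where "g x = indicator {0..4} x * (2 * x powr (-1/2))" for x :: real
  have [measurable]: "g \<in> borel_measurable borel" unfolding g_def by measurable
  have gpos: "0 \<le> g x" for x by (simp add: g_def)
  have half: "sin x powr (-1/2) \<le> g x" if "0 < x" "x \<le> pi/2" for x
  proof -
    have "sin x powr (-1/2) \<le> (x/2) powr (-1/2)"
      using that sin_ge_half[of x] by (intro powr_mono2') auto
    also have "\<dots> = x powr (-1/2) * 2 powr (1/2)"
      using that by (simp add: powr_divide powr_minus field_simps)
    also have "\<dots> \<le> x powr (-1/2) * 2 powr 1" by (intro mult_left_mono powr_mono) auto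
    finally show ?thesis using that pi_less_4 by (simp add: g_def)
  qed
  have pt: "sinw \<theta> \<le> g \<theta> + g (pi - \<theta>)" for \<theta>
  proof (cases "0 < \<theta> \<and> \<theta> < pi")
    case True
    then consider "\<theta> \<le> pi/2" | "pi - \<theta> \<le> pi/2" by linarith
    then show ?thesis
    proof cases
      case 1 then show ?thesis using half[of \<theta>] True gpos[of "pi-\<theta>"] by (simp add: sinw_def)
    next
      case 2 then show ?thesis using half[of "pi-\<theta>"] True gpos[of "\<theta>"] by (simp add: sinw_def)
    qed
  next
    case False then show ?thesis using gpos[of \<theta>] gpos[of "pi-\<theta>"] by (auto simp: sinw_def)
  qed
  have "(\<integral>\<^sup>+\<theta>. ennreal (sinw \<theta>) \<partial>lborel) \<le> (\<integral>\<^sup>+\<theta>. ennreal (g \<theta>) + ennreal (g (pi - \<theta>)) \<partial>lborel)"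
    using pt gpos by (intro nn_integral_mono) (auto simp flip: ennreal_plus intro: ennreal_leI)
  also have "\<dots> = (\<integral>\<^sup>+\<theta>. ennreal (g \<theta>) \<partial>lborel) + (\<integral>\<^sup>+\<theta>. ennreal (g \<theta>) \<partial>lborel)"
    by (subst nn_integral_add) (auto simp: nn_integral_translate_real)
  also have "(\<integral>\<^sup>+\<theta>. ennreal (g \<theta>) \<partial>lborel) = ennreal 8"
  proof -
    have "(\<integral>\<^sup>+\<theta>. ennreal (g \<theta>) \<partial>lborel) = (\<integral>\<^sup>+\<theta>. 2 * ennreal (indicator {0..4} \<theta> * \<theta> powr (-1/2)) \<partial>lborel)"
      unfolding g_def by (intro nn_integral_cong) (auto simp: ennreal_mult split: split_indicator)
    also have "\<dots> = 2 * (\<integral>\<^sup>+\<theta>. ennreal (indicator {0..4} \<theta> * \<theta> powr (-1/2)) \<partial>lborel)"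
      by (rule nn_integral_cmult) auto
    also have "\<dots> = ennreal 8"
      by (subst nn_integral_powr_near_0) (auto simp: powr_half_sqrt simp flip: ennreal_numeral ennreal_mult)
    finally show ?thesis .
  qed
  finally show ?thesis by (simp flip: ennreal_plus)
qed

text \<open>Substituting \<rho> = r + \<zeta> u extracts the power a - 1 of |\<zeta>| by scaling;
  the remaining integral of \<open>jap u powr (a-2)\<close> is at most 2 + 2/(1/2) = 6 because a
  \<le> 1/2.\<close>

lemma nn_integral_dist_powr:
  assumes a: "a \<le> 1/2" and \<zeta>: "\<zeta> \<noteq> 0"
  shows "(\<integral>\<^sup>+\<rho>. ennreal (((r - \<rho>)\<^sup>2 + \<zeta>\<^sup>2) powr (-(2-a)/2)) \<partial>lborel) \<le> ennreal (6 * \<bar>\<zeta>\<bar> powr (a-1))"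
proof -
  have eq: "((r - (r + \<zeta> * u))\<^sup>2 + \<zeta>\<^sup>2) powr (-(2-a)/2) = \<bar>\<zeta>\<bar> powr (a-2) * jap u powr (a-2)" for u
  proof -
    have "(r - (r + \<zeta> * u))\<^sup>2 + \<zeta>\<^sup>2 = (\<bar>\<zeta>\<bar> * jap u)\<^sup>2"
      using \<zeta> jap_pos[of u] by (simp add: power_mult_distrib jap_def algebra_simps)
    then show ?thesis using \<zeta> jap_pos[of u] by (simp add: square_powr powr_mult diff_divide_distrib)
  qed
  have le: "jap u powr (a-2) \<le> jap u powr (-1-1/2)" for u
    by (rule powr_mono) (use a jap_ge in auto)
  have "(\<integral>\<^sup>+\<rho>. ennreal (((r - \<rho>)\<^sup>2 + \<zeta>\<^sup>2) powr (-(2-a)/2)) \<partial>lborel)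
     = ennreal \<bar>\<zeta>\<bar> * (\<integral>\<^sup>+u. ennreal (\<bar>\<zeta>\<bar> powr (a-2) * jap u powr (a-2)) \<partial>lborel)"
    by (subst nn_integral_real_affine[OF _ \<zeta>, of _ r], simp) (simp only: eq)
  also have "\<dots> \<le> ennreal \<bar>\<zeta>\<bar> * (\<integral>\<^sup>+u. ennreal (\<bar>\<zeta>\<bar> powr (a-2)) * ennreal (jap u powr (-1-1/2)) \<partial>lborel)"
    using le by (intro mult_left_mono nn_integral_mono) (auto simp flip: ennreal_mult intro!: ennreal_leI mult_left_mono)
  also have "\<dots> = ennreal \<bar>\<zeta>\<bar> * (ennreal (\<bar>\<zeta>\<bar> powr (a-2)) * (\<integral>\<^sup>+u. ennreal (jap u powr (-1-1/2)) \<partial>lborel))"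
    by (subst nn_integral_cmult) auto
  also have "\<dots> \<le> ennreal \<bar>\<zeta>\<bar> * (ennreal (\<bar>\<zeta>\<bar> powr (a-2)) * ennreal (2 + 2/(1/2)))"
    by (intro mult_left_mono nn_integral_jap_powr) auto
  also have "\<dots> = ennreal (\<bar>\<zeta>\<bar> * \<bar>\<zeta>\<bar> powr (a-2) * 6)"
    by (simp add: mult.assoc flip: ennreal_numeral ennreal_mult)
  also have "\<bar>\<zeta>\<bar> * \<bar>\<zeta>\<bar> powr (a-2) = \<bar>\<zeta>\<bar> powr (a-1)"
    using \<zeta> by (simp add: powr_mult_base)
  finally show ?thesis by (simp add: mult.commute)
qed

lemma AE_coord_ne:
  "AE y in (lborel :: triple measure). rho y \<noteq> r" "AE y in (lborel :: triple measure). wz y \<noteq> z"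
proof -
  have s: "{y. rho y = r} \<in> sets (lborel :: triple measure)" "{y. wz y = z} \<in> sets (lborel :: triple measure)"
    by measurable
  have "emeasure lborel {y. rho y = r} = (\<integral>\<^sup>+y. indicator {y. rho y = r} y \<partial>lborel)"
    using s by simp
  also have "\<dots> = (\<integral>\<^sup>+w. \<integral>\<^sup>+\<rho>. \<integral>\<^sup>+\<theta>. indicator {y. rho y = r} ((\<rho>,w),\<theta>) \<partial>lborel \<partial>lborel \<partial>lborel)"
    using s by (intro nn_integral_triple) auto
  also have "\<dots> = (\<integral>\<^sup>+w. \<integral>\<^sup>+\<rho>. 0 \<partial>(lborel :: real measure) \<partial>(lborel :: real measure))"
  proof (rule nn_integral_cong, rule nn_integral_cong_AE)
    fix w :: real
    show "AE \<rho> in lborel. (\<integral>\<^sup>+\<theta>. indicator {y. rho y = r} ((\<rho>,w),\<theta>) \<partial>lborel) = 0"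
      using AE_lborel_singleton[of r] by eventually_elim simp
  qed
  finally have 1: "emeasure lborel {y. rho y = r} = 0" by simp
  have "emeasure lborel {y. wz y = z} = (\<integral>\<^sup>+y. indicator {y. wz y = z} y \<partial>lborel)"
    using s by simp
  also have "\<dots> = (\<integral>\<^sup>+w. \<integral>\<^sup>+\<rho>. \<integral>\<^sup>+\<theta>. indicator {y. wz y = z} ((\<rho>,w),\<theta>) \<partial>lborel \<partial>lborel \<partial>lborel)"
    using s by (intro nn_integral_triple) auto
  also have "\<dots> = (\<integral>\<^sup>+w. 0 \<partial>(lborel :: real measure))"
  proof (rule nn_integral_cong_AE)
    show "AE w in lborel. (\<integral>\<^sup>+\<rho>. \<integral>\<^sup>+\<theta>. indicator {y. wz y = z} ((\<rho>,w),\<theta>) \<partial>lborel \<partial>lborel) = 0"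
      using AE_lborel_singleton[of z] by eventually_elim simp
  qed
  finally have 2: "emeasure lborel {y. wz y = z} = 0" by simp
  show "AE y in (lborel :: triple measure). rho y \<noteq> r"
    by (rule AE_I[OF _ 1 s(1)]) auto
  show "AE y in (lborel :: triple measure). wz y \<noteq> z"
    by (rule AE_I[OF _ 2 s(2)]) auto
qed

lemma nn_integral_product_triple:
  assumes [measurable]: "f \<in> borel_measurable borel" "g \<in> borel_measurable borel" "h \<in> borel_measurable borel"
    and pos: "\<And>x. 0 \<le> f x" "\<And>x. 0 \<le> g x" "\<And>x. 0 \<le> h x"
  shows "(\<integral>\<^sup>+y. ennreal (f (th y) * g (rho y) * h (wz y)) \<partial>(lborel :: triple measure))
    = (\<integral>\<^sup>+x. ennreal (f x) \<partial>lborel) * (\<integral>\<^sup>+x. ennreal (g x) \<partial>lborel) * (\<integral>\<^sup>+x. ennreal (h x) \<partial>lborel)"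
proof -
  have "(\<integral>\<^sup>+y. ennreal (f (th y) * g (rho y) * h (wz y)) \<partial>(lborel :: triple measure))
     = (\<integral>\<^sup>+w. \<integral>\<^sup>+\<rho>. \<integral>\<^sup>+\<theta>. ennreal (g \<rho> * h w) * ennreal (f \<theta>) \<partial>lborel \<partial>lborel \<partial>lborel)"
    by (subst nn_integral_triple) (auto simp: pos ennreal_mult[symmetric] mult_ac)
  also have "\<dots> = (\<integral>\<^sup>+w. \<integral>\<^sup>+\<rho>. ((\<integral>\<^sup>+x. ennreal (f x) \<partial>lborel) * ennreal (h w)) * ennreal (g \<rho>) \<partial>lborel \<partial>lborel)"
    by (subst nn_integral_cmult) (auto simp: pos ennreal_mult mult_ac)
  also have "\<dots> = (\<integral>\<^sup>+w. ((\<integral>\<^sup>+x. ennreal (f x) \<partial>lborel) * (\<integral>\<^sup>+x. ennreal (g x) \<partial>lborel)) * ennreal (h w) \<partial>lborel)"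
    by (subst nn_integral_cmult) (auto simp: mult_ac)
  also have "\<dots> = (\<integral>\<^sup>+x. ennreal (f x) \<partial>lborel) * (\<integral>\<^sup>+x. ennreal (g x) \<partial>lborel) * (\<integral>\<^sup>+x. ennreal (h x) \<partial>lborel)"
    by (subst nn_integral_cmult) auto
  finally show ?thesis .
qed

text \<open>The angle contributes at most 16 and the radius at most 6 times a power of |z - w|,
  which leaves a one-dimensional Riesz potential of order a. The dependence on r disappears because
  \<rho> is integrated over the whole line.\<close>

lemma nn_integral_riesz_triple:
  assumes f[measurable]: "f \<in> borel_measurable borel" and fpos: "\<And>x. 0 \<le> f x" and a: "a \<le> 1/2"
  shows "(\<integral>\<^sup>+y. ennreal (sinw (th y) * ((r - rho y)\<^sup>2 + (z - wz y)\<^sup>2) powr (-(2-a)/2) * f (wz y))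
            \<partial>(lborel :: triple measure))
     \<le> ennreal 96 * (\<integral>\<^sup>+w. ennreal (\<bar>z - w\<bar> powr (a-1) * f w) \<partial>lborel)"
proof -
  have sp: "0 \<le> sinw x" for x by (simp add: sinw_def)
  have "(\<integral>\<^sup>+y. ennreal (sinw (th y) * ((r - rho y)\<^sup>2 + (z - wz y)\<^sup>2) powr (-(2-a)/2) * f (wz y)) \<partial>(lborel :: triple measure))
     = (\<integral>\<^sup>+w. \<integral>\<^sup>+\<rho>. \<integral>\<^sup>+\<theta>. ennreal (((r - \<rho>)\<^sup>2 + (z - w)\<^sup>2) powr (-(2-a)/2) * f w) * ennreal (sinw \<theta>) \<partial>lborel \<partial>lborel \<partial>lborel)"
    by (subst nn_integral_triple) (auto simp: sp fpos ennreal_mult[symmetric] mult_ac)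
  also have "\<dots> = (\<integral>\<^sup>+w. \<integral>\<^sup>+\<rho>. ((\<integral>\<^sup>+x. ennreal (sinw x) \<partial>lborel) * ennreal (f w)) * ennreal (((r - \<rho>)\<^sup>2 + (z - w)\<^sup>2) powr (-(2-a)/2)) \<partial>lborel \<partial>lborel)"
    by (subst nn_integral_cmult) (auto simp: fpos ennreal_mult mult_ac)
  also have "\<dots> = (\<integral>\<^sup>+w. ((\<integral>\<^sup>+x. ennreal (sinw x) \<partial>lborel) * ennreal (f w)) * (\<integral>\<^sup>+\<rho>. ennreal (((r - \<rho>)\<^sup>2 + (z - w)\<^sup>2) powr (-(2-a)/2)) \<partial>lborel) \<partial>lborel)"
    by (subst nn_integral_cmult) auto
  also have "\<dots> \<le> (\<integral>\<^sup>+w. ennreal 96 * ennreal (\<bar>z - w\<bar> powr (a-1) * f w) \<partial>lborel)"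
  proof (rule nn_integral_mono_AE)
    show "AE w in lborel. ((\<integral>\<^sup>+x. ennreal (sinw x) \<partial>lborel) * ennreal (f w)) * (\<integral>\<^sup>+\<rho>. ennreal (((r - \<rho>)\<^sup>2 + (z - w)\<^sup>2) powr (-(2-a)/2)) \<partial>lborel)
      \<le> ennreal 96 * ennreal (\<bar>z - w\<bar> powr (a-1) * f w)"
      using AE_lborel_singleton[of z]
    proof eventually_elim
      case (elim w)
      have "((\<integral>\<^sup>+x. ennreal (sinw x) \<partial>lborel) * ennreal (f w)) * (\<integral>\<^sup>+\<rho>. ennreal (((r - \<rho>)\<^sup>2 + (z - w)\<^sup>2) powr (-(2-a)/2)) \<partial>lborel)
        \<le> (ennreal 16 * ennreal (f w)) * ennreal (6 * \<bar>z - w\<bar> powr (a-1))"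
        using elim a by (intro mult_mono nn_integral_sinw nn_integral_dist_powr) auto
      also have "\<dots> = ennreal (16 * f w * (6 * \<bar>z - w\<bar> powr (a-1)))"
        using fpos[of w] by (subst ennreal_mult[symmetric], simp, simp)+ simp
      also have "\<dots> = ennreal 96 * ennreal (\<bar>z - w\<bar> powr (a-1) * f w)"
        using fpos[of w] by (subst ennreal_mult[symmetric]) (auto simp: mult_ac)
      finally show ?case .
    qed
  qed
  also have "\<dots> = ennreal 96 * (\<integral>\<^sup>+w. ennreal (\<bar>z - w\<bar> powr (a-1) * f w) \<partial>lborel)"
    by (rule nn_integral_cmult) auto
  finally show ?thesis .
qed

lemma sin_powr_le_sinw:
  assumes "y \<in> good" "a \<le> 1/2"
  shows "sin (th y) powr (-a) \<le> sinw (th y)"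
proof -
  have "sin (th y) powr (-a) \<le> sin (th y) powr (-1/2)"
    using assms sin_good[OF assms(1)] by (intro powr_mono') auto
  then show ?thesis using assms by (simp add: sinw_def good_def)
qed

lemma sinw_ge_1: "y \<in> good \<Longrightarrow> 1 \<le> sinw (th y)"
  using sin_powr_le_sinw[of y 0] sin_good[of y] by simp

lemma sinw_nonneg: "0 \<le> sinw x" by (simp add: sinw_def)

definition dens_bound :: "real \<Rightarrow> real \<Rightarrow> real \<Rightarrow> real \<Rightarrow> (real \<times> real \<Rightarrow> real) \<Rightarrow> bool" where
  "dens_bound \<alpha> \<mu> c B \<Omega> \<longleftrightarrow> (\<forall>\<rho> w. 0 < \<rho> \<longrightarrow>
     \<bar>\<Omega> (\<rho>, w)\<bar> \<le> B * (\<rho> powr \<mu> * jap w powr (-(\<alpha>+\<mu>)-c) + jap w powr (-\<alpha>-c)))"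

text \<open>The growth \<open>rho y powr (a - \<alpha>)\<close> is exactly the reciprocal of the
  radial factor left by \<open>kmaj_le\<close> for the same a; this dictates the choice of a. The
  constant is 3072 = 96 * 32.\<close>

lemma kmaj_dens_le:
  assumes a: "3/10 \<le> a" "a \<le> 1/2" and c: "0 < c" "c \<le> 1" and r: "0 \<le> r"
  shows "(\<integral>\<^sup>+y. ennreal (kmaj \<alpha> r z y * (rho y powr (a - \<alpha>) * jap (wz y) powr (-a-c))) \<partial>(lborel :: triple measure)) \<le> ennreal (3072/c)"
proof -
  have "(\<integral>\<^sup>+y. ennreal (kmaj \<alpha> r z y * (rho y powr (a - \<alpha>) * jap (wz y) powr (-a-c))) \<partial>(lborel :: triple measure))
    \<le> (\<integral>\<^sup>+y. ennreal (sinw (th y) * ((r - rho y)\<^sup>2 + (z - wz y)\<^sup>2) powr (-(2-a)/2) * jap (wz y) powr (-a-c)) \<partial>(lborel :: triple measure))"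
  proof (rule nn_integral_mono_AE)
    show "AE y in (lborel :: triple measure). ennreal (kmaj \<alpha> r z y * (rho y powr (a - \<alpha>) * jap (wz y) powr (-a-c)))
       \<le> ennreal (sinw (th y) * ((r - rho y)\<^sup>2 + (z - wz y)\<^sup>2) powr (-(2-a)/2) * jap (wz y) powr (-a-c))"
      using AE_coord_ne(1)[of r]
    proof eventually_elim
      case (elim y)
      show ?case
      proof (cases "y \<in> good")
        case False
        then show ?thesis using sinw_nonneg by (simp add: kmaj_def wt_bad)
      next
        case True
        have rp: "0 < rho y" using True by (simp add: good_def)
        define d where "d = ((r - rho y)\<^sup>2 + (z - wz y)\<^sup>2) powr (-(2-a)/2)"
        have d0: "0 \<le> d" by (simp add: d_def)
        have "kmaj \<alpha> r z y \<le> rho y powr (\<alpha> - a) * sin (th y) powr (-a) * d"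
          unfolding d_def by (rule kmaj_le) (use True r elim a in auto)
        also have "\<dots> \<le> rho y powr (\<alpha> - a) * sinw (th y) * d"
          using sin_powr_le_sinw[OF True a(2)] d0 by (intro mult_right_mono mult_left_mono) auto
        finally have "kmaj \<alpha> r z y * (rho y powr (a - \<alpha>) * jap (wz y) powr (-a-c))
           \<le> rho y powr (\<alpha> - a) * sinw (th y) * d * (rho y powr (a - \<alpha>) * jap (wz y) powr (-a-c))"
          by (intro mult_right_mono) auto
        also have "\<dots> = (rho y powr (\<alpha> - a) * rho y powr (a - \<alpha>)) * (sinw (th y) * d * jap (wz y) powr (-a-c))"
          by simp
        also have "rho y powr (\<alpha> - a) * rho y powr (a - \<alpha>) = 1"
          using rp by (simp add: powr_add[symmetric])
        finally show ?thesis unfolding d_def by (intro ennreal_leI) simp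
      qed
    qed
  qed
  also have "\<dots> \<le> ennreal 96 * (\<integral>\<^sup>+w. ennreal (\<bar>z - w\<bar> powr (a-1) * jap w powr (-a-c)) \<partial>lborel)"
    by (rule nn_integral_riesz_triple) (use a in auto)
  also have "\<dots> \<le> ennreal 96 * ennreal (32/c)"
    by (intro mult_left_mono nn_integral_riesz_le) (use a c in auto)
  also have "\<dots> = ennreal (3072/c)"
    using c by (subst ennreal_mult[symmetric]) auto
  finally show ?thesis .
qed

text \<open>The two terms of \<open>dens_bound\<close> are treated with different exponents, a =
  \<alpha> + \<mu> for the growing one and a = \<alpha> for the other; each contributes
  3072/c.\<close>

lemma kmaj_dens_bound:
  assumes \<Omega>[measurable]: "\<Omega> \<in> borel_measurable borel" and b: "dens_bound \<alpha> \<mu> c B \<Omega>"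
    and a: "3/10 \<le> \<alpha>" "0 \<le> \<mu>" "\<alpha> + \<mu> \<le> 1/2" and c: "0 < c" "c \<le> 1" and B: "0 \<le> B" and r: "0 \<le> r"
  shows "(\<integral>\<^sup>+y. ennreal (kmaj \<alpha> r z y * \<bar>\<Omega> (fst y)\<bar>) \<partial>(lborel :: triple measure)) \<le> ennreal (6144 * B/c)"
proof -
  have [measurable]: "(\<lambda>y::triple. \<Omega> (fst y)) \<in> borel_measurable borel"
    by (intro measurable_compose[OF _ \<Omega>] borel_measurable_continuous_onI continuous_intros)
  let ?f = "\<lambda>a y. kmaj \<alpha> r z y * (rho y powr (a - \<alpha>) * jap (wz y) powr (-a-c))"
  have pos: "0 \<le> ?f a y" for a y by (simp add: kmaj_nonneg)
  have "(\<integral>\<^sup>+y. ennreal (kmaj \<alpha> r z y * \<bar>\<Omega> (fst y)\<bar>) \<partial>(lborel :: triple measure))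
    \<le> (\<integral>\<^sup>+y. ennreal B * (ennreal (?f (\<alpha>+\<mu>) y) + ennreal (?f \<alpha> y)) \<partial>(lborel :: triple measure))"
  proof (rule nn_integral_mono)
    fix y :: triple
    have "kmaj \<alpha> r z y * \<bar>\<Omega> (fst y)\<bar> \<le> B * (?f (\<alpha>+\<mu>) y + ?f \<alpha> y)"
    proof (cases "y \<in> good")
      case True
      then have rp: "0 < rho y" by (simp add: good_def)
      have "\<bar>\<Omega> (fst y)\<bar> \<le> B * (rho y powr \<mu> * jap (wz y) powr (-(\<alpha>+\<mu>)-c) + jap (wz y) powr (-\<alpha>-c))"
        using b rp unfolding dens_bound_def rho_def wz_def by (metis prod.collapse)
      then have "kmaj \<alpha> r z y * \<bar>\<Omega> (fst y)\<bar> \<le> kmaj \<alpha> r z y * (B * (rho y powr \<mu> * jap (wz y) powr (-(\<alpha>+\<mu>)-c) + jap (wz y) powr (-\<alpha>-c)))"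
        by (rule mult_left_mono[OF _ kmaj_nonneg])
      then show ?thesis using rp by (simp add: algebra_simps)
    qed (simp add: kmaj_def wt_bad)
    then show "ennreal (kmaj \<alpha> r z y * \<bar>\<Omega> (fst y)\<bar>) \<le> ennreal B * (ennreal (?f (\<alpha>+\<mu>) y) + ennreal (?f \<alpha> y))"
      using pos[where a="\<alpha>+\<mu>" and y=y] pos[where a=\<alpha> and y=y] B
      by (simp only: ennreal_plus[symmetric] ennreal_mult[symmetric] add_nonneg_nonneg) (rule ennreal_leI)
  qed
  also have "\<dots> = ennreal B * ((\<integral>\<^sup>+y. ennreal (?f (\<alpha>+\<mu>) y) \<partial>(lborel :: triple measure)) + (\<integral>\<^sup>+y. ennreal (?f \<alpha> y) \<partial>(lborel :: triple measure)))"
    by (subst nn_integral_cmult, measurable, subst nn_integral_add) auto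
  also have "\<dots> \<le> ennreal B * (ennreal (3072/c) + ennreal (3072/c))"
    by (intro mult_left_mono add_mono kmaj_dens_le) (use a c r in auto)
  also have "\<dots> = ennreal (6144 * B/c)"
    using B c by (subst ennreal_plus[symmetric], simp, simp, subst ennreal_mult[symmetric]) (auto simp: field_simps)
  finally show ?thesis .
qed

text \<open>Differentiation under the integral sign in integrated form, by Fubini. It asks for a
  bound on the L1 norm of the differentiated kernel, uniform in t, instead of a common pointwise
  majorant of the difference quotients; this suits kernels whose singularity moves with t.\<close>

lemma ftc_under_integral:
  fixes k k1 :: "real \<Rightarrow> 'a::euclidean_space \<Rightarrow> real"
  assumes ab: "a \<le> b"
    and meas[measurable]: "(\<lambda>(t,y). k1 t y) \<in> borel_measurable (lborel \<Otimes>\<^sub>M lborel)"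
    and deriv: "\<And>t y. t \<in> {a..b} \<Longrightarrow> ((\<lambda>t. k t y) has_real_derivative k1 t y) (at t within {a..b})"
    and cont: "\<And>y. continuous_on {a..b} (\<lambda>t. k1 t y)"
    and bound: "\<And>t. t \<in> {a..b} \<Longrightarrow> (\<integral>\<^sup>+y. ennreal \<bar>k1 t y\<bar> \<partial>lborel) \<le> ennreal C"
    and int: "integrable lborel (k a)" "integrable lborel (k b)"
  shows "(\<integral>y. k b y \<partial>lborel) - (\<integral>y. k a y \<partial>lborel) = (LBINT t:{a..b}. \<integral>y. k1 t y \<partial>lborel)"
    and "set_integrable lborel {a..b} (\<lambda>t. \<integral>y. k1 t y \<partial>lborel)"
proof -
  have I: "integrable (lborel \<Otimes>\<^sub>M lborel) (\<lambda>(t,y). indicator {a..b} t * k1 t y)"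
  proof (rule integrableI_bounded)
    show "(\<lambda>(t,y). indicator {a..b} t * k1 t y) \<in> borel_measurable (lborel \<Otimes>\<^sub>M lborel)"
      using meas by measurable
    have "(\<integral>\<^sup>+x. ennreal (norm (case x of (t,y) \<Rightarrow> indicator {a..b} t * k1 t y)) \<partial>(lborel \<Otimes>\<^sub>M lborel))
      = (\<integral>\<^sup>+t. \<integral>\<^sup>+y. ennreal (norm (indicator {a..b} t * k1 t y)) \<partial>lborel \<partial>lborel)"
      by (subst lborel.nn_integral_fst[symmetric]) (use meas in auto)
    also have "\<dots> \<le> (\<integral>\<^sup>+t. ennreal C * indicator {a..b} t \<partial>lborel)"
    proof (rule nn_integral_mono)
      fix t
      show "(\<integral>\<^sup>+y. ennreal (norm (indicator {a..b} t * k1 t y)) \<partial>lborel) \<le> ennreal C * indicator {a..b} t"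
        using bound[of t] by (cases "t \<in> {a..b}") auto
    qed
    also have "\<dots> = ennreal C * ennreal (b - a)"
      using ab by (simp add: nn_integral_cmult)
    also have "\<dots> < \<infinity>" by (simp add: ennreal_mult_less_top)
    finally show "(\<integral>\<^sup>+x. ennreal (norm (case x of (t,y) \<Rightarrow> indicator {a..b} t * k1 t y)) \<partial>(lborel \<Otimes>\<^sub>M lborel)) < \<infinity>" .
  qed
  have "(\<integral>t. indicator {a..b} t * k1 t y \<partial>lborel) = k b y - k a y" for y
  proof -
    have "(\<integral>t. indicator {a..b} t *\<^sub>R k1 t y \<partial>lborel) = k b y - k a y"
      by (rule integral_FTC_atLeastAtMost[OF ab])
        (use deriv cont in \<open>auto simp: has_real_derivative_iff_has_vector_derivative\<close>)
    then show ?thesis by simp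
  qed
  then have "(\<integral>y. k b y - k a y \<partial>lborel) = (\<integral>y. (\<integral>t. indicator {a..b} t * k1 t y \<partial>lborel) \<partial>lborel)"
    by simp
  also have "\<dots> = (\<integral>t. (\<integral>y. indicator {a..b} t * k1 t y \<partial>lborel) \<partial>lborel)"
    by (rule lborel_pair.Fubini_integral[OF I])
  finally show "(\<integral>y. k b y \<partial>lborel) - (\<integral>y. k a y \<partial>lborel) = (LBINT t:{a..b}. \<integral>y. k1 t y \<partial>lborel)"
    using int by (simp add: set_lebesgue_integral_def)
  have "integrable lborel (\<lambda>t. \<integral>y. indicator {a..b} t * k1 t y \<partial>lborel)"
    using lborel_pair.integrable_fst[OF I] .
  then show "set_integrable lborel {a..b} (\<lambda>t. \<integral>y. k1 t y \<partial>lborel)"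
    by (simp add: set_integrable_def)
qed

lemma integral_diff_imp_derivative:
  fixes F G :: "real \<Rightarrow> real"
  assumes diff: "\<And>a b. a \<le> b \<Longrightarrow> a \<in> I \<Longrightarrow> b \<in> I \<Longrightarrow> F b - F a = (LBINT t:{a..b}. G t)"
    and cont: "continuous_on I G" and I: "I = {p..q} \<or> I = UNIV" and x: "x \<in> I"
  shows "(F has_real_derivative G x) (at x within I)"
proof -
  have main: "(F has_real_derivative G x) (at x within {p..q})" if sub: "{p..q} \<subseteq> I" and x: "x \<in> {p..q}" for p q
  proof -
    have c: "continuous_on {p..q} G" using cont sub continuous_on_subset by blast
    have eq: "F p + integral {p..u} G = F u" if u: "u \<in> {p..q}" for u
    proof -
      have cu: "continuous_on {p..u} G" using c u by (auto intro: continuous_on_subset)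
      have "(LBINT t:{p..u}. G t) = integral {p..u} G"
        by (intro set_borel_integral_eq_integral borel_integrable_atLeastAtMost')  (rule cu)
      then show ?thesis using diff[of p u] u sub by force
    qed
    have "((\<lambda>u. F p + integral {p..u} G) has_real_derivative G x) (at x within {p..q})"
      using integral_has_real_derivative[OF c x] by (auto intro!: derivative_eq_intros)
    then show ?thesis
      using eq by (rule has_field_derivative_transform_within[OF _ zero_less_one x])
  qed
  from I show ?thesis
  proof
    assume "I = {p..q}" then show ?thesis using main[of p q] x by simp
  next
    assume U: "I = UNIV"
    have "(F has_real_derivative G x) (at x within {x-1..x+1})" using main U by auto
    then show ?thesis using U at_within_interior[of x "{x-1..x+1}"] by simp
  qed
qed

section \<open>Potentials of class $C^1$\<close>

lemma integral_lborel_shift: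
  fixes f :: "'a::euclidean_space \<Rightarrow> real"
  assumes [measurable]: "f \<in> borel_measurable borel"
  shows "(\<integral>y. f (c + y) \<partial>lborel) = (\<integral>y. f y \<partial>lborel)"
    and "integrable lborel f \<Longrightarrow> integrable lborel (\<lambda>y. f (c + y))"
proof -
  have "(\<integral>y. f y \<partial>lborel) = (\<integral>y. f y \<partial>(distr lborel borel ((+) c)))"
    by (simp add: lborel_distr_plus)
  also have "\<dots> = (\<integral>y. f (c + y) \<partial>lborel)" by (rule integral_distr) auto
  finally show "(\<integral>y. f (c + y) \<partial>lborel) = (\<integral>y. f y \<partial>lborel)" by simp
  assume "integrable lborel f"
  then have "integrable (distr lborel borel ((+) c)) f" by (simp add: lborel_distr_plus)
  then show "integrable lborel (\<lambda>y. f (c + y))" by (subst (asm) integrable_distr_eq) auto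
qed

definition quot_kernel :: "real \<Rightarrow> real \<Rightarrow> real" where "quot_kernel s x = \<bar>x\<bar> powr (-s) / (1 + x\<^sup>2)"

lemma quot_kernel_measurable[measurable]: "quot_kernel s \<in> borel_measurable borel"
  unfolding quot_kernel_def by measurable

lemma quot_kernel_nonneg: "0 \<le> quot_kernel s x" by (simp add: quot_kernel_def)

lemma nn_integral_quot_kernel:
  assumes s: "0 \<le> s" "s < 1"
  shows "(\<integral>\<^sup>+x. ennreal (quot_kernel s x) \<partial>lborel) < \<infinity>"
proof -
  have pt: "quot_kernel s x \<le> indicator {x. \<bar>x\<bar> \<le> 1} x * \<bar>x\<bar> powr (-s) + jap x powr (-1-1)" for x
  proof (cases "\<bar>x\<bar> \<le> 1")
    case True
    have "\<bar>x\<bar> powr (-s) / (1 + x\<^sup>2) \<le> \<bar>x\<bar> powr (-s) / 1"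
      by (rule divide_left_mono) (auto simp: add_pos_nonneg)
    then show ?thesis using True by (simp add: quot_kernel_def add_increasing2)
  next
    case False
    have "\<bar>x\<bar> powr (-s) \<le> \<bar>x\<bar> powr 0" using False s by (intro powr_mono) auto
    then have "\<bar>x\<bar> powr (-s) \<le> 1" using False by (auto split: if_splits)
    then have "\<bar>x\<bar> powr (-s) / (1 + x\<^sup>2) \<le> 1 / (1 + x\<^sup>2)"
      using False by (intro divide_right_mono) auto
    also have "\<dots> = jap x powr (-1-1)"
    proof -
      have "jap x powr (-1-1) = 1 / (jap x powr 2)"
        by (simp add: powr_minus divide_inverse)
      also have "jap x powr 2 = 1 + x\<^sup>2" using jap_pos[of x] by (simp add: jap_def)
      finally show ?thesis by simp
    qed
    finally show ?thesis using False by (simp add: quot_kernel_def)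
  qed
  have "(\<integral>\<^sup>+x. ennreal (quot_kernel s x) \<partial>lborel)
    \<le> (\<integral>\<^sup>+x. ennreal (indicator {x. \<bar>x\<bar> \<le> 1} x * \<bar>x\<bar> powr (-s)) + ennreal (jap x powr (-1-1)) \<partial>lborel)"
    using pt by (intro nn_integral_mono) (auto simp flip: ennreal_plus intro!: ennreal_leI)
  also have "\<dots> = (\<integral>\<^sup>+x. ennreal (indicator {x. \<bar>x\<bar> \<le> 1} x * \<bar>x\<bar> powr (-s)) \<partial>lborel)
      + (\<integral>\<^sup>+x. ennreal (jap x powr (-1-1)) \<partial>lborel)"
    by (rule nn_integral_add) auto
  also have "\<dots> \<le> ennreal (2 * 1 powr (-s+1) / (-s+1)) + ennreal (2 + 2/1)"
    by (intro add_mono nn_integral_abs_powr_near_0 nn_integral_jap_powr) (use s in auto)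
  also have "\<dots> < \<infinity>" by simp
  finally show ?thesis .
qed

text \<open>A planar singularity of order 2 - \<alpha> \<le> 17/10 is distributed as 9/10 in rho and
  8/10 in w, each integrable on the line. The product form makes the majorants translates of one
  another, so all of them have the same integral, as convergence with moving majorants
  requires.\<close>

definition near_majorant :: "real \<Rightarrow> real \<Rightarrow> triple \<Rightarrow> real" where
  "near_majorant r z y = sinw (th y) * quot_kernel (9/10) (rho y - r) * quot_kernel (8/10) (wz y - z)"

lemma near_majorant_measurable[measurable]: "near_majorant r z \<in> borel_measurable borel"
  unfolding near_majorant_def by measurable

lemma near_majorant_nonneg: "0 \<le> near_majorant r z y"
  by (simp add: near_majorant_def sinw_nonneg quot_kernel_nonneg)

lemma near_majorant_integral:
  "integrable lborel (near_majorant r z)" "(\<integral>y. near_majorant r z y \<partial>lborel) = (\<integral>y. near_majorant 0 0 y \<partial>lborel)"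
proof -
  have eq: "near_majorant r z y = near_majorant 0 0 (((-r,-z),0) + y)" for y
    by (simp add: near_majorant_def rho_def wz_def th_def)
  have "(\<integral>\<^sup>+y. ennreal (near_majorant 0 0 y) \<partial>lborel) = (\<integral>\<^sup>+y. ennreal (sinw (th y) * quot_kernel (9/10) (rho y) * quot_kernel (8/10) (wz y)) \<partial>(lborel :: triple measure))"
    by (simp add: near_majorant_def)
  also have "\<dots> = (\<integral>\<^sup>+x. ennreal (sinw x) \<partial>lborel) * (\<integral>\<^sup>+x. ennreal (quot_kernel (9/10) x) \<partial>lborel) * (\<integral>\<^sup>+x. ennreal (quot_kernel (8/10) x) \<partial>lborel)"
    by (rule nn_integral_product_triple) (auto simp: sinw_nonneg quot_kernel_nonneg)
  also have "\<dots> < \<infinity>"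
    using nn_integral_quot_kernel[of "9/10"] nn_integral_quot_kernel[of "8/10"] le_less_trans[OF nn_integral_sinw, of \<infinity>]
    by (auto simp: ennreal_mult_less_top)
  finally have 0: "integrable lborel (near_majorant 0 0)"
    by (intro integrableI_bounded) (auto simp: near_majorant_nonneg)
  have "near_majorant r z = (\<lambda>y. near_majorant 0 0 (((-r,-z),0) + y))" using eq by auto
  then show "integrable lborel (near_majorant r z)" "(\<integral>y. near_majorant r z y \<partial>lborel) = (\<integral>y. near_majorant 0 0 y \<partial>lborel)"
    using integral_lborel_shift[of "near_majorant 0 0" "((-r,-z),0)"] 0 by simp_all
qed

text \<open>One constant for both regimes of \<open>near_bound\<close>: 6 M (1 + M^2) is what
  \<open>k0\<close> costs near the singularity and 2 M^4 (1 + M^2) is the cost away from it.\<close>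

definition CM :: "real \<Rightarrow> real" where "CM M = 6 * M^4 * (1 + M\<^sup>2)"

text \<open>For |w - z| \<le> 1 the interpolation \<open>kmaj_le\<close> with a = \<alpha> applies,
  and \<open>k0\<close> differs from \<open>kmaj\<close> by the square root of \<open>D2\<close>,
  which is at most 3 M. For |w - z| > 1 nothing is singular: the weight is at most M^3 and decay of
  order 3 in w suffices, while in rho everything happens on a bounded interval.\<close>

lemma near_bound:
  assumes M: "1 \<le> M" and r: "0 \<le> r" "r \<le> M" and a: "3/10 \<le> \<alpha>" "\<alpha> \<le> 1/2"
    and rho: "rho y \<le> M" and ne: "rho y \<noteq> r" "wz y \<noteq> z"
  shows "kmaj \<alpha> r z y \<le> CM M * near_majorant r z y" "k0 \<alpha> r z y \<le> CM M * near_majorant r z y"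
proof -
  have CM0: "0 \<le> CM M" using M by (simp add: CM_def)
  have "kmaj \<alpha> r z y \<le> CM M * near_majorant r z y \<and> k0 \<alpha> r z y \<le> CM M * near_majorant r z y"
  proof (cases "y \<in> good")
    case False
    then show ?thesis using CM0 by (simp add: kmaj_def k0_def wt_bad near_majorant_nonneg)
  next
    case y: True
    define x where "x = \<bar>rho y - r\<bar>"
    define u where "u = \<bar>wz y - z\<bar>"
    define s where "s = sinw (th y)"
    define D where "D = D2 r z y"
    have rp: "0 < rho y" using y by (simp add: good_def)
    have x: "0 < x" "x \<le> M" and u: "0 < u" using ne r rp rho by (auto simp: x_def u_def)
    have s1: "1 \<le> s" using sinw_ge_1[OF y] by (simp add: s_def)
    have g: "near_majorant r z y = s * (x powr (-9/10) / (1 + x\<^sup>2)) * (u powr (-8/10) / (1 + u\<^sup>2))"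
      by (simp add: near_majorant_def quot_kernel_def x_def u_def s_def)
    have xg: "x powr (-9/10) \<le> (1 + M\<^sup>2) * (x powr (-9/10) / (1 + x\<^sup>2))"
    proof -
      have "x\<^sup>2 \<le> M\<^sup>2" using x by (intro power_mono) auto
      then have "x powr (-9/10) * (1 + x\<^sup>2) \<le> x powr (-9/10) * (1 + M\<^sup>2)" by (intro mult_left_mono) auto
      then show ?thesis by (simp add: pos_le_divide_eq add_pos_nonneg mult.commute)
    qed
    have Tw: "kmaj \<alpha> r z y = wt \<alpha> y * D powr (-2)" and kw: "k0 \<alpha> r z y = kmaj \<alpha> r z y * D powr (1/2)"
      by (simp_all add: kmaj_def kernel_bounds(3) D_def)
    have Dge: "u\<^sup>2 \<le> D" using D2_ge(1)[of z y r] by (simp add: u_def D_def power2_commute)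
    have Dpos: "0 < D" using D2_pos[OF y] by (simp add: D_def)
    show ?thesis
    proof (cases "u \<le> 1")
      case True
      have "kmaj \<alpha> r z y \<le> rho y powr (\<alpha> - \<alpha>) * sin (th y) powr (-\<alpha>) * ((r - rho y)\<^sup>2 + (z - wz y)\<^sup>2) powr (-(2-\<alpha>)/2)"
        by (rule kmaj_le) (use y r ne a in auto)
      also have "((r - rho y)\<^sup>2 + (z - wz y)\<^sup>2) = x\<^sup>2 + u\<^sup>2" by (simp add: x_def u_def power2_commute)
      \<comment> \<open>The splitting gives x the order 9/10. What remains for u has order 11/10 -
        \<alpha>, at most 8/10 because \<alpha> \<ge> 3/10.\<close>
      also have "(x\<^sup>2 + u\<^sup>2) powr (-(2-\<alpha>)/2) = (x\<^sup>2 + u\<^sup>2) powr (-9/20) * (x\<^sup>2 + u\<^sup>2) powr (-(11/10-\<alpha>)/2)"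
        unfolding powr_add[symmetric] by (rule arg_cong) (simp add: field_simps)
      also have "rho y powr (\<alpha> - \<alpha>) * sin (th y) powr (-\<alpha>) * \<dots>
          \<le> 1 * s * ((x\<^sup>2) powr (-9/20) * (u\<^sup>2) powr (-(11/10-\<alpha>)/2))"
        using rp s1 x u a sin_powr_le_sinw[OF y a(2)]
        by (intro mult_mono powr_mono2') (auto simp: s_def)
      also have "(x\<^sup>2) powr (-9/20) = x powr (-9/10)" using x by (simp add: square_powr)
      also have "(u\<^sup>2) powr (-(11/10-\<alpha>)/2) = u powr (-(11/10-\<alpha>))"
        using u by (simp add: square_powr diff_divide_distrib)
      also have "1 * s * (x powr (-9/10) * u powr (-(11/10-\<alpha>))) \<le> 1 * s * (x powr (-9/10) * u powr (-8/10))"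
        using s1 True u a by (intro mult_left_mono powr_mono') auto
      also have "\<dots> \<le> 1 * s * (((1 + M\<^sup>2) * (x powr (-9/10) / (1 + x\<^sup>2))) * (2 * (u powr (-8/10) / (1 + u\<^sup>2))))"
      proof (intro mult_left_mono mult_mono xg)
        have "u\<^sup>2 \<le> 1" using True u by (simp add: power_le_one)
        then have "u powr (-8/10) * (1 + u\<^sup>2) \<le> u powr (-8/10) * 2" by (intro mult_left_mono) auto
        then show "u powr (-8/10) \<le> 2 * (u powr (-8/10) / (1 + u\<^sup>2))"
          by (simp add: pos_le_divide_eq add_pos_nonneg mult.commute)
      qed (use s1 in auto)
      also have "\<dots> = 2 * (1 + M\<^sup>2) * near_majorant r z y" unfolding g by simp
      finally have T1: "kmaj \<alpha> r z y \<le> 2 * (1 + M\<^sup>2) * near_majorant r z y" .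
      have "D \<le> (3 * M)\<^sup>2"
      proof -
        have "- (r * rho y * cos (th y)) \<le> r * rho y * 1"
          using r rp abs_cos_le_one[of "th y"] unfolding mult_minus_right[symmetric]
          by (intro mult_left_mono) auto
        then have "D \<le> (r + rho y)\<^sup>2 + u\<^sup>2" by (simp add: D_def D2_def u_def power2_sum power2_commute)
        also have "(r + rho y)\<^sup>2 \<le> (2 * M)\<^sup>2" using r rp rho by (intro power_mono) auto
        also have "u\<^sup>2 \<le> M\<^sup>2" using True u M by (intro power_mono) auto
        finally have "D \<le> 5 * M\<^sup>2" by (simp add: power_mult_distrib)
        also have "\<dots> \<le> 9 * M\<^sup>2" by (rule mult_right_mono) auto
        finally show ?thesis by (simp add: power_mult_distrib)
      qed
      then have "D powr (1/2) \<le> 3 * M"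
        using Dpos M by (simp add: powr_half_sqrt real_le_lsqrt)
      then have "k0 \<alpha> r z y \<le> (2 * (1 + M\<^sup>2) * near_majorant r z y) * (3 * M)"
        unfolding kw using T1 kmaj_nonneg[of \<alpha> r z y] by (intro mult_mono) (auto simp: near_majorant_nonneg)
      moreover have M4: "1 \<le> M^4" "M \<le> M^4" using M power_increasing[of 1 4 M] by auto
      moreover have "2 * (1 + M\<^sup>2) * near_majorant r z y \<le> CM M * near_majorant r z y"
        unfolding CM_def using M4 by (intro mult_right_mono near_majorant_nonneg) (auto simp: add_pos_nonneg)
      moreover have "(2 * (1 + M\<^sup>2) * near_majorant r z y) * (3 * M) = (6 * M * (1 + M\<^sup>2)) * near_majorant r z y" by simp
      moreover have "(6 * M * (1 + M\<^sup>2)) * near_majorant r z y \<le> CM M * near_majorant r z y"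
        unfolding CM_def using M4 by (intro mult_right_mono near_majorant_nonneg) (auto simp: add_pos_nonneg)
      ultimately show ?thesis using T1 by linarith
    next
      case False
      have w: "wt \<alpha> y \<le> M ^ 3"
      proof -
        have "rho y powr (2 + \<alpha>) \<le> M powr (2 + \<alpha>)" using rp rho a by (intro powr_mono2) auto
        also have "\<dots> \<le> M powr 3" using M a by (intro powr_mono) auto
        finally have "rho y powr (2 + \<alpha>) * (sin (th y))\<^sup>2 \<le> M powr 3 * 1"
          by (intro mult_mono) (auto simp: abs_square_le_1)
        then show ?thesis using y M by (simp add: wt_def)
      qed
      \<comment> \<open>The exponent e = 4 will serve \<open>kmaj\<close> and e = 3 will serve
        \<open>k0\<close>.\<close>
      have D2u: "D powr (-e/2) \<le> u powr (-3)" if "3 \<le> e" for e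
      proof -
        have "D powr (-e/2) \<le> (u\<^sup>2) powr (-e/2)" using Dge u that by (intro powr_mono2') auto
        also have "\<dots> = u powr (-e)" using u by (simp add: square_powr)
        also have "\<dots> \<le> u powr (-3)" using False that by (intro powr_mono) auto
        finally show ?thesis .
      qed
      have u3: "u powr (-3) \<le> 2 * (u powr (-8/10) / (1 + u\<^sup>2))"
      proof -
        have "1 + u\<^sup>2 \<le> 2 * u powr 2" using False by (simp add: power2_eq_square)  (metis less_eq_real_def linorder_not_less mult_le_cancel_left1 mult_le_cancel_right1 not_one_le_zero order_trans)
        then have "u powr (-3) * (1 + u\<^sup>2) \<le> u powr (-3) * (2 * u powr 2)" by (intro mult_left_mono) auto
        also have "\<dots> = 2 * u powr (-1)" by (simp only: mult.left_commute[of _ 2] powr_add[symmetric]) simp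
        also have "\<dots> \<le> 2 * u powr (-8/10)" using False by (intro mult_left_mono powr_mono) auto
        finally show ?thesis by (simp add: pos_le_divide_eq add_pos_nonneg)
      qed
      \<comment> \<open>Since x \<le> M, the rho factor of the majorant times a power of M is at
        least 1 and can be inserted into the estimate.\<close>
      have x1: "1 \<le> M * x powr (-9/10)"
      proof -
        have "M powr (-9/10) \<le> x powr (-9/10)" using x M by (intro powr_mono2') auto
        then have "M * M powr (-9/10) \<le> M * x powr (-9/10)" using M by (intro mult_left_mono) auto
        moreover have "M * M powr (-9/10) = M powr (1/10)" using M powr_mult_base[of M "-9/10"] by simp
        moreover have "1 \<le> M powr (1/10)" using M by (simp add: ge_one_powr_ge_zero)
        ultimately show ?thesis by linarith
      qed
      have main: "wt \<alpha> y * D powr (-e/2) \<le> CM M * near_majorant r z y" if "3 \<le> e" for e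
      proof -
        have "wt \<alpha> y * D powr (-e/2) \<le> M^3 * (2 * (u powr (-8/10) / (1 + u\<^sup>2)))"
          using w D2u[OF that] u3 M wt_nonneg by (intro mult_mono) auto
        also have "\<dots> = 1 * 1 * (M^3 * (2 * (u powr (-8/10) / (1 + u\<^sup>2))))" by simp
        also have "\<dots> \<le> s * (M * ((1 + M\<^sup>2) * (x powr (-9/10) / (1 + x\<^sup>2)))) * (M^3 * (2 * (u powr (-8/10) / (1 + u\<^sup>2))))"
        proof (intro mult_right_mono mult_mono s1)
          have "M * x powr (-9/10) \<le> M * ((1 + M\<^sup>2) * (x powr (-9/10) / (1 + x\<^sup>2)))"
            using xg M by (intro mult_left_mono) auto
          then show "1 \<le> M * ((1 + M\<^sup>2) * (x powr (-9/10) / (1 + x\<^sup>2)))" using x1 by linarith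
        qed (use s1 M in auto)
        also have "\<dots> = (2 * M^4 * (1 + M\<^sup>2)) * near_majorant r z y" unfolding g by (simp add: eval_nat_numeral)
        also have "\<dots> \<le> CM M * near_majorant r z y"
          unfolding CM_def using M by (intro mult_right_mono near_majorant_nonneg) (auto simp: add_pos_nonneg)
        finally show ?thesis .
      qed
      have "kmaj \<alpha> r z y = wt \<alpha> y * D powr (-4/2)" by (simp add: Tw)
      moreover have "k0 \<alpha> r z y = wt \<alpha> y * D powr (-3/2)" by (simp add: k0_def D_def)
      ultimately show ?thesis using main[of 4] main[of 3] by simp
    qed
  qed
  then show "kmaj \<alpha> r z y \<le> CM M * near_majorant r z y" "k0 \<alpha> r z y \<le> CM M * near_majorant r z y" by auto
qed

lemma near_majorant_tendsto:
  assumes "x \<longlonglongrightarrow> (r,z)" "rho y \<noteq> r" "wz y \<noteq> z"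
  shows "(\<lambda>n. near_majorant (fst (x n)) (snd (x n)) y) \<longlonglongrightarrow> near_majorant r z y"
proof -
  have "(\<lambda>n. fst (x n)) \<longlonglongrightarrow> r" "(\<lambda>n. snd (x n)) \<longlonglongrightarrow> z"
    using tendsto_fst[OF assms(1)] tendsto_snd[OF assms(1)] by auto
  moreover have "(1 + (a::real)\<^sup>2) \<noteq> 0" for a by (smt (verit) zero_le_power2)
  ultimately show ?thesis unfolding near_majorant_def quot_kernel_def
    using assms by (intro tendsto_intros) auto
qed

text \<open>Continuity across the singularity. As the evaluation point converges, the majorants
  converge almost everywhere and keep the same integral by translation invariance, so
  \<open>integral_tendsto_moving_bound\<close> applies where a fixed majorant is not at
  hand.\<close>

lemma near_potential:
  fixes K :: "real \<Rightarrow> real \<Rightarrow> triple \<Rightarrow> real"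
  assumes [measurable]: "\<And>r z. K r z \<in> borel_measurable borel"
    and cont: "\<And>y. continuous_on S (\<lambda>p. K (fst p) (snd p) y)"
    and bd: "\<And>r z. (r,z) \<in> S \<Longrightarrow> AE y in lborel. \<bar>K r z y\<bar> \<le> C * near_majorant r z y"
  shows "\<And>r z. (r,z) \<in> S \<Longrightarrow> integrable lborel (K r z)"
    and "continuous_on S (\<lambda>p. \<integral>y. K (fst p) (snd p) y \<partial>lborel)"
    and "\<And>r z. (r,z) \<in> S \<Longrightarrow> (\<integral>\<^sup>+y. ennreal \<bar>K r z y\<bar> \<partial>lborel) \<le> ennreal (C * (\<integral>y. near_majorant 0 0 y \<partial>lborel))"
proof -
  show "integrable lborel (K r z)" if "(r,z) \<in> S" for r z
    by (rule Bochner_Integration.integrable_bound[OF integrable_mult_right[OF near_majorant_integral(1), of C r z]])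
      (use bd[OF that] in auto)
  show "(\<integral>\<^sup>+y. ennreal \<bar>K r z y\<bar> \<partial>lborel) \<le> ennreal (C * (\<integral>y. near_majorant 0 0 y \<partial>lborel))" if "(r,z) \<in> S" for r z
  proof -
    have "(\<integral>\<^sup>+y. ennreal \<bar>K r z y\<bar> \<partial>lborel) \<le> (\<integral>\<^sup>+y. ennreal (C * near_majorant r z y) \<partial>lborel)"
      by (rule nn_integral_mono_AE) (use bd[OF that] in \<open>auto intro: ennreal_leI\<close>)
    also have "\<dots> = ennreal (\<integral>y. C * near_majorant r z y \<partial>lborel)"
      by (rule nn_integral_eq_integral) (use near_majorant_integral(1) bd[OF that] in auto)
    finally show ?thesis by (simp add: near_majorant_integral(2)[of r z])
  qed
  show "continuous_on S (\<lambda>p. \<integral>y. K (fst p) (snd p) y \<partial>lborel)"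
    unfolding continuous_on_sequentially comp_def
  proof (intro ballI allI impI)
    fix x :: "nat \<Rightarrow> real \<times> real" and a
    assume a: "a \<in> S" and "(\<forall>n. x n \<in> S) \<and> x \<longlonglongrightarrow> a"
    then have x: "\<And>n. x n \<in> S" "x \<longlonglongrightarrow> a" by auto
    have x2: "x \<longlonglongrightarrow> (fst a, snd a)" using x by simp
    show "(\<lambda>n. \<integral>y. K (fst (x n)) (snd (x n)) y \<partial>lborel) \<longlonglongrightarrow> (\<integral>y. K (fst a) (snd a) y \<partial>lborel)"
    proof (rule integral_tendsto_moving_bound(1))
      show "integrable lborel (\<lambda>y. C * near_majorant (fst (x n)) (snd (x n)) y)" for n
        using near_majorant_integral(1) by simp
      show "integrable lborel (\<lambda>y. C * near_majorant (fst a) (snd a) y)" using near_majorant_integral(1) by simp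
      show "AE y in lborel. (\<lambda>n. K (fst (x n)) (snd (x n)) y) \<longlonglongrightarrow> K (fst a) (snd a) y"
        using cont a x by (auto simp: continuous_on_sequentially comp_def)
      show "AE y in lborel. (\<lambda>n. C * near_majorant (fst (x n)) (snd (x n)) y) \<longlonglongrightarrow> C * near_majorant (fst a) (snd a) y"
        using AE_coord_ne(1)[of "fst a"] AE_coord_ne(2)[of "snd a"]
      proof eventually_elim
        case (elim y)
        then show ?case by (intro tendsto_mult_left near_majorant_tendsto[OF x2])
      qed
      show "AE y in lborel. \<bar>K (fst (x n)) (snd (x n)) y\<bar> \<le> C * near_majorant (fst (x n)) (snd (x n)) y" for n
        using bd x(1)[of n] by simp
      show "(\<lambda>n. \<integral>y. C * near_majorant (fst (x n)) (snd (x n)) y \<partial>lborel) \<longlonglongrightarrow> (\<integral>y. C * near_majorant (fst a) (snd a) y \<partial>lborel)"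
        by (simp add: near_majorant_integral(2)[of "fst _" "snd _"] near_majorant_integral(2)[of "fst a" "snd a"])
    qed auto
  qed
qed

text \<open>The counterpart of \<open>near_potential\<close> with a fixed majorant, for the part of
  the vorticity that lies far out in rho compared with the evaluation points.\<close>

lemma dominated_potential:
  fixes K :: "real \<Rightarrow> real \<Rightarrow> triple \<Rightarrow> real"
  assumes [measurable]: "\<And>r z. K r z \<in> borel_measurable borel"
    and g: "integrable lborel g"
    and cont: "\<And>y. continuous_on S (\<lambda>p. K (fst p) (snd p) y)"
    and bd: "\<And>r z y. (r,z) \<in> S \<Longrightarrow> \<bar>K r z y\<bar> \<le> g y"
  shows "\<And>r z. (r,z) \<in> S \<Longrightarrow> integrable lborel (K r z)"
    and "continuous_on S (\<lambda>p. \<integral>y. K (fst p) (snd p) y \<partial>lborel)"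
    and "\<And>r z. (r,z) \<in> S \<Longrightarrow> (\<integral>\<^sup>+y. ennreal \<bar>K r z y\<bar> \<partial>lborel) \<le> ennreal (\<integral>y. g y \<partial>lborel)"
proof -
  show "integrable lborel (K r z)" if "(r,z) \<in> S" for r z
  proof (rule Bochner_Integration.integrable_bound[OF g], simp, rule AE_I2)
    fix y show "norm (K r z y) \<le> norm (g y)" using bd[OF that, of y] by simp
  qed
  show "(\<integral>\<^sup>+y. ennreal \<bar>K r z y\<bar> \<partial>lborel) \<le> ennreal (\<integral>y. g y \<partial>lborel)" if "(r,z) \<in> S" for r z
  proof -
    have g0: "0 \<le> g y" for y using bd[OF that, of y] by linarith
    have "(\<integral>\<^sup>+y. ennreal \<bar>K r z y\<bar> \<partial>lborel) \<le> (\<integral>\<^sup>+y. ennreal (g y) \<partial>lborel)"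
      by (rule nn_integral_mono) (use bd[OF that] in \<open>auto intro: ennreal_leI\<close>)
    also have "\<dots> = ennreal (\<integral>y. g y \<partial>lborel)"
      by (rule nn_integral_eq_integral) (use g g0 in auto)
    finally show ?thesis .
  qed
  show "continuous_on S (\<lambda>p. \<integral>y. K (fst p) (snd p) y \<partial>lborel)"
    unfolding continuous_on_sequentially comp_def
  proof (intro ballI allI impI)
    fix x :: "nat \<Rightarrow> real \<times> real" and a
    assume a: "a \<in> S" and "(\<forall>n. x n \<in> S) \<and> x \<longlonglongrightarrow> a"
    then have x: "\<And>n. x n \<in> S" "x \<longlonglongrightarrow> a" by auto
    show "(\<lambda>n. \<integral>y. K (fst (x n)) (snd (x n)) y \<partial>lborel) \<longlonglongrightarrow> (\<integral>y. K (fst a) (snd a) y \<partial>lborel)"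
    proof (rule integral_dominated_convergence[OF _ _ g])
      show "AE y in lborel. (\<lambda>n. K (fst (x n)) (snd (x n)) y) \<longlonglongrightarrow> K (fst a) (snd a) y"
        using cont a x by (auto simp: continuous_on_sequentially comp_def)
      show "AE y in lborel. norm (K (fst (x n)) (snd (x n)) y) \<le> g y" for n
        using bd x(1)[of n] by (auto simp: prod_eq_iff)
    qed auto
  qed
qed

text \<open>Class C^1 up to the boundary on a rectangle touching the axis, with the partial
  derivatives as explicit data. Derivatives are taken within the sides: one-sided at r = 0, as
  intended, but also at the artificial edges r = M and |z| = M, which are removed later by enlarging
  the rectangle.\<close>

definition C1_rect :: "real \<Rightarrow> (real \<times> real \<Rightarrow> real) \<Rightarrow> (real \<times> real \<Rightarrow> real) \<Rightarrow> (real \<times> real \<Rightarrow> real) \<Rightarrow> bool" where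
  "C1_rect M F Fr Fz \<longleftrightarrow>
     continuous_on ({0..M} \<times> {-M..M}) F \<and>
     continuous_on ({0..M} \<times> {-M..M}) Fr \<and> continuous_on ({0..M} \<times> {-M..M}) Fz \<and>
     (\<forall>r\<in>{0..M}. \<forall>z\<in>{-M..M}.
        ((\<lambda>r. F (r,z)) has_real_derivative Fr (r,z)) (at r within {0..M}) \<and>
        ((\<lambda>z. F (r,z)) has_real_derivative Fz (r,z)) (at z within {-M..M}))"

lemma C1_rect_integral:
  fixes K Kr Kz :: "real \<Rightarrow> real \<Rightarrow> triple \<Rightarrow> real"
  defines "S M \<equiv> {0..M::real} \<times> {-M..M}"
  assumes meas: "\<And>z. (\<lambda>(t,y). Kr t z y) \<in> borel_measurable (lborel \<Otimes>\<^sub>M lborel)"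
      "\<And>r. (\<lambda>(t,y). Kz r t y) \<in> borel_measurable (lborel \<Otimes>\<^sub>M lborel)"
    and deriv: "\<And>r z y A. ((\<lambda>r. K r z y) has_real_derivative Kr r z y) (at r within A)"
      "\<And>r z y A. ((\<lambda>z. K r z y) has_real_derivative Kz r z y) (at z within A)"
    and cont: "\<And>y. continuous_on (S M) (\<lambda>p. Kr (fst p) (snd p) y)" "\<And>y. continuous_on (S M) (\<lambda>p. Kz (fst p) (snd p) y)"
    and int: "\<And>r z. (r,z) \<in> S M \<Longrightarrow> integrable lborel (K r z)"
    and bound: "\<And>r z. (r,z) \<in> S M \<Longrightarrow> (\<integral>\<^sup>+y. ennreal \<bar>Kr r z y\<bar> \<partial>lborel) \<le> ennreal C"
       "\<And>r z. (r,z) \<in> S M \<Longrightarrow> (\<integral>\<^sup>+y. ennreal \<bar>Kz r z y\<bar> \<partial>lborel) \<le> ennreal C"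
    and icont: "continuous_on (S M) (\<lambda>p. \<integral>y. K (fst p) (snd p) y \<partial>lborel)"
       "continuous_on (S M) (\<lambda>p. \<integral>y. Kr (fst p) (snd p) y \<partial>lborel)"
       "continuous_on (S M) (\<lambda>p. \<integral>y. Kz (fst p) (snd p) y \<partial>lborel)"
  shows "C1_rect M (\<lambda>p. \<integral>y. K (fst p) (snd p) y \<partial>lborel)
      (\<lambda>p. \<integral>y. Kr (fst p) (snd p) y \<partial>lborel) (\<lambda>p. \<integral>y. Kz (fst p) (snd p) y \<partial>lborel)"
  unfolding C1_rect_def
proof (intro conjI ballI)
  fix r z assume rz: "r \<in> {0..M}" "z \<in> {-M..M}"
  have "((\<lambda>r. \<integral>y. K r z y \<partial>lborel) has_real_derivative (\<integral>y. Kr r z y \<partial>lborel)) (at r within {0..M})"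
  proof (rule integral_diff_imp_derivative)
    fix a b :: real assume ab: "a \<le> b" "a \<in> {0..M}" "b \<in> {0..M}"
    show "(\<integral>y. K b z y \<partial>lborel) - (\<integral>y. K a z y \<partial>lborel) = (LBINT t:{a..b}. \<integral>y. Kr t z y \<partial>lborel)"
    proof (rule ftc_under_integral(1)[where C=C, OF ab(1) meas(1)])
      show "continuous_on {a..b} (\<lambda>t. Kr t z y)" for y
        by (rule continuous_on_compose2[OF cont(1)[of y], of "{a..b}" "\<lambda>t. (t,z)", simplified])
          (use ab rz in \<open>auto simp: S_def intro!: continuous_intros\<close>)
    qed (use deriv bound ab rz int in \<open>auto simp: S_def\<close>)
  next
    show "continuous_on {0..M} (\<lambda>t. \<integral>y. Kr t z y \<partial>lborel)"
        by (rule continuous_on_compose2[OF icont(2), of "{0..M}" "\<lambda>t. (t,z)", simplified])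
          (use rz in \<open>auto simp: S_def intro!: continuous_intros\<close>)
  qed (use rz in auto)
  then show "((\<lambda>r. \<integral>y. K (fst (r,z)) (snd (r,z)) y \<partial>lborel) has_real_derivative (\<integral>y. Kr (fst (r,z)) (snd (r,z)) y \<partial>lborel)) (at r within {0..M})"
    by simp
  have "((\<lambda>z. \<integral>y. K r z y \<partial>lborel) has_real_derivative (\<integral>y. Kz r z y \<partial>lborel)) (at z within {-M..M})"
  proof (rule integral_diff_imp_derivative)
    fix a b :: real assume ab: "a \<le> b" "a \<in> {-M..M}" "b \<in> {-M..M}"
    show "(\<integral>y. K r b y \<partial>lborel) - (\<integral>y. K r a y \<partial>lborel) = (LBINT t:{a..b}. \<integral>y. Kz r t y \<partial>lborel)"
    proof (rule ftc_under_integral(1)[where C=C, OF ab(1) meas(2)])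
      show "continuous_on {a..b} (\<lambda>t. Kz r t y)" for y
        by (rule continuous_on_compose2[OF cont(2)[of y], of "{a..b}" "\<lambda>t. (r,t)", simplified])
          (use ab rz in \<open>auto simp: S_def intro!: continuous_intros\<close>)
    qed (use deriv bound ab rz int in \<open>auto simp: S_def\<close>)
  next
    show "continuous_on {-M..M} (\<lambda>t. \<integral>y. Kz r t y \<partial>lborel)"
        by (rule continuous_on_compose2[OF icont(3), of "{-M..M}" "\<lambda>t. (r,t)", simplified])
          (use rz in \<open>auto simp: S_def intro!: continuous_intros\<close>)
  qed (use rz in auto)
  then show "((\<lambda>z. \<integral>y. K (fst (r,z)) (snd (r,z)) y \<partial>lborel) has_real_derivative (\<integral>y. Kz (fst (r,z)) (snd (r,z)) y \<partial>lborel)) (at z within {-M..M})"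
    by simp
qed (use icont in \<open>auto simp: S_def\<close>)

section \<open>The strain of a vorticity density\<close>

lemma C1_rect_mono:
  assumes "C1_rect R F Fr Fz" "0 \<le> M" "M \<le> R"
  shows "C1_rect M F Fr Fz"
proof -
  have sub: "{0..M} \<times> {-M..M} \<subseteq> {0..R} \<times> {-R..R}" "{0..M} \<subseteq> {0..R}" "{-M..M} \<subseteq> {-R..R}" using assms by auto
  show ?thesis
    using assms(1) unfolding C1_rect_def
    using sub by (auto intro: continuous_on_subset DERIV_subset subsetD)
qed

lemma C1_rect_add:
  assumes "C1_rect M F Fr Fz" "C1_rect M G Gr Gz"
  shows "C1_rect M (\<lambda>p. F p + G p) (\<lambda>p. Fr p + Gr p) (\<lambda>p. Fz p + Gz p)"
  using assms unfolding C1_rect_def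
  by (auto intro!: continuous_on_add DERIV_add)

lemma fst_triple_measurable[measurable]:
  assumes "\<Omega> \<in> borel_measurable borel" shows "(\<lambda>y::triple. \<Omega> (fst y)) \<in> borel_measurable borel"
  by (intro measurable_compose[OF _ assms] borel_measurable_continuous_onI continuous_intros)

text \<open>The cut-off concerns rho alone and hence commutes with translations in z: shifting the
  density in \<open>near_shift\<close> produces no boundary term.\<close>

definition cut_in :: "real \<Rightarrow> (real \<times> real \<Rightarrow> real) \<Rightarrow> triple \<Rightarrow> real" where
  "cut_in R u y = indicator {y. rho y \<le> R} y * u (fst y)"

lemma cut_in_measurable[measurable]:
  assumes [measurable]: "u \<in> borel_measurable borel" shows "cut_in R u \<in> borel_measurable borel"
  unfolding cut_in_def by measurable

lemma near_kernel_bound: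
  assumes R: "1 \<le> R" and a: "3/10 \<le> \<alpha>" "\<alpha> \<le> 1/2" and U: "0 \<le> U"
    and u: "\<And>q. 0 < fst q \<Longrightarrow> fst q \<le> R \<Longrightarrow> \<bar>u q\<bar> \<le> U"
    and k: "k \<in> {k0 \<alpha>, kr \<alpha>, kz \<alpha>}" and r: "r \<in> {0..R}"
  shows "AE y in lborel. \<bar>k r z y * cut_in R u y\<bar> \<le> 3 * CM R * U * near_majorant r z y"
  using AE_coord_ne(1)[of r] AE_coord_ne(2)[of z]
proof eventually_elim
  case (elim y)
  have C0: "0 \<le> 3 * CM R * U * near_majorant r z y" using R U by (simp add: CM_def near_majorant_nonneg)
  show ?case
  proof (cases "y \<in> good \<and> rho y \<le> R")
    case True
    note nb = near_bound[OF R _ _ a, of r y z]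
    have T3: "3 * kmaj \<alpha> r z y \<le> 3 * (CM R * near_majorant r z y)" using nb(1) True elim r by auto
    have pos: "0 \<le> CM R * near_majorant r z y" using R by (simp add: CM_def near_majorant_nonneg)
    have "\<bar>k r z y\<bar> \<le> 3 * (CM R * near_majorant r z y)"
      using k
    proof (elim insertE)
      assume "k = k0 \<alpha>"
      then show ?thesis using nb(2) True elim r pos k0_nonneg[of \<alpha> r z y] by auto
    next
      assume "k = kr \<alpha>" then show ?thesis using kernel_bounds(2)[of \<alpha> r z y] T3 by auto
    next
      assume "k = kz \<alpha>" then show ?thesis using kernel_bounds(1)[of \<alpha> r z y] T3 by auto
    qed auto
    moreover have "\<bar>cut_in R u y\<bar> \<le> U"
      using True u[of "fst y"] by (auto simp: cut_in_def good_def rho_def)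
    ultimately have "\<bar>k r z y\<bar> * \<bar>cut_in R u y\<bar> \<le> 3 * (CM R * near_majorant r z y) * U"
      using pos by (intro mult_mono) auto
    then show ?thesis by (simp add: abs_mult mult_ac)
  next
    case False
    have eq: "k r z y * cut_in R u y = 0"
      using False k by (auto simp: cut_in_def k0_def kr_def kz_def wt_bad)
    show ?thesis using C0 unfolding eq by simp
  qed
qed

lemma near_potentials:
  assumes R: "1 \<le> R" and a: "3/10 \<le> \<alpha>" "\<alpha> \<le> 1/2" and U: "0 \<le> U"
    and u: "\<And>q. 0 < fst q \<Longrightarrow> fst q \<le> R \<Longrightarrow> \<bar>u q\<bar> \<le> U"
    and [measurable]: "u \<in> borel_measurable borel"
    and k: "k \<in> {k0 \<alpha>, kr \<alpha>, kz \<alpha>}"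
  shows "\<And>r z. r \<in> {0..R} \<Longrightarrow> integrable lborel (\<lambda>y. k r z y * cut_in R u y)"
    and "continuous_on ({0..R} \<times> UNIV) (\<lambda>p. \<integral>y. k (fst p) (snd p) y * cut_in R u y \<partial>lborel)"
    and "\<And>r z. r \<in> {0..R} \<Longrightarrow> (\<integral>\<^sup>+y. ennreal \<bar>k r z y * cut_in R u y\<bar> \<partial>lborel) \<le> ennreal (3 * CM R * U * (\<integral>y. near_majorant 0 0 y \<partial>lborel))"
proof -
  have m: "(\<lambda>y. k r z y * cut_in R u y) \<in> borel_measurable borel" for r z
    using k by auto
  have c: "continuous_on ({0..R} \<times> UNIV) (\<lambda>p. k (fst p) (snd p) y * cut_in R u y)" for y
    using k by (auto intro!: continuous_intros kernel_continuous)
  have b: "AE y in lborel. \<bar>k r z y * cut_in R u y\<bar> \<le> 3 * CM R * U * near_majorant r z y" if "(r,z) \<in> {0..R} \<times> UNIV" for r z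
    using near_kernel_bound[OF R a U u k] that by auto
  note near_potential[where K="\<lambda>r z y. k r z y * cut_in R u y", OF m c b]
  then show "\<And>r z. r \<in> {0..R} \<Longrightarrow> integrable lborel (\<lambda>y. k r z y * cut_in R u y)"
    and "continuous_on ({0..R} \<times> UNIV) (\<lambda>p. \<integral>y. k (fst p) (snd p) y * cut_in R u y \<partial>lborel)"
    and "\<And>r z. r \<in> {0..R} \<Longrightarrow> (\<integral>\<^sup>+y. ennreal \<bar>k r z y * cut_in R u y\<bar> \<partial>lborel) \<le> ennreal (3 * CM R * U * (\<integral>y. near_majorant 0 0 y \<partial>lborel))"
    by auto
qed

text \<open>The first derivatives of \<open>k0\<close> are bounded by \<open>kmaj\<close>, whose
  singularity is still integrable. The potential of a merely bounded density is therefore of class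
  C^1.\<close>

lemma near_C1:
  assumes R: "1 \<le> R" and a: "3/10 \<le> \<alpha>" "\<alpha> \<le> 1/2" and U: "0 \<le> U"
    and u: "\<And>q. 0 < fst q \<Longrightarrow> fst q \<le> R \<Longrightarrow> \<bar>u q\<bar> \<le> U"
    and m[measurable]: "u \<in> borel_measurable borel"
  shows "C1_rect R (\<lambda>p. \<integral>y. k0 \<alpha> (fst p) (snd p) y * cut_in R u y \<partial>lborel)
     (\<lambda>p. \<integral>y. kr \<alpha> (fst p) (snd p) y * cut_in R u y \<partial>lborel)
     (\<lambda>p. \<integral>y. kz \<alpha> (fst p) (snd p) y * cut_in R u y \<partial>lborel)"
proof (rule C1_rect_integral[where C="3 * CM R * U * (\<integral>y. near_majorant 0 0 y \<partial>lborel)"])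
  note np = near_potentials[OF R a U u m]
  show "(\<lambda>(t, y). kr \<alpha> t z y * cut_in R u y) \<in> borel_measurable (lborel \<Otimes>\<^sub>M lborel)" for z
    by measurable
  show "(\<lambda>(t, y). kz \<alpha> r t y * cut_in R u y) \<in> borel_measurable (lborel \<Otimes>\<^sub>M lborel)" for r
    by measurable
  show "((\<lambda>r. k0 \<alpha> r z y * cut_in R u y) has_real_derivative kr \<alpha> r z y * cut_in R u y) (at r within A)" for r z y A
    by (intro DERIV_cmult_right kernel_deriv)
  show "((\<lambda>z. k0 \<alpha> r z y * cut_in R u y) has_real_derivative kz \<alpha> r z y * cut_in R u y) (at z within A)" for r z y A
    by (intro DERIV_cmult_right kernel_deriv)
  show "continuous_on ({0..R} \<times> {- R..R}) (\<lambda>p. kr \<alpha> (fst p) (snd p) y * cut_in R u y)" for y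
    by (intro continuous_intros kernel_continuous)
  show "continuous_on ({0..R} \<times> {- R..R}) (\<lambda>p. kz \<alpha> (fst p) (snd p) y * cut_in R u y)" for y
    by (intro continuous_intros kernel_continuous)
  have sub: "{0..R} \<times> {- R..R} \<subseteq> {0..R} \<times> UNIV" by auto
  show "continuous_on ({0..R} \<times> {- R..R}) (\<lambda>p. \<integral>y. k0 \<alpha> (fst p) (snd p) y * cut_in R u y \<partial>lborel)"
    "continuous_on ({0..R} \<times> {- R..R}) (\<lambda>p. \<integral>y. kr \<alpha> (fst p) (snd p) y * cut_in R u y \<partial>lborel)"
    "continuous_on ({0..R} \<times> {- R..R}) (\<lambda>p. \<integral>y. kz \<alpha> (fst p) (snd p) y * cut_in R u y \<partial>lborel)"
    using continuous_on_subset[OF np(2) sub] by auto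
qed (use near_potentials[OF R a U u m] in auto)

lemma AE_fst_triple:
  assumes "AE q in (lborel :: (real \<times> real) measure). P q"
  shows "AE y in (lborel :: triple measure). P (fst y)"
proof -
  obtain N where N: "{q. \<not> P q} \<subseteq> N" "N \<in> sets lborel" "emeasure lborel N = 0"
    using assms by (elim AE_E) auto
  have "emeasure (lborel \<Otimes>\<^sub>M lborel) (N \<times> (UNIV :: real set)) = emeasure lborel N * emeasure lborel (UNIV :: real set)"
    by (rule lborel.emeasure_pair_measure_Times) (use N in auto)
  then have "emeasure (lborel :: triple measure) (N \<times> UNIV) = 0" using N by (simp add: lborel_prod)
  moreover have "N \<times> (UNIV :: real set) \<in> sets (lborel \<Otimes>\<^sub>M lborel)"
    by (rule pair_measureI) (use N in auto)
  then have "N \<times> (UNIV :: real set) \<in> sets lborel" by (simp only: lborel_prod)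
  ultimately show ?thesis using N by (intro AE_I[of _ _ "N \<times> UNIV"]) auto
qed

text \<open>The assumption \<open>eta_diff\<close> says that \<open>\<eta>\<close> is the derivative of \<open>\<Omega>\<close> in \<open>z\<close>. Up to the factor \<open>2 \<kappa>\<^sub>\<psi>\<^sub>1 / \<pi>\<close>, the function
  \<open>\<Phi>\<close> is \<open>\<psi>\<^sub>z\<close>.\<close>

locale density =
  fixes \<alpha> \<mu> c B :: real and \<Omega> \<eta> :: "real \<times> real \<Rightarrow> real"
  assumes alpha: "3/10 \<le> \<alpha>" "\<alpha> + \<mu> \<le> 1/2" "0 \<le> \<mu>" and c: "0 < c" "c \<le> 1" and B: "0 \<le> B"
    and Omega_measurable[measurable]: "\<Omega> \<in> borel_measurable borel"
    and Omega_odd: "\<Omega> (\<rho>, -w) = - \<Omega> (\<rho>, w)"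
    and Omega_bound: "dens_bound \<alpha> \<mu> c B \<Omega>"
    and eta_measurable[measurable]: "\<eta> \<in> borel_measurable borel"
    and eta_bound: "\<exists>U. \<forall>q. 0 < fst q \<longrightarrow> fst q \<le> M \<longrightarrow> \<bar>\<eta> q\<bar> \<le> U"
    and eta_diff: "0 \<le> h \<Longrightarrow> AE q in lborel. 0 < fst q \<longrightarrow>
        \<Omega> (fst q, snd q + h) - \<Omega> q = (LBINT t:{0..h}. \<eta> (fst q, snd q + t))"
begin

lemma alpha2: "\<alpha> \<le> 1/2" using alpha by simp

definition \<Phi> :: "real \<times> real \<Rightarrow> real" where
  "\<Phi> p = (\<integral>y. kz \<alpha> (fst p) (snd p) y * \<Omega> (fst y) \<partial>lborel)"

definition \<Phi>b :: real where "\<Phi>b = 3 * (6144 * B / c)"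

lemma kmaj_Omega: "0 \<le> r \<Longrightarrow> (\<integral>\<^sup>+y. ennreal (kmaj \<alpha> r z y * \<bar>\<Omega> (fst y)\<bar>) \<partial>lborel) \<le> ennreal (6144 * B / c)"
  by (rule kmaj_dens_bound[OF _ Omega_bound]) (use alpha c B in auto)

lemma kmaj_Omega_integrable: "0 \<le> r \<Longrightarrow> integrable lborel (\<lambda>y. kmaj \<alpha> r z y * \<bar>\<Omega> (fst y)\<bar>)"
  using le_less_trans[OF kmaj_Omega[of r z], of \<infinity>]
  by (intro integrableI_bounded) (auto simp: abs_mult kmaj_nonneg)

lemma kz_Omega:
  assumes "0 \<le> r"
  shows "(\<integral>\<^sup>+y. ennreal \<bar>kz \<alpha> r z y * \<Omega> (fst y)\<bar> \<partial>lborel) \<le> ennreal \<Phi>b"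
proof -
  have "(\<integral>\<^sup>+y. ennreal \<bar>kz \<alpha> r z y * \<Omega> (fst y)\<bar> \<partial>lborel) \<le> (\<integral>\<^sup>+y. 3 * ennreal (kmaj \<alpha> r z y * \<bar>\<Omega> (fst y)\<bar>) \<partial>lborel)"
  proof (rule nn_integral_mono)
    fix y
    have "\<bar>kz \<alpha> r z y * \<Omega> (fst y)\<bar> \<le> 3 * (kmaj \<alpha> r z y * \<bar>\<Omega> (fst y)\<bar>)"
      using mult_right_mono[OF kernel_bounds(1), of "\<bar>\<Omega> (fst y)\<bar>" \<alpha> r z y] by (simp add: abs_mult)
    also have "ennreal \<dots> = 3 * ennreal (kmaj \<alpha> r z y * \<bar>\<Omega> (fst y)\<bar>)"
      using kmaj_nonneg[of \<alpha> r z y] by (simp add: ennreal_mult)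
    finally show "ennreal \<bar>kz \<alpha> r z y * \<Omega> (fst y)\<bar> \<le> 3 * ennreal (kmaj \<alpha> r z y * \<bar>\<Omega> (fst y)\<bar>)"
      by (simp add: ennreal_leI)
  qed
  also have "\<dots> = 3 * (\<integral>\<^sup>+y. ennreal (kmaj \<alpha> r z y * \<bar>\<Omega> (fst y)\<bar>) \<partial>lborel)"
    by (rule nn_integral_cmult) auto
  also have "\<dots> \<le> ennreal 3 * ennreal (6144 * B / c)"
    using kmaj_Omega[OF assms, of z] by (auto intro: mult_left_mono)
  also have "\<dots> = ennreal \<Phi>b" unfolding \<Phi>b_def by (rule ennreal_mult[symmetric]) (use B c in auto)
  finally show ?thesis .
qed

lemma kz_Omega_integrable: "0 \<le> r \<Longrightarrow> integrable lborel (\<lambda>y. kz \<alpha> r z y * \<Omega> (fst y))"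
  using le_less_trans[OF kz_Omega[of r z], of \<infinity>] by (intro integrableI_bounded) auto

lemma Phi_bound: "0 \<le> fst p \<Longrightarrow> \<bar>\<Phi> p\<bar> \<le> \<Phi>b"
proof -
  assume r: "0 \<le> fst p"
  have "ennreal \<bar>\<Phi> p\<bar> \<le> (\<integral>\<^sup>+y. ennreal (norm (kz \<alpha> (fst p) (snd p) y * \<Omega> (fst y))) \<partial>lborel)"
    unfolding \<Phi>_def using integral_norm_bound_ennreal[OF kz_Omega_integrable[OF r]] by simp
  also have "\<dots> \<le> ennreal \<Phi>b" using kz_Omega[OF r] by simp
  finally show ?thesis using B c by (simp add: \<Phi>b_def ennreal_le_iff)
qed

lemma Omega_local_bound:
  assumes "1 \<le> R" "0 < fst q" "fst q \<le> R"
  shows "\<bar>\<Omega> q\<bar> \<le> B * (R + 1)"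
proof -
  obtain \<rho> w where q: "q = (\<rho>,w)" by (cases q)
  have "\<bar>\<Omega> (\<rho>,w)\<bar> \<le> B * (\<rho> powr \<mu> * jap w powr (-(\<alpha>+\<mu>)-c) + jap w powr (-\<alpha>-c))"
    using Omega_bound assms q by (auto simp: dens_bound_def)
  also have "\<dots> \<le> B * (R powr 1 * 1 + 1)"
  proof (intro mult_left_mono add_mono mult_mono)
    have "\<rho> powr \<mu> \<le> R powr \<mu>" using assms q alpha by (intro powr_mono2) auto
    also have "\<dots> \<le> R powr 1" using assms alpha by (intro powr_mono) auto
    finally show "\<rho> powr \<mu> \<le> R powr 1" .
    have "jap w powr e \<le> 1" if "e \<le> 0" for e
      using powr_mono[OF that jap_ge(1)[of w]] jap_pos[of w] by simp
    then show "jap w powr (-(\<alpha>+\<mu>)-c) \<le> 1" "jap w powr (-\<alpha>-c) \<le> 1" using alpha c by auto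
  qed (use B in auto)
  finally show ?thesis using q assms by simp
qed

text \<open>The kernel depends on z and w through z - w only, so the potential at height z + h
  equals the potential at height z of the density shifted by h. The difference of the two densities
  is an integral of \<eta>, and Fubini brings it outside.\<close>

lemma near_shift:
  assumes R: "1 \<le> R" and r: "r \<in> {0..R}" and h: "0 \<le> h"
  shows "(\<integral>y. k0 \<alpha> r (z+h) y * cut_in R \<Omega> y \<partial>lborel) - (\<integral>y. k0 \<alpha> r z y * cut_in R \<Omega> y \<partial>lborel)
      = (LBINT t:{z..z+h}. \<integral>y. k0 \<alpha> r t y * cut_in R \<eta> y \<partial>lborel)"
proof -
  obtain U where U: "\<And>q. 0 < fst q \<Longrightarrow> fst q \<le> R \<Longrightarrow> \<bar>\<eta> q\<bar> \<le> \<bar>U\<bar>"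
    using eta_bound[of R] by (meson abs_ge_self order_trans)
  have BR: "0 \<le> B * (R + 1)" using B R by simp
  have sh: "k0 \<alpha> r (z+t) (((0,t),0) + y) = k0 \<alpha> r z y" for t y
    by (simp add: k0_def wt_def D2_def rho_def wz_def th_def good_def indicator_def)
  have shi: "cut_in R u (((0,t),0) + y) = indicator {y. rho y \<le> R} y * u (fst (fst y), snd (fst y) + t)" for t y u
    by (simp add: cut_in_def rho_def indicator_def plus_prod_def add.commute)
  define f where "f u t y = k0 \<alpha> r z y * (indicator {y. rho y \<le> R} y * u (fst (fst y), snd (fst y) + t))" for u t y
  have eqf: "(\<integral>y. k0 \<alpha> r (z+t) y * cut_in R u y \<partial>lborel) = (\<integral>y. f u t y \<partial>lborel)"
    if [measurable]: "u \<in> borel_measurable borel" for u t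
    using integral_lborel_shift(1)[of "\<lambda>y. k0 \<alpha> r (z+t) y * cut_in R u y" "((0,t),0)"]
    by (simp add: sh shi f_def)
  have int\<Omega>: "integrable lborel (f \<Omega> t)" for t
  proof -
    have "integrable lborel (\<lambda>y. k0 \<alpha> r (z+t) y * cut_in R \<Omega> y)"
      by (rule near_potentials(1)[OF R alpha(1) alpha2 BR Omega_local_bound[OF R] Omega_measurable _ r]) auto
    then show ?thesis
      using integral_lborel_shift(2)[of "\<lambda>y. k0 \<alpha> r (z+t) y * cut_in R \<Omega> y" "((0,t),0)"]
      by (simp add: sh shi f_def[abs_def])
  qed
  have g: "(\<lambda>x. u (fst (fst (snd x)), snd (fst (snd x)) + fst x)) \<in> borel_measurable (lborel \<Otimes>\<^sub>M (lborel :: triple measure))"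
    if "u \<in> borel_measurable borel" for u :: "real \<times> real \<Rightarrow> real"
  proof (rule measurable_compose[OF _ that])
    have "(\<lambda>x::real \<times> triple. (fst (fst (snd x)), snd (fst (snd x)) + fst x)) \<in> borel_measurable borel"
      by (intro borel_measurable_continuous_onI continuous_intros)
    then show "(\<lambda>x. (fst (fst (snd x)), snd (fst (snd x)) + fst x)) \<in> borel_measurable (lborel \<Otimes>\<^sub>M (lborel :: triple measure))"
      by (simp add: lborel_prod)
  qed
  have m: "(\<lambda>(t,y). indicator {0..h} t * f \<eta> t y) \<in> borel_measurable (lborel \<Otimes>\<^sub>M lborel)"
    unfolding f_def case_prod_beta
    by (intro borel_measurable_times g[OF eta_measurable] borel_measurable_indicator' kernel_measurable(3)) measurable
  have "(\<integral>y. f \<Omega> h y \<partial>lborel) - (\<integral>y. f \<Omega> 0 y \<partial>lborel) = (\<integral>y. f \<Omega> h y - f \<Omega> 0 y \<partial>lborel)"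
    using int\<Omega> by simp
  also have "\<dots> = (\<integral>y. (\<integral>t. indicator {0..h} t * f \<eta> t y \<partial>lborel) \<partial>lborel)"
  proof (rule integral_cong_AE)
    have "(\<lambda>x. case (case x of (y,t) \<Rightarrow> (t,y)) of (t,y) \<Rightarrow> indicator {0..h} t * f \<eta> t y) \<in> borel_measurable (lborel \<Otimes>\<^sub>M lborel)"
      by (rule measurable_compose[OF measurable_pair_swap' m])
    then have "(\<lambda>(y,t). indicator {0..h} t * f \<eta> t y) \<in> borel_measurable (lborel \<Otimes>\<^sub>M lborel)"
      by (simp add: case_prod_beta')
    then show "(\<lambda>y. \<integral>t. indicator {0..h} t * f \<eta> t y \<partial>lborel) \<in> borel_measurable lborel"
      by (rule lborel.borel_measurable_lebesgue_integral)
    show "AE y in lborel. f \<Omega> h y - f \<Omega> 0 y = (\<integral>t. indicator {0..h} t * f \<eta> t y \<partial>lborel)"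
      using AE_fst_triple[OF eta_diff[OF h]]
    proof eventually_elim
      case (elim y)
      show ?case
      proof (cases "y \<in> good")
        case True
        then have "0 < fst (fst y)" by (simp add: good_def rho_def)
        then have e: "\<Omega> (fst (fst y), snd (fst y) + h) - \<Omega> (fst y) = (\<integral>t. indicator {0..h} t * \<eta> (fst (fst y), snd (fst y) + t) \<partial>lborel)"
          using elim by (simp add: set_lebesgue_integral_def)
        have "f \<Omega> h y - f \<Omega> 0 y = (k0 \<alpha> r z y * indicator {y. rho y \<le> R} y) * (\<Omega> (fst (fst y), snd (fst y) + h) - \<Omega> (fst y))"
          by (simp add: f_def algebra_simps)
        also have "\<dots> = (\<integral>t. indicator {0..h} t * f \<eta> t y \<partial>lborel)"
          unfolding e by (subst integral_mult_right_zero[symmetric]) (simp add: f_def mult_ac)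
        finally show ?thesis .
      qed (simp add: f_def k0_def wt_bad)
    qed
  qed (use int\<Omega> in \<open>auto intro: borel_measurable_diff\<close>)
  also have "\<dots> = (\<integral>t. (\<integral>y. indicator {0..h} t * f \<eta> t y \<partial>lborel) \<partial>lborel)"
  proof (rule lborel_pair.Fubini_integral)
    show "integrable (lborel \<Otimes>\<^sub>M lborel) (\<lambda>(t,y). indicator {0..h} t * f \<eta> t y)"
    proof (rule integrableI_bounded)
      show "(\<lambda>(t,y). indicator {0..h} t * f \<eta> t y) \<in> borel_measurable (lborel \<Otimes>\<^sub>M lborel)" by (rule m)
      have "(\<integral>\<^sup>+x. ennreal (norm (case x of (t,y) \<Rightarrow> indicator {0..h} t * f \<eta> t y)) \<partial>(lborel \<Otimes>\<^sub>M lborel))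
         = (\<integral>\<^sup>+t. \<integral>\<^sup>+y. ennreal (norm (indicator {0..h} t * f \<eta> t y)) \<partial>lborel \<partial>lborel)"
        by (subst lborel.nn_integral_fst[symmetric]) (use m in auto)
      also have "\<dots> \<le> (\<integral>\<^sup>+t. ennreal (3 * CM R * \<bar>U\<bar> * (\<integral>y. near_majorant 0 0 y \<partial>lborel)) * indicator {0..h} t \<partial>lborel)"
      proof (rule nn_integral_mono)
        fix t
        have "(\<integral>\<^sup>+y. ennreal \<bar>f \<eta> t y\<bar> \<partial>lborel) \<le> ennreal (3 * CM R * \<bar>U\<bar> * (\<integral>y. near_majorant 0 0 y \<partial>lborel))"
        proof -
          have "(\<integral>\<^sup>+y. ennreal \<bar>f \<eta> t y\<bar> \<partial>lborel) \<le> (\<integral>\<^sup>+y. ennreal \<bar>k0 \<alpha> r z y * cut_in R (\<lambda>q. \<eta> (fst q, snd q + t)) y\<bar> \<partial>lborel)"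
            by (simp add: f_def cut_in_def)
          \<comment> \<open>A shift in w preserves the bound of \<eta> on the strip 0 < rho \<le> R,
            so the estimate is uniform in t.\<close>
          also have "\<dots> \<le> ennreal (3 * CM R * \<bar>U\<bar> * (\<integral>y. near_majorant 0 0 y \<partial>lborel))"
          proof (rule near_potentials(3)[OF R alpha(1) alpha2 _ _ _ _ r])
            show "(\<lambda>q. \<eta> (fst q, snd q + t)) \<in> borel_measurable borel"
              by (intro measurable_compose[OF _ eta_measurable] borel_measurable_continuous_onI continuous_intros)
          qed (use U in auto)
          finally show ?thesis .
        qed
        then show "(\<integral>\<^sup>+y. ennreal (norm (indicator {0..h} t * f \<eta> t y)) \<partial>lborel) \<le> ennreal (3 * CM R * \<bar>U\<bar> * (\<integral>y. near_majorant 0 0 y \<partial>lborel)) * indicator {0..h} t"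
          by (cases "t \<in> {0..h}") auto
      qed
      also have "\<dots> = ennreal (3 * CM R * \<bar>U\<bar> * (\<integral>y. near_majorant 0 0 y \<partial>lborel)) * ennreal h"
        using h by (simp add: nn_integral_cmult)
      also have "\<dots> < \<infinity>" by (simp add: ennreal_mult_less_top)
      finally show "(\<integral>\<^sup>+x. ennreal (norm (case x of (t,y) \<Rightarrow> indicator {0..h} t * f \<eta> t y)) \<partial>(lborel \<Otimes>\<^sub>M lborel)) < \<infinity>" .
    qed
  qed
  also have "\<dots> = (\<integral>t. indicator {0..h} t * (\<integral>y. k0 \<alpha> r (z+t) y * cut_in R \<eta> y \<partial>lborel) \<partial>lborel)"
    by (simp add: eqf)
  also have "\<dots> = (\<integral>t. indicator {z..z+h} (z+t) * (\<integral>y. k0 \<alpha> r (z+t) y * cut_in R \<eta> y \<partial>lborel) \<partial>lborel)"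
    by (intro Bochner_Integration.integral_cong) (auto simp: indicator_def)
  also have "\<dots> = (\<integral>t. indicator {z..z+h} t * (\<integral>y. k0 \<alpha> r t y * cut_in R \<eta> y \<partial>lborel) \<partial>lborel)"
    by (rule integral_lborel_shift(1)) measurable
  finally show ?thesis
    using eqf[of \<Omega> h] eqf[of \<Omega> 0] by (simp add: set_lebesgue_integral_def)
qed

text \<open>The z derivative of the \<open>k0\<close> potential of \<Omega> is computed in two ways.
  Falling on the kernel it gives the \<open>kz\<close> potential of \<Omega>; falling on the density
  it gives the \<open>k0\<close> potential of \<eta>, which \<open>near_C1\<close> shows to be of
  class C^1. So the two potentials coincide and second derivatives of the kernel never occur near
  the singularity. The gap M < R puts z in the interior of the larger interval, where derivatives
  are unique.\<close>

lemma near_C1_Phi: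
  assumes R: "1 \<le> R" and M: "0 \<le> M" "M < R"
  obtains Fr Fz where "C1_rect M (\<lambda>p. \<integral>y. kz \<alpha> (fst p) (snd p) y * cut_in R \<Omega> y \<partial>lborel) Fr Fz"
proof -
  obtain U where U: "\<And>q. 0 < fst q \<Longrightarrow> fst q \<le> R \<Longrightarrow> \<bar>\<eta> q\<bar> \<le> \<bar>U\<bar>"
    using eta_bound[of R] by (meson abs_ge_self order_trans)
  have BR: "0 \<le> B * (R + 1)" using B R by simp
  let ?E = "\<lambda>p. \<integral>y. k0 \<alpha> (fst p) (snd p) y * cut_in R \<eta> y \<partial>lborel"
  let ?F = "\<lambda>p. \<integral>y. kz \<alpha> (fst p) (snd p) y * cut_in R \<Omega> y \<partial>lborel"
  let ?Er = "\<lambda>p. \<integral>y. kr \<alpha> (fst p) (snd p) y * cut_in R \<eta> y \<partial>lborel"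
  let ?Ez = "\<lambda>p. \<integral>y. kz \<alpha> (fst p) (snd p) y * cut_in R \<eta> y \<partial>lborel"
  note P = near_C1[OF R alpha(1) alpha2 BR Omega_local_bound[OF R] Omega_measurable]
  note E = near_C1[OF R alpha(1) alpha2 abs_ge_zero[of U] U eta_measurable]
  have eq: "?F (r,z) = ?E (r,z)" if rz: "r \<in> {0..M}" "z \<in> {-M..M}" for r z
  proof -
    have r: "r \<in> {0..R}" and z: "z \<in> {-R..R}" "z \<in> interior {-R..R}" using rz M by auto
    have "((\<lambda>z. \<integral>y. k0 \<alpha> r z y * cut_in R \<Omega> y \<partial>lborel) has_real_derivative ?F (r,z)) (at z within {-R..R})"
      using P r z(1) unfolding C1_rect_def by simp
    then have 1: "((\<lambda>z. \<integral>y. k0 \<alpha> r z y * cut_in R \<Omega> y \<partial>lborel) has_real_derivative ?F (r,z)) (at z)"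
      using at_within_interior[OF z(2)] by simp
    have cE: "continuous_on {-R..R} (\<lambda>z. ?E (r,z))"
      by (rule continuous_on_compose2[of "{0..R} \<times> {-R..R}" ?E])
        (use E r in \<open>auto simp: C1_rect_def intro!: continuous_intros\<close>)
    have "((\<lambda>z. \<integral>y. k0 \<alpha> r z y * cut_in R \<Omega> y \<partial>lborel) has_real_derivative ?E (r,z)) (at z within {-R..R})"
    proof (rule integral_diff_imp_derivative[OF _ cE _ z(1)])
      fix a b :: real assume "a \<le> b"
      then show "(\<integral>y. k0 \<alpha> r b y * cut_in R \<Omega> y \<partial>lborel) - (\<integral>y. k0 \<alpha> r a y * cut_in R \<Omega> y \<partial>lborel) = (LBINT t:{a..b}. ?E (r,t))"
        using near_shift[OF R r, of "b - a" a] by simp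
    qed auto
    then have 2: "((\<lambda>z. \<integral>y. k0 \<alpha> r z y * cut_in R \<Omega> y \<partial>lborel) has_real_derivative ?E (r,z)) (at z)"
      using at_within_interior[OF z(2)] by simp
    show ?thesis by (rule DERIV_unique[OF 1 2])
  qed
  have CE: "C1_rect M ?E ?Er ?Ez" using C1_rect_mono[OF E] M by auto
  have "C1_rect M ?F ?Er ?Ez"
    unfolding C1_rect_def
  proof (intro conjI ballI)
    show "continuous_on ({0..M} \<times> {-M..M}) ?F"
      using CE eq by (subst continuous_on_cong[OF refl, where g="?E"]) (auto simp: C1_rect_def)
    fix r z assume rz: "r \<in> {0..M}" "z \<in> {-M..M}"
    have a: "((\<lambda>r. ?E (r,z)) has_real_derivative ?Er (r,z)) (at r within {0..M})"
      "((\<lambda>z. ?E (r,z)) has_real_derivative ?Ez (r,z)) (at z within {-M..M})"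
      using CE rz unfolding C1_rect_def by auto
    show "((\<lambda>r. ?F (r,z)) has_real_derivative ?Er (r,z)) (at r within {0..M})"
      using a(1) by (rule has_field_derivative_transform_within[OF _ zero_less_one rz(1)]) (use eq rz in auto)
    show "((\<lambda>z. ?F (r,z)) has_real_derivative ?Ez (r,z)) (at z within {-M..M})"
      using a(2) by (rule has_field_derivative_transform_within[OF _ zero_less_one rz(2)]) (use eq rz in auto)
  qed (use CE in \<open>auto simp: C1_rect_def\<close>)
  then show ?thesis by (rule that)
qed

definition cut_out :: "real \<Rightarrow> triple \<Rightarrow> real" where
  "cut_out R y = indicator {y. R < rho y} y * \<Omega> (fst y)"

lemma cut_out_measurable[measurable]: "cut_out R \<in> borel_measurable borel"
  unfolding cut_out_def by measurable

text \<open>From r, |z| \<le> M < rho/4 one gets (r - rho)^2 \<ge> 9/16 rho^2, and (z - w)^2 \<ge>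
  w^2/2 - z^2 with z^2 \<le> rho^2/16. As 9/16 - 1/16 = 1/2, the squared distance from the
  evaluation point is at least half of that from the origin, and the kernel at the origin dominates
  uniformly over the rectangle.\<close>

lemma far_kmaj:
  assumes M: "1 \<le> M" and rz: "r \<in> {0..M}" "z \<in> {-M..M}" and y: "4 * M < rho y"
  shows "kmaj \<alpha> r z y \<le> 4 * kmaj \<alpha> 0 0 y" "y \<in> good \<Longrightarrow> D2 r z y powr (-1/2) \<le> 1"
proof -
  define p where "p = rho y"
  define w where "w = wz y"
  have p: "4 * M < p" using y by (simp add: p_def)
  have 1: "9/16 * p\<^sup>2 \<le> (r - p)\<^sup>2"
  proof -
    have "(3/4 * p)\<^sup>2 \<le> (p - r)\<^sup>2" using p rz M by (intro power_mono) auto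
    then show ?thesis unfolding power2_commute[of p r] by (simp add: power_mult_distrib power2_eq_square)
  qed
  have 2: "w\<^sup>2 / 2 - z\<^sup>2 \<le> (z - w)\<^sup>2"
    using zero_le_power2[of "w - 2 * z"] by (simp add: power2_eq_square algebra_simps)
  have 3: "z\<^sup>2 \<le> p\<^sup>2 / 16"
  proof -
    have "\<bar>z\<bar>\<^sup>2 \<le> (p/4)\<^sup>2" using rz p by (intro power_mono) auto
    then show ?thesis by (simp add: power_divide)
  qed
  have 4: "16 \<le> p\<^sup>2"
    using power_mono[of 4 p 2] p M by simp
  have D0: "D2 0 0 y = p\<^sup>2 + w\<^sup>2" by (simp add: D2_def p_def w_def)
  have DD: "D2 0 0 y / 2 \<le> D2 r z y" if "y \<in> good"
  proof -
    have "(r - p)\<^sup>2 + (z - w)\<^sup>2 \<le> D2 r z y" using D2_ge_dist[OF that, of r z] rz by (simp add: p_def w_def)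
    then show ?thesis using 1 2 3 D0 by linarith
  qed
  show "kmaj \<alpha> r z y \<le> 4 * kmaj \<alpha> 0 0 y"
  proof (cases "y \<in> good")
    case True
    have "D2 r z y powr (-2) \<le> (D2 0 0 y / 2) powr (-2)"
      using DD[OF True] D2_pos[OF True, of 0 0] by (intro powr_mono2') auto
    also have "\<dots> = 4 * D2 0 0 y powr (-2)"
      using D2_pos[OF True, of 0 0] by (simp add: powr_divide powr_minus) (simp add: field_simps)
    finally show ?thesis using wt_nonneg[of \<alpha> y] unfolding kmaj_def by (simp add: mult_left_mono mult.left_commute[of 4])
  qed (simp add: kmaj_def wt_bad)
  show "D2 r z y powr (-1/2) \<le> 1" if "y \<in> good"
  proof -
    have "1 \<le> D2 r z y" using DD[OF that] D0 4 zero_le_power2[of w] by linarith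
    then show ?thesis using powr_mono2'[of "-1/2" 1 "D2 r z y"] by simp
  qed
qed

text \<open>Beyond rho = 4 M even the second derivatives of \<open>k0\<close> are dominated by a
  multiple of the integrable function \<open>kmaj \<alpha> 0 0 y\<close> times |\<Omega>|; the
  factor is 72 = 18 * 4, from \<open>kernel_bounds\<close> and \<open>far_kmaj\<close>.\<close>

lemma far_C1_Phi:
  assumes M: "1 \<le> M"
  obtains Fr Fz where "C1_rect M (\<lambda>p. \<integral>y. kz \<alpha> (fst p) (snd p) y * cut_out (4*M) y \<partial>lborel) Fr Fz"
proof -
  define g where "g y = 72 * (kmaj \<alpha> 0 0 y * \<bar>\<Omega> (fst y)\<bar>)" for y
  have gi: "integrable lborel g" unfolding g_def using kmaj_Omega_integrable[of 0 0] by simp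
  let ?S = "{0..M} \<times> {-M..M}"
  have bd: "\<bar>k r z y * cut_out (4*M) y\<bar> \<le> g y" if k: "k \<in> {kz \<alpha>, kzz \<alpha>, kzr \<alpha>}" and rz: "(r,z) \<in> ?S" for k r z y
  proof (cases "y \<in> good \<and> 4 * M < rho y")
    case True
    note f = far_kmaj[OF M, of r z y]
    have Dle: "18 * kmaj \<alpha> r z y * D2 r z y powr (-1/2) \<le> 18 * kmaj \<alpha> r z y * 1"
      using f(2) True rz kmaj_nonneg[of \<alpha> r z y] by (intro mult_left_mono) auto
    have T4: "kmaj \<alpha> r z y \<le> 4 * kmaj \<alpha> 0 0 y" using f(1) True rz by auto
    have "\<bar>k r z y\<bar> \<le> 18 * kmaj \<alpha> r z y"
      using k kernel_bounds[of \<alpha> r z y] Dle kmaj_nonneg[of \<alpha> r z y] by auto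
    also have "\<dots> \<le> 72 * kmaj \<alpha> 0 0 y" using T4 by simp
    finally have "\<bar>k r z y\<bar> * \<bar>\<Omega> (fst y)\<bar> \<le> 72 * kmaj \<alpha> 0 0 y * \<bar>\<Omega> (fst y)\<bar>" by (rule mult_right_mono) auto
    then show ?thesis using True by (simp add: g_def cut_out_def abs_mult)
  next
    case False
    then have eq: "k r z y * cut_out (4*M) y = 0" using k by (auto simp: cut_out_def kz_def kzz_def kzr_def wt_bad)
    show ?thesis unfolding eq by (simp add: g_def kmaj_nonneg)
  qed
  have dp: "\<And>r z. (r,z) \<in> ?S \<Longrightarrow> integrable lborel (\<lambda>y. k r z y * cut_out (4*M) y)"
     "continuous_on ?S (\<lambda>p. \<integral>y. k (fst p) (snd p) y * cut_out (4*M) y \<partial>lborel)"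
     "\<And>r z. (r,z) \<in> ?S \<Longrightarrow> (\<integral>\<^sup>+y. ennreal \<bar>k r z y * cut_out (4*M) y\<bar> \<partial>lborel) \<le> ennreal (\<integral>y. g y \<partial>lborel)"
    if k: "k \<in> {kz \<alpha>, kzz \<alpha>, kzr \<alpha>}" for k
  proof -
    have m: "(\<lambda>y. k r z y * cut_out (4*M) y) \<in> borel_measurable borel" for r z using k by auto
    have c: "continuous_on ?S (\<lambda>p. k (fst p) (snd p) y * cut_out (4*M) y)" for y
      using k by (auto intro!: continuous_intros kernel_continuous)
    note d = dominated_potential[where K="\<lambda>r z y. k r z y * cut_out (4*M) y" and S="?S", OF m gi c bd[OF k]]
    show "\<And>r z. (r,z) \<in> ?S \<Longrightarrow> integrable lborel (\<lambda>y. k r z y * cut_out (4*M) y)"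
     "continuous_on ?S (\<lambda>p. \<integral>y. k (fst p) (snd p) y * cut_out (4*M) y \<partial>lborel)"
     "\<And>r z. (r,z) \<in> ?S \<Longrightarrow> (\<integral>\<^sup>+y. ennreal \<bar>k r z y * cut_out (4*M) y\<bar> \<partial>lborel) \<le> ennreal (\<integral>y. g y \<partial>lborel)"
      using d by auto
  qed
  have "C1_rect M (\<lambda>p. \<integral>y. kz \<alpha> (fst p) (snd p) y * cut_out (4*M) y \<partial>lborel)
     (\<lambda>p. \<integral>y. kzr \<alpha> (fst p) (snd p) y * cut_out (4*M) y \<partial>lborel)
     (\<lambda>p. \<integral>y. kzz \<alpha> (fst p) (snd p) y * cut_out (4*M) y \<partial>lborel)"
  proof (rule C1_rect_integral[where C="\<integral>y. g y \<partial>lborel"])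
    show "(\<lambda>(t, y). kzr \<alpha> t z y * cut_out (4*M) y) \<in> borel_measurable (lborel \<Otimes>\<^sub>M lborel)" for z
      by measurable
    show "(\<lambda>(t, y). kzz \<alpha> r t y * cut_out (4*M) y) \<in> borel_measurable (lborel \<Otimes>\<^sub>M lborel)" for r
      by measurable
    show "((\<lambda>r. kz \<alpha> r z y * cut_out (4*M) y) has_real_derivative kzr \<alpha> r z y * cut_out (4*M) y) (at r within A)" for r z y A
      by (intro DERIV_cmult_right kernel_deriv)
    show "((\<lambda>z. kz \<alpha> r z y * cut_out (4*M) y) has_real_derivative kzz \<alpha> r z y * cut_out (4*M) y) (at z within A)" for r z y A
      by (intro DERIV_cmult_right kernel_deriv)
    show "continuous_on ?S (\<lambda>p. kzr \<alpha> (fst p) (snd p) y * cut_out (4*M) y)" for y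
      by (intro continuous_intros kernel_continuous)
    show "continuous_on ?S (\<lambda>p. kzz \<alpha> (fst p) (snd p) y * cut_out (4*M) y)" for y
      by (intro continuous_intros kernel_continuous)
  qed (use dp in auto)
  then show ?thesis by (rule that)
qed

lemma C1_Phi:
  assumes M: "1 \<le> M"
  obtains Fr Fz where "C1_rect M \<Phi> Fr Fz"
proof -
  have M4: "1 \<le> 4 * M" "0 \<le> M" "M < 4 * M" using M by auto
  obtain Nr Nz where N: "C1_rect M (\<lambda>p. \<integral>y. kz \<alpha> (fst p) (snd p) y * cut_in (4*M) \<Omega> y \<partial>lborel) Nr Nz"
    using near_C1_Phi[OF M4] by blast
  obtain Gr Gz where G: "C1_rect M (\<lambda>p. \<integral>y. kz \<alpha> (fst p) (snd p) y * cut_out (4*M) y \<partial>lborel) Gr Gz"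
    using far_C1_Phi[OF M] by blast
  have eq: "\<Phi> p = (\<integral>y. kz \<alpha> (fst p) (snd p) y * cut_in (4*M) \<Omega> y \<partial>lborel) + (\<integral>y. kz \<alpha> (fst p) (snd p) y * cut_out (4*M) y \<partial>lborel)"
    if p: "p \<in> {0..M} \<times> {-M..M}" for p
  proof -
    have i: "integrable lborel (\<lambda>y. kz \<alpha> (fst p) (snd p) y * \<Omega> (fst y))"
      using kz_Omega_integrable[of "fst p" "snd p"] p by auto
    have i1: "integrable lborel (\<lambda>y. kz \<alpha> (fst p) (snd p) y * cut_in (4*M) \<Omega> y)"
      by (rule Bochner_Integration.integrable_bound[OF i]) (auto simp: cut_in_def abs_mult split: split_indicator)
    have i2: "integrable lborel (\<lambda>y. kz \<alpha> (fst p) (snd p) y * cut_out (4*M) y)"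
      by (rule Bochner_Integration.integrable_bound[OF i]) (auto simp: cut_out_def abs_mult split: split_indicator)
    show ?thesis unfolding \<Phi>_def
      by (subst Bochner_Integration.integral_add[OF i1 i2, symmetric])
        (auto intro!: Bochner_Integration.integral_cong simp: cut_in_def cut_out_def split: split_indicator)
  qed
  have S: "C1_rect M (\<lambda>p. (\<integral>y. kz \<alpha> (fst p) (snd p) y * cut_in (4*M) \<Omega> y \<partial>lborel) + (\<integral>y. kz \<alpha> (fst p) (snd p) y * cut_out (4*M) y \<partial>lborel))
      (\<lambda>p. Nr p + Gr p) (\<lambda>p. Nz p + Gz p)" (is "C1_rect M ?F ?Fr ?Fz")
    by (rule C1_rect_add[OF N G])
  have "C1_rect M \<Phi> ?Fr ?Fz"
    unfolding C1_rect_def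
  proof (intro conjI ballI)
    show "continuous_on ({0..M} \<times> {-M..M}) \<Phi>"
      using S eq by (subst continuous_on_cong[OF refl, where g="?F"]) (auto simp: C1_rect_def)
    fix r z assume rz: "r \<in> {0..M}" "z \<in> {-M..M}"
    have a: "((\<lambda>r. ?F (r,z)) has_real_derivative ?Fr (r,z)) (at r within {0..M})"
      "((\<lambda>z. ?F (r,z)) has_real_derivative ?Fz (r,z)) (at z within {-M..M})"
      using S rz unfolding C1_rect_def by auto
    show "((\<lambda>r. \<Phi> (r,z)) has_real_derivative ?Fr (r,z)) (at r within {0..M})"
      using a(1) by (rule has_field_derivative_transform_within[OF _ zero_less_one rz(1)]) (use eq rz in auto)
    show "((\<lambda>z. \<Phi> (r,z)) has_real_derivative ?Fz (r,z)) (at z within {-M..M})"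
      using a(2) by (rule has_field_derivative_transform_within[OF _ zero_less_one rz(2)]) (use eq rz in auto)
  qed (use S in \<open>auto simp: C1_rect_def\<close>)
  then show ?thesis by (rule that)
qed

end

section \<open>From rectangles to the half plane\<close>

lemma at_within_half_plane:
  fixes r M :: real
  assumes "0 \<le> r" "r < M"
  shows "at r within {0..M} = at r within {0..}"
  by (rule at_within_nhd[of _ "{..<M}"]) (use assms in auto)

lemma dr_eqI:
  assumes r: "0 \<le> r" and d: "((\<lambda>r. F (r,z)) has_real_derivative D) (at r within {0..})"
  shows "dr F (r,z) = D"
  using vector_derivative_within_closed_interval[of 0 "r+1" r "\<lambda>r. F (r,z)" D] at_within_half_plane[of r "r+1"] r d
  unfolding dr_def by (simp add: has_real_derivative_iff_has_vector_derivative)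

lemma dz_eqI: "((\<lambda>z. F (r,z)) has_real_derivative D) (at z) \<Longrightarrow> dz F (r,z) = D"
  unfolding dz_def by (auto simp: has_real_derivative_iff_has_vector_derivative intro: vector_derivative_at)

lemma continuous_on_half_plane_rect:
  fixes F :: "real \<times> real \<Rightarrow> real"
  assumes "\<And>M. 1 \<le> M \<Longrightarrow> continuous_on ({0..M} \<times> {-M..M}) F"
  shows "continuous_on half_plane F"
  unfolding continuous_on_eq_continuous_within
proof
  fix p :: "real \<times> real" assume p: "p \<in> half_plane"
  define M where "M = \<bar>fst p\<bar> + \<bar>snd p\<bar> + 1"
  have M: "1 \<le> M" "fst p < M" "\<bar>snd p\<bar> < M" by (auto simp: M_def)
  have pM: "p \<in> {0..M} \<times> {-M..M}" using p M by (cases p) (auto simp: half_plane_def)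
  have "continuous (at p within {0..M} \<times> {-M..M}) F"
    using assms[OF M(1)] pM by (auto simp: continuous_on_eq_continuous_within)
  moreover have "at p within {0..M} \<times> {-M..M} = at p within half_plane"
  proof (rule at_within_nhd[of _ "{..<M} \<times> {-M<..<M}"])
    show "p \<in> {..<M} \<times> {-M<..<M}" using M by (cases p) auto
    show "({0..M} \<times> {-M..M}) \<inter> ({..<M} \<times> {-M<..<M}) - {p} = half_plane \<inter> ({..<M} \<times> {-M<..<M}) - {p}"
      by (auto simp: half_plane_def)
  qed (auto intro!: open_Times)
  ultimately show "continuous (at p within half_plane) F" by simp
qed

text \<open>In a larger rectangle a given point is off the artificial edges, so the derivatives
  within the sides become a two-sided derivative in z and a derivative within \<open>{0..}\<close>
  in r. These determine \<open>dr F\<close> and \<open>dz F\<close>, which therefore agree with the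
  data of every rectangle and inherit continuity.\<close>

lemma C1_rect_global:
  assumes "\<And>M. 1 \<le> M \<Longrightarrow> \<exists>Fr Fz. C1_rect M F Fr Fz"
  shows "continuous_on half_plane F" "continuous_on half_plane (dr F)" "continuous_on half_plane (dz F)"
    and "\<And>r z. 0 \<le> r \<Longrightarrow> ((\<lambda>r. F (r,z)) has_real_derivative dr F (r,z)) (at r within {0..})"
    and "\<And>r z. 0 \<le> r \<Longrightarrow> ((\<lambda>z. F (r,z)) has_real_derivative dz F (r,z)) (at z)"
proof -
  have eqs: "dr F (r,z) = Fr (r,z) \<and> dz F (r,z) = Fz (r,z)
      \<and> ((\<lambda>r. F (r,z)) has_real_derivative Fr (r,z)) (at r within {0..})
      \<and> ((\<lambda>z. F (r,z)) has_real_derivative Fz (r,z)) (at z)"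
    if C: "C1_rect M F Fr Fz" and rz: "0 \<le> r" "r < M" "\<bar>z\<bar> < M" for M Fr Fz r z
  proof -
    have rz': "r \<in> {0..M}" "z \<in> {-M..M}" using rz by auto
    have a0: "((\<lambda>r. F (r,z)) has_real_derivative Fr (r,z)) (at r within {0..M})"
      "((\<lambda>z. F (r,z)) has_real_derivative Fz (r,z)) (at z within {-M..M})"
      using C rz' unfolding C1_rect_def by blast+
    moreover have "at z within {-M..M} = at z" using rz by (intro at_within_interior) auto
    ultimately have a: "((\<lambda>r. F (r,z)) has_real_derivative Fr (r,z)) (at r within {0..})"
      "((\<lambda>z. F (r,z)) has_real_derivative Fz (r,z)) (at z)"
      using at_within_half_plane[OF rz(1,2)] by auto
    then show ?thesis using dr_eqI[OF rz(1) a(1)] dz_eqI[OF a(2)] by auto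
  qed
  have sub: "\<exists>Fr Fz. C1_rect (M+1) F Fr Fz \<and> C1_rect M F Fr Fz" if "1 \<le> M" for M
    using assms[of "M+1"] C1_rect_mono[of "M+1" F _ _ M] that by force
  show "continuous_on half_plane F"
    using assms by (intro continuous_on_half_plane_rect) (auto simp: C1_rect_def)
  show "continuous_on half_plane (dr F)"
  proof (rule continuous_on_half_plane_rect)
    fix M :: real assume M: "1 \<le> M"
    obtain Fr Fz where C: "C1_rect (M+1) F Fr Fz" "C1_rect M F Fr Fz" using sub[OF M] by blast
    have "dr F p = Fr p" if "p \<in> {0..M} \<times> {-M..M}" for p
      using eqs[OF C(1), of "fst p" "snd p"] that by auto
    then show "continuous_on ({0..M} \<times> {-M..M}) (dr F)"
      using C(2) by (subst continuous_on_cong[OF refl, where g=Fr]) (auto simp: C1_rect_def)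
  qed
  show "continuous_on half_plane (dz F)"
  proof (rule continuous_on_half_plane_rect)
    fix M :: real assume M: "1 \<le> M"
    obtain Fr Fz where C: "C1_rect (M+1) F Fr Fz" "C1_rect M F Fr Fz" using sub[OF M] by blast
    have "dz F p = Fz p" if "p \<in> {0..M} \<times> {-M..M}" for p
      using eqs[OF C(1), of "fst p" "snd p"] that by auto
    then show "continuous_on ({0..M} \<times> {-M..M}) (dz F)"
      using C(2) by (subst continuous_on_cong[OF refl, where g=Fz]) (auto simp: C1_rect_def)
  qed
  fix r z :: real assume r: "0 \<le> r"
  obtain Fr Fz where C: "C1_rect (r + \<bar>z\<bar> + 1) F Fr Fz" using assms[of "r + \<bar>z\<bar> + 1"] r by auto
  from eqs[OF C, of r z] r
  show "((\<lambda>r. F (r,z)) has_real_derivative dr F (r,z)) (at r within {0..})"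
    "((\<lambda>z. F (r,z)) has_real_derivative dz F (r,z)) (at z)" by auto
qed

text \<open>Recovers the stream function G from the strain F. As G vanishes on z = 0, it is the
  integral of \<open>z * F (r, s * z)\<close> over s in [0, 1], and its r derivative H comes from
  the Leibniz rule applied to this formula, with no estimate on the r derivative of the Biot-Savart
  integral itself. Integrating over the unit interval treats both signs of z at once.\<close>

lemma z_primitive:
  fixes F Fr G :: "real \<times> real \<Rightarrow> real"
  defines "H \<equiv> \<lambda>p. integral {0..1} (\<lambda>s. snd p * Fr (fst p, s * snd p))"
  assumes F: "continuous_on half_plane F" "continuous_on half_plane Fr"
    and dF: "\<And>r z. 0 \<le> r \<Longrightarrow> ((\<lambda>r. F (r,z)) has_real_derivative Fr (r,z)) (at r within {0..})"
    and G: "\<And>r. 0 \<le> r \<Longrightarrow> G (r,0) = 0" "\<And>r z. 0 \<le> r \<Longrightarrow> ((\<lambda>z. G (r,z)) has_real_derivative F (r,z)) (at z)"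
  shows "continuous_on half_plane G" "continuous_on half_plane H"
    and "\<And>r z. 0 \<le> r \<Longrightarrow> ((\<lambda>r. G (r,z)) has_real_derivative H (r,z)) (at r within {0..})"
    and "\<And>r z. 0 \<le> r \<Longrightarrow> ((\<lambda>z. H (r,z)) has_real_derivative Fr (r,z)) (at z)"
proof -
  have hc: "continuous_on (half_plane \<times> cbox 0 1) (\<lambda>(p,s). snd p * E (fst p, s * snd p))"
    if "continuous_on half_plane E" for E :: "real \<times> real \<Rightarrow> real"
    unfolding case_prod_beta
    by (intro continuous_intros continuous_on_compose2[OF that]) (auto simp: half_plane_def)
  have Geq: "G (r,z) = integral {0..1} (\<lambda>s. z * F (r, s * z))" if "0 \<le> r" for r z
  proof -
    have "((\<lambda>s. z * F (r, s * z)) has_integral G (r, 1 * z) - G (r, 0 * z)) {0..1}"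
    proof (rule fundamental_theorem_of_calculus)
      fix s :: real
      have "((\<lambda>s. G (r, s * z)) has_real_derivative F (r, s * z) * z) (at s)"
        by (rule DERIV_chain2[OF G(2)[OF that]]) (auto intro!: derivative_eq_intros)
      then show "((\<lambda>s. G (r, s * z)) has_vector_derivative z * F (r, s * z)) (at s within {0..1})"
        by (auto simp: has_real_derivative_iff_has_vector_derivative mult.commute intro: has_vector_derivative_at_within)
    qed simp
    then have "integral {0..1} (\<lambda>s. z * F (r, s * z)) = G (r, 1 * z) - G (r, 0 * z)" by (rule integral_unique)
    then show ?thesis using G(1)[OF that] by (simp del: Henstock_Kurzweil_Integration.integral_mult_right)
  qed
  show "continuous_on half_plane H"
    unfolding H_def using integral_continuous_on_param[OF hc[OF F(2)]] by simp
  have "continuous_on half_plane (\<lambda>p. integral {0..1} (\<lambda>s. snd p * F (fst p, s * snd p)))"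
    using integral_continuous_on_param[OF hc[OF F(1)]] by simp
  then show "continuous_on half_plane G"
    by (rule continuous_on_eq) (auto simp: half_plane_def Geq)
  fix r z :: real assume r: "0 \<le> r"
  have cont_r: "continuous_on ({0..} \<times> cbox 0 1) (\<lambda>(r,s). z * E (r, s * z))"
    if "continuous_on half_plane E" for E :: "real \<times> real \<Rightarrow> real"
    unfolding case_prod_beta
    by (intro continuous_intros continuous_on_compose2[OF that]) (auto simp: half_plane_def)
  have "((\<lambda>r. integral (cbox 0 1) (\<lambda>s. z * F (r, s * z))) has_real_derivative integral (cbox 0 1) (\<lambda>s. z * Fr (r, s * z))) (at r within {0..})"
  proof (rule leibniz_rule_field_derivative)
    fix x t :: real assume "x \<in> {0..}"
    then show "((\<lambda>x. z * F (x, t * z)) has_real_derivative z * Fr (x, t * z)) (at x within {0..})"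
      by (intro DERIV_cmult dF) auto
  next
    fix x :: real assume x: "x \<in> {0..}"
    have "continuous_on (cbox 0 1) (\<lambda>s. z * F (x, s * z))"
      by (intro continuous_intros continuous_on_compose2[OF F(1)]) (use x in \<open>auto simp: half_plane_def\<close>)
    then show "(\<lambda>s. z * F (x, s * z)) integrable_on cbox 0 1" by (rule integrable_continuous)
  qed (use r cont_r[OF F(2)] in \<open>auto simp: case_prod_beta'\<close>)
  from this[unfolded box_real] show "((\<lambda>r. G (r,z)) has_real_derivative H (r,z)) (at r within {0..})"
    unfolding H_def fst_conv snd_conv
    by (rule has_field_derivative_transform_within[OF _ zero_less_one]) (use r Geq in auto)
  define N where "N = \<bar>z\<bar> + 1"
  \<comment> \<open>A primitive in z whose base point -N lies below all heights under consideration;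
    then \<open>H (r,u)\<close> is \<open>A u - A 0\<close> for u of either sign.\<close>
  define A where "A u = integral {-N..u} (\<lambda>t. Fr (r,t))" for u
  have cFr: "continuous_on {-N..N} (\<lambda>t. Fr (r,t))"
    by (intro continuous_on_compose2[OF F(2)] continuous_intros) (use r in \<open>auto simp: half_plane_def\<close>)
  have A: "(A has_real_derivative Fr (r,u)) (at u)" if "\<bar>u\<bar> < N" for u
  proof -
    have "u \<in> {-N..N}" using that by auto
    then have "(A has_real_derivative Fr (r,u)) (at u within {-N..N})"
      unfolding A_def[abs_def] by (rule integral_has_real_derivative[OF cFr])
    moreover have "at u within {-N..N} = at u" using that by (intro at_within_interior) auto
    ultimately show ?thesis by simp
  qed
  have HA: "H (r,u) = A u - A 0" if u: "\<bar>u\<bar> < N" for u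
  proof -
    have "((\<lambda>s. u * Fr (r, s * u)) has_integral A (1 * u) - A (0 * u)) {0..1}"
    proof (rule fundamental_theorem_of_calculus)
      fix s :: real assume s: "s \<in> {0..1}"
      have "\<bar>s * u\<bar> \<le> 1 * \<bar>u\<bar>" unfolding abs_mult using s by (intro mult_right_mono) auto
      then have "((\<lambda>s. A (s * u)) has_real_derivative Fr (r, s * u) * u) (at s)"
        using u by (intro DERIV_chain2[OF A]) (auto intro!: derivative_eq_intros)
      then show "((\<lambda>s. A (s * u)) has_vector_derivative u * Fr (r, s * u)) (at s within {0..1})"
        by (auto simp: has_real_derivative_iff_has_vector_derivative mult.commute intro: has_vector_derivative_at_within)
    qed simp
    then have "integral {0..1} (\<lambda>s. u * Fr (r, s * u)) = A (1 * u) - A (0 * u)" by (rule integral_unique)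
    then show ?thesis by (simp add: H_def)
  qed
  have zN: "z \<in> {-N<..<N}" by (auto simp: N_def)
  have "((\<lambda>u. A u - A 0) has_real_derivative Fr (r,z)) (at z)"
    using A[of z] zN by (auto intro!: derivative_eq_intros)
  then show "((\<lambda>z. H (r,z)) has_real_derivative Fr (r,z)) (at z)"
    by (rule has_field_derivative_transform_within_open[of _ _ _ "{-N<..<N}"]) (use zN HA in auto)
qed

text \<open>Completeness of Lebesgue measure. It gives the measurability of integrands that contain
  the given vorticity, which is only known to agree almost everywhere with a Borel function.\<close>

lemma lebesgue_measurable_AE_cong:
  fixes f g :: "'a::euclidean_space \<Rightarrow> real"
  assumes g: "g \<in> borel_measurable lebesgue" and ae: "AE x in lebesgue. f x = g x"
  shows "f \<in> borel_measurable lebesgue"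
proof (rule measurableI)
  fix A :: "real set" assume A: "A \<in> sets borel"
  show "f -` A \<inter> space lebesgue \<in> sets lebesgue"
  proof (rule completion.in_sets_AE)
    show "AE x in lebesgue. x \<in> g -` A \<inter> space lebesgue \<longleftrightarrow> x \<in> f -` A \<inter> space lebesgue"
      using ae by eventually_elim auto
    show "g -` A \<inter> space lebesgue \<in> sets lebesgue" using measurable_sets[OF g A] .
  qed auto
qed auto

section \<open>The stream function as a limit of truncated integrals\<close>

context density
begin

definition trunc :: "real \<Rightarrow> real \<times> real \<Rightarrow> real" where
  "trunc L q = indicator {q. norm q < L} q * \<Omega> q"

lemma trunc_measurable[measurable]: "trunc L \<in> borel_measurable borel"
  unfolding trunc_def by measurable

definition SL :: "real \<Rightarrow> real \<Rightarrow> real \<Rightarrow> real" where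
  "SL L r z = (\<integral>y. k0 \<alpha> r z y * trunc L (fst y) \<partial>lborel)"

lemma trunc_cut:
  assumes "L \<le> R" shows "trunc L (fst y) = cut_in R (trunc L) y"
proof -
  have "\<bar>fst (fst y)\<bar> \<le> norm (fst y)" using norm_fst_le[of "fst (fst y)" "snd (fst y)"] by simp
  then show ?thesis using assms by (auto simp: trunc_def cut_in_def rho_def split: split_indicator)
qed

lemma trunc_bound:
  assumes "1 \<le> R" "0 < fst q" "fst q \<le> R" shows "\<bar>trunc L q\<bar> \<le> B * (R + 1)"
  using Omega_local_bound[OF assms] B assms by (auto simp: trunc_def abs_mult split: split_indicator)

text \<open>A truncated density vanishes for rho \<ge> L, so with R at least L and r the integral is
  one of the potentials already estimated on rho \<le> R. In w the kernel decays fast enough for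
  bounded densities.\<close>

lemma SL_integrable: "0 \<le> r \<Longrightarrow> integrable lborel (\<lambda>y. k0 \<alpha> r z y * trunc L (fst y))"
proof -
  assume r: "0 \<le> r"
  define R where "R = max 1 (max r L)"
  have R: "1 \<le> R" "r \<in> {0..R}" "L \<le> R" using r by (auto simp: R_def)
  have "integrable lborel (\<lambda>y. k0 \<alpha> r z y * cut_in R (trunc L) y)"
    by (rule near_potentials(1)[OF R(1) alpha(1) alpha2 _ trunc_bound[OF R(1)] trunc_measurable _ R(2)])
       (use B R in auto)
  then show ?thesis using trunc_cut[OF R(3)] by simp
qed

lemma SL_diff:
  assumes r: "0 \<le> r" and z: "z1 \<le> z2"
  shows "SL L r z2 - SL L r z1 = (LBINT t:{z1..z2}. \<integral>y. kz \<alpha> r t y * trunc L (fst y) \<partial>lborel)"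
  unfolding SL_def
proof (rule ftc_under_integral(1)[where C=\<Phi>b, OF z])
  show "(\<lambda>(t, y). kz \<alpha> r t y * trunc L (fst y)) \<in> borel_measurable (lborel \<Otimes>\<^sub>M lborel)" by measurable
  show "((\<lambda>t. k0 \<alpha> r t y * trunc L (fst y)) has_real_derivative kz \<alpha> r t y * trunc L (fst y)) (at t within {z1..z2})" for t y
    by (intro DERIV_cmult_right kernel_deriv)
  show "continuous_on {z1..z2} (\<lambda>t. kz \<alpha> r t y * trunc L (fst y))" for y
    by (intro continuous_intros DERIV_continuous_on[OF kernel_deriv(3)])
  show "(\<integral>\<^sup>+y. ennreal \<bar>kz \<alpha> r t y * trunc L (fst y)\<bar> \<partial>lborel) \<le> ennreal \<Phi>b" for t
  proof -
    have "(\<integral>\<^sup>+y. ennreal \<bar>kz \<alpha> r t y * trunc L (fst y)\<bar> \<partial>lborel) \<le> (\<integral>\<^sup>+y. ennreal \<bar>kz \<alpha> r t y * \<Omega> (fst y)\<bar> \<partial>lborel)"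
      by (intro nn_integral_mono ennreal_leI) (auto simp: trunc_def split: split_indicator)
    then show ?thesis using kz_Omega[OF r, of t] by (rule order_trans)
  qed
qed (use SL_integrable[OF r] in auto)

text \<open>The reflection of w to -w preserves Lebesgue measure, the truncating balls and the
  kernel at height 0, but reverses the sign of the density; so the integral equals its own
  negative.\<close>

lemma SL_0: "SL L r 0 = 0"
proof -
  have k: "k0 \<alpha> r 0 ((\<rho>,-w),\<theta>) = k0 \<alpha> r 0 ((\<rho>,w),\<theta>)" for \<rho> w \<theta>
    by (simp add: k0_def wt_def D2_def good_def indicator_def)
  have t: "trunc L (\<rho>,-w) = - trunc L (\<rho>,w)" for \<rho> w
    by (simp add: trunc_def Omega_odd norm_Pair indicator_def)
  define f where "f y = k0 \<alpha> r 0 y * trunc L (fst y)" for y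
  have [measurable]: "f \<in> borel_measurable borel" unfolding f_def by measurable
  define \<sigma> :: "triple \<Rightarrow> triple" where "\<sigma> y = ((fst (fst y), - snd (fst y)), snd y)" for y
  have fs: "f (\<sigma> y) = - f y" for y
    by (cases y) (auto simp: \<sigma>_def f_def k t)
  have [measurable]: "\<sigma> \<in> borel_measurable borel" unfolding \<sigma>_def
    by (intro borel_measurable_continuous_onI continuous_intros)
  have d: "distr lborel borel \<sigma> = lborel"
  proof (rule measure_eqI)
    fix A assume "A \<in> sets (distr lborel borel \<sigma>)"
    then have A[measurable]: "A \<in> sets borel" by simp
    have "emeasure (distr lborel borel \<sigma>) A = (\<integral>\<^sup>+y. indicator A (\<sigma> y) \<partial>lborel)"
      by (subst nn_integral_indicator[symmetric], simp, subst nn_integral_distr) auto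
    also have "\<dots> = (\<integral>\<^sup>+w. \<integral>\<^sup>+\<rho>. \<integral>\<^sup>+\<theta>. indicator A ((\<rho>,-w),\<theta>) \<partial>lborel \<partial>lborel \<partial>lborel)"
      by (subst nn_integral_triple, measurable) (simp add: \<sigma>_def)
    also have "\<dots> = (\<integral>\<^sup>+w. \<integral>\<^sup>+\<rho>. \<integral>\<^sup>+\<theta>. indicator A ((\<rho>,w),\<theta>) \<partial>lborel \<partial>lborel \<partial>lborel)"
      by (subst nn_integral_real_affine[where c="-1" and t=0]) auto
    also have "\<dots> = (\<integral>\<^sup>+y. indicator A y \<partial>lborel)"
      by (subst nn_integral_triple) auto
    finally show "emeasure (distr lborel borel \<sigma>) A = emeasure lborel A" by simp
  qed simp
  have "(\<integral>y. f y \<partial>lborel) = (\<integral>y. f y \<partial>(distr lborel borel \<sigma>))" by (simp add: d)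
  also have "\<dots> = (\<integral>y. f (\<sigma> y) \<partial>lborel)" by (rule integral_distr) auto
  also have "\<dots> = - (\<integral>y. f y \<partial>lborel)" by (simp add: fs)
  finally show ?thesis by (simp add: SL_def f_def)
qed

text \<open>Dominated convergence twice, in y and then in t. The product of \<open>kz\<close> and
  \<Omega> is absolutely integrable, with the bound \<open>\<Phi>b\<close> independent of the
  height, and truncation only decreases its absolute value.\<close>

lemma Phi_integral_lim:
  assumes r: "0 \<le> r"
  shows "((\<lambda>L. LBINT t:{z1..z2}. \<integral>y. kz \<alpha> r t y * trunc L (fst y) \<partial>lborel) \<longlongrightarrow> (LBINT t:{z1..z2}. \<Phi> (r,t))) at_top"
proof -
  have bd: "\<bar>\<integral>y. kz \<alpha> r t y * trunc L (fst y) \<partial>lborel\<bar> \<le> \<Phi>b" for t L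
  proof -
    have i: "integrable lborel (\<lambda>y. kz \<alpha> r t y * trunc L (fst y))"
      by (rule Bochner_Integration.integrable_bound[OF kz_Omega_integrable[OF r, of t]])
        (auto simp: trunc_def split: split_indicator)
    have "ennreal \<bar>\<integral>y. kz \<alpha> r t y * trunc L (fst y) \<partial>lborel\<bar> \<le> (\<integral>\<^sup>+y. ennreal (norm (kz \<alpha> r t y * trunc L (fst y))) \<partial>lborel)"
      using integral_norm_bound_ennreal[OF i] by simp
    also have "\<dots> \<le> (\<integral>\<^sup>+y. ennreal \<bar>kz \<alpha> r t y * \<Omega> (fst y)\<bar> \<partial>lborel)"
      by (intro nn_integral_mono ennreal_leI) (auto simp: trunc_def split: split_indicator)
    also have "\<dots> \<le> ennreal \<Phi>b" by (rule kz_Omega[OF r])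
    finally show ?thesis using B c by (simp add: \<Phi>b_def ennreal_le_iff)
  qed
  have lim: "((\<lambda>L. \<integral>y. kz \<alpha> r t y * trunc L (fst y) \<partial>lborel) \<longlongrightarrow> \<Phi> (r,t)) at_top" for t
    unfolding \<Phi>_def fst_conv snd_conv
  proof (rule integral_dominated_convergence_at_top)
    show "integrable lborel (\<lambda>y. \<bar>kz \<alpha> r t y * \<Omega> (fst y)\<bar>)"
      using kz_Omega_integrable[OF r, of t] by (rule integrable_abs)
    show "\<forall>\<^sub>F L in at_top. AE y in lborel. norm (kz \<alpha> r t y * trunc L (fst y)) \<le> \<bar>kz \<alpha> r t y * \<Omega> (fst y)\<bar>"
      by (intro always_eventually allI AE_I2) (auto simp: trunc_def split: split_indicator)
    show "AE y in lborel. ((\<lambda>L. kz \<alpha> r t y * trunc L (fst y)) \<longlongrightarrow> kz \<alpha> r t y * \<Omega> (fst y)) at_top"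
    proof (rule AE_I2, rule tendsto_eventually)
      fix y :: triple
      show "\<forall>\<^sub>F L in at_top. kz \<alpha> r t y * trunc L (fst y) = kz \<alpha> r t y * \<Omega> (fst y)"
        using eventually_gt_at_top[of "norm (fst y)"] by eventually_elim (simp add: trunc_def)
    qed
  qed auto
  show ?thesis unfolding set_lebesgue_integral_def
  proof (rule integral_dominated_convergence_at_top)
    show "integrable lborel (\<lambda>t. indicator {z1..z2} t * \<Phi>b)"
      by (intro integrable_mult_left integrable_real_indicator) (auto simp: emeasure_lborel_Icc_eq)
    show "\<forall>\<^sub>F L in at_top. AE t in lborel. norm (indicator {z1..z2} t *\<^sub>R (\<integral>y. kz \<alpha> r t y * trunc L (fst y) \<partial>lborel)) \<le> indicator {z1..z2} t * \<Phi>b"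
      by (intro always_eventually allI AE_I2) (auto simp: bd split: split_indicator)
    show "AE t in lborel. ((\<lambda>L. indicator {z1..z2} t *\<^sub>R (\<integral>y. kz \<alpha> r t y * trunc L (fst y) \<partial>lborel)) \<longlongrightarrow> indicator {z1..z2} t *\<^sub>R \<Phi> (r,t)) at_top"
      by (intro AE_I2 tendsto_intros lim)
    show "(\<lambda>t. indicator {z1..z2} t *\<^sub>R \<Phi> (r, t)) \<in> borel_measurable lborel"
      unfolding \<Phi>_def fst_conv snd_conv by measurable
  qed measurable
qed

definition \<Psi> :: "real \<times> real \<Rightarrow> real" where
  "\<Psi> p = Lim at_top (\<lambda>L. SL L (fst p) (snd p))"

text \<open>Existence of the limit in the Biot-Savart law. Absolute convergence is not guaranteed
  for \<open>k0\<close>; instead each truncated integral vanishes at height 0 and is therefore the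
  integral of its z derivative, and those derivatives converge.\<close>

lemma SL_lim:
  assumes r: "0 \<le> r" shows "((\<lambda>L. SL L r z) \<longlongrightarrow> \<Psi> (r,z)) at_top"
proof -
  obtain l where l: "((\<lambda>L. SL L r z) \<longlongrightarrow> l) at_top"
  proof (cases "0 \<le> z")
    case True
    show ?thesis using Phi_integral_lim[OF r, of 0 z] SL_diff[OF r True] SL_0 that by simp
  next
    case False
    then have "SL L r z = - (LBINT t:{z..0}. \<integral>y. kz \<alpha> r t y * trunc L (fst y) \<partial>lborel)" for L
      using SL_diff[OF r, of z 0 L] SL_0[of L r] by simp
    then show ?thesis using tendsto_minus[OF Phi_integral_lim[OF r, of z 0]] that by simp
  qed
  then show ?thesis unfolding \<Psi>_def using tendsto_Lim[OF _ l] by simp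
qed

lemma Psi_0: "0 \<le> r \<Longrightarrow> \<Psi> (r,0) = 0"
  using SL_lim[of r 0] by (simp add: SL_0 tendsto_const_iff)

lemma Phi_C1:
  shows "continuous_on half_plane \<Phi>" "continuous_on half_plane (dr \<Phi>)" "continuous_on half_plane (dz \<Phi>)"
    and "\<And>r z. 0 \<le> r \<Longrightarrow> ((\<lambda>r. \<Phi> (r,z)) has_real_derivative dr \<Phi> (r,z)) (at r within {0..})"
    and "\<And>r z. 0 \<le> r \<Longrightarrow> ((\<lambda>z. \<Phi> (r,z)) has_real_derivative dz \<Phi> (r,z)) (at z)"
proof -
  have "\<exists>Fr Fz. C1_rect M \<Phi> Fr Fz" if "1 \<le> M" for M using C1_Phi[OF that] by blast
  note C = C1_rect_global[OF this]
  show "continuous_on half_plane \<Phi>" "continuous_on half_plane (dr \<Phi>)" "continuous_on half_plane (dz \<Phi>)"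
    and "\<And>r z. 0 \<le> r \<Longrightarrow> ((\<lambda>r. \<Phi> (r,z)) has_real_derivative dr \<Phi> (r,z)) (at r within {0..})"
    and "\<And>r z. 0 \<le> r \<Longrightarrow> ((\<lambda>z. \<Phi> (r,z)) has_real_derivative dz \<Phi> (r,z)) (at z)"
    by (rule C; simp)+
qed

lemma Psi_deriv:
  assumes r: "0 \<le> r" shows "((\<lambda>z. \<Psi> (r,z)) has_real_derivative \<Phi> (r,z)) (at z)"
proof -
  have "((\<lambda>z. \<Psi> (r,z)) has_real_derivative \<Phi> (r,z)) (at z within UNIV)"
  proof (rule integral_diff_imp_derivative)
    fix a b :: real assume "a \<le> b"
    have "((\<lambda>L. SL L r b - SL L r a) \<longlongrightarrow> \<Psi> (r,b) - \<Psi> (r,a)) at_top"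
      by (intro tendsto_diff SL_lim r)
    moreover have "((\<lambda>L. SL L r b - SL L r a) \<longlongrightarrow> (LBINT t:{a..b}. \<Phi> (r,t))) at_top"
      using Phi_integral_lim[OF r, of a b] SL_diff[OF r \<open>a \<le> b\<close>] by simp
    ultimately show "\<Psi> (r,b) - \<Psi> (r,a) = (LBINT t:{a..b}. \<Phi> (r,t))"
      by (rule tendsto_unique[rotated]) simp
  next
    show "continuous_on UNIV (\<lambda>t. \<Phi> (r,t))"
      by (intro continuous_on_compose2[OF Phi_C1(1)] continuous_intros) (use r in \<open>auto simp: half_plane_def\<close>)
  qed auto
  then show ?thesis by simp
qed

text \<open>Links the literal definition, an iterated integral against Lebesgue measure with
  \<omega> known up to null sets, to the Borel integral over triples on which all estimates were
  made.\<close>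

lemma BS_eq:
  assumes r: "0 \<le> r" and ae: "AE q in lborel. 0 < fst q \<longrightarrow> \<omega> q = \<Omega> q"
  shows "BS \<alpha> \<omega> (r,z) = 2 * kappa_psi1 \<alpha> / pi * \<Psi> (r,z)"
proof -
  have "(LINT q:{q \<in> half_plane. norm q < L}|lebesgue. (LBINT \<theta>:{0..pi}.
       fst q powr (2 + \<alpha>) * \<omega> q * (sin \<theta>)\<^sup>2
         / ((fst (r,z))\<^sup>2 + (fst q)\<^sup>2 - 2 * fst (r,z) * fst q * cos \<theta> + (snd (r,z) - snd q)\<^sup>2) powr (3/2))) = SL L r z" for L
  proof -
    define g where "g q = (\<integral>\<theta>. k0 \<alpha> r z (q,\<theta>) * trunc L q \<partial>lborel)" for q
    have gm[measurable]: "g \<in> borel_measurable borel"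
    proof -
      have "(\<lambda>(q,\<theta>). k0 \<alpha> r z (q,\<theta>) * trunc L q) \<in> borel_measurable (lborel \<Otimes>\<^sub>M lborel)"
      proof -
        have "(\<lambda>y. k0 \<alpha> r z y * trunc L (fst y)) \<in> borel_measurable (borel :: triple measure)" by measurable
        then show ?thesis by (simp add: lborel_prod case_prod_beta')
      qed
      from lborel.borel_measurable_lebesgue_integral[OF this] show ?thesis by (simp add: g_def[abs_def])
    qed
    have ae2: "AE q in lebesgue. 0 < fst q \<longrightarrow> \<omega> q = \<Omega> q" by (rule AE_completion[OF ae])
    have pt: "indicator {q \<in> half_plane. norm q < L} q *\<^sub>R (LBINT \<theta>:{0..pi}.
         fst q powr (2 + \<alpha>) * \<omega> q * (sin \<theta>)\<^sup>2
         / (r\<^sup>2 + (fst q)\<^sup>2 - 2 * r * fst q * cos \<theta> + (z - snd q)\<^sup>2) powr (3/2)) = g q"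
      if "0 < fst q \<longrightarrow> \<omega> q = \<Omega> q" for q
    proof (cases "0 < fst q \<and> norm q < L")
      case True
      then have "trunc L q = \<omega> q" using that by (simp add: trunc_def)
      moreover have "indicator {0..pi} \<theta> *\<^sub>R (fst q powr (2 + \<alpha>) * \<omega> q * (sin \<theta>)\<^sup>2
         / (r\<^sup>2 + (fst q)\<^sup>2 - 2 * r * fst q * cos \<theta> + (z - snd q)\<^sup>2) powr (3/2)) = k0 \<alpha> r z (q,\<theta>) * \<omega> q" for \<theta>
      proof -
        obtain a b where q: "q = (a,b)" by (cases q)
        have a: "0 < a" using True q by simp
        have k: "k0 \<alpha> r z (q,\<theta>) = indicator {0<..<pi} \<theta> * (a powr (2 + \<alpha>) * (sin \<theta>)\<^sup>2 * D2 r z (q,\<theta>) powr (-3/2))"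
          using a by (simp add: q k0_def wt_def good_def indicator_def)
        have D: "D2 r z (q,\<theta>) = r\<^sup>2 + a\<^sup>2 - 2 * r * a * cos \<theta> + (z - b)\<^sup>2" by (simp add: q D2_def)
        \<comment> \<open>The angles 0 and pi, excluded from \<open>good\<close>, contribute nothing
          since the sine vanishes there.\<close>
        have i: "indicator {0<..<pi} \<theta> * (sin \<theta>)\<^sup>2 = indicator {0..pi} \<theta> * (sin \<theta>)\<^sup>2"
          by (cases "\<theta> = 0 \<or> \<theta> = pi") (auto simp: indicator_def)
        have P: "X powr (-3/2) = 1 / X powr (3/2)" for X :: real
          using powr_minus_divide[of X "3/2"] by simp
        have "k0 \<alpha> r z (q,\<theta>) = (indicator {0<..<pi} \<theta> * (sin \<theta>)\<^sup>2) * (a powr (2 + \<alpha>) * D2 r z (q,\<theta>) powr (-3/2))"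
          unfolding k by (simp only: mult_ac)
        then have "k0 \<alpha> r z (q,\<theta>) = indicator {0..pi} \<theta> * (a powr (2 + \<alpha>) * (sin \<theta>)\<^sup>2 * (1 / D2 r z (q,\<theta>) powr (3/2)))"
          unfolding i P by (simp only: mult_ac)
        then show ?thesis unfolding D by (simp add: q)
      qed
      ultimately show ?thesis
        using True by (simp add: g_def set_lebesgue_integral_def half_plane_def)
    next
      case False
      then have k: "k0 \<alpha> r z (q,\<theta>) * trunc L q = 0" for \<theta>
        by (auto simp: k0_def wt_def good_def trunc_def rho_def)
      have g0: "g q = 0" unfolding g_def by (simp only: k) simp
      show ?thesis
      proof (cases "q \<in> half_plane \<and> norm q < L")
        case True
        \<comment> \<open>On the axis the literal integrand vanishes because
          \<open>0 powr (2 + \<alpha>) = 0\<close>.\<close>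
        then have "fst q = 0" using False by (auto simp: half_plane_def)
        then show ?thesis using g0 by (simp add: set_lebesgue_integral_def)
      qed (use g0 in simp)
    qed
    have "(LINT q:{q \<in> half_plane. norm q < L}|lebesgue. (LBINT \<theta>:{0..pi}.
       fst q powr (2 + \<alpha>) * \<omega> q * (sin \<theta>)\<^sup>2
         / ((fst (r,z))\<^sup>2 + (fst q)\<^sup>2 - 2 * fst (r,z) * fst q * cos \<theta> + (snd (r,z) - snd q)\<^sup>2) powr (3/2)))
      = (\<integral>q. g q \<partial>lebesgue)"
      unfolding set_lebesgue_integral_def[of lebesgue] fst_conv snd_conv
    proof (rule Bochner_Integration.integral_cong_AE)
      show gl: "g \<in> borel_measurable lebesgue" using gm by (simp add: measurable_completion)
      show ae3: "AE q in lebesgue. indicator {q \<in> half_plane. norm q < L} q *\<^sub>R (LBINT \<theta>:{0..pi}.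
         fst q powr (2 + \<alpha>) * \<omega> q * (sin \<theta>)\<^sup>2
         / (r\<^sup>2 + (fst q)\<^sup>2 - 2 * r * fst q * cos \<theta> + (z - snd q)\<^sup>2) powr (3/2)) = g q"
        using ae2 by eventually_elim (rule pt)
      show "(\<lambda>q. indicator {q \<in> half_plane. norm q < L} q *\<^sub>R (LBINT \<theta>:{0..pi}.
         fst q powr (2 + \<alpha>) * \<omega> q * (sin \<theta>)\<^sup>2
         / (r\<^sup>2 + (fst q)\<^sup>2 - 2 * r * fst q * cos \<theta> + (z - snd q)\<^sup>2) powr (3/2))) \<in> borel_measurable lebesgue"
        by (rule lebesgue_measurable_AE_cong[OF gl ae3])
    qed
    also have "\<dots> = (\<integral>q. g q \<partial>lborel)" by (rule integral_completion) simp
    also have "\<dots> = (\<integral>y. k0 \<alpha> r z y * trunc L (fst y) \<partial>(lborel \<Otimes>\<^sub>M lborel))"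
      unfolding g_def
      using lborel_pair.integral_fst'[of "\<lambda>y. k0 \<alpha> r z y * trunc L (fst y)"] SL_integrable[OF r, of z L]
      by (simp add: lborel_prod)
    finally show ?thesis by (simp add: SL_def lborel_prod)
  qed
  then have "BS \<alpha> \<omega> (r,z) = 2 * kappa_psi1 \<alpha> / pi * Lim at_top (\<lambda>L. SL L r z)"
    unfolding BS_def by simp
  then show ?thesis by (simp add: \<Psi>_def)
qed

end

text \<open>The beta integral of w^(-a) (|z| - w)^(a-1) over 0 < w < |z|, or its mirror image for z
  < 0; its value does not depend on z. Cutting at |z|/2 and bounding the regular factor on each half
  by its value at the midpoint gives 2/(1-a) + 2/a \<le> 4 + 7.\<close>

lemma nn_integral_beta_le:
  assumes a: "3/10 \<le> a" "a \<le> 1/2"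
  shows "(\<integral>\<^sup>+w. ennreal (\<bar>z - w\<bar> powr (a-1) * (indicator {w. \<bar>w\<bar> < \<bar>z\<bar> \<and> 0 < w * z} w * \<bar>w\<bar> powr (-a))) \<partial>lborel) \<le> ennreal 11"
proof -
  define m where "m = \<bar>z\<bar> / 2"
  have m0: "0 \<le> m" by (simp add: m_def)
  define g1 where "g1 w = m powr (a-1) * (indicator {x. \<bar>x\<bar> \<le> m} w * \<bar>w\<bar> powr (-a))" for w
  define g2 where "g2 w = m powr (-a) * (indicator {x. \<bar>x\<bar> \<le> m} w * \<bar>w\<bar> powr (a-1))" for w
  have [measurable]: "g1 \<in> borel_measurable borel" "g2 \<in> borel_measurable borel"
    unfolding g1_def g2_def by measurable
  have pos: "0 \<le> g1 w" "0 \<le> g2 w" for w unfolding g1_def g2_def by auto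
  have pt: "\<bar>z - w\<bar> powr (a-1) * (indicator {w. \<bar>w\<bar> < \<bar>z\<bar> \<and> 0 < w * z} w * \<bar>w\<bar> powr (-a)) \<le> g1 w + g2 (z - w)" for w
  proof (cases "\<bar>w\<bar> < \<bar>z\<bar> \<and> 0 < w * z")
    case True
    have mp: "0 < m" using True by (auto simp: m_def)
    have d: "\<bar>z - w\<bar> = \<bar>z\<bar> - \<bar>w\<bar>" using True by (auto simp: zero_less_mult_iff)
    show ?thesis
    proof (cases "\<bar>w\<bar> \<le> m")
      case w: True
      have "\<bar>z - w\<bar> powr (a-1) \<le> m powr (a-1)"
        using mp w a d by (intro powr_mono2') (auto simp: m_def)
      then have "\<bar>z - w\<bar> powr (a-1) * \<bar>w\<bar> powr (-a) \<le> m powr (a-1) * \<bar>w\<bar> powr (-a)" by (rule mult_right_mono) auto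
      then have "\<bar>z - w\<bar> powr (a-1) * \<bar>w\<bar> powr (-a) \<le> g1 w" using w by (simp add: g1_def)
      then show ?thesis using True pos(2)[of "z-w"] by simp
    next
      case w: False
      have "\<bar>w\<bar> powr (-a) \<le> m powr (-a)" using mp w a by (intro powr_mono2') auto
      then have "\<bar>z - w\<bar> powr (a-1) * \<bar>w\<bar> powr (-a) \<le> \<bar>z - w\<bar> powr (a-1) * m powr (-a)" by (rule mult_left_mono) auto
      then have "\<bar>z - w\<bar> powr (a-1) * \<bar>w\<bar> powr (-a) \<le> g2 (z - w)" using w d by (simp add: g2_def m_def mult.commute)
      then show ?thesis using True pos(1)[of w] by simp
    qed
  qed (use pos(1)[of w] pos(2)[of "z-w"] in simp)
  have sc: "ennreal (m powr (-s)) * ennreal (2 * m powr s / t) \<le> ennreal (2/t)" if "0 < t" for s t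
  proof -
    have "m powr (-s) * (2 * m powr s / t) \<le> 2 / t"
      using that by (cases "m = 0") (simp_all add: powr_minus field_simps)
    then show ?thesis using that by (subst ennreal_mult[symmetric]) (auto intro: ennreal_leI)
  qed
  have "(\<integral>\<^sup>+w. ennreal (\<bar>z - w\<bar> powr (a-1) * (indicator {w. \<bar>w\<bar> < \<bar>z\<bar> \<and> 0 < w * z} w * \<bar>w\<bar> powr (-a))) \<partial>lborel)
     \<le> (\<integral>\<^sup>+w. ennreal (g1 w) + ennreal (g2 (z - w)) \<partial>lborel)"
    by (intro nn_integral_mono) (use pt pos in \<open>auto simp flip: ennreal_plus intro!: ennreal_leI\<close>)
  also have "\<dots> = (\<integral>\<^sup>+w. ennreal (g1 w) \<partial>lborel) + (\<integral>\<^sup>+w. ennreal (g2 w) \<partial>lborel)"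
    by (subst nn_integral_add) (auto simp: nn_integral_translate_real)
  also have "(\<integral>\<^sup>+w. ennreal (g1 w) \<partial>lborel) \<le> ennreal (2/(1-a))"
  proof -
    have "(\<integral>\<^sup>+w. ennreal (g1 w) \<partial>lborel) = (\<integral>\<^sup>+w. ennreal (m powr (a-1)) * ennreal (indicator {x. \<bar>x\<bar> \<le> m} w * \<bar>w\<bar> powr (-a)) \<partial>lborel)"
      unfolding g1_def by (intro nn_integral_cong) (auto simp: ennreal_mult)
    also have "\<dots> = ennreal (m powr (a-1)) * (\<integral>\<^sup>+w. ennreal (indicator {x. \<bar>x\<bar> \<le> m} w * \<bar>w\<bar> powr (-a)) \<partial>lborel)"
      by (rule nn_integral_cmult) auto
    also have "\<dots> \<le> ennreal (m powr (a-1)) * ennreal (2 * m powr (-a+1) / (-a+1))"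
      by (intro mult_left_mono nn_integral_abs_powr_near_0) (use a m0 in auto)
    also have "\<dots> \<le> ennreal (2/(1-a))" using sc[of "1-a" "1-a"] a by simp
    finally show ?thesis .
  qed
  also have "(\<integral>\<^sup>+w. ennreal (g2 w) \<partial>lborel) \<le> ennreal (2/a)"
  proof -
    have "(\<integral>\<^sup>+w. ennreal (g2 w) \<partial>lborel) = (\<integral>\<^sup>+w. ennreal (m powr (-a)) * ennreal (indicator {x. \<bar>x\<bar> \<le> m} w * \<bar>w\<bar> powr (a-1)) \<partial>lborel)"
      unfolding g2_def by (intro nn_integral_cong) (auto simp: ennreal_mult)
    also have "\<dots> = ennreal (m powr (-a)) * (\<integral>\<^sup>+w. ennreal (indicator {x. \<bar>x\<bar> \<le> m} w * \<bar>w\<bar> powr (a-1)) \<partial>lborel)"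
      by (rule nn_integral_cmult) auto
    also have "\<dots> \<le> ennreal (m powr (-a)) * ennreal (2 * m powr (a-1+1) / (a-1+1))"
      by (intro mult_left_mono nn_integral_abs_powr_near_0) (use a m0 in auto)
    also have "\<dots> \<le> ennreal (2/a)" using sc[of a a] a by simp
    finally show ?thesis .
  qed
  finally have "(\<integral>\<^sup>+w. ennreal (\<bar>z - w\<bar> powr (a-1) * (indicator {w. \<bar>w\<bar> < \<bar>z\<bar> \<and> 0 < w * z} w * \<bar>w\<bar> powr (-a))) \<partial>lborel) \<le> ennreal (2/(1-a)) + ennreal (2/a)"
    by (simp add: add_mono)
  also have "\<dots> = ennreal (2/(1-a) + 2/a)" using a by (intro ennreal_plus[symmetric]) auto
  also have "\<dots> \<le> ennreal 11"
  proof (rule ennreal_leI)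
    have "2/(1-a) \<le> 4" "2/a \<le> 7" using a by (auto simp: field_simps)
    then show "2/(1-a) + 2/a \<le> 11" by linarith
  qed
  finally show ?thesis .
qed

section \<open>One-sided bound for the strain of a profile of fixed sign\<close>

context density begin

text \<open>Only the vorticity at heights between \<open>0\<close> and \<open>z\<close> contributes positively to the strain, and
  this part is bounded by a scale-invariant beta integral.\<close>

lemma Phi_le_of_sign:
  assumes W: "\<And>q. \<Omega> q = W (snd q)" and neg: "\<And>w. 0 \<le> w \<Longrightarrow> W w \<le> 0"
    and bd: "\<And>w. w \<noteq> 0 \<Longrightarrow> \<bar>W w\<bar> \<le> C0 * \<bar>w\<bar> powr (-\<alpha>)" and C0: "0 \<le> C0" and r: "0 \<le> r"
  shows "\<Phi> (r,z) \<le> 3168 * C0"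
proof -
  define f where "f w = indicator {w. \<bar>w\<bar> < \<bar>z\<bar> \<and> 0 < w * z} w * \<bar>w\<bar> powr (-\<alpha>)" for w
  have [measurable]: "f \<in> borel_measurable borel" unfolding f_def by measurable
  have f0: "0 \<le> f w" for w by (simp add: f_def)
  have odd: "W (-w) = - W w" for w using Omega_odd[of 0 w] W by simp
  have W0: "W 0 = 0" using odd[of 0] by simp
  have pt: "kz \<alpha> r z y * \<Omega> (fst y) \<le> 3 * C0 * (kmaj \<alpha> r z y * f (wz y))" for y
  proof -
    define w where "w = wz y"
    have \<Omega>: "\<Omega> (fst y) = W w" by (simp add: W w_def wz_def)
    have R0: "0 \<le> 3 * C0 * (kmaj \<alpha> r z y * f w)" using C0 kmaj_nonneg f0 by simp
    have kzs: "kz \<alpha> r z y * W w = - ((z - w) * W w) * (3 * wt \<alpha> y * D2 r z y powr (-5/2))"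
      by (simp add: kz_def w_def algebra_simps)
    have p3: "0 \<le> 3 * wt \<alpha> y * D2 r z y powr (-5/2)" using wt_nonneg by simp
    show ?thesis
    proof (cases "\<bar>w\<bar> < \<bar>z\<bar> \<and> 0 < w * z")
      case True
      then have "w \<noteq> 0" by auto
      have "kz \<alpha> r z y * W w \<le> \<bar>kz \<alpha> r z y\<bar> * \<bar>W w\<bar>" by (metis abs_ge_self abs_mult)
      also have "\<dots> \<le> (3 * kmaj \<alpha> r z y) * (C0 * \<bar>w\<bar> powr (-\<alpha>))"
        by (intro mult_mono kernel_bounds bd \<open>w \<noteq> 0\<close>) (auto simp: kmaj_nonneg)
      also have "\<dots> = 3 * C0 * (kmaj \<alpha> r z y * f w)" using True by (simp add: f_def)
      finally show ?thesis by (simp add: \<Omega> w_def)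
    next
      case False
      \<comment> \<open>W is odd and nonpositive on w \<ge> 0, so this product can be negative only
        if w lies strictly between 0 and z. As \<open>kz\<close> is a negative multiple of z - w,
        all other w contribute nonpositively to the strain.\<close>
      have "0 \<le> (z - w) * W w"
      proof (cases "w = 0")
        case True then show ?thesis using W0 by simp
      next
        case w0: False
        have wneg: "0 \<le> W w" if "w \<le> 0" using neg[of "-w"] odd[of w] that by simp
        show ?thesis
        proof (cases "0 < w")
          case True
          then have "z \<le> w" using False by (auto simp: not_less zero_less_mult_iff)
          then show ?thesis using neg[of w] True by (simp add: mult_nonpos_nonpos)
        next
          case w': False
          then have "w \<le> z" using False w0 by (auto simp: not_less zero_less_mult_iff)
          then show ?thesis using wneg w' by simp
        qed
      qed
      then have "kz \<alpha> r z y * W w \<le> 0" unfolding kzs using p3 by (simp only: mult_nonpos_nonneg neg_le_0_iff_le)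
      then have "kz \<alpha> r z y * W w \<le> 3 * C0 * (kmaj \<alpha> r z y * f w)" using R0 by linarith
      then show ?thesis by (simp add: \<Omega> w_def)
    qed
  qed
  have Tf: "(\<integral>\<^sup>+y. ennreal (kmaj \<alpha> r z y * f (wz y)) \<partial>(lborel :: triple measure)) \<le> ennreal 1056"
  proof -
    have "(\<integral>\<^sup>+y. ennreal (kmaj \<alpha> r z y * f (wz y)) \<partial>(lborel :: triple measure))
      \<le> (\<integral>\<^sup>+y. ennreal (sinw (th y) * ((r - rho y)\<^sup>2 + (z - wz y)\<^sup>2) powr (-(2-\<alpha>)/2) * f (wz y)) \<partial>(lborel :: triple measure))"
    proof (rule nn_integral_mono_AE)
      show "AE y in (lborel :: triple measure). ennreal (kmaj \<alpha> r z y * f (wz y))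
         \<le> ennreal (sinw (th y) * ((r - rho y)\<^sup>2 + (z - wz y)\<^sup>2) powr (-(2-\<alpha>)/2) * f (wz y))"
        using AE_coord_ne(1)[of r]
      proof eventually_elim
        case (elim y)
        show ?case
        proof (cases "y \<in> good")
          case False
          then show ?thesis using sinw_nonneg f0 by (simp add: kmaj_def wt_bad)
        next
          case True
          define d where "d = ((r - rho y)\<^sup>2 + (z - wz y)\<^sup>2) powr (-(2-\<alpha>)/2)"
          have "kmaj \<alpha> r z y \<le> rho y powr (\<alpha> - \<alpha>) * sin (th y) powr (-\<alpha>) * d"
            unfolding d_def by (rule kmaj_le) (use True r elim alpha in auto)
          also have "\<dots> \<le> 1 * sinw (th y) * d"
            using sin_powr_le_sinw[OF True alpha2] by (intro mult_right_mono mult_mono) (auto simp: d_def)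
          finally show ?thesis unfolding d_def using f0 by (intro ennreal_leI mult_right_mono) auto
        qed
      qed
    qed
    also have "\<dots> \<le> ennreal 96 * (\<integral>\<^sup>+w. ennreal (\<bar>z - w\<bar> powr (\<alpha>-1) * f w) \<partial>lborel)"
      by (rule nn_integral_riesz_triple) (use f0 alpha in auto)
    also have "\<dots> \<le> ennreal 96 * ennreal 11"
      unfolding f_def by (intro mult_left_mono nn_integral_beta_le) (use alpha in auto)
    also have "\<dots> = ennreal 1056" by (simp flip: ennreal_mult)
    finally show ?thesis .
  qed
  have Tint: "integrable lborel (\<lambda>y. kmaj \<alpha> r z y * f (wz y))"
    by (rule integrableI_bounded) (use le_less_trans[OF Tf, of \<infinity>] in \<open>auto simp: abs_mult kmaj_nonneg f0\<close>)
  have "\<Phi> (r,z) \<le> (\<integral>y. 3 * C0 * (kmaj \<alpha> r z y * f (wz y)) \<partial>lborel)"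
    unfolding \<Phi>_def fst_conv snd_conv
    by (intro integral_mono kz_Omega_integrable r integrable_mult_right Tint pt)
  also have "\<dots> = 3 * C0 * (\<integral>y. kmaj \<alpha> r z y * f (wz y) \<partial>lborel)" by simp
  also have "\<dots> \<le> 3 * C0 * 1056"
  proof (rule mult_left_mono)
    have "ennreal (\<integral>y. kmaj \<alpha> r z y * f (wz y) \<partial>lborel) = (\<integral>\<^sup>+y. ennreal (kmaj \<alpha> r z y * f (wz y)) \<partial>lborel)"
      by (rule nn_integral_eq_integral[symmetric]) (auto simp: Tint kmaj_nonneg f0)
    then have "ennreal (\<integral>y. kmaj \<alpha> r z y * f (wz y) \<partial>lborel) \<le> ennreal 1056" using Tf by (simp only:)
    then show "(\<integral>y. kmaj \<alpha> r z y * f (wz y) \<partial>lborel) \<le> 1056" by (subst (asm) ennreal_le_iff) auto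
  qed (use C0 in auto)
  finally show ?thesis by simp
qed

end

text \<open>Of the integral in the definition only the interval [1, 2] is kept; the integrand is at
  least 1/56 there because 5^(5/2) \<le> 56. Hence the reciprocal is at most 56, and 2 * (1/6) * 56
  is below 7 pi.\<close>

lemma kappa_psi1_bounds:
  assumes "0 \<le> \<alpha>" "\<alpha> \<le> 1/2"
  shows "0 \<le> 2 * kappa_psi1 \<alpha> / pi" "2 * kappa_psi1 \<alpha> / pi \<le> 7"
proof -
  define h where "h s = s powr (2 + \<alpha>) / (s\<^sup>2 + 1) powr (5/2)" for s :: real
  define I where "I = (LBINT s:{0..}. h s)"
  have h0: "0 \<le> h s" for s by (simp add: h_def)
  have I0: "0 \<le> I" unfolding I_def set_lebesgue_integral_def by (rule integral_nonneg_AE) (auto simp: h0)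
  have "inverse I \<le> 56"
  proof (cases "set_integrable lborel {0..} h")
    case False
    \<comment> \<open>An undefined integral has the value 0, and \<open>inverse 0 = 0\<close>, so
      the bound holds in this case as well.\<close>
    then have "I = 0" by (simp add: I_def set_lebesgue_integral_def set_integrable_def not_integrable_integral_eq)
    then show ?thesis by simp
  next
    case True
    have "(5::real) powr (5/2) \<le> 56"
    proof (rule power2_le_imp_le)
      have "((5::real) powr (5/2))\<^sup>2 = 5 powr 5" by (simp add: power2_eq_square flip: powr_add)
      then show "((5::real) powr (5/2))\<^sup>2 \<le> 56\<^sup>2" by simp
    qed simp
    have "1/56 \<le> h s" if "s \<in> {1..2}" for s
    proof -
      have "1 \<le> s powr (2 + \<alpha>)" using that assms by (simp add: ge_one_powr_ge_zero)
      moreover have "(s\<^sup>2 + 1) powr (5/2) \<le> 56"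
      proof -
        have "s\<^sup>2 \<le> 2\<^sup>2" using that by (intro power_mono) auto
        then have "(s\<^sup>2 + 1) powr (5/2) \<le> 5 powr (5/2)" by (intro powr_mono2) auto
        then show ?thesis using \<open>(5::real) powr (5/2) \<le> 56\<close> by simp
      qed
      moreover have "0 < (s\<^sup>2 + 1) powr (5/2)" by (simp add: add_nonneg_eq_0_iff less_le)
      ultimately show ?thesis unfolding h_def by (intro frac_le) auto
    qed
    then have "(\<integral>s. indicator {1..2::real} s * (1/56) \<partial>lborel) \<le> I"
      unfolding I_def set_lebesgue_integral_def
      using True[unfolded set_integrable_def]
      by (intro integral_mono) (auto simp: h0 emeasure_lborel_Icc_eq intro!: integrable_mult_left integrable_real_indicator split: split_indicator)
    then have "1/56 \<le> I" by simp
    then show ?thesis using I0 by (simp add: field_simps)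
  qed
  moreover have k: "kappa_psi1 \<alpha> = \<alpha> / 3 * inverse I" by (simp add: kappa_psi1_def I_def h_def)
  ultimately have "kappa_psi1 \<alpha> \<le> (1/2) / 3 * 56" unfolding k using assms I0 by (intro mult_mono) auto
  moreover show "0 \<le> 2 * kappa_psi1 \<alpha> / pi" unfolding k using assms I0 by simp
  ultimately have "2 * kappa_psi1 \<alpha> \<le> 7 * pi" using pi_gt3 by linarith
  then show "2 * kappa_psi1 \<alpha> / pi \<le> 7" by (simp add: pos_divide_le_eq)
qed

section \<open>Bump functions and weak derivatives\<close>

text \<open>Successive derivatives occur as existential witnesses only, so closure under products,
  powers and affine substitutions goes by induction on the order without a formula for higher
  derivatives.\<close>

primrec smooth_upto :: "nat \<Rightarrow> (real \<Rightarrow> real) \<Rightarrow> bool" where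
  "smooth_upto 0 f \<longleftrightarrow> True"
| "smooth_upto (Suc n) f \<longleftrightarrow> (\<exists>f'. (\<forall>x. (f has_real_derivative f' x) (at x)) \<and> smooth_upto n f')"

lemma smooth_upto_Suc_imp: "smooth_upto (Suc n) f \<Longrightarrow> smooth_upto n f"
  by (induction n arbitrary: f) auto

lemma smooth_upto_const: "smooth_upto n (\<lambda>x. c)"
proof (induction n arbitrary: c)
  case (Suc n)
  show ?case unfolding smooth_upto.simps by (rule exI[of _ "\<lambda>x. 0"]) (use Suc in auto)
qed simp

lemma smooth_upto_add: "smooth_upto n f \<Longrightarrow> smooth_upto n g \<Longrightarrow> smooth_upto n (\<lambda>x. f x + g x)"
proof (induction n arbitrary: f g)
  case (Suc n)
  then obtain f' g' where "\<forall>x. (f has_real_derivative f' x) (at x)" "smooth_upto n f'"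
     "\<forall>x. (g has_real_derivative g' x) (at x)" "smooth_upto n g'" by auto
  then show ?case unfolding smooth_upto.simps
    by (intro exI[of _ "\<lambda>x. f' x + g' x"]) (auto intro!: DERIV_add Suc.IH)
qed simp

lemma smooth_upto_mult: "smooth_upto n f \<Longrightarrow> smooth_upto n g \<Longrightarrow> smooth_upto n (\<lambda>x. f x * g x)"
proof (induction n arbitrary: f g)
  case (Suc n)
  then obtain f' g' where *: "\<forall>x. (f has_real_derivative f' x) (at x)" "smooth_upto n f'"
     "\<forall>x. (g has_real_derivative g' x) (at x)" "smooth_upto n g'" by auto
  have "smooth_upto n f" "smooth_upto n g" using Suc.prems smooth_upto_Suc_imp by blast+
  then show ?case unfolding smooth_upto.simps using *
    by (intro exI[of _ "\<lambda>x. f' x * g x + g' x * f x"]) (auto intro!: DERIV_mult smooth_upto_add Suc.IH)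
qed simp

lemma smooth_upto_power: "smooth_upto n f \<Longrightarrow> smooth_upto n (\<lambda>x. f x ^ k)"
  by (induction k) (auto intro: smooth_upto_const smooth_upto_mult)

lemma smooth_upto_affine: "smooth_upto n f \<Longrightarrow> smooth_upto n (\<lambda>x. f (a + c * x))"
proof (induction n arbitrary: f)
  case (Suc n)
  then obtain f' where *: "\<forall>x. (f has_real_derivative f' x) (at x)" "smooth_upto n f'" by auto
  have "((\<lambda>x. f (a + c * x)) has_real_derivative f' (a + c * x) * c) (at x)" for x
    by (rule DERIV_chain2[OF *(1)[rule_format]]) (auto intro!: derivative_eq_intros)
  then show ?case unfolding smooth_upto.simps using *
    by (intro exI[of _ "\<lambda>x. f' (a + c * x) * c"]) (auto intro!: smooth_upto_mult smooth_upto_const Suc.IH)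
qed simp

text \<open>For \<open>p\<close> ranging over all polynomials, these functions form a family closed under differentiation.\<close>

definition flat :: "real poly \<Rightarrow> real \<Rightarrow> real" where
  "flat p x = (if 0 < x then poly p (1/x) * exp (- (1/x)) else 0)"

lemma poly_exp_tendsto_0: "((\<lambda>x::real. poly p x * exp (- x)) \<longlongrightarrow> 0) at_top"
proof (induction p)
  case 0
  then show ?case by simp
next
  case (pCons a p)
  have pw: "((\<lambda>x::real. x ^ k * exp (- x)) \<longlongrightarrow> 0) at_top" for k
    using tendsto_power_div_exp_0[of k] by (simp add: exp_minus divide_inverse)
  have q: "((\<lambda>x::real. x * (poly p x * exp (- x))) \<longlongrightarrow> 0) at_top" for p
  proof -
    have "((\<lambda>x::real. \<Sum>i\<le>degree p. coeff p i * (x ^ Suc i * exp (- x))) \<longlongrightarrow> (\<Sum>i\<le>degree p. coeff p i * 0)) at_top"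
      by (intro tendsto_intros pw)
    moreover have "(\<lambda>x::real. \<Sum>i\<le>degree p. coeff p i * (x ^ Suc i * exp (- x))) = (\<lambda>x. x * (poly p x * exp (- x)))"
      by (auto simp: fun_eq_iff poly_altdef sum_distrib_left sum_distrib_right mult_ac)
    ultimately show ?thesis by simp
  qed
  have "((\<lambda>x::real. a * (x ^ 0 * exp (- x)) + x * (poly p x * exp (- x))) \<longlongrightarrow> a * 0 + 0) at_top"
    by (intro tendsto_intros pw q)
  then show ?case by (simp add: algebra_simps)
qed

text \<open>With y = 1/x, the x derivative of p(y) exp(-y) is y^2 (p - p')(y) exp(-y), and
  \<open>[:0,0,1:]\<close> is the polynomial y^2. At 0 the difference quotient from the right is y
  p(y) exp(-y), which tends to 0, the value prescribed by the same formula.\<close>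

lemma flat_deriv: "(flat p has_real_derivative flat ([:0,0,1:] * (p - pderiv p)) x) (at x)"
proof -
  consider "x < 0" | "x = 0" | "0 < x" by linarith
  then show ?thesis
  proof cases
    case 1
    have "((\<lambda>x. 0) has_real_derivative 0) (at x)" by simp
    then have "(flat p has_real_derivative 0) (at x)"
      by (rule has_field_derivative_transform_within_open[of _ _ _ "{..<0}"]) (use 1 in \<open>auto simp: flat_def\<close>)
    then show ?thesis using 1 by (simp add: flat_def)
  next
    case 3
    have "((\<lambda>x. poly p (1/x) * exp (- (1/x))) has_real_derivative flat ([:0,0,1:] * (p - pderiv p)) x) (at x)"
      using 3 by (auto intro!: derivative_eq_intros poly_DERIV[THEN DERIV_chain2] simp: flat_def field_simps power2_eq_square)
    then show ?thesis
      by (rule has_field_derivative_transform_within_open[of _ _ _ "{0<..}"]) (use 3 in \<open>auto simp: flat_def\<close>)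
  next
    case 2
    have "((\<lambda>h. (flat p (0 + h) - flat p 0) / h) \<longlongrightarrow> 0) (at 0)"
    proof (rule filterlim_split_at)
      have "((\<lambda>h::real. 0::real) \<longlongrightarrow> 0) (at_left 0)" by simp
      then show "((\<lambda>h. (flat p (0 + h) - flat p 0) / h) \<longlongrightarrow> 0) (at_left 0)"
        by (rule Lim_transform_eventually) (auto simp: flat_def eventually_at_filter)
      have "((\<lambda>x::real. poly ([:0,1:] * p) x * exp (- x)) \<longlongrightarrow> 0) at_top" by (rule poly_exp_tendsto_0)
      then have "((\<lambda>h::real. poly ([:0,1:] * p) (inverse h) * exp (- (inverse h))) \<longlongrightarrow> 0) (at_right 0)"
        by (rule filterlim_compose) (rule filterlim_inverse_at_top_right)
      then show "((\<lambda>h. (flat p (0 + h) - flat p 0) / h) \<longlongrightarrow> 0) (at_right 0)"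
        by (rule Lim_transform_eventually) (auto simp: flat_def eventually_at_filter field_simps)
    qed
    then show ?thesis using 2 by (simp add: DERIV_def flat_def)
  qed
qed

lemma smooth_upto_flat: "smooth_upto n (flat p)"
proof (induction n arbitrary: p)
  case (Suc n)
  show ?case unfolding smooth_upto.simps using flat_deriv Suc by blast
qed simp

text \<open>The product of the two flat functions is smooth, vanishes outside (a, b) and lies in (0,
  1] inside. The n-th power of its complement tends to 0 inside and is 1 outside, so these compactly
  supported smooth functions converge pointwise to the indicator of (a, b), staying between 0 and
  that indicator.\<close>

definition bump :: "nat \<Rightarrow> real \<Rightarrow> real \<Rightarrow> real \<Rightarrow> real" where
  "bump n a b x = 1 - (1 - flat 1 (x - a) * flat 1 (b - x)) ^ n"

lemma smooth_upto_bump: "smooth_upto k (bump n a b)"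
proof -
  have "smooth_upto k (\<lambda>x. flat 1 (-a + 1 * x))" "smooth_upto k (\<lambda>x. flat 1 (b + (-1) * x))" by (intro smooth_upto_affine smooth_upto_flat)+
  then have "smooth_upto k (\<lambda>x. 1 + (-1) * (1 + (-1) * (flat 1 (-a + 1 * x) * flat 1 (b + (-1) * x))) ^ n)"
    by (intro smooth_upto_add smooth_upto_mult smooth_upto_power smooth_upto_const)
  then show ?thesis by (simp add: bump_def[abs_def])
qed

lemma bump_props:
  shows "0 \<le> bump n a b x" "bump n a b x \<le> 1" "x \<notin> {a<..<b} \<Longrightarrow> bump n a b x = 0"
    and "(\<lambda>n. bump n a b x) \<longlonglongrightarrow> indicator {a<..<b} x"
proof -
  have f: "0 \<le> flat 1 x" "flat 1 x \<le> 1" "0 < x \<Longrightarrow> 0 < flat 1 x" "x \<le> 0 \<Longrightarrow> flat 1 x = 0" for x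
    by (auto simp: flat_def)
  define c where "c = 1 - flat 1 (x - a) * flat 1 (b - x)"
  have c: "0 \<le> c" "c \<le> 1" using f by (auto simp: c_def mult_le_one)
  show "0 \<le> bump n a b x" "bump n a b x \<le> 1"
    using c by (auto simp: bump_def c_def[symmetric] power_le_one)
  show out: "x \<notin> {a<..<b} \<Longrightarrow> bump n a b x = 0" for n
    using f(4)[of "x - a"] f(4)[of "b - x"] by (auto simp: bump_def not_less)
  show "(\<lambda>n. bump n a b x) \<longlonglongrightarrow> indicator {a<..<b} x"
  proof (cases "x \<in> {a<..<b}")
    case True
    then have "c < 1" using f(3)[of "x - a"] f(3)[of "b - x"] by (auto simp: c_def)
    then have "(\<lambda>n. 1 - c ^ n) \<longlonglongrightarrow> 1 - 0" using c by (intro tendsto_intros LIMSEQ_realpow_zero)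
    then show ?thesis using True by (simp add: bump_def c_def)
  qed (simp add: out)
qed

section \<open>Product test functions\<close>

lemma open_half_plane_open: "open open_half_plane"
proof -
  have "open_half_plane = {0<..} \<times> UNIV" by (auto simp: open_half_plane_def)
  moreover have "open ({0::real<..} \<times> (UNIV :: real set))"
    by (intro open_Times) auto
  ultimately show ?thesis by metis
qed

lemma product_derivatives:
  assumes "\<And>x. (A has_real_derivative A' x) (at x)" "\<And>x. (C has_real_derivative C' x) (at x)"
    and f: "\<And>p. p \<in> open_half_plane \<Longrightarrow> f p = A (fst p) * C (snd p)" and p: "p \<in> open_half_plane"
  shows "dr f p = A' (fst p) * C (snd p)" "dz f p = A (fst p) * C' (snd p)"
    "f differentiable (at p within half_plane)"
proof -
  obtain r z where pq: "p = (r,z)" by (cases p)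
  have r: "0 < r" using p pq by (simp add: open_half_plane_def)
  have "((\<lambda>x. A x * C z) has_real_derivative A' r * C z) (at r)"
    by (intro DERIV_cmult_right assms)
  then have "((\<lambda>x. f (x, z)) has_real_derivative A' r * C z) (at r)"
    by (rule has_field_derivative_transform_within_open[of _ _ _ "{0<..}"]) (use r f in \<open>auto simp: open_half_plane_def\<close>)
  then have "((\<lambda>x. f (x, z)) has_vector_derivative A' r * C z) (at r)"
    by (simp add: has_real_derivative_iff_has_vector_derivative)
  moreover have "at r within {0..} = at r" using r by (intro at_within_interior) (auto simp: interior_real_atLeast)
  ultimately show "dr f p = A' (fst p) * C (snd p)" by (simp add: dr_def pq vector_derivative_at)
  have "((\<lambda>x. A r * C x) has_real_derivative A r * C' z) (at z)"
    by (intro DERIV_cmult assms)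
  moreover have "f (r, x) = A r * C x" for x using f[of "(r,x)"] r by (simp add: open_half_plane_def)
  ultimately have "((\<lambda>x. f (r, x)) has_real_derivative A r * C' z) (at z)" by simp
  then show "dz f p = A (fst p) * C' (snd p)"
    by (simp add: dz_def pq vector_derivative_at has_real_derivative_iff_has_vector_derivative)
  have A: "(A has_derivative (\<lambda>h. A' r * h)) (at (fst p))" and C: "(C has_derivative (\<lambda>h. C' z * h)) (at (snd p))"
    using assms(1)[of r] assms(2)[of z] by (auto simp: has_field_derivative_def pq)
  have A2: "((\<lambda>p. A (fst p)) has_derivative (\<lambda>h. A' r * fst h)) (at p)"
    by (rule has_derivative_compose[where g=A and f=fst, OF _ A]) (intro has_derivative_fst has_derivative_ident)
  have C2: "((\<lambda>p. C (snd p)) has_derivative (\<lambda>h. C' z * snd h)) (at p)"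
    by (rule has_derivative_compose[where g=C and f=snd, OF _ C]) (intro has_derivative_snd has_derivative_ident)
  have "((\<lambda>p. A (fst p) * C (snd p)) has_derivative
      (\<lambda>h. A (fst p) * (C' z * snd h) + (A' r * fst h) * C (snd p))) (at p)"
    by (rule has_derivative_mult[OF A2 C2])
  then have "(f has_derivative (\<lambda>h. A (fst p) * (C' z * snd h) + (A' r * fst h) * C (snd p))) (at p)"
    by (rule has_derivative_transform_within_open[OF _ open_half_plane_open p]) (use f in auto)
  then show "f differentiable (at p within half_plane)"
    by (auto simp: differentiable_def intro: has_derivative_at_withinI)
qed

text \<open>The equality with a product is assumed on the open half plane only, because the
  induction passes to \<open>dr f\<close> and \<open>dz f\<close>, which are known to be products
  again at those points.\<close>

lemma Ck_on_product:
  assumes "smooth_upto (Suc k) A" "smooth_upto (Suc k) C" "\<And>p. p \<in> open_half_plane \<Longrightarrow> f p = A (fst p) * C (snd p)"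
  shows "Ck_on k open_half_plane f"
  using assms
proof (induction k arbitrary: A C f)
  case 0
  then obtain A' C' where d: "\<And>x. (A has_real_derivative A' x) (at x)" "\<And>x. (C has_real_derivative C' x) (at x)" by auto
  have "continuous_on UNIV A" "continuous_on UNIV C" using d DERIV_continuous_on by blast+
  then have "continuous_on open_half_plane (\<lambda>p. A (fst p))" "continuous_on open_half_plane (\<lambda>p. C (snd p))"
    by (auto elim!: continuous_on_compose2 intro: continuous_on_fst continuous_on_snd continuous_on_id)
  then have "continuous_on open_half_plane (\<lambda>p. A (fst p) * C (snd p))" by (rule continuous_on_mult)
  then have "continuous_on open_half_plane f" by (rule continuous_on_eq) (simp add: 0(3))
  then show ?case by simp
next
  case (Suc k)
  then obtain A' C' where d: "\<And>x. (A has_real_derivative A' x) (at x)" "\<And>x. (C has_real_derivative C' x) (at x)"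
    "smooth_upto (Suc k) A'" "smooth_upto (Suc k) C'" by auto
  have s: "smooth_upto (Suc k) A" "smooth_upto (Suc k) C" using Suc.prems smooth_upto_Suc_imp by blast+
  note pd = product_derivatives[OF d(1,2) Suc.prems(3)]
  show ?case unfolding Ck_on.simps
  proof (intro conjI ballI)
    show "Ck_on k open_half_plane (dr f)" by (rule Suc.IH[OF d(3) s(2)]) (rule pd(1))
    show "Ck_on k open_half_plane (dz f)" by (rule Suc.IH[OF s(1) d(4)]) (rule pd(2))
  qed (rule pd(3))
qed

lemma test_function_product:
  assumes A: "\<And>k. smooth_upto k A" and C: "\<And>k. smooth_upto k C" and a: "0 < a"
    and supp: "\<And>x. x \<notin> {a..b} \<Longrightarrow> A x = 0" "\<And>x. x \<notin> {c..d} \<Longrightarrow> C x = 0"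
  shows "test_function (\<lambda>p. A (fst p) * C (snd p))"
  unfolding test_function_def
proof (intro conjI allI exI[of _ "{a..b} \<times> {c..d}"] impI)
  show "Ck_on k open_half_plane (\<lambda>p. A (fst p) * C (snd p))" for k by (rule Ck_on_product[OF A C]) simp
  show "p \<notin> {a..b} \<times> {c..d} \<Longrightarrow> A (fst p) * C (snd p) = 0" for p
    using supp(1)[of "fst p"] supp(2)[of "snd p"] by (cases p) auto
qed (use a in \<open>auto simp: open_half_plane_def intro!: compact_Times\<close>)

text \<open>Open boxes are stable under intersection and generate the Borel sets, and the Borel sets
  over which F integrates to 0 form a Dynkin system. So F integrates to 0 over every Borel set,
  which forces it to vanish almost everywhere.\<close>

lemma AE_zero_of_boxes:
  fixes F :: "'a::euclidean_space \<Rightarrow> real"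
  assumes int: "integrable lborel F" and box: "\<And>a b. (\<integral>q. indicator (box a b) q * F q \<partial>lborel) = 0"
  shows "AE q in lborel. F q = 0"
proof -
  have "(\<integral>q. indicator A q * F q \<partial>lborel) = 0" if "A \<in> sets borel" for A
  proof -
    have I: "integrable lborel (\<lambda>q. indicator A q * F q)" if "A \<in> sets borel" for A
      using integrable_mult_indicator[of A lborel F] int that by simp
    have gen: "A \<in> sigma_sets UNIV (range (\<lambda>(a,b). box a b))"
      using that by (subst (asm) borel_eq_box) auto
    have IS: "Int_stable (range (\<lambda>(a,b). box a b :: 'a set))"
      by (auto simp: Int_stable_def box_Int_box)
    have P: "range (\<lambda>(a,b). box a b :: 'a set) \<subseteq> Pow UNIV" by auto
    show ?thesis using IS P gen
    proof (induction rule: sigma_sets_induct_disjoint)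
      case (basic A)
      then show ?case using box by auto
    next
      case empty
      then show ?case by simp
    next
      case (compl A)
      have A: "A \<in> sets borel" using compl(1) by (subst borel_eq_box) auto
      \<comment> \<open>For complements the integral over the whole space is required; it is a
        dominated limit of integrals over growing boxes.\<close>
      have u: "(\<integral>q. F q \<partial>lborel) = 0"
      proof -
        have "(\<lambda>n. \<integral>q. indicator (box (-(real n *\<^sub>R One)) (real n *\<^sub>R One)) q * F q \<partial>lborel) \<longlonglongrightarrow> (\<integral>q. F q \<partial>lborel)"
        proof (rule integral_dominated_convergence[where w="\<lambda>q. \<bar>F q\<bar>"])
          show "AE x in lborel. (\<lambda>n. indicator (box (- (real n *\<^sub>R One)) (real n *\<^sub>R One)) x * F x) \<longlonglongrightarrow> F x"
          proof (rule AE_I2, rule tendsto_eventually)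
            fix x :: 'a
            obtain N :: nat where N: "norm x < real N" using reals_Archimedean2 by blast
            have bx: "x \<in> box (- (real n *\<^sub>R One)) (real n *\<^sub>R One)" if "N \<le> n" for n
            proof -
              have "\<bar>x \<bullet> i\<bar> < real n" if "i \<in> Basis" for i
                using Basis_le_norm[OF that, of x] N \<open>N \<le> n\<close> by linarith
              then show ?thesis by (force simp: mem_box abs_less_iff)
            qed
            show "\<forall>\<^sub>F n in sequentially. indicator (box (- (real n *\<^sub>R One)) (real n *\<^sub>R One)) x * F x = F x"
              by (rule eventually_mono[OF eventually_ge_at_top[of N]]) (simp add: bx)
          qed
        qed (use int in \<open>auto split: split_indicator\<close>)
        then have "(\<lambda>n::nat. 0::real) \<longlonglongrightarrow> (\<integral>q. F q \<partial>lborel)" by (simp only: box)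
        then show ?thesis by (simp add: LIMSEQ_const_iff)
      qed
      have "(\<integral>q. indicator (UNIV - A) q * F q \<partial>lborel) = (\<integral>q. F q - indicator A q * F q \<partial>lborel)"
        by (intro Bochner_Integration.integral_cong) (auto split: split_indicator)
      also have "\<dots> = 0" using int I[OF A] u compl(2) by simp
      finally show ?case .
    next
      case (union A)
      have A: "A i \<in> sets borel" for i using union(2) by (subst borel_eq_box) auto
      have "(LINT q:(\<Union>i. A i)|lborel. F q) = (\<Sum>i. LINT q:A i|lborel. F q)"
        by (rule lebesgue_integral_countable_add)
          (use A union(1) int I in \<open>auto simp: disjoint_family_on_def set_integrable_def\<close>)
      then show ?case using union(3) by (simp add: set_lebesgue_integral_def)
    qed
  qed
  then have "(LINT q:A|lborel. F q) = (LINT q:A|lborel. 0)" if "A \<in> sets lborel" for A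
    using that by (simp add: set_lebesgue_integral_def)
  then show ?thesis by (rule density_unique_real[OF int integrable_zero])
qed

text \<open>Averaging B over a window of length h produces a function whose derivative is a finite
  difference of B. As a factor of a test function it converts a weak z derivative into a finite
  difference of the function itself.\<close>

lemma sliding_average:
  assumes B: "\<And>k. smooth_upto k B" and supp: "\<And>x. x \<notin> {c..d} \<Longrightarrow> B x = 0" and h: "0 \<le> h"
  defines "C \<equiv> \<lambda>z. integral {0..h} (\<lambda>t. B (z - t))"
  shows "\<And>z. (C has_real_derivative B z - B (z - h)) (at z)" "\<And>k. smooth_upto k C" "\<And>x. x \<notin> {c..d+h} \<Longrightarrow> C x = 0"
    and "\<And>z. C z = (\<integral>t. indicator {0..h} t * B (z - t) \<partial>lborel)"
proof -
  obtain B' where B': "\<And>x. (B has_real_derivative B' x) (at x)" "smooth_upto (Suc 0) B'"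
    using B[of "Suc (Suc 0)"] by auto
  obtain B'' where B'': "\<And>x. (B' has_real_derivative B'' x) (at x)" using B'(2) by auto
  have cB: "continuous_on UNIV B" "continuous_on UNIV B'" using B'(1) B'' DERIV_continuous_on by blast+
  have cBt: "continuous_on {0..h} (\<lambda>t. B (z - t))" for z
    by (rule continuous_on_compose2[OF cB(1)]) (auto intro!: continuous_intros)
  show d: "(C has_real_derivative B z - B (z - h)) (at z)" for z
  proof -
    have "((\<lambda>z. integral (cbox 0 h) (\<lambda>t. B (z - t))) has_real_derivative integral (cbox 0 h) (\<lambda>t. B' (z - t))) (at z within UNIV)"
    proof (rule leibniz_rule_field_derivative)
      show "((\<lambda>x. B (x - t)) has_real_derivative B' (x - t)) (at x within UNIV)" for x t
      proof -
        have "((\<lambda>x. x - t) has_real_derivative 1 - 0) (at x within UNIV)" by (intro DERIV_diff DERIV_ident DERIV_const)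
        from DERIV_chain2[OF B'(1) this] show ?thesis by simp
      qed
      show "(\<lambda>t. B (x - t)) integrable_on cbox 0 h" for x
        using cBt by (intro integrable_continuous) auto
      show "continuous_on (UNIV \<times> cbox 0 h) (\<lambda>(x, t). B' (x - t))"
        unfolding case_prod_beta by (rule continuous_on_compose2[OF cB(2)]) (auto intro!: continuous_intros)
    qed auto
    moreover have "((\<lambda>t. B' (z - t)) has_integral - B (z - h) - - B (z - 0)) {0..h}"
    proof (rule fundamental_theorem_of_calculus[OF h])
      fix t
      have "((\<lambda>t. z - t) has_real_derivative 0 - 1) (at t)" by (intro DERIV_diff DERIV_ident DERIV_const)
      from DERIV_minus[OF DERIV_chain2[OF B'(1) this]]
      have "((\<lambda>t. - B (z - t)) has_real_derivative B' (z - t)) (at t)" by simp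
      then show "((\<lambda>t. - B (z - t)) has_vector_derivative B' (z - t)) (at t within {0..h})"
        by (auto simp: has_real_derivative_iff_has_vector_derivative intro: has_vector_derivative_at_within)
    qed
    then have "integral {0..h} (\<lambda>t. B' (z - t)) = B z - B (z - h)" by (simp add: integral_unique)
    ultimately show ?thesis by (simp add: C_def)
  qed
  show "smooth_upto k C" for k
  proof (cases k)
    case (Suc n)
    have "smooth_upto n (\<lambda>z. B z + (-1) * B (-h + 1 * z))"
      by (intro smooth_upto_add smooth_upto_mult smooth_upto_const smooth_upto_affine B)
    then show ?thesis unfolding Suc smooth_upto.simps using d
      by (intro exI[of _ "\<lambda>z. B z - B (z - h)"]) simp
  qed simp
  show "x \<notin> {c..d+h} \<Longrightarrow> C x = 0" for x
  proof -
    assume "x \<notin> {c..d+h}"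
    then have "B (x - t) = 0" if "t \<in> {0..h}" for t using that supp by auto
    then have "C x = integral {0..h} (\<lambda>t. 0)" unfolding C_def by (intro integral_cong) auto
    then show "C x = 0" by simp
  qed
  show "C z = (\<integral>t. indicator {0..h} t * B (z - t) \<partial>lborel)" for z
    using set_borel_integral_eq_integral(2)[OF borel_integrable_atLeastAtMost'[OF cBt[of z]]]
    by (simp add: C_def set_lebesgue_integral_def)
qed

lemma smooth_upto_continuous:
  assumes "smooth_upto (Suc 0) f" shows "continuous_on UNIV f"
proof -
  obtain f' where "\<And>x. (f has_real_derivative f' x) (at x)" using assms by auto
  then show ?thesis by (rule DERIV_continuous_on)
qed

lemma box_real_prod: "box a b = {fst a<..<fst b} \<times> {snd a<..<snd b}" for a b :: "real \<times> real"
  by (cases a; cases b) (auto simp: mem_box Basis_prod_def)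

lemma integrable_bounded_support:
  fixes f :: "'a::euclidean_space \<Rightarrow> real"
  assumes [measurable]: "f \<in> borel_measurable borel" and K: "bounded K"
    and bd: "\<And>x. x \<in> K \<Longrightarrow> \<bar>f x\<bar> \<le> U" and z: "\<And>x. x \<notin> K \<Longrightarrow> f x = 0"
  shows "integrable lborel f"
proof -
  obtain a where a: "K \<subseteq> cbox (-a) a" using bounded_subset_cbox_symmetric[OF K] by blast
  have "integrable lborel (\<lambda>x. indicator (cbox (-a) a) x * \<bar>U\<bar>)"
    by (intro integrable_mult_left integrable_real_indicator) (auto intro!: emeasure_bounded_finite[unfolded infinity_ennreal_def])
  then show ?thesis
  proof (rule Bochner_Integration.integrable_bound, measurable, intro AE_I2)
    fix x show "norm (f x) \<le> norm (indicator (cbox (-a) a) x * \<bar>U\<bar>)"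
      using bd[of x] z[of x] a by (cases "x \<in> K") (auto simp: indicator_def)
  qed
qed

text \<open>The weak identity is tested with a bump in r times a sliding average of a bump in z.
  Translations in z and Fubini turn it into the statement that the error F of the claimed identity
  is orthogonal to all products of bumps. Such products converge to indicators of rectangles, and
  rectangles at positive distance from the axis exhaust the half plane, so F vanishes almost
  everywhere.\<close>

lemma weak_derivative_difference:
  fixes \<Omega> \<eta> :: "real \<times> real \<Rightarrow> real"
  assumes \<Omega>[measurable]: "\<Omega> \<in> borel_measurable borel" and \<eta>[measurable]: "\<eta> \<in> borel_measurable borel"
    and zero: "\<And>q. fst q \<le> 0 \<Longrightarrow> \<Omega> q = 0" "\<And>q. fst q \<le> 0 \<Longrightarrow> \<eta> q = 0"
    and bd: "\<And>R. \<exists>U. \<forall>q. fst q \<le> R \<longrightarrow> \<bar>\<Omega> q\<bar> \<le> U \<and> \<bar>\<eta> q\<bar> \<le> U"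
    and weak: "\<And>\<phi>. test_function \<phi> \<Longrightarrow> (\<integral>q. \<Omega> q * dz \<phi> q \<partial>lborel) = - (\<integral>q. \<eta> q * \<phi> q \<partial>lborel)"
    and h: "0 \<le> h"
  shows "AE q in lborel. \<Omega> (fst q, snd q + h) - \<Omega> q = (LBINT t:{0..h}. \<eta> (fst q, snd q + t))"
proof -
  define I where "I q = (\<integral>t. indicator {0..h} t * \<eta> (fst q, snd q + t) \<partial>lborel)" for q
  define F where "F q = \<Omega> (fst q, snd q + h) - \<Omega> q - I q" for q
  have sm[measurable]: "(\<lambda>q. \<Omega> (fst q, snd q + t)) \<in> borel_measurable borel" "(\<lambda>q. \<eta> (fst q, snd q + t)) \<in> borel_measurable borel" for t
    by (intro measurable_compose[OF _ \<Omega>] measurable_compose[OF _ \<eta>] borel_measurable_continuous_onI continuous_intros)+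
  have jm: "(\<lambda>x. \<eta> (fst (fst x), snd (fst x) + snd x)) \<in> borel_measurable (borel :: triple measure)"
    by (intro measurable_compose[OF _ \<eta>] borel_measurable_continuous_onI continuous_intros)
  have jm1: "(\<lambda>x. \<eta> (fst x)) \<in> borel_measurable (borel :: triple measure)"
    by (intro measurable_compose[OF _ \<eta>] borel_measurable_continuous_onI continuous_intros)
  have indm: "(\<lambda>x. indicator {0..h} (snd x) :: real) \<in> borel_measurable (borel :: triple measure)"
    by (rule measurable_compose[of snd borel borel]) (auto intro!: borel_measurable_continuous_onI continuous_intros)
  have Im[measurable]: "I \<in> borel_measurable borel"
  proof -
    have "(\<lambda>(q,t). indicator {0..h} t * \<eta> (fst q, snd q + t)) \<in> borel_measurable (lborel \<Otimes>\<^sub>M lborel)"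
      using borel_measurable_times[OF indm jm] by (simp add: lborel_prod case_prod_beta')
    from lborel.borel_measurable_lebesgue_integral[OF this] show ?thesis by (simp add: I_def[abs_def])
  qed
  have Fm[measurable]: "F \<in> borel_measurable borel" unfolding F_def by measurable
  have Ibd: "\<bar>I q\<bar> \<le> h * U" if U: "\<And>t. \<bar>\<eta> (fst q, t)\<bar> \<le> U" for q U
  proof -
    have U0: "0 \<le> U" using U[of 0] by linarith
    have i: "integrable lborel (\<lambda>t. indicator {0..h} t * U)"
      by (intro integrable_mult_left integrable_real_indicator) (auto simp: emeasure_lborel_Icc_eq)
    have j: "integrable lborel (\<lambda>t. indicator {0..h} t * \<eta> (fst q, snd q + t))"
    proof (rule Bochner_Integration.integrable_bound[OF i])
      have "(\<lambda>t. \<eta> (fst q, snd q + t)) \<in> borel_measurable borel"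
        by (intro measurable_compose[OF _ \<eta>] borel_measurable_continuous_onI continuous_intros)
      then show "(\<lambda>t. indicator {0..h} t * \<eta> (fst q, snd q + t)) \<in> borel_measurable lborel" by simp
      show "AE t in lborel. norm (indicator {0..h} t * \<eta> (fst q, snd q + t)) \<le> norm (indicator {0..h} t * U)"
        using U U0 by (intro AE_I2) (auto simp: indicator_def)
    qed
    have "norm (I q) \<le> (\<integral>t. norm (indicator {0..h} t * \<eta> (fst q, snd q + t)) \<partial>lborel)"
      unfolding I_def by (rule integral_norm_bound)
    also have "\<dots> \<le> (\<integral>t. indicator {0..h} t * U \<partial>lborel)"
      using U U0 by (intro integral_mono integrable_norm i j) (auto simp: indicator_def)
    also have "\<dots> = h * U" using h by simp
    finally show ?thesis by simp
  qed
  have Fbd: "\<exists>U. \<forall>q. fst q \<le> R \<longrightarrow> \<bar>F q\<bar> \<le> U" for R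
  proof -
    obtain U where U: "\<And>q. fst q \<le> R \<Longrightarrow> \<bar>\<Omega> q\<bar> \<le> U \<and> \<bar>\<eta> q\<bar> \<le> U" using bd by blast
    have "\<bar>F q\<bar> \<le> U + U + h * U" if "fst q \<le> R" for q
      using U[of q] U[of "(fst q, snd q + h)"] Ibd[of q U] U that unfolding F_def by (smt (verit) fst_conv)
    then show ?thesis by blast
  qed
  have bump_test: "(\<integral>q. bump n a b (fst q) * bump n c d (snd q) * F q \<partial>lborel) = 0" if a: "0 < a" for n a b c d
  proof -
    define A where "A = bump n a b"
    define Bf where "Bf = bump n c d"
    define C where "C z = integral {0..h} (\<lambda>t. Bf (z - t))" for z
    have SA: "smooth_upto k A" and SB: "smooth_upto k Bf" for k by (auto simp: A_def Bf_def smooth_upto_bump)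
    have A01: "0 \<le> A x" "A x \<le> 1" and B01: "0 \<le> Bf x" "Bf x \<le> 1" for x by (auto simp: A_def Bf_def bump_props)
    have sA: "A x = 0" if "x \<notin> {a..b}" for x using that bump_props(3)[of x a b n] by (auto simp: A_def)
    have sB: "Bf x = 0" if "x \<notin> {c..d}" for x using that bump_props(3)[of x c d n] by (auto simp: Bf_def)
    have contAB: "continuous_on UNIV A" "continuous_on UNIV Bf"
      using smooth_upto_continuous SA SB by blast+
    have [measurable]: "A \<in> borel_measurable borel" "Bf \<in> borel_measurable borel"
      using contAB by (auto intro: borel_measurable_continuous_onI)
    note sl = sliding_average[OF SB sB h, folded C_def]
    obtain A' where A': "\<And>x. (A has_real_derivative A' x) (at x)" using SA[of "Suc 0"] by auto
    obtain U where U: "\<And>q. fst q \<le> b \<Longrightarrow> \<bar>\<Omega> q\<bar> \<le> U" "\<And>q. fst q \<le> b \<Longrightarrow> \<bar>\<eta> q\<bar> \<le> U" using bd[of b] by blast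
    have bdmul: "\<bar>x * s * t\<bar> \<le> U" if "\<bar>x\<bar> \<le> U" "0 \<le> s" "s \<le> 1" "0 \<le> t" "t \<le> 1" for x s t :: real
    proof -
      have "\<bar>x\<bar> * (s * t) \<le> U * 1" using that by (intro mult_mono) (auto intro: mult_le_one)
      then show ?thesis using that by (simp add: abs_mult mult.assoc)
    qed
    define \<phi> where "\<phi> p = A (fst p) * C (snd p)" for p :: "real \<times> real"
    have tf: "test_function \<phi>"
      unfolding \<phi>_def[abs_def] by (rule test_function_product[OF SA sl(2) a sA sl(3)])
    have "\<Omega> q * dz \<phi> q = \<Omega> q * A (fst q) * Bf (snd q) - \<Omega> q * A (fst q) * Bf (snd q - h)" for q
    proof (cases "0 < fst q")
      case True
      then have "dz \<phi> q = A (fst q) * (Bf (snd q) - Bf (snd q - h))"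
        by (intro product_derivatives(2)[OF A' sl(1)]) (auto simp: \<phi>_def open_half_plane_def)
      then show ?thesis by (simp only: right_diff_distrib mult.assoc)
    qed (simp add: zero(1))
    then have L: "(\<integral>q. \<Omega> q * dz \<phi> q \<partial>lborel) = (\<integral>q. \<Omega> q * A (fst q) * Bf (snd q) - \<Omega> q * A (fst q) * Bf (snd q - h) \<partial>lborel)"
      by simp
    have m1[measurable]: "(\<lambda>q. A (fst q)) \<in> borel_measurable (borel :: (real \<times> real) measure)"
       "(\<lambda>q. Bf (snd q - t)) \<in> borel_measurable (borel :: (real \<times> real) measure)" for t
      by (rule borel_measurable_continuous_onI, rule continuous_on_compose2[OF contAB(1)], auto intro!: continuous_intros)
         (rule borel_measurable_continuous_onI, rule continuous_on_compose2[OF contAB(2)], auto intro!: continuous_intros)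
    have bK: "bounded ({a..b} \<times> {c..d+h})" by (intro bounded_Times) auto
    have shiftint: "integrable lborel (\<lambda>q. \<Omega> q * A (fst q) * Bf (snd q - t))" if t: "t \<in> {0..h}" for t
    proof (rule integrable_bounded_support[OF _ bK, where U=U])
      fix q assume "q \<notin> {a..b} \<times> {c..d + h}"
      then have "fst q \<notin> {a..b} \<or> snd q - t \<notin> {c..d}" using t by (cases q) auto
      then show "\<Omega> q * A (fst q) * Bf (snd q - t) = 0" using sA sB by auto
    qed (use U A01 B01 bdmul in \<open>auto\<close>)
    have i1: "integrable lborel (\<lambda>q. \<Omega> q * A (fst q) * Bf (snd q))" using shiftint[of 0] h by simp
    have sh: "(\<integral>q. \<Omega> q * A (fst q) * Bf (snd q - h) \<partial>lborel) = (\<integral>q. \<Omega> (fst q, snd q + h) * A (fst q) * Bf (snd q) \<partial>lborel)"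
      using integral_lborel_shift(1)[of "\<lambda>q. \<Omega> q * A (fst q) * Bf (snd q - h)" "(0,h)"]
      by (simp add: plus_prod_def add.commute)
    have shi: "integrable lborel (\<lambda>q. \<Omega> (fst q, snd q + h) * A (fst q) * Bf (snd q))"
      using integral_lborel_shift(2)[of "\<lambda>q. \<Omega> q * A (fst q) * Bf (snd q - h)" "(0,h)"] shiftint[of h] h
      by (simp add: plus_prod_def add.commute)
    \<comment> \<open>For fixed t these differ by the translation of q by (0, t). Integrated in t,
      \<open>K1\<close> gives \<eta> times the test function and \<open>K2\<close> gives the product
      of bumps times I; Fubini on both sides connects them.\<close>
    define K1 where "K1 x = indicator {0..h} (snd x) * (\<eta> (fst x) * A (fst (fst x)) * Bf (snd (fst x) - snd x))" for x :: triple
    define K2 where "K2 x = indicator {0..h} (snd x) * (\<eta> (fst (fst x), snd (fst x) + snd x) * A (fst (fst x)) * Bf (snd (fst x)))" for x :: triple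
    have m2: "(\<lambda>x. A (fst (fst x))) \<in> borel_measurable (borel :: triple measure)"
       "(\<lambda>x. Bf (snd (fst x) - snd x)) \<in> borel_measurable (borel :: triple measure)"
       "(\<lambda>x. Bf (snd (fst x))) \<in> borel_measurable (borel :: triple measure)"
      by (rule borel_measurable_continuous_onI, rule continuous_on_compose2[OF contAB(1)], auto intro!: continuous_intros)
         (rule borel_measurable_continuous_onI, rule continuous_on_compose2[OF contAB(2)], auto intro!: continuous_intros)+
    have Km: "K1 \<in> borel_measurable borel" "K2 \<in> borel_measurable borel"
      unfolding K1_def K2_def by (intro borel_measurable_times indm jm jm1 m2)+
    have bK3: "bounded (({a..b} \<times> {c..d+h}) \<times> {0..h})" by (intro bounded_Times) auto
    have Ki: "integrable (lborel \<Otimes>\<^sub>M lborel) K1" "integrable (lborel \<Otimes>\<^sub>M lborel) K2"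
    proof -
      have "integrable lborel K1"
      proof (rule integrable_bounded_support[OF Km(1) bK3, where U=U])
        fix x assume "x \<notin> ({a..b} \<times> {c..d+h}) \<times> {0..h}"
        then have "snd x \<notin> {0..h} \<or> fst (fst x) \<notin> {a..b} \<or> snd (fst x) - snd x \<notin> {c..d}" by (cases x) auto
        then show "K1 x = 0" using sA sB by (auto simp: K1_def)
      next
        fix x assume "x \<in> ({a..b} \<times> {c..d+h}) \<times> {0..h}"
        then show "\<bar>K1 x\<bar> \<le> U" using bdmul[OF U(2)[of "fst x"] A01 B01] by (auto simp: K1_def)
      qed
      moreover have "integrable lborel K2"
      proof (rule integrable_bounded_support[OF Km(2) bK3, where U=U])
        fix x assume "x \<notin> ({a..b} \<times> {c..d+h}) \<times> {0..h}"
        then have "snd x \<notin> {0..h} \<or> fst (fst x) \<notin> {a..b} \<or> snd (fst x) \<notin> {c..d}" using h by (cases x) auto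
        then show "K2 x = 0" using sA sB by (auto simp: K2_def)
      next
        fix x assume "x \<in> ({a..b} \<times> {c..d+h}) \<times> {0..h}"
        then show "\<bar>K2 x\<bar> \<le> U" using bdmul[OF U(2)[of "(fst (fst x), snd (fst x) + snd x)"] A01 B01] by (auto simp: K2_def)
      qed
      ultimately show "integrable (lborel \<Otimes>\<^sub>M lborel) K1" "integrable (lborel \<Otimes>\<^sub>M lborel) K2"
        by (simp_all add: lborel_prod)
    qed
    have "(\<integral>q. \<eta> q * \<phi> q \<partial>lborel) = (\<integral>q. (\<integral>t. K1 (q,t) \<partial>lborel) \<partial>lborel)"
    proof (rule Bochner_Integration.integral_cong[OF refl])
      fix q
      have "(\<integral>t. K1 (q,t) \<partial>lborel) = (\<integral>t. (\<eta> q * A (fst q)) * (indicator {0..h} t * Bf (snd q - t)) \<partial>lborel)"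
        by (simp add: K1_def mult_ac)
      also have "\<dots> = \<eta> q * A (fst q) * C (snd q)" by (subst integral_mult_right_zero) (simp only: sl(4))
      finally show "\<eta> q * \<phi> q = (\<integral>t. K1 (q,t) \<partial>lborel)" by (simp add: \<phi>_def)
    qed
    also have "\<dots> = (\<integral>t. (\<integral>q. K1 (q,t) \<partial>lborel) \<partial>lborel)"
      using lborel_pair.Fubini_integral[of "\<lambda>q t. K1 (q,t)"] Ki(1) by simp
    also have "\<dots> = (\<integral>t. (\<integral>q. K2 (q,t) \<partial>lborel) \<partial>lborel)"
    proof (rule Bochner_Integration.integral_cong[OF refl])
      fix t
      have [measurable]: "(\<lambda>q. K1 (q,t)) \<in> borel_measurable borel" unfolding K1_def by simp
      show "(\<integral>q. K1 (q,t) \<partial>lborel) = (\<integral>q. K2 (q,t) \<partial>lborel)"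
        by (subst integral_lborel_shift(1)[of "\<lambda>q. K1 (q,t)" "(0,t)", symmetric])
          (simp_all add: K1_def K2_def plus_prod_def add.commute)
    qed
    also have "\<dots> = (\<integral>q. (\<integral>t. K2 (q,t) \<partial>lborel) \<partial>lborel)"
      using lborel_pair.Fubini_integral[of "\<lambda>q t. K2 (q,t)"] Ki(2) by simp
    also have K2I: "(\<lambda>q. \<integral>t. K2 (q,t) \<partial>lborel) = (\<lambda>q. A (fst q) * Bf (snd q) * I q)"
    proof
      fix q
      have "(\<integral>t. K2 (q,t) \<partial>lborel) = (\<integral>t. (A (fst q) * Bf (snd q)) * (indicator {0..h} t * \<eta> (fst q, snd q + t)) \<partial>lborel)"
        by (simp add: K2_def mult_ac)
      also have "\<dots> = A (fst q) * Bf (snd q) * I q" unfolding I_def by (rule integral_mult_right_zero)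
      finally show "(\<integral>t. K2 (q,t) \<partial>lborel) = A (fst q) * Bf (snd q) * I q" .
    qed
    finally have R: "(\<integral>q. \<eta> q * \<phi> q \<partial>lborel) = (\<integral>q. A (fst q) * Bf (snd q) * I q \<partial>lborel)" .
    have Ii: "integrable lborel (\<lambda>q. A (fst q) * Bf (snd q) * I q)"
      using lborel_pair.integrable_fst'[OF Ki(2)] by (simp add: K2I)
    have "(\<integral>q. A (fst q) * Bf (snd q) * F q \<partial>lborel)
      = (\<integral>q. \<Omega> (fst q, snd q + h) * A (fst q) * Bf (snd q) - \<Omega> q * A (fst q) * Bf (snd q) - A (fst q) * Bf (snd q) * I q \<partial>lborel)"
      by (intro Bochner_Integration.integral_cong) (auto simp: F_def algebra_simps)
    also have "\<dots> = (\<integral>q. \<Omega> (fst q, snd q + h) * A (fst q) * Bf (snd q) \<partial>lborel)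
        - (\<integral>q. \<Omega> q * A (fst q) * Bf (snd q) \<partial>lborel) - (\<integral>q. A (fst q) * Bf (snd q) * I q \<partial>lborel)"
      using shi i1 Ii by simp
    also have "\<dots> = - (\<integral>q. \<Omega> q * dz \<phi> q \<partial>lborel) - (\<integral>q. \<eta> q * \<phi> q \<partial>lborel)"
      unfolding L R using i1 shiftint[of h] h by (simp add: sh)
    also have "\<dots> = 0" using weak[OF tf] by simp
    finally show ?thesis by (simp add: A_def Bf_def)
  qed
  \<comment> \<open>The bumps on a rectangle converge to its indicator and are dominated by it, and
    F is bounded there; so the vanishing passes to the limit.\<close>
  have rect: "(\<integral>q. indicator ({a<..<b} \<times> {c<..<d}) q * F q \<partial>lborel) = 0" if a: "0 < a" for a b c d
  proof -
    obtain U where U: "\<And>q. fst q \<le> b \<Longrightarrow> \<bar>F q\<bar> \<le> U" using Fbd by blast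
    have bK: "bounded ({a<..<b} \<times> {c<..<d})" by (intro bounded_Times) auto
    have o: "open ({a<..<b} \<times> {c<..<d})" by (intro open_Times) auto
    have wi: "integrable lborel (\<lambda>q. indicator ({a<..<b} \<times> {c<..<d}) q * \<bar>F q\<bar>)"
    proof (rule integrable_bounded_support[OF _ bK, where U=U])
      show "(\<lambda>q. indicator ({a<..<b} \<times> {c<..<d}) q * \<bar>F q\<bar>) \<in> borel_measurable borel"
        by (intro borel_measurable_times borel_measurable_indicator borel_measurable_abs) (use o Fm in \<open>auto intro: borel_open\<close>)
    qed (use U in \<open>auto split: split_indicator\<close>)
    have "(\<lambda>n. \<integral>q. bump n a b (fst q) * bump n c d (snd q) * F q \<partial>lborel) \<longlonglongrightarrow> (\<integral>q. indicator ({a<..<b} \<times> {c<..<d}) q * F q \<partial>lborel)"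
    proof (rule integral_dominated_convergence[OF _ _ wi])
      show "(\<lambda>q. indicator ({a<..<b} \<times> {c<..<d}) q * F q) \<in> borel_measurable lborel" by (intro borel_measurable_times borel_measurable_indicator borel_measurable_abs) (use o Fm in \<open>auto intro: borel_open\<close>)
      show "(\<lambda>q. bump n a b (fst q) * bump n c d (snd q) * F q) \<in> borel_measurable lborel" for n
      proof -
        have cb: "continuous_on UNIV (bump n a b)" for n a b by (rule smooth_upto_continuous[OF smooth_upto_bump])
        have "continuous_on UNIV (\<lambda>q::real \<times> real. bump n a b (fst q))" "continuous_on UNIV (\<lambda>q::real \<times> real. bump n c d (snd q))"
          by (rule continuous_on_compose2[OF cb], auto intro!: continuous_intros)+
        then have "(\<lambda>q::real \<times> real. bump n a b (fst q)) \<in> borel_measurable borel" "(\<lambda>q::real \<times> real. bump n c d (snd q)) \<in> borel_measurable borel"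
          by (auto intro: borel_measurable_continuous_onI)
        then show ?thesis by measurable
      qed
      show "AE q in lborel. (\<lambda>n. bump n a b (fst q) * bump n c d (snd q) * F q) \<longlonglongrightarrow> indicator ({a<..<b} \<times> {c<..<d}) q * F q"
      proof (rule AE_I2)
        fix q
        have "(\<lambda>n. bump n a b (fst q) * bump n c d (snd q) * F q) \<longlonglongrightarrow> indicator {a<..<b} (fst q) * indicator {c<..<d} (snd q) * F q"
          by (intro tendsto_intros bump_props(4))
        moreover have "indicator ({a<..<b} \<times> {c<..<d}) q = (indicator {a<..<b} (fst q) * indicator {c<..<d} (snd q) :: real)"
          by (cases q) (auto split: split_indicator)
        ultimately show "(\<lambda>n. bump n a b (fst q) * bump n c d (snd q) * F q) \<longlonglongrightarrow> indicator ({a<..<b} \<times> {c<..<d}) q * F q" by simp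
      qed
      show "AE q in lborel. norm (bump n a b (fst q) * bump n c d (snd q) * F q) \<le> indicator ({a<..<b} \<times> {c<..<d}) q * \<bar>F q\<bar>" for n
      proof (rule AE_I2)
        fix q :: "real \<times> real"
        show "norm (bump n a b (fst q) * bump n c d (snd q) * F q) \<le> indicator ({a<..<b} \<times> {c<..<d}) q * \<bar>F q\<bar>"
        proof (cases "fst q \<in> {a<..<b} \<and> snd q \<in> {c<..<d}")
          case True
          have "bump n a b (fst q) * bump n c d (snd q) \<le> 1" by (intro mult_le_one bump_props)
          then have "bump n a b (fst q) * bump n c d (snd q) * \<bar>F q\<bar> \<le> 1 * \<bar>F q\<bar>" by (rule mult_right_mono) simp
          then show ?thesis using True by (cases q) (simp add: abs_mult bump_props)
        next
          case False
          then have eq: "bump n a b (fst q) * bump n c d (snd q) = 0" using bump_props(3)[of "fst q" a b n] bump_props(3)[of "snd q" c d n] by auto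
          show ?thesis unfolding eq by simp
        qed
      qed
    qed
    then show ?thesis by (simp only: bump_test[OF a]) (simp add: LIMSEQ_const_iff)
  qed
  \<comment> \<open>The left edge 1/(N+1) keeps the rectangle away from the axis, since test
    functions have compact support in the open half plane; countably many rectangles
    suffice.\<close>
  have "AE q in lborel. indicator ({1 / real (Suc N)<..<real (Suc N)} \<times> {- real (Suc N)<..<real (Suc N)}) q * F q = 0" for N
  proof (rule AE_zero_of_boxes)
    let ?S = "{1 / real (Suc N)<..<real (Suc N)} \<times> {- real (Suc N)<..<real (Suc N)}"
    obtain U where U: "\<And>q. fst q \<le> real (Suc N) \<Longrightarrow> \<bar>F q\<bar> \<le> U" using Fbd by blast
    have bK: "bounded ?S" by (intro bounded_Times) auto
    have o: "open ?S" by (intro open_Times) auto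
    show "integrable lborel (\<lambda>q. indicator ?S q * F q)"
    proof (rule integrable_bounded_support[OF _ bK, where U=U])
      show "(\<lambda>q. indicator ?S q * F q) \<in> borel_measurable borel" by (intro borel_measurable_times borel_measurable_indicator borel_measurable_abs) (use o Fm in \<open>auto intro: borel_open\<close>)
    qed (use U in \<open>auto split: split_indicator\<close>)
    fix a b :: "real \<times> real"
    have "(\<lambda>q. indicator (box a b) q * (indicator ?S q * F q)) =
      (\<lambda>q. indicator ({max (fst a) (1 / real (Suc N))<..<min (fst b) (real (Suc N))} \<times> {max (snd a) (- real (Suc N))<..<min (snd b) (real (Suc N))}) q * F q)"
      unfolding box_real_prod by (auto simp: fun_eq_iff indicator_def)
    then show "(\<integral>q. indicator (box a b) q * (indicator ?S q * F q) \<partial>lborel) = 0"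
      by (simp only:) (rule rect, simp add: less_max_iff_disj)
  qed
  then have "AE q in lborel. \<forall>N. indicator ({1 / real (Suc N)<..<real (Suc N)} \<times> {- real (Suc N)<..<real (Suc N)}) q * F q = 0"
    by (simp only: AE_all_countable) simp
  then show ?thesis
  proof eventually_elim
    case (elim q)
    have "F q = 0"
    proof (cases "0 < fst q")
      case False
      then show ?thesis using zero by (simp add: F_def I_def)
    next
      case True
      obtain N :: nat where N: "1 / fst q + \<bar>fst q\<bar> + \<bar>snd q\<bar> < real N" using reals_Archimedean2 by blast
      have p: "0 < 1 / fst q" using True by simp
      have "1 / fst q < real (Suc N)" "fst q < real (Suc N)" "\<bar>snd q\<bar> < real (Suc N)"
        using N p of_nat_Suc[of N, where 'a=real] by linarith+
      then have "q \<in> {1 / real (Suc N)<..<real (Suc N)} \<times> {- real (Suc N)<..<real (Suc N)}"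
        using True by (cases q) (auto simp: field_simps abs_less_iff)
      then show ?thesis using elim[rule_format, of N] by simp
    qed
    then show ?case by (simp add: F_def I_def set_lebesgue_integral_def)
  qed
qed

section \<open>Weighted norms\<close>

text \<open>kappa < 1 amounts to 2^(4/3) < 8/3, that is 16 < 512/27 after cubing.\<close>

lemma kappa_bounds: "0 < kappa" "kappa < 1" "0 < kappa1" "kappa1 < 1/1000"
proof -
  have "((2::real) powr (4/3)) powr 3 = 2 powr 4" by (simp add: powr_powr)
  then have p: "((2::real) powr (4/3)) ^ 3 = 16" by simp
  have "(2::real) powr (4/3) < 8/3"
  proof (rule power_less_imp_less_base)
    show "((2::real) powr (4/3)) ^ 3 < (8/3) ^ 3" unfolding p by (simp add: power3_eq_cube)
  qed simp
  moreover have "0 < (2::real) powr (4/3)" by simp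
  moreover have "0 < 1/4 * (t - 2/3 + 2) \<and> 1/4 * (t - 2/3 + 2) < 1" if "t < 8/3" "0 < t" for t :: real
    using that by auto
  ultimately have k: "0 < kappa \<and> kappa < 1" unfolding kappa_def by blast
  then show "0 < kappa" "kappa < 1" by auto
  from k show "0 < kappa1" "kappa1 < 1/1000" unfolding kappa1_def by auto
qed

text \<open>When f is not integrable its Bochner integral is 0 by convention, so the bound holds
  without a separate proof of measurability.\<close>

lemma abs_integral_le_of_nn:
  fixes f :: "'a \<Rightarrow> real"
  assumes "(\<integral>\<^sup>+x. ennreal \<bar>f x\<bar> \<partial>M) \<le> ennreal C" "0 \<le> C"
  shows "\<bar>\<integral>x. f x \<partial>M\<bar> \<le> C"
proof (cases "integrable M f")
  case True
  have "ennreal \<bar>\<integral>x. f x \<partial>M\<bar> \<le> ennreal C"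
    using integral_norm_bound_ennreal[OF True] assms(1) by (auto intro: order_trans)
  then show ?thesis using assms(2) by (simp add: ennreal_le_iff)
qed (simp add: not_integrable_integral_eq assms)

text \<open>The integrand is at most a multiple of y^\<alpha> near 0 and of y^(-1-\<epsilon>) at
  infinity, because \<alpha> - 1 - 1/3 = -1 - \<epsilon>. So J is of order 1/\<epsilon>, and
  removing the corresponding weight from a norm costs a factor of order \<epsilon>^(-kappa).\<close>

lemma Jfun_bound:
  assumes W: "\<And>y. 0 \<le> y \<Longrightarrow> \<bar>W13 y\<bar> \<le> C13 * min y (jap y powr (-1/3))" and C: "0 \<le> C13"
    and e: "0 < \<epsilon>" "\<alpha> = 1/3 - \<epsilon>" "0 \<le> \<alpha>" and b: "b \<le> 0"
  shows "\<bar>Jfun \<alpha> b W13 x\<bar> \<le> C13 * (1 + 1/\<epsilon>)"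
proof -
  define g where "g y = C13 * (indicator {0..1} y * y powr \<alpha>) + C13 * (indicator {1..} y * y powr (-1-\<epsilon>))" for y :: real
  have pt: "\<bar>indicator {0..x} y * (y powr (\<alpha> - 1) * jap y powr b * W13 y)\<bar> \<le> g y" for y
  proof (cases "0 < y")
    case True
    have jb: "jap y powr b \<le> 1" using powr_mono[OF b jap_ge(1)[of y]] jap_pos[of y] by simp
    have "\<bar>indicator {0..x} y * (y powr (\<alpha> - 1) * jap y powr b * W13 y)\<bar> \<le> y powr (\<alpha> - 1) * jap y powr b * \<bar>W13 y\<bar>"
      by (auto simp: abs_mult split: split_indicator)
    also have "\<dots> \<le> y powr (\<alpha> - 1) * 1 * (C13 * min y (jap y powr (-1/3)))"
      using True jb W[of y] by (intro mult_mono) auto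
    also have "\<dots> \<le> g y"
    proof (cases "y \<le> 1")
      case y1: True
      have "y powr (\<alpha> - 1) * 1 * (C13 * min y (jap y powr (-1/3))) \<le> y powr (\<alpha> - 1) * 1 * (C13 * y)"
        using C by (intro mult_left_mono) auto
      also have "\<dots> = C13 * y powr \<alpha>" using True powr_mult_base[of y "\<alpha> - 1"] by (simp add: mult_ac)
      also have "\<dots> \<le> g y" using True y1 C by (simp add: g_def)
      finally show ?thesis .
    next
      case False
      have "jap y powr (-1/3) \<le> y powr (-1/3)" using True jap_ge(2)[of y] by (intro powr_mono2') auto
      then have "y powr (\<alpha> - 1) * 1 * (C13 * min y (jap y powr (-1/3))) \<le> y powr (\<alpha> - 1) * 1 * (C13 * y powr (-1/3))"
        using C by (intro mult_left_mono) auto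
      also have "\<dots> = C13 * (y powr (\<alpha> - 1) * y powr (-1/3))" by simp
      also have "y powr (\<alpha> - 1) * y powr (-1/3) = y powr (-1-\<epsilon>)" unfolding powr_add[symmetric] e(2) by simp
      also have "C13 * \<dots> \<le> g y" using False C by (simp add: g_def)
      finally show ?thesis .
    qed
    finally show ?thesis .
  next
    case False
    have g0: "0 \<le> g y" using C by (simp add: g_def)
    have eq: "indicator {0..x} y * (y powr (\<alpha> - 1) * jap y powr b * W13 y) = 0"
      using False by (auto split: split_indicator)
    show ?thesis unfolding eq using g0 by simp
  qed
  have "(\<integral>\<^sup>+y. ennreal \<bar>indicator {0..x} y * (y powr (\<alpha> - 1) * jap y powr b * W13 y)\<bar> \<partial>lborel)
    \<le> (\<integral>\<^sup>+y. ennreal C13 * ennreal (indicator {0..1} y * y powr \<alpha>) + ennreal C13 * ennreal (indicator {1..} y * y powr (-1-\<epsilon>)) \<partial>lborel)"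
  proof (rule nn_integral_mono)
    fix y :: real
    have "ennreal \<bar>indicator {0..x} y * (y powr (\<alpha> - 1) * jap y powr b * W13 y)\<bar> \<le> ennreal (g y)" by (rule ennreal_leI[OF pt])
    also have "\<dots> = ennreal C13 * ennreal (indicator {0..1} y * y powr \<alpha>) + ennreal C13 * ennreal (indicator {1..} y * y powr (-1-\<epsilon>))"
      unfolding g_def using C by (subst ennreal_plus) (auto simp: ennreal_mult)
    finally show "ennreal \<bar>indicator {0..x} y * (y powr (\<alpha> - 1) * jap y powr b * W13 y)\<bar> \<le> \<dots>" .
  qed
  also have "\<dots> = ennreal C13 * (\<integral>\<^sup>+y. ennreal (indicator {0..1} y * y powr \<alpha>) \<partial>lborel) + ennreal C13 * (\<integral>\<^sup>+y. ennreal (indicator {1..} y * y powr (-1-\<epsilon>)) \<partial>lborel)"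
    by (subst nn_integral_add) (auto simp: nn_integral_cmult)
  also have "\<dots> = ennreal C13 * ennreal (1 / (\<alpha> + 1)) + ennreal C13 * ennreal (1 / \<epsilon>)"
    using nn_integral_powr_near_0[of \<alpha> 1] nn_integral_powr_at_infinity[of \<epsilon> 1] e by simp
  also have "\<dots> = ennreal (C13 * (1 / (\<alpha> + 1)) + C13 * (1 / \<epsilon>))"
  proof -
    have "ennreal C13 * ennreal u + ennreal C13 * ennreal v = ennreal (C13 * u + C13 * v)" if "0 \<le> u" "0 \<le> v" for u v
      using C that by (simp add: ennreal_mult)
    from this[of "1 / (\<alpha> + 1)" "1 / \<epsilon>"] show ?thesis using e by simp
  qed
  also have "\<dots> \<le> ennreal (C13 * (1 + 1/\<epsilon>))"
  proof (rule ennreal_leI)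
    have "C13 * (1 / (\<alpha> + 1)) \<le> C13 * 1" using C e by (intro mult_left_mono) auto
    then show "C13 * (1 / (\<alpha> + 1)) + C13 * (1 / \<epsilon>) \<le> C13 * (1 + 1/\<epsilon>)" by (simp add: algebra_simps)
  qed
  finally have "\<bar>\<integral>y. indicator {0..x} y * (y powr (\<alpha> - 1) * jap y powr b * W13 y) \<partial>lborel\<bar> \<le> C13 * (1 + 1/\<epsilon>)"
    by (rule abs_integral_le_of_nn) (use C e in auto)
  then show ?thesis by (simp add: Jfun_def set_lebesgue_integral_def)
qed

lemma powr_add_le:
  fixes r j \<mu> :: real
  assumes "0 \<le> r" "0 < j" "0 \<le> \<mu>" "\<mu> \<le> 1"
  shows "(r + j) powr \<mu> \<le> 2 * (r powr \<mu> + j powr \<mu>)"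
proof -
  define m where "m = max r j"
  have m: "0 < m" "r + j \<le> 2 * m" using assms by (auto simp: m_def)
  have "(r + j) powr \<mu> \<le> (2 * m) powr \<mu>" using assms m by (intro powr_mono2) auto
  also have "\<dots> = 2 powr \<mu> * m powr \<mu>" using m by (simp add: powr_mult)
  also have "\<dots> \<le> 2 * m powr \<mu>" using powr_mono[of \<mu> 1 "2::real"] assms by (intro mult_right_mono) auto
  also have "m powr \<mu> \<le> r powr \<mu> + j powr \<mu>" by (auto simp: m_def max_def)
  finally show ?thesis by simp
qed

text \<open>Unwinds the weights into the form of \<open>dens_bound\<close>. With j =
  \<open>jap z\<close> and s = r + j, which dominates \<open>jap (norm (r,z))\<close>, the first
  weight is at least \<open>s powr (- E) * CJ powr (- kappa)\<close> and the anisotropic one is the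
  power kappa_ag of j/s. Together they allow growth \<open>s powr (kappa_ag + E)\<close>, which is
  finally split between r and j. The number m stands for a further weight that is at least
  1.\<close>

lemma weighted_bound:
  assumes J: "jap (Jfun \<alpha> b W13 (norm (r,z))) \<le> CJ" and CJ: "0 < CJ" and r: "0 < r"
    and e2: "0 \<le> eps2 cW (1/3 - \<alpha>)" "kappa_ag + eps2 cW (1/3 - \<alpha>) \<le> 1"
    and m: "1 \<le> m"
    and x: "\<bar>Gamma_w \<alpha> b cW W13 (r,z) * Gamma_ag (r,z) * m * jap z powr e * x\<bar> \<le> \<delta>"
  shows "\<bar>x\<bar> \<le> 2 * \<delta> * CJ powr kappa * (r powr (kappa_ag + eps2 cW (1/3 - \<alpha>)) * jap z powr (- kappa_ag - e)
     + jap z powr (eps2 cW (1/3 - \<alpha>) - e))"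
proof -
  define E where "E = eps2 cW (1/3 - \<alpha>)"
  define j where "j = jap z"
  define s where "s = r + j"
  have j: "0 < j" "1 \<le> j" using jap_ge jap_pos by (auto simp: j_def)
  have s: "0 < s" using r j by (simp add: s_def)
  have ka: "0 \<le> kappa_ag" by (simp add: kappa_ag_def)
  have js: "jap (norm (r,z)) \<le> s"
  proof -
    have "1 + (norm (r,z))\<^sup>2 \<le> s\<^sup>2"
      using r j by (simp add: norm_Pair s_def j_def jap_def power2_sum)
    then show ?thesis unfolding jap_def by (intro real_le_lsqrt) (use s in auto)
  qed
  have G1: "s powr (- E) * CJ powr (- kappa) \<le> Gamma_w \<alpha> b cW W13 (r,z)"
  proof -
    have "1 * s powr (-E) * CJ powr (-kappa) \<le> (norm (r,z) powr (- kappa_O + 1) + 1) * jap (norm (r,z)) powr (-E) * jap (Jfun \<alpha> b W13 (norm (r,z))) powr (-kappa)"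
      using J CJ js s e2 kappa_bounds(1) jap_pos by (intro mult_mono powr_mono2') (auto simp: E_def)
    then show ?thesis by (simp add: Gamma_w_def E_def)
  qed
  have G2: "Gamma_ag (r,z) = j powr kappa_ag * s powr (- kappa_ag)"
    using j s unfolding Gamma_ag_def j_def s_def by (simp add: powr_divide powr_minus_divide)
  define P where "P = s powr (- E) * CJ powr (- kappa) * (j powr kappa_ag * s powr (- kappa_ag)) * 1 * j powr e"
  have Pe: "P = CJ powr (- kappa) * s powr (-(kappa_ag + E)) * j powr (kappa_ag + e)"
    by (simp add: P_def powr_add powr_diff powr_minus divide_inverse mult_ac)
  have Ppos: "0 < P" unfolding Pe using CJ s j by simp
  have G0: "0 \<le> Gamma_w \<alpha> b cW W13 (r,z)" using G1 order_trans[of 0 "s powr (- E) * CJ powr (- kappa)"] by simp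
  have "P * \<bar>x\<bar> \<le> Gamma_w \<alpha> b cW W13 (r,z) * Gamma_ag (r,z) * m * jap z powr e * \<bar>x\<bar>"
    unfolding P_def G2 using G1 G0 m by (intro mult_mono mult_right_mono) (auto simp: j_def)
  also have "\<dots> = \<bar>Gamma_w \<alpha> b cW W13 (r,z) * Gamma_ag (r,z) * m * jap z powr e * x\<bar>"
    using G0 m by (simp add: abs_mult G2)
  finally have "P * \<bar>x\<bar> \<le> \<delta>" using x by simp
  then have "\<bar>x\<bar> \<le> \<delta> / P" using Ppos by (simp add: pos_le_divide_eq mult.commute)
  also have "\<delta> / P = \<delta> * CJ powr kappa * (s powr (kappa_ag + E) * j powr (- kappa_ag - e))"
    unfolding Pe using CJ s j by (simp add: powr_minus powr_diff powr_add field_simps)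
  also have "\<dots> \<le> \<delta> * CJ powr kappa * (2 * (r powr (kappa_ag + E) + j powr (kappa_ag + E)) * j powr (- kappa_ag - e))"
  proof -
    have "0 \<le> \<delta>" using x by linarith
    moreover have "s powr (kappa_ag + E) \<le> 2 * (r powr (kappa_ag + E) + j powr (kappa_ag + E))"
      unfolding s_def using r j e2 ka by (intro powr_add_le) (auto simp: E_def)
    ultimately show ?thesis by (intro mult_left_mono mult_right_mono) auto
  qed
  also have "\<dots> = 2 * \<delta> * CJ powr kappa * (r powr (kappa_ag + E) * j powr (- kappa_ag - e) + (j powr (kappa_ag + E) * j powr (- kappa_ag - e)))"
    by (simp add: algebra_simps)
  also have "j powr (kappa_ag + E) * j powr (- kappa_ag - e) = j powr (E - e)"
    unfolding powr_add[symmetric] by simp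
  finally show ?thesis by (simp add: E_def j_def)
qed

section \<open>Essential bounds and Borel representatives\<close>

lemma half_plane_measure: "\<not> (AE p in lborel. \<not> (0 \<le> fst (p :: real \<times> real)))"
proof
  assume "AE p in lborel. \<not> (0 \<le> fst (p :: real \<times> real))"
  then have "AE p in lborel. p \<notin> box (0::real,0::real) (1,1)"
    by eventually_elim (auto simp: box_real_prod)
  then have "emeasure lborel (box (0::real,0::real) (1,1)) = 0"
    by (subst (asm) AE_iff_null_sets[symmetric]) (auto simp: null_sets_def)
  then show False by (simp add: emeasure_lborel_box_eq Basis_prod_def)
qed

lemma Linf_normD: "AE p in lborel. 0 \<le> fst p \<longrightarrow> ereal \<bar>f p\<bar> \<le> Linf_norm f"
proof -
  have "closed half_plane" unfolding half_plane_def by (intro closed_Collect_le continuous_intros)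
  then have h: "half_plane \<in> sets lebesgue" by (auto intro: sets_completionI_sets borel_closed)
  have "AE p in lebesgue_on half_plane. ereal \<bar>f p\<bar> \<le> Linf_norm f"
    unfolding Linf_norm_def by (rule esssup_AE)
  then have "AE p in lebesgue. p \<in> half_plane \<longrightarrow> ereal \<bar>f p\<bar> \<le> Linf_norm f"
    using h by (subst (asm) AE_restrict_space_iff) auto
  then show ?thesis by (simp add: AE_completion_iff half_plane_def)
qed

text \<open>On a null set an essential supremum could be minus infinity; here the half plane has
  positive measure. Nonnegativity is what allows a single norm to be bounded by the sum of the three
  in the extended reals.\<close>

lemma Linf_norm_nonneg: "0 \<le> Linf_norm f"
proof (rule ccontr)
  assume "\<not> 0 \<le> Linf_norm f"
  have "AE p in lborel. \<not> (0 \<le> fst (p :: real \<times> real))"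
    using Linf_normD[of f]
  proof eventually_elim
    case (elim p)
    have "0 \<le> ereal \<bar>f p\<bar>" by simp
    then show ?case using elim \<open>\<not> 0 \<le> Linf_norm f\<close> order_trans by blast
  qed
  then show False using half_plane_measure by blast
qed

lemma Linf_norm_le_AE:
  assumes "Linf_norm f \<le> ereal \<delta>"
  shows "AE p in lborel. 0 < fst p \<longrightarrow> \<bar>f p\<bar> \<le> \<delta>"
  using Linf_normD[of f]
proof eventually_elim
  case (elim p)
  then show ?case using assms by (auto dest: order_trans)
qed

text \<open>The compact rectangles \<open>K n\<close> exhaust the open half plane from inside, so
  the extension by zero is a pointwise limit of integrable functions.\<close>

lemma loc_integrable_measurable:
  assumes "loc_integrable u"
  shows "(\<lambda>q. indicator open_half_plane q * u q) \<in> borel_measurable lebesgue"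
proof -
  define K where "K n = {1 / real (Suc n)..real (Suc n)} \<times> {- real (Suc n)..real (Suc n)}" for n
  have K: "compact (K n)" "K n \<subseteq> open_half_plane" for n
  proof -
    show "compact (K n)" unfolding K_def by (intro compact_Times) auto
    have p: "0 < 1 / real (Suc n)" by simp
    show "K n \<subseteq> open_half_plane"
    proof
      fix q assume "q \<in> K n"
      then have "1 / real (Suc n) \<le> fst q" by (auto simp: K_def)
      then show "q \<in> open_half_plane" using less_le_trans[OF p] by (simp add: open_half_plane_def)
    qed
  qed
  have m: "(\<lambda>q. indicator (K n) q * u q) \<in> borel_measurable lebesgue" for n
  proof -
    have "integrable lebesgue (\<lambda>q. indicator (K n) q *\<^sub>R u q)"
      using assms K[of n] unfolding loc_integrable_def set_integrable_def by blast
    from borel_measurable_integrable[OF this] show ?thesis by simp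
  qed
  show ?thesis
  proof (rule borel_measurable_LIMSEQ_real[OF _ m])
    fix q :: "real \<times> real"
    show "(\<lambda>n. indicator (K n) q * u q) \<longlonglongrightarrow> indicator open_half_plane q * u q"
    proof (cases "q \<in> open_half_plane")
      case True
      then have q: "0 < fst q" by (simp add: open_half_plane_def)
      obtain N :: nat where N: "1 / fst q + \<bar>fst q\<bar> + \<bar>snd q\<bar> < real N" using reals_Archimedean2 by blast
      have "q \<in> K n" if "N \<le> n" for n
      proof -
        have p: "0 < 1 / fst q" using q by simp
        have n: "real N \<le> real n" using that by simp
        have "1 / fst q \<le> real (Suc n)" "fst q \<le> real (Suc n)" "\<bar>snd q\<bar> \<le> real (Suc n)"
          using N p n of_nat_Suc[of n, where 'a=real] by linarith+
        then show ?thesis using q by (cases q) (auto simp: K_def field_simps abs_le_iff)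
      qed
      then have "\<forall>\<^sub>F n in sequentially. indicator (K n) q * u q = indicator open_half_plane q * u q"
        using True by (intro eventually_mono[OF eventually_ge_at_top[of N]]) simp
      then show ?thesis by (rule tendsto_eventually)
    next
      case False
      then have "q \<notin> K n" for n using K by blast
      then show ?thesis using False by simp
    qed
  qed
qed

lemma loc_integrable_borel_version:
  assumes "loc_integrable u"
  obtains u' where "u' \<in> borel_measurable borel" "AE q in lborel. 0 < fst q \<longrightarrow> u' q = u q"
proof -
  obtain u' where "u' \<in> borel_measurable lborel" "AE q in lborel. indicator open_half_plane q * u q = u' q"
    using completion_ex_borel_measurable_real[OF loc_integrable_measurable[OF assms]] by blast
  moreover from this(2) have "AE q in lborel. 0 < fst q \<longrightarrow> u' q = u q"
    by eventually_elim (auto simp: open_half_plane_def)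
  ultimately show ?thesis using that by auto
qed

text \<open>Reflection in z preserves Lebesgue measure. This lets a Borel representative of an odd
  function be antisymmetrised without leaving its class modulo null sets.\<close>

lemma AE_reflect:
  assumes "AE q in (lborel :: (real \<times> real) measure). P q"
  shows "AE q in lborel. P (fst q, - snd q)"
proof -
  define \<sigma> :: "real \<times> real \<Rightarrow> real \<times> real" where "\<sigma> q = (fst q, - snd q)" for q
  have [measurable]: "\<sigma> \<in> borel_measurable borel" unfolding \<sigma>_def
    by (intro borel_measurable_continuous_onI continuous_intros)
  have two: "(\<integral>\<^sup>+q. G q \<partial>lborel) = (\<integral>\<^sup>+\<rho>. \<integral>\<^sup>+w. G (\<rho>,w) \<partial>lborel \<partial>lborel)"
    if "G \<in> borel_measurable borel" for G :: "real \<times> real \<Rightarrow> ennreal"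
    using that lborel.nn_integral_fst[of G "lborel :: real measure"] by (simp add: lborel_prod)
  have d: "distr lborel borel \<sigma> = lborel"
  proof (rule measure_eqI)
    fix A assume "A \<in> sets (distr lborel borel \<sigma>)"
    then have A[measurable]: "A \<in> sets borel" by simp
    have [measurable]: "(\<lambda>q. indicator A (\<sigma> q) :: ennreal) \<in> borel_measurable borel" by measurable
    have "emeasure (distr lborel borel \<sigma>) A = (\<integral>\<^sup>+y. indicator A (\<sigma> y) \<partial>lborel)"
      by (subst nn_integral_indicator[symmetric], simp, subst nn_integral_distr) auto
    also have "\<dots> = (\<integral>\<^sup>+\<rho>. \<integral>\<^sup>+w. indicator A (\<rho>,-w) \<partial>lborel \<partial>lborel)"
      by (subst two, measurable) (simp add: \<sigma>_def)
    also have "\<dots> = (\<integral>\<^sup>+\<rho>. \<integral>\<^sup>+w. indicator A (\<rho>,w) \<partial>lborel \<partial>lborel)"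
    proof (rule nn_integral_cong)
      fix \<rho> :: real
      have "(\<lambda>w. indicator A (\<rho>,w) :: ennreal) \<in> borel_measurable borel"
        by (rule measurable_compose[of "\<lambda>w. (\<rho>,w)" borel borel]) (auto intro!: borel_measurable_continuous_onI continuous_intros)
      from nn_integral_real_affine[OF this, of "-1" 0]
      show "(\<integral>\<^sup>+w. indicator A (\<rho>,-w) \<partial>lborel) = (\<integral>\<^sup>+w. indicator A (\<rho>,w) \<partial>lborel)" by simp
    qed
    also have "\<dots> = (\<integral>\<^sup>+y. indicator A y \<partial>lborel)" by (subst two) auto
    finally show "emeasure (distr lborel borel \<sigma>) A = emeasure lborel A" by simp
  qed simp
  obtain N where N: "{q. \<not> P q} \<subseteq> N" "N \<in> sets borel" "emeasure lborel N = 0"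
    using assms by (elim AE_E) auto
  have "emeasure lborel (\<sigma> -` N) = emeasure (distr lborel borel \<sigma>) N"
    using N by (subst emeasure_distr) auto
  then have "emeasure lborel (\<sigma> -` N) = 0" using N d by simp
  moreover have "\<sigma> -` N \<in> sets lborel" using measurable_sets[of \<sigma> borel borel N] N by simp
  ultimately show ?thesis using N by (intro AE_I[of _ _ "\<sigma> -` N"]) (auto simp: \<sigma>_def)
qed

lemma lebesgue_half_plane_integral:
  fixes U u g :: "real \<times> real \<Rightarrow> real"
  assumes U[measurable]: "U \<in> borel_measurable borel" and z: "\<And>q. fst q \<le> 0 \<Longrightarrow> U q = 0"
    and ae: "AE q in lborel. 0 < fst q \<longrightarrow> U q = u q"
    and g: "continuous_on open_half_plane g"
  shows "(LINT p:open_half_plane|lebesgue. u p * g p) = (\<integral>q. U q * g q \<partial>lborel)"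
proof -
  have gm[measurable]: "(\<lambda>q. indicator open_half_plane q * g q) \<in> borel_measurable borel"
    using borel_measurable_continuous_on_indicator[OF _ g] open_half_plane_open by simp
  have eq: "U q * g q = U q * (indicator open_half_plane q * g q)" for q
    using z[of q] by (auto simp: open_half_plane_def not_less split: split_indicator)
  have m: "(\<lambda>q. U q * g q) \<in> borel_measurable borel" unfolding eq by measurable
  have ml: "(\<lambda>q. U q * g q) \<in> borel_measurable lebesgue" using m by (simp add: measurable_completion)
  have ae2: "AE q in lebesgue. indicator open_half_plane q *\<^sub>R (u q * g q) = U q * g q"
    using AE_completion[OF ae] by eventually_elim (auto simp: open_half_plane_def z split: split_indicator)
  have "(LINT p:open_half_plane|lebesgue. u p * g p) = (\<integral>q. U q * g q \<partial>lebesgue)"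
    unfolding set_lebesgue_integral_def
    by (rule integral_cong_AE[OF lebesgue_measurable_AE_cong[OF ml ae2] ml ae2])
  also have "\<dots> = (\<integral>q. U q * g q \<partial>lborel)" by (rule integral_completion) (use m in simp)
  finally show ?thesis .
qed

text \<open>The corrections \<open>cW * \<epsilon> powr (2 - kappa)\<close> in
  \<open>alpha_l\<close> and \<open>eps2\<close> cancel, so the decay exceeds the critical exponent
  \<alpha> by a fixed multiple of \<epsilon>: 1/8 comes from \<open>alpha_l\<close>, 1 from \<alpha>
  = 1/3 - \<epsilon>, and kappa1 is lost to \<open>eps2\<close>.\<close>

lemma decay_exponent: "alpha_l cW \<epsilon> - eps2 cW \<epsilon> - (1/3 - \<epsilon>) = (9/8 - kappa1) * \<epsilon>"
  by (simp add: alpha_l_def eps2_def algebra_simps)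

lemma jap_minus[simp]: "jap (- x) = jap x" by (simp add: jap_def)

text \<open>The norms control \<omega> modulo null sets, while the locale \<open>density\<close>
  asks for a Borel function that is odd and bounded at every point; a representative is corrected
  accordingly. The factor with exponent kappa in the bound is the price of the weight containing
  \<open>Jfun\<close>.\<close>

lemma omega_density:
  fixes \<omega> :: "real \<times> real \<Rightarrow> real"
  assumes W13: "\<And>y. 0 \<le> y \<Longrightarrow> \<bar>W13 y\<bar> \<le> C13 * min y (jap y powr (-1/3))" and C13: "0 \<le> C13"
    and e: "0 < \<epsilon>" "\<epsilon> \<le> 1/30" "\<alpha> = 1/3 - \<epsilon>" and b: "b \<le> 0"
    and e2: "0 \<le> eps2 cW \<epsilon>" "kappa_ag + eps2 cW \<epsilon> \<le> 1/10"
    and odd: "\<forall>r\<ge>0. \<forall>z. \<omega> (r, - z) = - \<omega> (r, z)"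
    and norms: "norm_Linf_Gamma \<alpha> b cW W13 \<omega> + norm_W1r_Gamma \<alpha> b cW W13 \<omega> + norm_W1z_Gamma \<alpha> b cW W13 \<omega> \<le> ereal \<delta>"
  shows "\<exists>\<Omega> \<eta>. density \<alpha> (kappa_ag + eps2 cW \<epsilon>) ((9/8 - kappa1) * \<epsilon>) (2 * \<delta> * ((1 + 2 * C13) / \<epsilon>) powr kappa) \<Omega> \<eta>
     \<and> (AE q in lborel. 0 < fst q \<longrightarrow> \<omega> q = \<Omega> q)"
proof -
  have ee: "1/3 - \<alpha> = \<epsilon>" using e by simp
  define CJ where "CJ = (1 + 2 * C13) / \<epsilon>"
  have CJ: "0 < CJ" using C13 e by (simp add: CJ_def)
  have J: "jap (Jfun \<alpha> b W13 x) \<le> CJ" for x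
  proof -
    have "jap (Jfun \<alpha> b W13 x) \<le> 1 + C13 * (1 + 1/\<epsilon>)"
      using jap_le[of "Jfun \<alpha> b W13 x"] Jfun_bound[OF W13 C13 e(1,3) _ b, of x] e by simp
    also have "\<dots> \<le> 1/\<epsilon> + C13 * (1/\<epsilon> + 1/\<epsilon>)"
      using e C13 by (intro add_mono mult_left_mono) auto
    also have "\<dots> = CJ" by (simp add: CJ_def add_divide_distrib)
    finally show ?thesis .
  qed
  define N1 where "N1 = norm_Linf_Gamma \<alpha> b cW W13 \<omega>"
  define N2 where "N2 = norm_W1r_Gamma \<alpha> b cW W13 \<omega>"
  define N3 where "N3 = norm_W1z_Gamma \<alpha> b cW W13 \<omega>"
  have N0: "0 \<le> N1" "0 \<le> N2" "0 \<le> N3"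
    unfolding N1_def N2_def N3_def norm_Linf_Gamma_def norm_W1r_Gamma_def norm_W1z_Gamma_def
    by (auto intro!: Linf_norm_nonneg INF_greatest)
  have N: "N1 \<le> ereal \<delta>" "N3 \<le> ereal \<delta>"
  proof -
    have "N1 + 0 + 0 \<le> N1 + N2 + N3" "0 + 0 + N3 \<le> N1 + N2 + N3" by (intro add_mono N0 order_refl)+
    then show "N1 \<le> ereal \<delta>" "N3 \<le> ereal \<delta>" using norms unfolding N1_def N2_def N3_def by auto
  qed
  have d0: "0 \<le> \<delta>" using order_trans[OF N0(1) N(1)] by simp
  let ?G = "\<lambda>e p. Gamma_w \<alpha> b cW W13 p * Gamma_ag p * jap (snd p) powr e"
  \<comment> \<open>The seminorm is an infimum, so a weak derivative is picked with norm below
    \<delta> + 1. The excess is harmless: \<eta> only has to be locally bounded in r, and the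
    constant of the density estimate involves \<delta> alone.\<close>
  obtain h where h: "is_weak_deriv dz \<omega> h"
    "Linf_norm (\<lambda>p. Gamma_w \<alpha> b cW W13 p * Gamma_ag p * jap (snd p) powr (alpha_l cW (1/3 - \<alpha>) + 1) * h p) < ereal (\<delta> + 1)"
  proof -
    have "N3 < ereal (\<delta> + 1)" using N(2) by (rule le_less_trans) simp
    then show ?thesis using that unfolding N3_def norm_W1z_Gamma_def by (auto simp: INF_less_iff)
  qed
  define \<mu> where "\<mu> = kappa_ag + eps2 cW \<epsilon>"
  have mu: "0 \<le> \<mu>" "\<mu> \<le> 1/10" using e2 by (auto simp: \<mu>_def kappa_ag_def)
  define bd where "bd D s q = 2 * D * CJ powr kappa * (fst q powr \<mu> * jap (snd q) powr (- kappa_ag - s) + jap (snd q) powr (eps2 cW \<epsilon> - s))"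
    for D s and q :: "real \<times> real"
  have fm[measurable]: "(fst :: real \<times> real \<Rightarrow> real) \<in> borel_measurable borel"
    by (intro borel_measurable_continuous_onI continuous_intros)
  have jm: "(\<lambda>q :: real \<times> real. jap (snd q)) \<in> borel_measurable borel"
    by (rule measurable_compose[OF _ jap_measurable]) (intro borel_measurable_continuous_onI continuous_intros)
  have bd_meas[measurable]: "bd D s \<in> borel_measurable borel" for D s
    unfolding bd_def[abs_def]
    by (intro borel_measurable_times borel_measurable_add powr_real_measurable borel_measurable_const fm jm)
  have wb: "\<bar>x\<bar> \<le> bd D s p"
    if "\<bar>Gamma_w \<alpha> b cW W13 p * Gamma_ag p * m * jap (snd p) powr s * x\<bar> \<le> D" "1 \<le> m" "0 < fst p" for x D s p m
  proof -
    obtain r z where p: "p = (r,z)" by (cases p)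
    have "\<bar>x\<bar> \<le> 2 * D * CJ powr kappa * (r powr (kappa_ag + eps2 cW (1/3 - \<alpha>)) * jap z powr (- kappa_ag - s) + jap z powr (eps2 cW (1/3 - \<alpha>) - s))"
      by (rule weighted_bound[OF J CJ, where m=m]) (use that p e2 ee mu in \<open>auto simp: \<mu>_def\<close>)
    then show ?thesis by (simp add: bd_def p ee \<mu>_def)
  qed
  define al where "al = alpha_l cW \<epsilon>"
  have \<omega>b: "AE p in lborel. 0 < fst p \<longrightarrow> \<bar>\<omega> p\<bar> \<le> bd \<delta> al p"
    using Linf_norm_le_AE[OF N(1)[unfolded N1_def norm_Linf_Gamma_def]]
  proof eventually_elim
    case (elim p)
    then show ?case using wb[of p "max (1 / norm p) 1" al "\<omega> p" \<delta>] by (auto simp: al_def ee)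
  qed
  have hb: "AE p in lborel. 0 < fst p \<longrightarrow> \<bar>h p\<bar> \<le> bd (\<delta> + 1) (al + 1) p"
    using Linf_norm_le_AE[OF less_imp_le[OF h(2)]]
  proof eventually_elim
    case (elim p)
    then show ?case using wb[of p 1 "al + 1" "h p" "\<delta> + 1"] by (auto simp: al_def ee)
  qed
  have li: "loc_integrable \<omega>" "loc_integrable h" using h(1) by (auto simp: is_weak_deriv_def)
  obtain u1 where u1[measurable]: "u1 \<in> borel_measurable borel" and u1ae: "AE q in lborel. 0 < fst q \<longrightarrow> u1 q = \<omega> q"
    using loc_integrable_borel_version[OF li(1)] by blast
  obtain h1 where h1[measurable]: "h1 \<in> borel_measurable borel" and h1ae: "AE q in lborel. 0 < fst q \<longrightarrow> h1 q = h q"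
    using loc_integrable_borel_version[OF li(2)] by blast
  \<comment> \<open>Antisymmetrising gives oddness at every point and still agrees with \<omega>
    almost everywhere, by \<open>AE_reflect\<close>.\<close>
  define u2 where "u2 q = (u1 q - u1 (fst q, - snd q)) / 2" for q
  have refl_meas: "(\<lambda>q. u1 (fst q, - snd q)) \<in> borel_measurable borel"
    by (intro measurable_compose[OF _ u1] borel_measurable_continuous_onI continuous_intros)
  have [measurable]: "u2 \<in> borel_measurable borel" unfolding u2_def[abs_def] using refl_meas by measurable
  \<comment> \<open>Setting the function to 0 where the bound fails changes it on a null set and
    makes the bound hold everywhere. The bound is even in z, so oddness survives.\<close>
  define \<Omega> where "\<Omega> q = (if 0 < fst q \<and> \<bar>u2 q\<bar> \<le> bd \<delta> al q then u2 q else 0)" for q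
  define \<eta> where "\<eta> q = (if 0 < fst q \<and> \<bar>h1 q\<bar> \<le> bd (\<delta> + 1) (al + 1) q then h1 q else 0)" for q
  have \<Omega>m[measurable]: "\<Omega> \<in> borel_measurable borel" unfolding \<Omega>_def[abs_def] by measurable
  have \<eta>m[measurable]: "\<eta> \<in> borel_measurable borel" unfolding \<eta>_def[abs_def] by measurable
  have bd0: "0 \<le> bd D s q" if "0 \<le> D" for D s q using that by (simp add: bd_def)
  have \<Omega>ae: "AE q in lborel. 0 < fst q \<longrightarrow> \<Omega> q = \<omega> q"
    using u1ae AE_reflect[OF u1ae] \<omega>b
  proof eventually_elim
    case (elim q)
    show ?case
    proof
      assume q: "0 < fst q"
      then have "u2 q = \<omega> q" using elim odd[rule_format, of "fst q" "snd q"] by (simp add: u2_def)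
      then show "\<Omega> q = \<omega> q" using elim q by (simp add: \<Omega>_def)
    qed
  qed
  have \<eta>ae: "AE q in lborel. 0 < fst q \<longrightarrow> \<eta> q = h q"
    using h1ae hb by eventually_elim (auto simp: \<eta>_def)
  have \<Omega>b: "\<bar>\<Omega> q\<bar> \<le> bd \<delta> al q" for q using bd0[OF d0] by (auto simp: \<Omega>_def)
  have \<eta>b: "\<bar>\<eta> q\<bar> \<le> bd (\<delta> + 1) (al + 1) q" for q using bd0[of "\<delta> + 1"] d0 by (auto simp: \<eta>_def)
  have al_e2: "eps2 cW \<epsilon> - al \<le> 0"
  proof -
    have "0 \<le> (9/8 - kappa1) * \<epsilon>" using kappa_bounds e by (intro mult_nonneg_nonneg) auto
    then show ?thesis using decay_exponent[of cW \<epsilon>] e unfolding al_def by linarith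
  qed
  have loc: "bd D s q \<le> 2 * D * CJ powr kappa * (max 1 R powr \<mu> + 1)" if "0 < fst q" "fst q \<le> R" "al \<le> s" "0 \<le> D" for D s q R
  proof -
    have j: "jap w powr x \<le> 1" if "x \<le> 0" for w x using powr_mono[OF that jap_ge(1)[of w]] jap_pos[of w] by simp
    have "fst q powr \<mu> \<le> max 1 R powr \<mu>" using that mu by (intro powr_mono2) auto
    moreover have "jap (snd q) powr (- kappa_ag - s) \<le> 1" "jap (snd q) powr (eps2 cW \<epsilon> - s) \<le> 1"
      using al_e2 that e2 by (auto intro!: j simp: kappa_ag_def)
    ultimately have "fst q powr \<mu> * jap (snd q) powr (- kappa_ag - s) + jap (snd q) powr (eps2 cW \<epsilon> - s) \<le> max 1 R powr \<mu> * 1 + 1"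
      by (intro add_mono mult_mono) auto
    then show ?thesis unfolding bd_def using that by (intro mult_left_mono) auto
  qed
  have bdd: "\<exists>U. \<forall>q. fst q \<le> R \<longrightarrow> \<bar>\<Omega> q\<bar> \<le> U \<and> \<bar>\<eta> q\<bar> \<le> U" for R
  proof -
    let ?U = "2 * (\<delta> + 1) * CJ powr kappa * (max 1 R powr \<mu> + 1)"
    have mono: "2 * \<delta> * CJ powr kappa * (max 1 R powr \<mu> + 1) \<le> ?U" by (intro mult_right_mono) auto
    have "\<bar>\<Omega> q\<bar> \<le> ?U \<and> \<bar>\<eta> q\<bar> \<le> ?U" if "fst q \<le> R" for q
    proof (cases "0 < fst q")
      case True
      have "\<bar>\<Omega> q\<bar> \<le> ?U" using \<Omega>b[of q] loc[OF True that, of al \<delta>] mono d0 by linarith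
      moreover have "\<bar>\<eta> q\<bar> \<le> ?U" using \<eta>b[of q] loc[OF True that, of "al + 1" "\<delta> + 1"] d0 by linarith
      ultimately show ?thesis by simp
    next
      case False
      have "0 \<le> ?U" using d0 by simp
      then show ?thesis using False by (simp add: \<Omega>_def \<eta>_def)
    qed
    then show ?thesis by blast
  qed
  have weak: "(\<integral>q. \<Omega> q * dz \<phi> q \<partial>lborel) = - (\<integral>q. \<eta> q * \<phi> q \<partial>lborel)" if t: "test_function \<phi>" for \<phi>
  proof -
    have "Ck_on 0 open_half_plane \<phi>" "Ck_on (Suc 0) open_half_plane \<phi>" using t by (auto simp: test_function_def simp del: Ck_on.simps)
    then have c: "continuous_on open_half_plane \<phi>" "continuous_on open_half_plane (dz \<phi>)" by auto
    have "(LINT p:open_half_plane|lebesgue. \<omega> p * dz \<phi> p) = (\<integral>q. \<Omega> q * dz \<phi> q \<partial>lborel)"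
      by (rule lebesgue_half_plane_integral[OF \<Omega>m _ \<Omega>ae c(2)]) (simp add: \<Omega>_def)
    moreover have "(LINT p:open_half_plane|lebesgue. h p * \<phi> p) = (\<integral>q. \<eta> q * \<phi> q \<partial>lborel)"
      by (rule lebesgue_half_plane_integral[OF \<eta>m _ \<eta>ae c(1)]) (simp add: \<eta>_def)
    ultimately show ?thesis using h(1) t by (simp add: is_weak_deriv_def)
  qed
  have "density \<alpha> \<mu> ((9/8 - kappa1) * \<epsilon>) (2 * \<delta> * CJ powr kappa) \<Omega> \<eta>"
  proof
    show "3/10 \<le> \<alpha>" "\<alpha> + \<mu> \<le> 1/2" "0 \<le> \<mu>" using e mu by auto
    have "0 < 9/8 - kappa1" "9/8 - kappa1 \<le> 2" using kappa_bounds by auto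
    then show "0 < (9/8 - kappa1) * \<epsilon>" using e by simp
    have "(9/8 - kappa1) * \<epsilon> \<le> 2 * (1/30)" using \<open>0 < 9/8 - kappa1\<close> \<open>9/8 - kappa1 \<le> 2\<close> e by (intro mult_mono) auto
    then show "(9/8 - kappa1) * \<epsilon> \<le> 1" by simp
    show "0 \<le> 2 * \<delta> * CJ powr kappa" using d0 by simp
    show "\<Omega> (\<rho>, - w) = - \<Omega> (\<rho>, w)" for \<rho> w
    proof -
      have "u2 (\<rho>, - w) = - u2 (\<rho>, w)" by (simp add: u2_def field_simps)
      moreover have "bd \<delta> al (\<rho>, - w) = bd \<delta> al (\<rho>, w)" by (simp add: bd_def)
      ultimately show ?thesis by (simp add: \<Omega>_def)
    qed
    have ex: "-(\<alpha> + \<mu>) - (9/8 - kappa1) * \<epsilon> = - kappa_ag - al" "- \<alpha> - (9/8 - kappa1) * \<epsilon> = eps2 cW \<epsilon> - al"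
      using decay_exponent[of cW \<epsilon>] e by (auto simp: \<mu>_def al_def)
    show "dens_bound \<alpha> \<mu> ((9/8 - kappa1) * \<epsilon>) (2 * \<delta> * CJ powr kappa) \<Omega>"
      unfolding dens_bound_def ex using \<Omega>b by (auto simp: bd_def)
    show "\<exists>U. \<forall>q. 0 < fst q \<longrightarrow> fst q \<le> M \<longrightarrow> \<bar>\<eta> q\<bar> \<le> U" for M using bdd[of M] by blast
    fix t :: real assume t: "0 \<le> t"
    show "AE q in lborel. 0 < fst q \<longrightarrow> \<Omega> (fst q, snd q + t) - \<Omega> q = (LBINT s:{0..t}. \<eta> (fst q, snd q + s))"
      using weak_derivative_difference[OF \<Omega>m \<eta>m _ _ bdd weak t]
      by (auto simp: \<Omega>_def \<eta>_def)
  qed measurable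
  moreover have "AE q in lborel. 0 < fst q \<longrightarrow> \<omega> q = \<Omega> q" using \<Omega>ae by eventually_elim auto
  ultimately show ?thesis unfolding \<mu>_def CJ_def by blast
qed

text \<open>A profile does not depend on r, hence growth exponent 0; the margin c fits because the
  profile decays with exponent al \<ge> \<alpha> + c.\<close>

lemma profile_density:
  fixes W :: "real \<Rightarrow> real"
  assumes sm: "smooth1 W" and odd: "\<And>x. W (- x) = - W x"
    and bd: "\<And>x. \<bar>W x\<bar> \<le> C0 * jap x powr (- al)" "\<And>x. \<bar>deriv W x\<bar> \<le> C1"
    and a: "3/10 \<le> \<alpha>" "\<alpha> \<le> 1/2" and c: "0 < c" "c \<le> 1" "\<alpha> + c \<le> al" and C0: "0 \<le> C0"
  shows "density \<alpha> 0 c C0 (\<lambda>q. W (snd q)) (\<lambda>q. deriv W (snd q))"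
proof
  have fd: "W field_differentiable (at x)" "deriv W field_differentiable (at x)" for x
    using sm[unfolded smooth1_def, rule_format, of 0 x] sm[unfolded smooth1_def, rule_format, of 1 x] by auto
  have D: "(W has_real_derivative deriv W x) (at x)" for x using fd(1) by (simp add: field_differentiable_derivI)
  have cont: "continuous_on UNIV W" "continuous_on UNIV (deriv W)"
    using fd by (auto intro!: continuous_at_imp_continuous_on field_differentiable_imp_continuous_at)
  show "(\<lambda>q. W (snd q)) \<in> borel_measurable borel" "(\<lambda>q. deriv W (snd q)) \<in> borel_measurable borel"
    by (rule borel_measurable_continuous_onI, rule continuous_on_compose2[OF cont(1)], auto intro!: continuous_intros)
       (rule borel_measurable_continuous_onI, rule continuous_on_compose2[OF cont(2)], auto intro!: continuous_intros)
  show "dens_bound \<alpha> 0 c C0 (\<lambda>q. W (snd q))"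
    unfolding dens_bound_def
  proof (intro allI impI)
    fix \<rho> w :: real assume r: "0 < \<rho>"
    have "\<bar>W w\<bar> \<le> C0 * jap w powr (- al)" by (rule bd)
    also have "\<dots> \<le> C0 * jap w powr (-\<alpha>-c)"
      using c jap_ge(1)[of w] C0 by (intro mult_left_mono powr_mono) auto
    also have "\<dots> \<le> C0 * (\<rho> powr 0 * jap w powr (- (\<alpha> + 0) - c) + jap w powr (- \<alpha> - c))"
      using C0 by (intro mult_left_mono) auto
    finally show "\<bar>W (snd (\<rho>, w))\<bar> \<le> C0 * (\<rho> powr 0 * jap w powr (- (\<alpha> + 0) - c) + jap w powr (- \<alpha> - c))" by simp
  qed
  show "\<exists>U. \<forall>q. 0 < fst q \<longrightarrow> fst q \<le> M \<longrightarrow> \<bar>deriv W (snd q)\<bar> \<le> U" for M using bd(2) by blast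
  fix h :: real assume h: "0 \<le> h"
  have "W (z + h) - W z = (LBINT t:{0..h}. deriv W (z + t))" for z
  proof -
    have "(\<integral>t. indicator {0..h} t *\<^sub>R deriv W (z + t) \<partial>lborel) = W (z + h) - W (z + 0)"
    proof (rule integral_FTC_atLeastAtMost[OF h])
      fix t :: real
      have "((\<lambda>t. z + t) has_real_derivative 0 + 1) (at t within {0..h})" by (intro DERIV_add DERIV_const DERIV_ident)
      from DERIV_chain2[OF D this] show "((\<lambda>t. W (z + t)) has_vector_derivative deriv W (z + t)) (at t within {0..h})"
        by (simp add: has_real_derivative_iff_has_vector_derivative)
      show "continuous_on {0..h} (\<lambda>t. deriv W (z + t))"
        by (rule continuous_on_compose2[OF cont(2)]) (auto intro!: continuous_intros)
    qed
    then show ?thesis by (simp add: set_lebesgue_integral_def)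
  qed
  then show "AE q in lborel. 0 < fst q \<longrightarrow> W (snd (fst q, snd q + h)) - W (snd q) = (LBINT t:{0..h}. deriv W (snd (fst q, snd q + t)))"
    by auto
qed (use a c C0 odd in auto)

section \<open>Trajectories and integration by parts\<close>

text \<open>Since |v'| \<le> L v, the product v exp(L t) increases and v exp(-L t) decreases. Having
  both inequalities shows that a nonnegative v that vanishes at one end vanishes at the other, which
  yields invariance forward and backward in time.\<close>

lemma gronwall_two_sided:
  fixes v :: "real \<Rightarrow> real"
  assumes pq: "p \<le> q" and d: "\<And>t. t \<in> {p..q} \<Longrightarrow> (v has_real_derivative v' t) (at t)"
    and b: "\<And>t. t \<in> {p..q} \<Longrightarrow> \<bar>v' t\<bar> \<le> L * v t"
  shows "v p \<le> v q * exp (L * (q - p))" "v q \<le> v p * exp (L * (q - p))"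
proof -
  have 1: "((\<lambda>t. v t * exp (L * (t - p))) has_real_derivative (v' t + L * v t) * exp (L * (t - p))) (at t)" if "t \<in> {p..q}" for t
    using d[OF that] by (auto intro!: derivative_eq_intros simp: algebra_simps)
  have 2: "((\<lambda>t. v t * exp (L * (q - t))) has_real_derivative (v' t - L * v t) * exp (L * (q - t))) (at t)" if "t \<in> {p..q}" for t
    using d[OF that] by (auto intro!: derivative_eq_intros simp: algebra_simps)
  have "v p * exp (L * (p - p)) \<le> v q * exp (L * (q - p))"
  proof (rule DERIV_nonneg_imp_nondecreasing[OF pq])
    fix t assume "p \<le> t" "t \<le> q"
    then show "\<exists>y. ((\<lambda>t. v t * exp (L * (t - p))) has_real_derivative y) (at t) \<and> 0 \<le> y"
      using 1[of t] b[of t] by (intro exI[of _ "(v' t + L * v t) * exp (L * (t - p))"]) (auto intro!: mult_nonneg_nonneg)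
  qed
  then show "v p \<le> v q * exp (L * (q - p))" by simp
  have "v p * exp (L * (q - p)) \<ge> v q * exp (L * (q - q))"
  proof (rule DERIV_nonpos_imp_nonincreasing[OF pq])
    fix t assume "p \<le> t" "t \<le> q"
    then show "\<exists>y. ((\<lambda>t. v t * exp (L * (q - t))) has_real_derivative y) (at t) \<and> y \<le> 0"
      using 2[of t] b[of t] by (intro exI[of _ "(v' t - L * v t) * exp (L * (q - t))"]) (auto intro!: mult_nonpos_nonneg)
  qed
  then show "v q \<le> v p * exp (L * (q - p))" by simp
qed

text \<open>What integration by parts along trajectories requires of the velocity. The factor r is
  split off from \<open>Qr\<close> because the identity divides by \<open>Qr\<close>, which vanishes
  on the axis. Dependence on r is Lipschitz only relative to the axis, just enough to compare a
  trajectory with the axial one.\<close>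

locale strain_flow =
  fixes a Qr Qz :: "real \<times> real \<Rightarrow> real" and X :: "real \<Rightarrow> real \<times> real \<Rightarrow> real \<times> real"
  assumes a_cont: "continuous_on half_plane a" "continuous_on half_plane (dr a)" "continuous_on half_plane (dz a)"
    and a_pos: "\<And>p. p \<in> half_plane \<Longrightarrow> 0 < a p"
    and a_deriv: "\<And>r z. 0 \<le> r \<Longrightarrow> ((\<lambda>r. a (r,z)) has_real_derivative dr a (r,z)) (at r within {0..})"
      "\<And>r z. 0 \<le> r \<Longrightarrow> ((\<lambda>z. a (r,z)) has_real_derivative dz a (r,z)) (at z)"
    and Qr_eq: "\<And>p. p \<in> half_plane \<Longrightarrow> Qr p = fst p * a p"
    and Qz_cont: "continuous_on half_plane Qz"
    and Qz_0: "\<And>r. 0 \<le> r \<Longrightarrow> Qz (r,0) = 0"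
    and Qz_lip: "\<And>R. \<exists>L. \<forall>r\<in>{0..R}. \<forall>z\<in>{-R..R}. \<forall>z'\<in>{-R..R}. \<bar>Qz (r,z) - Qz (r,z')\<bar> \<le> L * \<bar>z - z'\<bar>"
    and Qz_lip_r: "\<And>R. \<exists>L. \<forall>r\<in>{0..R}. \<forall>z\<in>{-R..R}. \<bar>Qz (r,z) - Qz (0,z)\<bar> \<le> L * r"
    and flow: "is_flow (\<lambda>p. (Qr p, Qz p)) X"
begin

section \<open>Invariant sets and monotonicity of trajectories\<close>

lemma X_half: "x \<in> half_plane \<Longrightarrow> X s x \<in> half_plane" and X_0: "x \<in> half_plane \<Longrightarrow> X 0 x = x"
  using flow by (auto simp: is_flow_def)

lemma X_deriv:
  assumes x: "x \<in> half_plane"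
  shows "((\<lambda>s. X s x) has_vector_derivative (Qr (X s x), Qz (X s x))) (at s)"
    "((\<lambda>s. fst (X s x)) has_real_derivative fst (X s x) * a (X s x)) (at s)"
    "((\<lambda>s. snd (X s x)) has_real_derivative Qz (X s x)) (at s)"
    "continuous_on S (\<lambda>s. X s x)"
proof -
  show v: "((\<lambda>s. X s x) has_vector_derivative (Qr (X s x), Qz (X s x))) (at s)" for s
    using flow x by (auto simp: is_flow_def)
  then have "((\<lambda>s. X s x) has_derivative (\<lambda>h. h *\<^sub>R (Qr (X s x), Qz (X s x)))) (at s)"
    by (simp add: has_vector_derivative_def)
  from has_derivative_fst[OF this] has_derivative_snd[OF this]
  show "((\<lambda>s. fst (X s x)) has_real_derivative fst (X s x) * a (X s x)) (at s)"
    "((\<lambda>s. snd (X s x)) has_real_derivative Qz (X s x)) (at s)"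
    using Qr_eq[OF X_half[OF x]] by (auto simp: has_field_derivative_def mult_commute_abs)
  show "continuous_on S (\<lambda>s. X s x)"
    using v by (meson continuous_at_imp_continuous_on has_vector_derivative_continuous)
qed

lemma trajectory_bounded:
  assumes x: "x \<in> half_plane"
  obtains K where "0 \<le> K" "\<And>s. s \<in> {p..q} \<Longrightarrow> fst (X s x) \<in> {0..K} \<and> snd (X s x) \<in> {-K..K}"
proof -
  have "compact ((\<lambda>s. X s x) ` {p..q})" by (intro compact_continuous_image X_deriv(4) x) auto
  then have "bounded ((\<lambda>s. X s x) ` {p..q})" by (rule compact_imp_bounded)
  then obtain K where "\<forall>y\<in>(\<lambda>s. X s x) ` {p..q}. norm y \<le> K" unfolding bounded_iff by blast
  then have K: "\<And>s. s \<in> {p..q} \<Longrightarrow> norm (X s x) \<le> K" by blast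
  have "fst (X s x) \<in> {0..\<bar>K\<bar>} \<and> snd (X s x) \<in> {-\<bar>K\<bar>..\<bar>K\<bar>}" if "s \<in> {p..q}" for s
    using K[OF that] X_half[OF x, of s] norm_fst_le[of "fst (X s x)" "snd (X s x)"] norm_snd_le[of "snd (X s x)" "fst (X s x)"]
    by (auto simp: half_plane_def)
  then show ?thesis using that[of "\<bar>K\<bar>"] by auto
qed

text \<open>Along a trajectory the radius solves r' = a r with a bounded on compact time intervals,
  so Gronwall compares the radii at two times up to a finite factor; the axis is neither reached nor
  left.\<close>

lemma fst_compare:
  assumes x: "x \<in> half_plane" and pq: "p \<le> q"
  obtains A where "fst (X p x) \<le> fst (X q x) * exp (A * (q - p))" "fst (X q x) \<le> fst (X p x) * exp (A * (q - p))"
proof -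
  have "compact ((\<lambda>s. a (X s x)) ` {p..q})"
    by (intro compact_continuous_image continuous_on_compose2[OF a_cont(1)] X_deriv(4) x) (auto intro: X_half[OF x])
  then have "bounded ((\<lambda>s. a (X s x)) ` {p..q})" by (rule compact_imp_bounded)
  then obtain A where "\<forall>y\<in>(\<lambda>s. a (X s x)) ` {p..q}. norm y \<le> A" unfolding bounded_iff by blast
  then have A: "\<And>s. s \<in> {p..q} \<Longrightarrow> \<bar>a (X s x)\<bar> \<le> A" by simp
  have "\<bar>fst (X t x) * a (X t x)\<bar> \<le> A * fst (X t x)" if "t \<in> {p..q}" for t
    using mult_right_mono[OF A[OF that], of "fst (X t x)"] X_half[OF x, of t] by (simp add: abs_mult half_plane_def mult.commute)
  from gronwall_two_sided[OF pq X_deriv(2)[OF x] this] show ?thesis by (rule that)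
qed

lemma fst_pos: "x \<in> half_plane \<Longrightarrow> 0 < fst x \<Longrightarrow> 0 < fst (X s x)"
proof -
  assume x: "x \<in> half_plane" "0 < fst x"
  have "0 < fst (X 0 x)" using X_0 x by simp
  moreover obtain A p q where pq: "fst (X 0 x) \<le> fst (X s x) * exp (A * (q - p))"
    using fst_compare[OF x(1), of 0 s] fst_compare[OF x(1), of s 0] by (metis linear)
  ultimately show ?thesis by (metis exp_gt_zero less_le_trans zero_less_mult_pos2)
qed

lemma fst_zero: "x \<in> half_plane \<Longrightarrow> fst x = 0 \<Longrightarrow> fst (X s x) = 0"
proof -
  assume x: "x \<in> half_plane" "fst x = 0"
  have 0: "fst (X 0 x) = 0" using X_0 x by simp
  obtain A p q where pq: "fst (X s x) \<le> fst (X 0 x) * exp (A * (q - p))"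
    using fst_compare[OF x(1), of 0 s] fst_compare[OF x(1), of s 0] by (metis linear)
  then show ?thesis using 0 X_half[OF x(1), of s] by (simp add: half_plane_def)
qed

text \<open>Positivity of a makes r nondecreasing in time, so trajectories followed backward stay at
  least as close to the axis as they started.\<close>

lemma fst_le: "x \<in> half_plane \<Longrightarrow> s \<le> 0 \<Longrightarrow> fst (X s x) \<le> fst x"
proof -
  assume x: "x \<in> half_plane" and s: "s \<le> 0"
  have "fst (X s x) \<le> fst (X 0 x)"
  proof (rule DERIV_nonneg_imp_nondecreasing[OF s])
    fix t
    have "0 \<le> fst (X t x) * a (X t x)" using X_half[OF x, of t] a_pos[of "X t x"] by (simp add: half_plane_def)
    then show "\<exists>y. ((\<lambda>s. fst (X s x)) has_real_derivative y) (at t) \<and> 0 \<le> y" using X_deriv(2)[OF x] by blast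
  qed
  then show ?thesis using X_0[OF x] by simp
qed

text \<open>\<open>Qz\<close> vanishes on z = 0 and is locally Lipschitz in z, so Gronwall applies
  to the square of the height: a trajectory meeting z = 0 would have started there.\<close>

lemma X_off_axis:
  assumes x: "x \<in> off_axis" shows "X s x \<in> off_axis"
proof -
  have xh: "x \<in> half_plane" and z: "snd x \<noteq> 0" using x by (auto simp: off_axis_def)
  define p where "p = min s 0"
  define q where "q = max s 0"
  have pq: "p \<le> q" by (simp add: p_def q_def)
  obtain K where K: "0 \<le> K" "\<And>t. t \<in> {p..q} \<Longrightarrow> fst (X t x) \<in> {0..K} \<and> snd (X t x) \<in> {-K..K}"
    using trajectory_bounded[OF xh, where p=p and q=q] by blast
  obtain L where L: "\<And>r z z'. r \<in> {0..K} \<Longrightarrow> z \<in> {-K..K} \<Longrightarrow> z' \<in> {-K..K} \<Longrightarrow> \<bar>Qz (r,z) - Qz (r,z')\<bar> \<le> L * \<bar>z - z'\<bar>"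
    using Qz_lip[of K] by blast
  have d: "((\<lambda>t. (snd (X t x))\<^sup>2) has_real_derivative 2 * snd (X t x) * Qz (X t x)) (at t)" for t
    using X_deriv(3)[OF xh, of t] by (auto intro!: derivative_eq_intros)
  have b: "\<bar>2 * snd (X t x) * Qz (X t x)\<bar> \<le> (2 * L) * (snd (X t x))\<^sup>2" if t: "t \<in> {p..q}" for t
  proof -
    have "\<bar>Qz (fst (X t x), snd (X t x)) - Qz (fst (X t x), 0)\<bar> \<le> L * \<bar>snd (X t x) - 0\<bar>"
      by (rule L) (use K t in auto)
    then have "\<bar>Qz (X t x)\<bar> \<le> L * \<bar>snd (X t x)\<bar>" using Qz_0 K(2)[OF t] by simp
    then have "\<bar>snd (X t x)\<bar> * \<bar>Qz (X t x)\<bar> \<le> \<bar>snd (X t x)\<bar> * (L * \<bar>snd (X t x)\<bar>)" by (rule mult_left_mono) simp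
    then show ?thesis by (simp add: abs_mult power2_eq_square mult_ac)
  qed
  note gw = gronwall_two_sided[OF pq d b]
  have "(snd (X s x))\<^sup>2 \<noteq> 0"
  proof
    assume s0: "(snd (X s x))\<^sup>2 = 0"
    have "(snd (X 0 x))\<^sup>2 \<le> (snd (X s x))\<^sup>2 * exp (2 * L * (q - p))"
      using gw by (cases "s \<le> 0") (auto simp: p_def q_def)
    then show False using s0 z X_0[OF xh] by simp
  qed
  then show ?thesis using X_half[OF xh] by (simp add: off_axis_def)
qed

text \<open>The derivative of a along trajectories, written with r a in place of \<open>Qr\<close>
  so that continuity up to the axis is visible.\<close>

definition a1 :: "real \<times> real \<Rightarrow> real" where "a1 p = dr a p * (fst p * a p) + dz a p * Qz p"

lemma a1_cont: "continuous_on half_plane a1"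
  unfolding a1_def by (intro continuous_intros a_cont Qz_cont)

text \<open>Continuous partial derivatives give total differentiability, but at the axis the r
  derivative is one-sided; trajectories starting with r > 0 remain in the open half plane, where the
  chain rule is available.\<close>

lemma a_traj_deriv:
  assumes x: "x \<in> half_plane" "0 < fst x"
  shows "((\<lambda>s. a (X s x)) has_real_derivative a1 (X s x)) (at s)"
proof -
  obtain r z where p: "X s x = (r,z)" by (cases "X s x")
  have r: "0 < r" using fst_pos[OF x, of s] p by simp
  have dr: "((\<lambda>r. a (r,z)) has_derivative (\<lambda>h. dr a (r,z) * h)) (at r within {0<..})"
    using a_deriv(1)[of r z] r by (auto simp: has_field_derivative_def intro: has_derivative_subset)
  have "((\<lambda>(r,z). a (r,z)) has_derivative (\<lambda>(h,k). dr a (r,z) * h + blinfun_scaleR_left (dz a (r,z)) k)) (at (r,z) within {0<..} \<times> UNIV)"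
  proof (rule has_derivative_partialsI[where f="\<lambda>r z. a (r,z)" and fx="(*) (dr a (r,z))" and fy="\<lambda>r z. blinfun_scaleR_left (dz a (r,z))", OF dr])
    show "((\<lambda>z. a (r',z)) has_derivative blinfun_apply (blinfun_scaleR_left (dz a (r',z')))) (at z' within UNIV)"
      if "r' \<in> {0<..}" for r' z'
      using a_deriv(2)[of r' z'] that by (simp add: has_field_derivative_def mult_commute_abs)
    have "continuous_on half_plane (\<lambda>p. blinfun_scaleR_left (dz a p))"
      by (intro continuous_intros a_cont)
    then have "continuous (at (r,z) within half_plane) (\<lambda>p. blinfun_scaleR_left (dz a p))"
      using r by (auto simp: continuous_on_eq_continuous_within half_plane_def)
    then have "continuous (at (r,z) within {0<..} \<times> UNIV) (\<lambda>p. blinfun_scaleR_left (dz a p))"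
      by (rule continuous_within_subset) (auto simp: half_plane_def)
    then show "continuous (at (r, z) within {0<..} \<times> UNIV) (\<lambda>(r, z). blinfun_scaleR_left (dz a (r, z)))"
      by (simp add: case_prod_beta')
  qed auto
  then have "(a has_derivative (\<lambda>(h,k). dr a (r,z) * h + dz a (r,z) * k)) (at (r,z) within {0<..} \<times> UNIV)"
    by (simp add: mult.commute)
  moreover have "at (r,z) within {0<..} \<times> UNIV = at (r,z)"
    using r by (intro at_within_open) (auto intro: open_Times)
  ultimately have A: "(a has_derivative (\<lambda>(h,k). dr a (r,z) * h + dz a (r,z) * k)) (at (X s x))" by (simp add: p)
  have "((\<lambda>s. X s x) has_derivative (\<lambda>h. h *\<^sub>R (Qr (X s x), Qz (X s x)))) (at s)"
    using X_deriv(1)[OF x(1), of s] by (simp add: has_vector_derivative_def)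
  from has_derivative_compose[OF this A]
  have "((\<lambda>s. a (X s x)) has_derivative (\<lambda>h. dr a (r,z) * (h * Qr (r,z)) + dz a (r,z) * (h * Qz (r,z)))) (at s)"
    by (simp add: p)
  moreover have "(\<lambda>h. dr a (r,z) * (h * Qr (r,z)) + dz a (r,z) * (h * Qz (r,z))) = (*) (a1 (X s x))"
    using r Qr_eq[of "(r,z)"] by (auto simp: p a1_def fun_eq_iff half_plane_def algebra_simps)
  ultimately show ?thesis by (simp add: has_field_derivative_def)
qed

text \<open>g is differentiable within the half plane, and trajectories never leave it, so the chain
  rule gives a two-sided derivative in time. Restricting the total derivative to the two coordinate
  lines identifies its coefficients with \<open>dr g\<close> and \<open>dz g\<close>.\<close>

lemma g_traj_deriv:
  assumes x: "x \<in> half_plane" and g: "g differentiable (at (X s x) within half_plane)"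
  shows "((\<lambda>s. g (X s x)) has_real_derivative dr g (X s x) * Qr (X s x) + dz g (X s x) * Qz (X s x)) (at s)"
proof -
  obtain r z where p: "X s x = (r,z)" by (cases "X s x")
  have r: "0 \<le> r" using X_half[OF x, of s] p by (simp add: half_plane_def)
  obtain g' where g': "(g has_derivative g') (at (r,z) within half_plane)"
    using g p by (auto simp: differentiable_def)
  interpret g': bounded_linear g' using g' by (rule has_derivative_bounded_linear)
  have l: "g' (h,k) = h * g' (1,0) + k * g' (0,1)" for h k
    using g'.add[of "(h,0)" "(0,k)"] g'.scaleR[of h "(1,0)"] g'.scaleR[of k "(0,1)"] by simp
  have l1: "(\<lambda>h. g' (h,0)) = (\<lambda>h. h * g' (1,0))" by (rule ext, subst l) simp
  have l2: "(\<lambda>k. g' (0,k)) = (\<lambda>k. k * g' (0,1))" by (rule ext, subst l) simp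
  have d1: "((\<lambda>r. (r,z)) has_derivative (\<lambda>h. (h,0))) (at r within {0..})"
    by (intro has_derivative_Pair has_derivative_ident has_derivative_const)
  have "(g has_derivative g') (at (r,z) within (\<lambda>r. (r,z)) ` {0..})"
    by (rule has_derivative_subset[OF g']) (auto simp: half_plane_def)
  from has_derivative_in_compose[OF d1 this]
  have "((\<lambda>r. g (r,z)) has_real_derivative g' (1,0)) (at r within {0..})"
    by (simp add: has_field_derivative_def l1 mult_commute_abs)
  then have 1: "dr g (r,z) = g' (1,0)" by (rule dr_eqI[OF r])
  have d2: "((\<lambda>z. (r,z)) has_derivative (\<lambda>k. (0,k))) (at z within UNIV)"
    by (intro has_derivative_Pair has_derivative_ident has_derivative_const)
  have "(g has_derivative g') (at (r,z) within range (\<lambda>z. (r,z)))"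
    by (rule has_derivative_subset[OF g']) (use r in \<open>auto simp: half_plane_def\<close>)
  from has_derivative_in_compose[OF d2 this]
  have "((\<lambda>z. g (r,z)) has_real_derivative g' (0,1)) (at z)"
    by (simp add: has_field_derivative_def l2 mult_commute_abs)
  then have 2: "dz g (r,z) = g' (0,1)" by (rule dz_eqI)
  have d3: "((\<lambda>s. X s x) has_derivative (\<lambda>h. h *\<^sub>R (Qr (X s x), Qz (X s x)))) (at s within UNIV)"
    using X_deriv(1)[OF x, of s] by (simp add: has_vector_derivative_def)
  have "(g has_derivative g') (at (X s x) within range (\<lambda>s. X s x))"
    unfolding p by (rule has_derivative_subset[OF g']) (use X_half[OF x] in auto)
  from has_derivative_in_compose[OF d3 this]
  have "((\<lambda>s. g (X s x)) has_derivative (\<lambda>h. g' (h *\<^sub>R (Qr (X s x), Qz (X s x))))) (at s)" by simp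
  moreover have "(\<lambda>h. g' (h *\<^sub>R (Qr (X s x), Qz (X s x)))) = (*) (dr g (X s x) * Qr (X s x) + dz g (X s x) * Qz (X s x))"
    unfolding p scaleR_Pair 1 2 by (rule ext, subst l) (simp add: algebra_simps)
  ultimately show ?thesis by (simp add: has_field_derivative_def)
qed

end

section \<open>Integration by parts along a trajectory and its limit at the axis\<close>

lemma set_integrable_continuous_interval:
  fixes \<phi> :: "real \<Rightarrow> real"
  shows "continuous_on {p..q} \<phi> \<Longrightarrow> set_integrable lborel {p..q} \<phi>"
  by (rule borel_integrable_atLeastAtMost')

lemma bounded_convergence_interval:
  fixes u :: "nat \<Rightarrow> real \<Rightarrow> real"
  assumes c: "\<And>n. continuous_on {p..q} (u n)" and b: "\<And>n s. s \<in> {p..q} \<Longrightarrow> \<bar>u n s\<bar> \<le> M"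
    and l: "\<And>s. s \<in> {p..q} \<Longrightarrow> (\<lambda>n. u n s) \<longlonglongrightarrow> v s"
  shows "set_integrable lborel {p..q} v" "(\<lambda>n. LBINT s:{p..q}. u n s) \<longlonglongrightarrow> (LBINT s:{p..q}. v s)"
proof -
  have m: "(\<lambda>s. indicator {p..q} s *\<^sub>R u n s) \<in> borel_measurable lborel" for n
    using borel_measurable_integrable[OF set_integrable_continuous_interval[OF c[of n], unfolded set_integrable_def]] .
  have lim: "(\<lambda>n. indicator {p..q} s *\<^sub>R u n s) \<longlonglongrightarrow> indicator {p..q} s *\<^sub>R v s" for s
    using l[of s] by (cases "s \<in> {p..q}") auto
  have m': "(\<lambda>s. indicator {p..q} s *\<^sub>R v s) \<in> borel_measurable lborel"
    by (rule borel_measurable_LIMSEQ_real[OF lim m])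
  have i: "integrable lborel (\<lambda>s. indicator {p..q} s * M)"
    using set_integrable_continuous_interval[OF continuous_on_const[of "{p..q}" M]] by (simp add: set_integrable_def)
  have bb: "AE s in lborel. norm (indicator {p..q} s *\<^sub>R u n s) \<le> indicator {p..q} s * M" for n
    using b by (auto split: split_indicator)
  have al: "AE s in lborel. (\<lambda>n. indicator {p..q} s *\<^sub>R u n s) \<longlonglongrightarrow> indicator {p..q} s *\<^sub>R v s" using lim by simp
  show "set_integrable lborel {p..q} v" unfolding set_integrable_def
    by (rule integrable_dominated_convergence[OF m' m i al bb])
  show "(\<lambda>n. LBINT s:{p..q}. u n s) \<longlonglongrightarrow> (LBINT s:{p..q}. v s)" unfolding set_lebesgue_integral_def
    by (rule integral_dominated_convergence[OF m' m i al bb])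
qed

locale ibp_flow = strain_flow +
  fixes f g :: "real \<times> real \<Rightarrow> real"
  assumes reg: "\<And>D T. compact D \<Longrightarrow> D \<subseteq> off_axis \<Longrightarrow> 0 < T \<Longrightarrow>
         Ck_on 1 D g \<and> continuous_on D f \<and>
         C0_upto_boundary D (\<lambda>p. g p / fst p) \<and> C0_upto_boundary D (\<lambda>p. snd p * dz g p / fst p) \<and>
         (\<forall>s\<in>{-T..T}. \<forall>x\<in>D. (\<lambda>s. f (X s x)) field_differentiable (at s)) \<and>
         continuous_on ({-T..T} \<times> D) (\<lambda>(s, x). deriv (\<lambda>s. f (X s x)) s)"
begin

text \<open>f is assumed differentiable along trajectories only, so its derivative is kept as a
  function of time and starting point rather than of the position; its joint continuity in these is
  part of \<open>reg\<close>.\<close>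

definition F' :: "real \<Rightarrow> real \<times> real \<Rightarrow> real" where "F' s y = deriv (\<lambda>s. f (X s y)) s"
definition I1 where "I1 s y = Qz (X s y) / Qr (X s y) * dz g (X s y) * f (X s y)"
definition I2 where "I2 s y = g (X s y) * deriv (\<lambda>t. f (X t y) / Qr (X t y)) s"
definition Bd where "Bd s y = f (X s y) * g (X s y) / Qr (X s y)"

lemma reg_cont:
  assumes "compact D" "D \<subseteq> off_axis"
  shows "continuous_on D f" "continuous_on D g" "continuous_on D (dr g)" "continuous_on D (dz g)"
    and "\<And>p. p \<in> D \<Longrightarrow> g differentiable (at p within half_plane)"
proof -
  have C: "Ck_on 1 D g" using reg[OF assms zero_less_one] by (elim conjE)
  have f: "continuous_on D f" using reg[OF assms zero_less_one] by (elim conjE)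
  have C': "(\<forall>p\<in>D. g differentiable at p within half_plane) \<and> continuous_on D (dr g) \<and> continuous_on D (dz g)"
    using C unfolding One_nat_def Ck_on.simps .
  show "continuous_on D f" by (rule f)
  show "continuous_on D (dr g)" "continuous_on D (dz g)" using C' by blast+
  show d: "g differentiable (at p within half_plane)" if "p \<in> D" for p using C' that by blast
  have sub: "D \<subseteq> half_plane" using assms(2) by (auto simp: off_axis_def)
  have "continuous (at p within D) g" if "p \<in> D" for p
    using differentiable_imp_continuous_within[OF d[OF that]] sub by (rule continuous_within_subset)
  then show "continuous_on D g" by (simp add: continuous_on_eq_continuous_within)
qed

lemma F'_deriv:
  assumes "y \<in> off_axis" shows "((\<lambda>s. f (X s y)) has_real_derivative F' s y) (at s)"
proof -
  have "(\<lambda>s. f (X s y)) field_differentiable (at s)"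
  proof -
    have "compact {y}" "{y} \<subseteq> off_axis" "0 < \<bar>s\<bar> + 1" "s \<in> {-(\<bar>s\<bar> + 1)..\<bar>s\<bar> + 1}" using assms by auto
    then have c: "compact {y}" "{y} \<subseteq> off_axis" "0 < \<bar>s\<bar> + 1" and s: "s \<in> {-(\<bar>s\<bar> + 1)..\<bar>s\<bar> + 1}" by auto
    from reg[OF c] have "\<forall>s\<in>{-(\<bar>s\<bar> + 1)..\<bar>s\<bar> + 1}. \<forall>x\<in>{y}. (\<lambda>s. f (X s x)) field_differentiable (at s)"
      by (elim conjE)
    from bspec[OF bspec[OF this s]] show ?thesis by simp
  qed
  then show ?thesis unfolding F'_def by (rule field_differentiable_derivI)
qed

lemma F'_cont:
  assumes "compact D" "D \<subseteq> off_axis" "0 < t" shows "continuous_on ({-t..t} \<times> D) (\<lambda>(s,x). F' s x)"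
  unfolding F'_def by (rule reg[OF assms, THEN conjunct2, THEN conjunct2, THEN conjunct2, THEN conjunct2, THEN conjunct2])

lemma F'_cont1:
  assumes "y \<in> off_axis" shows "continuous_on {p..q} (\<lambda>s. F' s y)"
proof -
  define t where "t = \<bar>p\<bar> + \<bar>q\<bar> + 1"
  have "continuous_on ({-t..t} \<times> {y}) (\<lambda>(s,x). F' s x)" using assms by (intro F'_cont) (auto simp: t_def)
  then have "continuous_on {p..q} (\<lambda>s. (\<lambda>(s,x). F' s x) (s,y))"
    by (rule continuous_on_compose2) (auto intro!: continuous_intros simp: t_def)
  then show ?thesis by simp
qed

text \<open>Since (r a)' = r (a^2 + a1) along a trajectory, the derivative is 1/r times an
  expression that stays continuous up to the axis. In \<open>I2_eq\<close> the factor 1/r joins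
  g.\<close>

lemma quotient_deriv:
  assumes y: "y \<in> off_axis" "0 < fst y"
  shows "((\<lambda>t. f (X t y) / Qr (X t y)) has_real_derivative
     (F' s y / a (X s y) - f (X s y) * ((a (X s y))\<^sup>2 + a1 (X s y)) / (a (X s y))\<^sup>2) / fst (X s y)) (at s)"
proof -
  have yh: "y \<in> half_plane" using y by (auto simp: off_axis_def)
  have R: "0 < fst (X t y)" for t by (rule fst_pos[OF yh y(2)])
  have A: "0 < a (X t y)" for t by (rule a_pos[OF X_half[OF yh]])
  have ne: "fst (X s y) * a (X s y) \<noteq> 0" using R[of s] A[of s] by simp
  have "((\<lambda>t. f (X t y) / (fst (X t y) * a (X t y))) has_real_derivative
     (F' s y * (fst (X s y) * a (X s y)) - f (X s y) * (fst (X s y) * a (X s y) * a (X s y) + a1 (X s y) * fst (X s y)))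
        / ((fst (X s y) * a (X s y)) * (fst (X s y) * a (X s y)))) (at s)"
    by (rule DERIV_divide[OF F'_deriv[OF y(1)] DERIV_mult[OF X_deriv(2)[OF yh] a_traj_deriv[OF yh y(2)]] ne])
  moreover have "(F' s y * (fst (X s y) * a (X s y)) - f (X s y) * (fst (X s y) * a (X s y) * a (X s y) + a1 (X s y) * fst (X s y)))
        / ((fst (X s y) * a (X s y)) * (fst (X s y) * a (X s y)))
     = (F' s y / a (X s y) - f (X s y) * ((a (X s y))\<^sup>2 + a1 (X s y)) / (a (X s y))\<^sup>2) / fst (X s y)"
    using R[of s] A[of s] by (simp add: field_simps power2_eq_square)
  ultimately show ?thesis using Qr_eq[OF X_half[OF yh]] by simp
qed

lemma I2_eq:
  assumes y: "y \<in> off_axis" "0 < fst y"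
  shows "I2 s y = g (X s y) / fst (X s y) * (F' s y / a (X s y) - f (X s y) * ((a (X s y))\<^sup>2 + a1 (X s y)) / (a (X s y))\<^sup>2)"
  unfolding I2_def DERIV_imp_deriv[OF quotient_deriv[OF y]] by simp

lemma traj_cont:
  assumes y: "y \<in> off_axis"
  shows "continuous_on {p..q} (\<lambda>s. f (X s y))" "continuous_on {p..q} (\<lambda>s. g (X s y))"
    "continuous_on {p..q} (\<lambda>s. dr g (X s y))" "continuous_on {p..q} (\<lambda>s. dz g (X s y))"
    and "\<And>s. g differentiable (at (X s y) within half_plane)"
    and "continuous_on half_plane \<phi> \<Longrightarrow> continuous_on {p..q} (\<lambda>s. \<phi> (X s y))"
proof -
  have yh: "y \<in> half_plane" using y by (auto simp: off_axis_def)
  define D where "D = (\<lambda>s. X s y) ` {p..q}"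
  have D: "compact D" "D \<subseteq> off_axis" unfolding D_def
    using X_off_axis[OF y] by (auto intro!: compact_continuous_image X_deriv(4) yh)
  note rc = reg_cont[OF D]
  have sub: "(\<lambda>s. X s y) ` {p..q} \<subseteq> D" by (simp add: D_def)
  show "continuous_on {p..q} (\<lambda>s. f (X s y))" "continuous_on {p..q} (\<lambda>s. g (X s y))"
    "continuous_on {p..q} (\<lambda>s. dr g (X s y))" "continuous_on {p..q} (\<lambda>s. dz g (X s y))"
    by (rule continuous_on_compose2[OF rc(1) X_deriv(4)[OF yh] sub] continuous_on_compose2[OF rc(2) X_deriv(4)[OF yh] sub]
       continuous_on_compose2[OF rc(3) X_deriv(4)[OF yh] sub] continuous_on_compose2[OF rc(4) X_deriv(4)[OF yh] sub])+
  show "g differentiable (at (X s y) within half_plane)" for s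
    using reg_cont(5)[of "{X s y}"] X_off_axis[OF y] by auto
  show "continuous_on half_plane \<phi> \<Longrightarrow> continuous_on {p..q} (\<lambda>s. \<phi> (X s y))"
    by (rule continuous_on_compose2[OF _ X_deriv(4)[OF yh]]) (auto intro: X_half[OF yh])
qed

lemma ibp_interior:
  assumes y: "y \<in> off_axis" "0 < fst y" and t: "0 < \<tau>"
  shows "continuous_on {-\<tau>..0} (\<lambda>s. dr g (X s y) * f (X s y))"
    and "continuous_on {-\<tau>..0} (\<lambda>s. I1 s y + I2 s y)"
    and "(LBINT s:{-\<tau>..0}. dr g (X s y) * f (X s y)) = - (LBINT s:{-\<tau>..0}. I1 s y + I2 s y) + (Bd 0 y - Bd (-\<tau>) y)"
proof -
  have yh: "y \<in> half_plane" using y by (auto simp: off_axis_def)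
  have R: "0 < fst (X s y)" for s by (rule fst_pos[OF yh y(2)])
  have A: "0 < a (X s y)" for s by (rule a_pos[OF X_half[OF yh]])
  have Q: "Qr (X s y) = fst (X s y) * a (X s y)" for s by (rule Qr_eq[OF X_half[OF yh]])
  have Qne: "Qr (X s y) \<noteq> 0" for s using R[of s] A[of s] Q[of s] by simp
  note tc = traj_cont[OF y(1)]
  have cR: "continuous_on {-\<tau>..0} (\<lambda>s. fst (X s y))" by (intro continuous_intros X_deriv(4) yh)
  note ch = tc(6)[OF a_cont(1), of "-\<tau>" 0] tc(6)[OF Qz_cont, of "-\<tau>" 0] tc(6)[OF a1_cont, of "-\<tau>" 0]
  have cQr: "continuous_on {-\<tau>..0} (\<lambda>s. Qr (X s y))" unfolding Q by (intro continuous_intros cR ch)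
  show c1: "continuous_on {-\<tau>..0} (\<lambda>s. dr g (X s y) * f (X s y))" by (intro continuous_on_mult tc)
  have Ane: "a (X s y) \<noteq> 0" "fst (X s y) \<noteq> 0" for s using A[of s] R[of s] by auto
  have cI1: "continuous_on {-\<tau>..0} (\<lambda>s. I1 s y)"
    unfolding I1_def by (intro continuous_on_mult continuous_on_divide tc ch cQr) (simp add: Qne)
  have cI2: "continuous_on {-\<tau>..0} (\<lambda>s. I2 s y)"
    unfolding I2_eq[OF y]
    by (intro continuous_on_mult continuous_on_divide continuous_on_diff continuous_on_add continuous_on_power tc(1,2) ch cR F'_cont1[OF y(1)])
       (simp_all add: Ane)
  show c2: "continuous_on {-\<tau>..0} (\<lambda>s. I1 s y + I2 s y)" by (intro continuous_on_add cI1 cI2)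
  \<comment> \<open>In the product rule \<open>Qr\<close> cancels in the first term, leaving
    \<open>dr g * f\<close>; the other two terms are \<open>I1\<close> and
    \<open>I2\<close>.\<close>
  have d: "((\<lambda>s. Bd s y) has_real_derivative dr g (X s y) * f (X s y) + (I1 s y + I2 s y)) (at s)" for s
  proof -
    have q: "((\<lambda>t. f (X t y) / Qr (X t y)) has_real_derivative deriv (\<lambda>t. f (X t y) / Qr (X t y)) s) (at s)"
      unfolding DERIV_imp_deriv[OF quotient_deriv[OF y]] by (rule quotient_deriv[OF y])
    from DERIV_mult[OF g_traj_deriv[OF yh tc(5)] q]
    have "((\<lambda>s. g (X s y) * (f (X s y) / Qr (X s y))) has_real_derivative
       (dr g (X s y) * Qr (X s y) + dz g (X s y) * Qz (X s y)) * (f (X s y) / Qr (X s y)) + deriv (\<lambda>t. f (X t y) / Qr (X t y)) s * g (X s y)) (at s)" .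
    moreover have "(dr g (X s y) * Qr (X s y) + dz g (X s y) * Qz (X s y)) * (f (X s y) / Qr (X s y)) + deriv (\<lambda>t. f (X t y) / Qr (X t y)) s * g (X s y)
       = dr g (X s y) * f (X s y) + (I1 s y + I2 s y)"
      using Qne[of s] by (simp add: I1_def I2_def field_simps)
    ultimately show ?thesis by (simp add: Bd_def mult.commute)
  qed
  have "(\<integral>s. indicator {-\<tau>..0} s *\<^sub>R (dr g (X s y) * f (X s y) + (I1 s y + I2 s y)) \<partial>lborel) = Bd 0 y - Bd (-\<tau>) y"
    by (rule integral_FTC_atLeastAtMost)
      (use t d c1 c2 in \<open>auto simp: has_real_derivative_iff_has_vector_derivative[symmetric] intro!: continuous_on_add intro: has_field_derivative_at_within\<close>)
  then have "(LBINT s:{-\<tau>..0}. dr g (X s y) * f (X s y) + (I1 s y + I2 s y)) = Bd 0 y - Bd (-\<tau>) y"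
    by (simp add: set_lebesgue_integral_def)
  then show "(LBINT s:{-\<tau>..0}. dr g (X s y) * f (X s y)) = - (LBINT s:{-\<tau>..0}. I1 s y + I2 s y) + (Bd 0 y - Bd (-\<tau>) y)"
    using set_integral_add(2)[OF set_integrable_continuous_interval[OF c1] set_integrable_continuous_interval[OF c2]] by linarith
qed

text \<open>Continuity of the flow at the axis, uniform over the time interval and with linear rate
  in \<rho>. The Lipschitz constants of \<open>Qz\<close> hold on a rectangle only, so a continuity
  argument backward in time is run to show that the trajectory stays inside. The number k is half
  the minimal height of the axial trajectory: remaining within k of it keeps the height at least
  k.\<close>

lemma axis_close:
  assumes z0: "z0 \<noteq> 0" and t: "0 < \<tau>"
  obtains \<rho>0 E k R where "0 < \<rho>0" "0 < k" "0 \<le> E" "1 \<le> R" "\<rho>0 \<le> 1"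
    "\<And>\<rho> s. \<rho> \<in> {0..\<rho>0} \<Longrightarrow> s \<in> {-\<tau>..0} \<Longrightarrow>
       fst (X s (\<rho>,z0)) \<in> {0..\<rho>} \<and> \<bar>snd (X s (\<rho>,z0)) - snd (X s (0,z0))\<bar> \<le> E * \<rho> \<and>
       \<bar>snd (X s (\<rho>,z0))\<bar> \<in> {k..R}"
proof -
  have h: "(\<rho>,z0) \<in> half_plane" if "0 \<le> \<rho>" for \<rho> using that by (simp add: half_plane_def)
  have o: "(0,z0) \<in> off_axis" using z0 by (simp add: off_axis_def half_plane_def)
  define \<zeta> where "\<zeta> s = snd (X s (0,z0))" for s
  have c\<zeta>: "continuous_on {-\<tau>..0} (\<lambda>s. \<bar>\<zeta> s\<bar>)" unfolding \<zeta>_def by (intro continuous_intros X_deriv(4) h) simp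
  have "\<exists>s\<in>{-\<tau>..0}. \<forall>t\<in>{-\<tau>..0}. \<bar>\<zeta> s\<bar> \<le> \<bar>\<zeta> t\<bar>" "\<exists>s\<in>{-\<tau>..0}. \<forall>t\<in>{-\<tau>..0}. \<bar>\<zeta> t\<bar> \<le> \<bar>\<zeta> s\<bar>"
    using continuous_attains_inf[OF _ _ c\<zeta>] continuous_attains_sup[OF _ _ c\<zeta>] t by auto
  then obtain s0 s1 where s0: "\<And>t. t \<in> {-\<tau>..0} \<Longrightarrow> \<bar>\<zeta> s0\<bar> \<le> \<bar>\<zeta> t\<bar>" and s1: "\<And>t. t \<in> {-\<tau>..0} \<Longrightarrow> \<bar>\<zeta> t\<bar> \<le> \<bar>\<zeta> s1\<bar>" by blast
  define k where "k = \<bar>\<zeta> s0\<bar> / 2"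
  define R where "R = \<bar>\<zeta> s1\<bar> + k + 1"
  have k: "0 < k" using X_off_axis[OF o, of s0] by (simp add: k_def \<zeta>_def off_axis_def)
  have R: "1 \<le> R" using k by (simp add: R_def)
  obtain L1 where L1: "\<And>r z z'. r \<in> {0..R} \<Longrightarrow> z \<in> {-R..R} \<Longrightarrow> z' \<in> {-R..R} \<Longrightarrow> \<bar>Qz (r,z) - Qz (r,z')\<bar> \<le> L1 * \<bar>z - z'\<bar>"
    using Qz_lip[of R] by blast
  obtain L2 where L2: "\<And>r z. r \<in> {0..R} \<Longrightarrow> z \<in> {-R..R} \<Longrightarrow> \<bar>Qz (r,z) - Qz (0,z)\<bar> \<le> L2 * r"
    using Qz_lip_r[of R] by blast
  define L where "L = \<bar>L1\<bar> + \<bar>L2\<bar>"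
  have L0: "0 \<le> L" by (simp add: L_def)
  define E where "E = exp (3 * L * \<tau>)"
  have E: "1 \<le> E" using L0 t by (simp add: E_def)
  \<comment> \<open>This gives E \<rho>0 \<le> k/2, so the final estimate is strictly better than
    the assumption |w| \<le> k under which it is derived.\<close>
  define \<rho>0 where "\<rho>0 = min 1 (k / (2 * E))"
  have r0: "0 < \<rho>0" "\<rho>0 \<le> 1" "E * \<rho>0 < k"
  proof -
    show "0 < \<rho>0" "\<rho>0 \<le> 1" using k E by (auto simp: \<rho>0_def)
    have "E * \<rho>0 \<le> E * (k / (2 * E))" using E by (intro mult_left_mono) (auto simp: \<rho>0_def)
    also have "\<dots> = k / 2" using E by simp
    finally show "E * \<rho>0 < k" using k by simp
  qed
  have main: "fst (X s (\<rho>,z0)) \<in> {0..\<rho>} \<and> \<bar>snd (X s (\<rho>,z0)) - \<zeta> s\<bar> \<le> E * \<rho>"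
    if \<rho>: "\<rho> \<in> {0..\<rho>0}" and s: "s \<in> {-\<tau>..0}" for \<rho> s
  proof -
    have hp: "(\<rho>,z0) \<in> half_plane" using \<rho> h by simp
    have fr: "fst (X u (\<rho>,z0)) \<in> {0..\<rho>}" if "u \<le> 0" for u
      using fst_le[OF hp that] X_half[OF hp, of u] by (simp add: half_plane_def)
    define w where "w u = snd (X u (\<rho>,z0)) - \<zeta> u" for u
    define w' where "w' u = Qz (X u (\<rho>,z0)) - Qz (X u (0,z0))" for u
    have dw: "(w has_real_derivative w' u) (at u)" for u
      unfolding w_def w'_def \<zeta>_def by (intro DERIV_diff X_deriv(3) h) (use \<rho> in auto)
    have cw: "continuous_on {-\<tau>..0} (\<lambda>u. \<bar>w u\<bar>)"
      using dw by (intro continuous_on_rabs) (meson DERIV_continuous_on has_field_derivative_at_within)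
    have w0: "w 0 = 0" using X_0[OF hp] X_0[OF h[of 0]] by (simp add: w_def \<zeta>_def)
    have step: "\<bar>w' u\<bar> \<le> L * (\<bar>w u\<bar> + \<rho>)" if u: "u \<in> {-\<tau>..0}" and wk: "\<bar>w u\<bar> \<le> k" for u
    proof -
      obtain r z where p: "X u (\<rho>,z0) = (r,z)" by (cases "X u (\<rho>,z0)")
      have p0: "X u (0,z0) = (0, \<zeta> u)" using fst_zero[of "(0,z0)" u] h[of 0] by (simp add: \<zeta>_def prod_eq_iff)
      have r: "0 \<le> r" "r \<le> \<rho>" using fr[of u] u p by auto
      have z: "z \<in> {-R..R}" "\<zeta> u \<in> {-R..R}" using wk s1[OF u] p k by (auto simp: w_def R_def)
      have rR: "r \<in> {0..R}" using r \<rho> r0 R by auto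
      have "\<bar>Qz (r,z) - Qz (r,\<zeta> u)\<bar> \<le> L1 * \<bar>z - \<zeta> u\<bar>" by (rule L1[OF rR z])
      also have "\<dots> \<le> L * \<bar>w u\<bar>" using p by (simp add: w_def L_def mult_right_mono)
      finally have e1: "\<bar>Qz (r,z) - Qz (r,\<zeta> u)\<bar> \<le> L * \<bar>w u\<bar>" .
      have "\<bar>Qz (r,\<zeta> u) - Qz (0,\<zeta> u)\<bar> \<le> L2 * r" by (rule L2[OF rR z(2)])
      also have "\<dots> \<le> L * \<rho>" using r by (intro mult_mono) (auto simp: L_def)
      finally have e2: "\<bar>Qz (r,\<zeta> u) - Qz (0,\<zeta> u)\<bar> \<le> L * \<rho>" .
      show ?thesis using e1 e2 by (simp add: w'_def p p0 distrib_left)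
    qed
    \<comment> \<open>Gronwall for w^2 + \<rho>^2, where the constant \<rho>^2 absorbs the
      inhomogeneous term L \<rho>. The rate is 3 L since 2 (w^2 + |w| \<rho>) is at most 3 (w^2 +
      \<rho>^2).\<close>
    have est: "(w u)\<^sup>2 \<le> (E * \<rho>)\<^sup>2" if u: "u \<in> {-\<tau>..0}" and all: "\<And>t. t \<in> {u..0} \<Longrightarrow> \<bar>w t\<bar> \<le> k" for u
    proof -
      have "(w u)\<^sup>2 + \<rho>\<^sup>2 \<le> ((w 0)\<^sup>2 + \<rho>\<^sup>2) * exp (3 * L * (0 - u))"
      proof (rule gronwall_two_sided(1)[where v="\<lambda>t. (w t)\<^sup>2 + \<rho>\<^sup>2" and v'="\<lambda>t. 2 * w t * w' t"])
        show "((\<lambda>t. (w t)\<^sup>2 + \<rho>\<^sup>2) has_real_derivative 2 * w t * w' t) (at t)" for t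
          using dw[of t] by (auto intro!: derivative_eq_intros)
        fix t assume t: "t \<in> {u..0}"
        then have t': "t \<in> {-\<tau>..0}" using u by auto
        have "\<bar>w t\<bar> * \<bar>w' t\<bar> \<le> \<bar>w t\<bar> * (L * (\<bar>w t\<bar> + \<rho>))" by (rule mult_left_mono[OF step[OF t' all[OF t]]]) simp
        then have "\<bar>2 * w t * w' t\<bar> \<le> 2 * (L * ((w t)\<^sup>2 + \<bar>w t\<bar> * \<rho>))" by (simp add: abs_mult power2_eq_square algebra_simps)
        also have "\<dots> \<le> 2 * (L * ((w t)\<^sup>2 + ((w t)\<^sup>2 + \<rho>\<^sup>2) / 2))"
        proof -
          have "\<bar>w t\<bar> * \<rho> \<le> ((w t)\<^sup>2 + \<rho>\<^sup>2) / 2"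
            using zero_le_power2[of "\<bar>w t\<bar> - \<rho>"] by (simp add: power2_diff)
          then show ?thesis using L0 by (intro mult_left_mono add_left_mono) auto
        qed
        also have "\<dots> \<le> 3 * L * ((w t)\<^sup>2 + \<rho>\<^sup>2)" using L0 by (simp add: algebra_simps)
        finally show "\<bar>2 * w t * w' t\<bar> \<le> 3 * L * ((w t)\<^sup>2 + \<rho>\<^sup>2)" .
      qed (use u in auto)
      also have "\<dots> \<le> \<rho>\<^sup>2 * E"
      proof -
        have "3 * L * (0 - u) \<le> 3 * L * \<tau>" using u L0 by (intro mult_left_mono) auto
        then show ?thesis unfolding w0 E_def by (auto intro!: mult_left_mono)
      qed
      also have "\<dots> \<le> \<rho>\<^sup>2 * E\<^sup>2" using E by (intro mult_left_mono) (auto simp: power2_eq_square)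
      finally have "(w u)\<^sup>2 + \<rho>\<^sup>2 \<le> (E * \<rho>)\<^sup>2" by (simp add: power_mult_distrib mult.commute)
      then show ?thesis using zero_le_power2[of \<rho>] by linarith
    qed
    have wk: "\<bar>w u\<bar> < k" if u: "u \<in> {-\<tau>..0}" for u
    proof (rule ccontr)
      assume "\<not> \<bar>w u\<bar> < k"
      \<comment> \<open>The largest element m of S is the failure closest to the initial time 0. On
        \<open>{m..0}\<close> the estimate applies, by continuity also at m, and contradicts the
        choice of \<rho>0.\<close>
      define S where "S = {v \<in> {-\<tau>..0}. k \<le> \<bar>w v\<bar>}"
      have uS: "u \<in> S" using u \<open>\<not> \<bar>w u\<bar> < k\<close> by (simp add: S_def)
      have "closed S" unfolding S_def
        by (rule continuous_on_closed_Collect_le[OF continuous_on_const cw]) simp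
      moreover have "bounded S" by (rule bounded_subset[of "{-\<tau>..0}"]) (auto simp: S_def)
      ultimately have "compact S" by (simp add: compact_eq_bounded_closed)
      then obtain m where m: "m \<in> S" "\<And>v. v \<in> S \<Longrightarrow> v \<le> m" using compact_attains_sup[of S] uS by blast
      have mm: "m \<in> {-\<tau>..0}" "k \<le> \<bar>w m\<bar>" using m by (auto simp: S_def)
      have lt: "\<bar>w v\<bar> < k" if "v \<in> {m<..0}" for v using m(2)[of v] that mm by (force simp: S_def)
      have m0: "m < 0" using mm w0 k by (cases "m = 0") auto
      have "\<bar>w m\<bar> \<le> k"
      proof (rule tendsto_upperbound)
        have "isCont (\<lambda>u. \<bar>w u\<bar>) m" using dw by (intro continuous_intros) (rule DERIV_isCont)
        then show "((\<lambda>u. \<bar>w u\<bar>) \<longlongrightarrow> \<bar>w m\<bar>) (at_right m)"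
          by (simp add: isCont_def filterlim_at_split)
        show "\<forall>\<^sub>F u in at_right m. \<bar>w u\<bar> \<le> k"
          using eventually_at_right_real[OF m0] by (rule eventually_mono) (use lt in force)
      qed simp
      then have "\<bar>w t\<bar> \<le> k" if "t \<in> {m..0}" for t using lt[of t] that by (cases "t = m") auto
      from est[OF mm(1) this] have "\<bar>w m\<bar> \<le> \<bar>E * \<rho>\<bar>" by (simp add: abs_le_square_iff)
      also have "\<dots> \<le> E * \<rho>0" using \<rho> E by (auto simp: abs_mult intro!: mult_left_mono)
      finally show False using mm r0 by simp
    qed
    have "(w s)\<^sup>2 \<le> (E * \<rho>)\<^sup>2" by (rule est[OF s]) (use wk s in \<open>auto intro: less_imp_le\<close>)
    then have "\<bar>w s\<bar> \<le> E * \<rho>" using E \<rho> by (simp add: abs_le_square_iff[symmetric])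
    then show ?thesis using fr[of s] s by (simp add: w_def)
  qed
  show ?thesis
  proof (rule that[of \<rho>0 k E R])
    fix \<rho> s assume \<rho>: "\<rho> \<in> {0..\<rho>0}" and s: "s \<in> {-\<tau>..0}"
    have "E * \<rho> \<le> E * \<rho>0" using \<rho> E by (intro mult_left_mono) auto
    then have "\<bar>snd (X s (\<rho>,z0)) - \<zeta> s\<bar> \<le> k" using main[OF \<rho> s] r0(3) by linarith
    moreover have "2 * k \<le> \<bar>\<zeta> s\<bar>" "\<bar>\<zeta> s\<bar> + k + 1 \<le> R" using s0[OF s] s1[OF s] by (auto simp: k_def R_def)
    ultimately have "k \<le> \<bar>snd (X s (\<rho>,z0))\<bar>" "\<bar>snd (X s (\<rho>,z0))\<bar> \<le> R" by arith+
    then have "\<bar>snd (X s (\<rho>,z0))\<bar> \<in> {k..R}" by simp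
    then show "fst (X s (\<rho>,z0)) \<in> {0..\<rho>} \<and> \<bar>snd (X s (\<rho>,z0)) - snd (X s (0,z0))\<bar> \<le> E * \<rho> \<and> \<bar>snd (X s (\<rho>,z0))\<bar> \<in> {k..R}"
      using main[OF \<rho> s] by (simp add: \<zeta>_def)
  qed (use r0 k E R in auto)
qed

text \<open>All trajectories from (\<rho>, z0) with \<rho> \<le> \<rho>0 stay in one compact K off
  the plane z = 0. There the integrands are continuous functions of the position, apart from the
  factor \<open>F'\<close>, which is bounded on the compact set of times and starting points. The
  limits of the integrands are precisely the values assigned by \<open>bdry_value\<close>.\<close>

lemma ibp_axis:
  assumes z0: "z0 \<noteq> 0" and t: "0 < \<tau>"
  defines "x \<equiv> (0,z0)"
  shows "set_integrable lborel {-\<tau>..0} (\<lambda>s. bdry_value (I1 s) x + bdry_value (I2 s) x)"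
    "(LBINT s:{-\<tau>..0}. dr g (X s x) * f (X s x)) =
       - (LBINT s:{-\<tau>..0}. bdry_value (I1 s) x + bdry_value (I2 s) x) + (bdry_value (Bd 0) x - bdry_value (Bd (-\<tau>)) x)"
proof -
  obtain \<rho>0 E k R where ac: "0 < \<rho>0" "0 < k" "0 \<le> E" "1 \<le> R" "\<rho>0 \<le> 1"
    and cl: "\<And>\<rho> s. \<rho> \<in> {0..\<rho>0} \<Longrightarrow> s \<in> {-\<tau>..0} \<Longrightarrow>
       fst (X s (\<rho>,z0)) \<in> {0..\<rho>} \<and> \<bar>snd (X s (\<rho>,z0)) - snd (X s (0,z0))\<bar> \<le> E * \<rho> \<and>
       \<bar>snd (X s (\<rho>,z0))\<bar> \<in> {k..R}"
    using axis_close[OF z0 t] by metis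
  define K where "K = {0..1::real} \<times> ({-R..-k} \<union> {k..R})"
  have cK: "compact K" unfolding K_def by (intro compact_Times compact_Un compact_Icc)
  have Kh: "K \<subseteq> half_plane" by (auto simp: K_def half_plane_def)
  have Ko: "K \<subseteq> off_axis" using ac by (auto simp: K_def half_plane_def off_axis_def)
  have XK: "X s (\<rho>,z0) \<in> K" if "\<rho> \<in> {0..\<rho>0}" "s \<in> {-\<tau>..0}" for \<rho> s
    using cl[OF that] ac that by (cases "X s (\<rho>,z0)") (auto simp: K_def)
  note r = reg[OF cK Ko zero_less_one]
  obtain hg where hg: "continuous_on K hg" "\<And>p. p \<in> K \<Longrightarrow> 0 < fst p \<Longrightarrow> hg p = g p / fst p"
    using r[THEN conjunct2, THEN conjunct2, THEN conjunct1] unfolding C0_upto_boundary_def by blast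
  obtain hz where hz: "continuous_on K hz" "\<And>p. p \<in> K \<Longrightarrow> 0 < fst p \<Longrightarrow> hz p = snd p * dz g p / fst p"
    using r[THEN conjunct2, THEN conjunct2, THEN conjunct2, THEN conjunct1] unfolding C0_upto_boundary_def by blast
  note rc = reg_cont[OF cK Ko]
  have Ane: "a p \<noteq> 0" if "p \<in> K" for p using a_pos[of p] Kh that by auto
  have sne: "snd p \<noteq> 0" if "p \<in> K" for p using Ko that by (auto simp: off_axis_def)
  note ch = continuous_on_subset[OF a_cont(1) Kh] continuous_on_subset[OF a1_cont Kh] continuous_on_subset[OF Qz_cont Kh]
  \<comment> \<open>E1 to E4 continue the terms of the identity to the axis, with \<open>hg\<close>
    in place of g/r and \<open>hz / snd p\<close> in place of \<open>dz g\<close> / r; heights in K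
    are bounded away from 0.\<close>
  define E1 where "E1 p = Qz p * f p * (hz p / snd p) / a p" for p
  define E2 where "E2 p = hg p / a p" for p
  define E3 where "E3 p = hg p * f p * ((a p)\<^sup>2 + a1 p) / (a p)\<^sup>2" for p
  define E4 where "E4 p = f p * hg p / a p" for p
  define E5 where "E5 p = dr g p * f p" for p
  have cE: "continuous_on K E1" "continuous_on K E2" "continuous_on K E3" "continuous_on K E4" "continuous_on K E5"
    unfolding E1_def E2_def E3_def E4_def E5_def
    by (intro continuous_on_mult continuous_on_divide continuous_on_add continuous_on_power rc(1) rc(3) ch hg(1) hz(1)
         continuous_on_snd continuous_on_id ballI; simp add: Ane sne)+
  define D where "D = {0..\<rho>0} \<times> {z0}"
  have D: "compact D" "D \<subseteq> off_axis" using z0 by (auto simp: D_def off_axis_def half_plane_def intro!: compact_Times)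
  have cF: "continuous_on ({-\<tau>..\<tau>} \<times> D) (\<lambda>(s,x). F' s x)" by (rule F'_cont[OF D t])
  have at0: "\<forall>\<^sub>F \<rho> in at_right 0. \<rho> \<in> {0<..\<rho>0}"
    using eventually_at_right_real[OF ac(1)] by (rule eventually_mono) auto
  have limX: "((\<lambda>\<rho>. X s (\<rho>,z0)) \<longlongrightarrow> X s x) (at_right 0)" if s: "s \<in> {-\<tau>..0}" for s
  proof -
    have "((\<lambda>\<rho>. fst (X s (\<rho>,z0))) \<longlongrightarrow> 0) (at_right 0)"
    proof (rule tendsto_sandwich)
      show "\<forall>\<^sub>F \<rho> in at_right 0. 0 \<le> fst (X s (\<rho>,z0))" "\<forall>\<^sub>F \<rho> in at_right 0. fst (X s (\<rho>,z0)) \<le> \<rho>"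
        using at0 by (rule eventually_mono, use cl[OF _ s] in force)+
    qed (auto intro!: tendsto_eq_intros)
    moreover have "((\<lambda>\<rho>. snd (X s (\<rho>,z0)) - snd (X s x)) \<longlongrightarrow> 0) (at_right 0)"
    proof (rule Lim_null_comparison)
      show "\<forall>\<^sub>F \<rho> in at_right 0. norm (snd (X s (\<rho>,z0)) - snd (X s x)) \<le> E * \<rho>"
        using at0 by (rule eventually_mono) (use cl[OF _ s] in \<open>auto simp: x_def\<close>)
    qed (auto intro!: tendsto_eq_intros)
    then have "((\<lambda>\<rho>. snd (X s (\<rho>,z0))) \<longlongrightarrow> snd (X s x)) (at_right 0)" by (simp add: LIM_zero_iff)
    ultimately have "((\<lambda>\<rho>. (fst (X s (\<rho>,z0)), snd (X s (\<rho>,z0)))) \<longlongrightarrow> (0, snd (X s x))) (at_right 0)"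
      by (rule tendsto_Pair)
    moreover have "(0, snd (X s x)) = X s x"
      using fst_zero[of x s] by (simp add: x_def half_plane_def prod_eq_iff)
    ultimately show ?thesis by simp
  qed
  have X0K: "X s x \<in> K" if "s \<in> {-\<tau>..0}" for s using XK[of 0 s] that ac by (simp add: x_def)
  have limE: "((\<lambda>\<rho>. \<phi> (X s (\<rho>,z0))) \<longlongrightarrow> \<phi> (X s x)) (at_right 0)"
    if \<phi>: "continuous_on K \<phi>" and s: "s \<in> {-\<tau>..0}" for \<phi> :: "real \<times> real \<Rightarrow> real" and s
    by (rule continuous_on_tendsto_compose[OF \<phi> limX[OF s] X0K[OF s]])
       (use at0 in \<open>rule eventually_mono\<close>, use XK[OF _ s] in force)
  have limF: "((\<lambda>\<rho>. F' s (\<rho>,z0)) \<longlongrightarrow> F' s x) (at_right 0)" if s: "s \<in> {-\<tau>..0}" for s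
  proof -
    have "((\<lambda>\<rho>. (\<lambda>(s,x). F' s x) (s,(\<rho>,z0))) \<longlongrightarrow> (\<lambda>(s,x). F' s x) (s,x)) (at_right 0)"
    proof (rule continuous_on_tendsto_compose[OF cF])
      show "((\<lambda>\<rho>. (s,(\<rho>,z0))) \<longlongrightarrow> (s,x)) (at_right 0)"
        unfolding x_def by (intro tendsto_intros)
      show "(s,x) \<in> {-\<tau>..\<tau>} \<times> D" using s ac by (simp add: D_def x_def)
      show "\<forall>\<^sub>F \<rho> in at_right 0. (s,(\<rho>,z0)) \<in> {-\<tau>..\<tau>} \<times> D"
        using at0 by (rule eventually_mono) (use s in \<open>auto simp: D_def\<close>)
    qed
    then show ?thesis by simp
  qed
  have eqs: "I1 s (\<rho>,z0) = E1 (X s (\<rho>,z0))"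
    "I2 s (\<rho>,z0) = E2 (X s (\<rho>,z0)) * F' s (\<rho>,z0) - E3 (X s (\<rho>,z0))"
    "Bd s (\<rho>,z0) = E4 (X s (\<rho>,z0))" if \<rho>: "\<rho> \<in> {0<..\<rho>0}" and s: "s \<in> {-\<tau>..0}" for \<rho> s
  proof -
    have h: "(\<rho>,z0) \<in> half_plane" "(\<rho>,z0) \<in> off_axis" and f0: "0 < fst (\<rho>,z0)"
      using \<rho> z0 by (auto simp: half_plane_def off_axis_def)
    have XKs: "X s (\<rho>,z0) \<in> K" using XK[OF _ s] \<rho> by simp
    have pos: "0 < fst (X s (\<rho>,z0))" by (rule fst_pos[OF h(1) f0])
    note * = hg(2)[OF XKs pos] hz(2)[OF XKs pos] Qr_eq[OF X_half[OF h(1)], of s]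
    note ** = Ane[OF XKs] sne[OF XKs] pos
    show "I1 s (\<rho>,z0) = E1 (X s (\<rho>,z0))" unfolding I1_def E1_def * using ** by (simp add: field_simps)
    show "Bd s (\<rho>,z0) = E4 (X s (\<rho>,z0))" unfolding Bd_def E4_def * using ** by (simp add: field_simps)
    show "I2 s (\<rho>,z0) = E2 (X s (\<rho>,z0)) * F' s (\<rho>,z0) - E3 (X s (\<rho>,z0))"
      unfolding I2_eq[OF h(2) f0] E2_def E3_def * using ** by (simp add: field_simps)
  qed
  define J where "J s = E1 (X s x) + (E2 (X s x) * F' s x - E3 (X s x))" for s
  have b1: "bdry_value (I1 s) x = E1 (X s x)" "bdry_value (I2 s) x = E2 (X s x) * F' s x - E3 (X s x)"
    "bdry_value (Bd s) x = E4 (X s x)" if s: "s \<in> {-\<tau>..0}" for s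
  proof -
    have ev: "\<forall>\<^sub>F \<rho> in at_right 0. E1 (X s (\<rho>,z0)) = I1 s (\<rho>,z0)"
       "\<forall>\<^sub>F \<rho> in at_right 0. E2 (X s (\<rho>,z0)) * F' s (\<rho>,z0) - E3 (X s (\<rho>,z0)) = I2 s (\<rho>,z0)"
       "\<forall>\<^sub>F \<rho> in at_right 0. E4 (X s (\<rho>,z0)) = Bd s (\<rho>,z0)"
      by (rule eventually_mono[OF at0], simp add: eqs[OF _ s])+
    have 1: "((\<lambda>\<rho>. I1 s (\<rho>,z0)) \<longlongrightarrow> E1 (X s x)) (at_right 0)"
      by (rule Lim_transform_eventually[OF limE[OF cE(1) s] ev(1)])
    have 2: "((\<lambda>\<rho>. I2 s (\<rho>,z0)) \<longlongrightarrow> E2 (X s x) * F' s x - E3 (X s x)) (at_right 0)"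
      by (rule Lim_transform_eventually[OF tendsto_diff[OF tendsto_mult[OF limE[OF cE(2) s] limF[OF s]] limE[OF cE(3) s]] ev(2)])
    have 3: "((\<lambda>\<rho>. Bd s (\<rho>,z0)) \<longlongrightarrow> E4 (X s x)) (at_right 0)"
      by (rule Lim_transform_eventually[OF limE[OF cE(4) s] ev(3)])
    show "bdry_value (I1 s) x = E1 (X s x)" "bdry_value (I2 s) x = E2 (X s x) * F' s x - E3 (X s x)"
      "bdry_value (Bd s) x = E4 (X s x)"
      using tendsto_Lim[OF trivial_limit_at_right_real 1] tendsto_Lim[OF trivial_limit_at_right_real 2]
        tendsto_Lim[OF trivial_limit_at_right_real 3] by (simp_all add: bdry_value_def x_def)
  qed
  have bounded: "\<exists>M. \<forall>p\<in>S. \<bar>\<phi> p\<bar> \<le> M" if "compact S" "continuous_on S \<phi>" for S and \<phi> :: "'b::metric_space \<Rightarrow> real"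
    using compact_imp_bounded[OF compact_continuous_image[OF that(2,1)]] by (auto simp: bounded_iff)
  obtain M1 where M1: "\<And>p. p \<in> K \<Longrightarrow> \<bar>E1 p\<bar> \<le> M1" using bounded[OF cK cE(1)] by blast
  obtain M2 where M2: "\<And>p. p \<in> K \<Longrightarrow> \<bar>E2 p\<bar> \<le> M2" using bounded[OF cK cE(2)] by blast
  obtain M3 where M3: "\<And>p. p \<in> K \<Longrightarrow> \<bar>E3 p\<bar> \<le> M3" using bounded[OF cK cE(3)] by blast
  obtain M5 where M5: "\<And>p. p \<in> K \<Longrightarrow> \<bar>E5 p\<bar> \<le> M5" using bounded[OF cK cE(5)] by blast
  obtain M6 where M6: "\<And>p. p \<in> {-\<tau>..\<tau>} \<times> D \<Longrightarrow> \<bar>(\<lambda>(s,x). F' s x) p\<bar> \<le> M6"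
    using bounded[OF compact_Times[OF compact_Icc D(1)] cF] by blast
  define \<rho> where "\<rho> n = \<rho>0 / real (Suc n)" for n
  have \<rho>: "\<rho> n \<in> {0<..\<rho>0}" for n using ac by (auto simp: \<rho>_def divide_simps)
  have \<rho>0: "filterlim \<rho> (at_right 0) sequentially" unfolding filterlim_at
  proof (intro conjI always_eventually allI)
    show "\<rho> n \<in> {0<..}" "\<rho> n \<noteq> 0" for n using \<rho>[of n] by auto
    show "\<rho> \<longlonglongrightarrow> 0" unfolding \<rho>_def by (rule LIMSEQ_Suc[OF lim_const_over_n])
  qed
  have yo: "(\<rho> n, z0) \<in> off_axis" "0 < fst (\<rho> n, z0)" for n
    using \<rho>[of n] z0 by (auto simp: off_axis_def half_plane_def)
  note ii = ibp_interior[OF yo t]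
  have XKn: "X s (\<rho> n, z0) \<in> K" if "s \<in> {-\<tau>..0}" for n s using XK[OF _ that] \<rho>[of n] by simp
  have IM: "\<bar>I1 s (\<rho> n, z0) + I2 s (\<rho> n, z0)\<bar> \<le> M1 + (M2 * M6 + M3)" if s: "s \<in> {-\<tau>..0}" for n s
  proof -
    have "\<bar>E2 (X s (\<rho> n,z0)) * F' s (\<rho> n,z0)\<bar> \<le> M2 * M6"
      unfolding abs_mult using M2[OF XKn[OF s]] M6[of "(s,(\<rho> n,z0))"] s \<rho>[of n]
      by (intro mult_mono) (auto simp: D_def intro: order_trans[OF abs_ge_zero])
    then show "\<bar>I1 s (\<rho> n, z0) + I2 s (\<rho> n, z0)\<bar> \<le> M1 + (M2 * M6 + M3)"
      unfolding eqs[OF \<rho> s] using M1[OF XKn[OF s, of n]] M3[OF XKn[OF s, of n]] by arith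
  qed
  have IJ: "(\<lambda>n. I1 s (\<rho> n, z0) + I2 s (\<rho> n, z0)) \<longlonglongrightarrow> J s" if s: "s \<in> {-\<tau>..0}" for s
    unfolding eqs[OF \<rho> s] J_def
    by (intro tendsto_intros filterlim_compose[OF limE[OF _ s] \<rho>0] filterlim_compose[OF limF[OF s] \<rho>0] cE)
  note dI = bounded_convergence_interval(1)[OF ii(2) IM IJ] and lI = bounded_convergence_interval(2)[OF ii(2) IM IJ]
  have "(\<lambda>n. LBINT s:{-\<tau>..0}. dr g (X s (\<rho> n, z0)) * f (X s (\<rho> n, z0))) \<longlonglongrightarrow> (LBINT s:{-\<tau>..0}. dr g (X s x) * f (X s x))"
  proof (rule bounded_convergence_interval(2)[where M=M5, OF ii(1)])
    fix n s assume s: "s \<in> {-\<tau>..0}"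
    show "\<bar>dr g (X s (\<rho> n, z0)) * f (X s (\<rho> n, z0))\<bar> \<le> M5" using M5[OF XKn[OF s]] by (simp add: E5_def)
  next
    fix s assume s: "s \<in> {-\<tau>..0}"
    show "(\<lambda>n. dr g (X s (\<rho> n, z0)) * f (X s (\<rho> n, z0))) \<longlonglongrightarrow> dr g (X s x) * f (X s x)"
      using filterlim_compose[OF limE[OF cE(5) s] \<rho>0] unfolding E5_def .
  qed
  moreover have "(\<lambda>n. LBINT s:{-\<tau>..0}. dr g (X s (\<rho> n, z0)) * f (X s (\<rho> n, z0))) \<longlonglongrightarrow>
       - (LBINT s:{-\<tau>..0}. J s) + (E4 (X 0 x) - E4 (X (-\<tau>) x))"
  proof -
    have s: "0 \<in> {-\<tau>..0}" "-\<tau> \<in> {-\<tau>..0}" using t by auto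
    have "(\<lambda>n. - (LBINT s:{-\<tau>..0}. I1 s (\<rho> n, z0) + I2 s (\<rho> n, z0)) + (E4 (X 0 (\<rho> n, z0)) - E4 (X (-\<tau>) (\<rho> n, z0)))) \<longlonglongrightarrow>
       - (LBINT s:{-\<tau>..0}. J s) + (E4 (X 0 x) - E4 (X (-\<tau>) x))"
      by (intro tendsto_intros lI filterlim_compose[OF limE \<rho>0] cE s)
    then show ?thesis unfolding ii(3) using eqs(3)[OF \<rho> s(1)] eqs(3)[OF \<rho> s(2)] by simp
  qed
  ultimately have "(LBINT s:{-\<tau>..0}. dr g (X s x) * f (X s x)) = - (LBINT s:{-\<tau>..0}. J s) + (E4 (X 0 x) - E4 (X (-\<tau>) x))"
    by (rule LIMSEQ_unique)
  moreover have Jeq: "J s = bdry_value (I1 s) x + bdry_value (I2 s) x" if "s \<in> {-\<tau>..0}" for s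
    using b1[OF that] by (simp add: J_def)
  have "(LBINT s:{-\<tau>..0}. J s) = (LBINT s:{-\<tau>..0}. bdry_value (I1 s) x + bdry_value (I2 s) x)"
    by (rule set_lebesgue_integral_cong) (use Jeq in auto)
  ultimately show "(LBINT s:{-\<tau>..0}. dr g (X s x) * f (X s x)) =
       - (LBINT s:{-\<tau>..0}. bdry_value (I1 s) x + bdry_value (I2 s) x) + (bdry_value (Bd 0) x - bdry_value (Bd (-\<tau>)) x)"
    using b1(3)[of 0] b1(3)[of "-\<tau>"] t by simp
  show "set_integrable lborel {-\<tau>..0} (\<lambda>s. bdry_value (I1 s) x + bdry_value (I2 s) x)"
    by (rule set_integrable_cong[OF refl refl, THEN iffD1, OF Jeq dI])
qed

lemma ibp:
  assumes x: "x \<in> off_axis" and t: "0 < \<tau>"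
  shows "set_integrable lborel {-\<tau>..0} (\<lambda>s. dr g (X s x) * f (X s x))"
    "set_integrable lborel {-\<tau>..0} (\<lambda>s. bdry_value (I1 s) x + bdry_value (I2 s) x)"
    "(LBINT s:{-\<tau>..0}. dr g (X s x) * f (X s x)) =
       - (LBINT s:{-\<tau>..0}. bdry_value (I1 s) x + bdry_value (I2 s) x) + (bdry_value (Bd 0) x - bdry_value (Bd (-\<tau>)) x)"
proof -
  show "set_integrable lborel {-\<tau>..0} (\<lambda>s. dr g (X s x) * f (X s x))"
    by (intro set_integrable_continuous_interval continuous_on_mult traj_cont x)
  show "set_integrable lborel {-\<tau>..0} (\<lambda>s. bdry_value (I1 s) x + bdry_value (I2 s) x)"
    "(LBINT s:{-\<tau>..0}. dr g (X s x) * f (X s x)) =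
       - (LBINT s:{-\<tau>..0}. bdry_value (I1 s) x + bdry_value (I2 s) x) + (bdry_value (Bd 0) x - bdry_value (Bd (-\<tau>)) x)"
  proof (atomize(full), cases "fst x = 0")
    case True
    then have e: "x = (0, snd x)" "snd x \<noteq> 0" using x by (auto simp: off_axis_def prod_eq_iff)
    show "set_integrable lborel {-\<tau>..0} (\<lambda>s. bdry_value (I1 s) x + bdry_value (I2 s) x) \<and>
     (LBINT s:{-\<tau>..0}. dr g (X s x) * f (X s x)) =
       - (LBINT s:{-\<tau>..0}. bdry_value (I1 s) x + bdry_value (I2 s) x) + (bdry_value (Bd 0) x - bdry_value (Bd (-\<tau>)) x)"
      using ibp_axis[OF e(2) t] unfolding e(1)[symmetric] by (rule conjI)
  next
    case False
    then have f0: "0 < fst x" using x by (auto simp: off_axis_def half_plane_def)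
    have b: "bdry_value u x = u x" for u using False by (simp add: bdry_value_def)
    show "set_integrable lborel {-\<tau>..0} (\<lambda>s. bdry_value (I1 s) x + bdry_value (I2 s) x) \<and>
     (LBINT s:{-\<tau>..0}. dr g (X s x) * f (X s x)) =
       - (LBINT s:{-\<tau>..0}. bdry_value (I1 s) x + bdry_value (I2 s) x) + (bdry_value (Bd 0) x - bdry_value (Bd (-\<tau>)) x)"
      unfolding b using ibp_interior(3)[OF x f0 t] set_integrable_continuous_interval[OF ibp_interior(2)[OF x f0 t]] by blast
  qed
qed

end

section \<open>Positivity of the radial strain rate\<close>

lemma compact_rect_bound:
  fixes F :: "real \<times> real \<Rightarrow> real"
  assumes "continuous_on half_plane F"
  obtains M where "0 \<le> M" "\<And>r z. r \<in> {0..R} \<Longrightarrow> z \<in> {-R..R} \<Longrightarrow> \<bar>F (r,z)\<bar> \<le> M"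
proof -
  have "compact (F ` ({0..R} \<times> {-R..R}))"
    by (intro compact_continuous_image continuous_on_subset[OF assms] compact_Times compact_Icc) (auto simp: half_plane_def)
  then obtain M where "\<forall>y\<in>F ` ({0..R} \<times> {-R..R}). norm y \<le> M"
    using compact_imp_bounded bounded_iff by metis
  then have M: "\<bar>F (r,z)\<bar> \<le> M" if "r \<in> {0..R}" "z \<in> {-R..R}" for r z using that by auto
  show ?thesis by (rule that[of "max 0 M"]) (use M in \<open>auto simp: le_max_iff_disj\<close>)
qed

text \<open>The z derivative of \<open>Uz\<close> is cl + 2 F + r \<open>dr F\<close>, locally
  bounded. An r derivative of \<open>Uz\<close> would involve a second r derivative of G; the
  difference to the axis does not, being 2 (G(r,z) - G(0,z)) + r H(r,z), bounded by a multiple of r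
  through bounds on H alone.\<close>

lemma strain_flow_of_stream_function:
  fixes F G :: "real \<times> real \<Rightarrow> real" and cl :: real
  assumes F: "continuous_on half_plane F" "continuous_on half_plane (dr F)" "continuous_on half_plane (dz F)"
    and dF: "\<And>r z. 0 \<le> r \<Longrightarrow> ((\<lambda>r. F (r,z)) has_real_derivative dr F (r,z)) (at r within {0..})"
      "\<And>r z. 0 \<le> r \<Longrightarrow> ((\<lambda>z. F (r,z)) has_real_derivative dz F (r,z)) (at z)"
    and G: "\<And>r. 0 \<le> r \<Longrightarrow> G (r,0) = 0" "\<And>r z. 0 \<le> r \<Longrightarrow> ((\<lambda>z. G (r,z)) has_real_derivative F (r,z)) (at z)"
    and pos: "\<And>p. p \<in> half_plane \<Longrightarrow> F p < cl"
    and Ur: "\<And>p. Ur p = cl * fst p - fst p * dz G p"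
    and Uz: "\<And>p. Uz p = cl * snd p + 2 * G p + fst p * dr G p"
    and flow: "is_flow (\<lambda>p. (Ur p, Uz p)) X"
  shows "strain_flow (\<lambda>p. cl - F p) Ur Uz X"
proof -
  define H where "H p = integral {0..1} (\<lambda>s. snd p * dr F (fst p, s * snd p))" for p
  note zp = z_primitive[OF F(1,2) dF(1) G, folded H_def]
  have drG: "dr G p = H p" if "p \<in> half_plane" for p
    using dr_eqI[OF _ zp(3), of "fst p" "snd p"] that by (simp add: half_plane_def)
  have dzG: "dz G p = F p" if "p \<in> half_plane" for p
    using dz_eqI[OF G(2), of "fst p" "snd p"] that by (simp add: half_plane_def)
  have da: "((\<lambda>r. cl - F (r,z)) has_real_derivative - dr F (r,z)) (at r within {0..})"
    "((\<lambda>z. cl - F (r,z)) has_real_derivative - dz F (r,z)) (at z)" if "0 \<le> r" for r z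
    using dF[OF that, of z] by (auto intro!: derivative_eq_intros)
  have dra: "dr (\<lambda>p. cl - F p) p = - dr F p" "dz (\<lambda>p. cl - F p) p = - dz F p" if "p \<in> half_plane" for p
    using dr_eqI[OF _ da(1), of "fst p" "snd p"] dz_eqI[OF da(2), of "fst p" "snd p"] that by (simp_all add: half_plane_def)
  have Uz': "Uz p = cl * snd p + 2 * G p + fst p * H p" if "p \<in> half_plane" for p using Uz drG[OF that] by simp
  show ?thesis
  proof
    show "continuous_on half_plane (\<lambda>p. cl - F p)" by (intro continuous_intros F)
    show "continuous_on half_plane (dr (\<lambda>p. cl - F p))" "continuous_on half_plane (dz (\<lambda>p. cl - F p))"
      by (rule continuous_on_eq[OF continuous_on_minus[OF F(2)]], simp add: dra)
         (rule continuous_on_eq[OF continuous_on_minus[OF F(3)]], simp add: dra)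
    show "0 < cl - F p" if "p \<in> half_plane" for p using pos[OF that] by simp
    show "((\<lambda>r. cl - F (r,z)) has_real_derivative dr (\<lambda>p. cl - F p) (r,z)) (at r within {0..})"
      "((\<lambda>z. cl - F (r,z)) has_real_derivative dz (\<lambda>p. cl - F p) (r,z)) (at z)" if "0 \<le> r" for r z
      using da[OF that, of z] dra[of "(r,z)"] that by (simp_all add: half_plane_def)
    show "Ur p = fst p * (cl - F p)" if "p \<in> half_plane" for p
      using Ur[of p] dzG[OF that] by (simp add: algebra_simps)
    have "continuous_on half_plane (\<lambda>p. cl * snd p + 2 * G p + fst p * H p)"
      by (intro continuous_intros zp(1,2))
    then show "continuous_on half_plane Uz" by (rule continuous_on_eq) (simp add: Uz')
    show "Uz (r,0) = 0" if "0 \<le> r" for r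
      using Uz'[of "(r,0)"] G(1)[OF that] that by (simp add: half_plane_def H_def)
    show "is_flow (\<lambda>p. (Ur p, Uz p)) X" by (rule flow)
    fix R :: real
    obtain M1 where M1: "0 \<le> M1" "\<And>r z. r \<in> {0..R} \<Longrightarrow> z \<in> {-R..R} \<Longrightarrow> \<bar>F (r,z)\<bar> \<le> M1"
      using compact_rect_bound[OF F(1)] by blast
    obtain M2 where M2: "0 \<le> M2" "\<And>r z. r \<in> {0..R} \<Longrightarrow> z \<in> {-R..R} \<Longrightarrow> \<bar>dr F (r,z)\<bar> \<le> M2"
      using compact_rect_bound[OF F(2)] by blast
    obtain M3 where M3: "0 \<le> M3" "\<And>r z. r \<in> {0..R} \<Longrightarrow> z \<in> {-R..R} \<Longrightarrow> \<bar>H (r,z)\<bar> \<le> M3"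
      using compact_rect_bound[OF zp(2)] by blast
    have "\<bar>Uz (r,z) - Uz (r,z')\<bar> \<le> (\<bar>cl\<bar> + 2 * M1 + R * M2) * \<bar>z - z'\<bar>"
      if r: "r \<in> {0..R}" and z: "z \<in> {-R..R}" "z' \<in> {-R..R}" for r z z'
    proof -
      have "norm ((cl * z + 2 * G (r,z) + r * H (r,z)) - (cl * z' + 2 * G (r,z') + r * H (r,z'))) \<le> (\<bar>cl\<bar> + 2 * M1 + R * M2) * norm (z - z')"
      proof (rule field_differentiable_bound[OF convex_real_interval(5) _ _ z])
        fix y assume y: "y \<in> {-R..R}"
        show "((\<lambda>z. cl * z + 2 * G (r,z) + r * H (r,z)) has_real_derivative cl + 2 * F (r,y) + r * dr F (r,y)) (at y within {-R..R})"
          by (rule has_field_derivative_at_within, rule DERIV_add[OF DERIV_add[OF DERIV_cmult_Id DERIV_cmult[OF G(2)]] DERIV_cmult[OF zp(4)]])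
             (use r in auto)
        have "\<bar>r * dr F (r,y)\<bar> \<le> R * M2" unfolding abs_mult using r M2(2)[OF r y] by (intro mult_mono) auto
        then show "norm (cl + 2 * F (r,y) + r * dr F (r,y)) \<le> \<bar>cl\<bar> + 2 * M1 + R * M2"
          using M1(2)[OF r y] unfolding real_norm_def by arith
      qed
      then show ?thesis using Uz'[of "(r,z)"] Uz'[of "(r,z')"] r by (simp add: half_plane_def)
    qed
    then show "\<exists>L. \<forall>r\<in>{0..R}. \<forall>z\<in>{-R..R}. \<forall>z'\<in>{-R..R}. \<bar>Uz (r,z) - Uz (r,z')\<bar> \<le> L * \<bar>z - z'\<bar>" by blast
    have "\<bar>Uz (r,z) - Uz (0,z)\<bar> \<le> (3 * M3) * r" if r: "r \<in> {0..R}" and z: "z \<in> {-R..R}" for r z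
    proof -
      have "norm (G (r,z) - G (0,z)) \<le> M3 * norm (r - 0)"
      proof (rule field_differentiable_bound[OF convex_real_interval(5)[of 0 R]])
        fix y assume y: "y \<in> {0..R}"
        show "((\<lambda>r. G (r,z)) has_real_derivative H (y,z)) (at y within {0..R})"
          using zp(3)[of y z] y by (auto intro: has_field_derivative_subset)
        show "norm (H (y,z)) \<le> M3" using M3(2)[OF y z] by simp
      qed (use r in auto)
      moreover have "\<bar>r * H (r,z)\<bar> \<le> r * M3" unfolding abs_mult using r M3(2)[OF r z] by (intro mult_mono) auto
      moreover have "Uz (r,z) - Uz (0,z) = 2 * (G (r,z) - G (0,z)) + r * H (r,z)"
        using Uz'[of "(r,z)"] Uz'[of "(0,z)"] r by (simp add: half_plane_def)
      moreover have "\<bar>2 * d1 + d2\<bar> \<le> 3 * m" if "\<bar>d1\<bar> \<le> m" "\<bar>d2\<bar> \<le> m" for d1 d2 m :: real using that by arith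
      ultimately show ?thesis using r by (simp add: mult.commute mult.left_commute)
    qed
    then show "\<exists>L. \<forall>r\<in>{0..R}. \<forall>z\<in>{-R..R}. \<bar>Uz (r,z) - Uz (0,z)\<bar> \<le> L * r" by blast
  qed
qed

lemma has_bochner_integral_powr_tail:
  fixes d :: real
  assumes "0 < d"
  shows "has_bochner_integral lborel (\<lambda>y. indicator {1..} y * y powr (-1 - d)) (1/d)"
  using nn_integral_powr_at_infinity[of d 1] assms by (intro has_bochner_integral_nn_integral) auto

text \<open>W has a fixed sign, so the part y \<ge> 1 bounds the whole integral, and there the power
  integral equals 1/(au - \<alpha>). The upper bound on |W| provides integrability; an undefined
  integral would have the value 0.\<close>

lemma profile_moment:
  fixes W :: "real \<Rightarrow> real"
  assumes meas: "W \<in> borel_measurable borel" and neg: "\<And>x. 0 < x \<Longrightarrow> W x < 0"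
    and lo: "\<And>x. 0 < x \<Longrightarrow> c0 * min x (x powr (-au)) \<le> \<bar>W x\<bar>"
    and up: "\<And>x. 0 < x \<Longrightarrow> \<bar>W x\<bar> \<le> C0 * min x (x powr (-al))"
    and a: "0 < \<alpha>" "\<alpha> < al" "\<alpha> < au" and C: "0 \<le> C0"
  shows "(LBINT y:{0..}. y powr (\<alpha> - 1) * W y) \<le> - (c0 / (au - \<alpha>))"
proof -
  define h where "h y = indicator {0..} y * (y powr (\<alpha> - 1) * W y)" for y
  have [measurable]: "W \<in> borel_measurable borel" by (rule meas)
  have hm: "h \<in> borel_measurable lborel" unfolding h_def by measurable
  have int1: "integrable lborel (\<lambda>y. C0 * (indicator {0..1} y + indicator {1..} y * y powr (-1 - (al - \<alpha>))))"
    using has_bochner_integral_powr_tail[of "al - \<alpha>"] a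
      set_integrable_continuous_interval[OF continuous_on_const[of "{0..1}" 1]]
    by (intro integrable_mult_right integrable_add) (auto simp: has_bochner_integral_iff set_integrable_def)
  have bd: "\<bar>h y\<bar> \<le> C0 * (indicator {0..1} y + indicator {1..} y * y powr (-1 - (al - \<alpha>)))" for y
  proof (cases "0 < y")
    case False
    then have "h y = 0" by (auto simp: h_def split: split_indicator)
    then show ?thesis using C by (auto intro!: mult_nonneg_nonneg)
  next
    case y: True
    have h: "\<bar>h y\<bar> = y powr (\<alpha> - 1) * \<bar>W y\<bar>" using y by (simp add: h_def abs_mult)
    show ?thesis
    proof (cases "y \<le> 1")
      case True
      have "y powr (\<alpha> - 1) * \<bar>W y\<bar> \<le> y powr (\<alpha> - 1) * (C0 * y)"
        using up[OF y] mult_left_mono[OF min.cobounded1 C, of y "y powr (-al)"] by (intro mult_left_mono) auto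
      also have "\<dots> = C0 * y powr \<alpha>" using y by (simp add: powr_diff)
      also have "\<dots> \<le> C0 * 1" using y True a C by (intro mult_left_mono powr_le1) auto
      also have "\<dots> \<le> C0 * (indicator {0..1} y + indicator {1..} y * y powr (-1 - (al - \<alpha>)))"
        using y True C by (intro mult_left_mono) auto
      finally show ?thesis by (simp add: h)
    next
      case False
      have "y powr (\<alpha> - 1) * \<bar>W y\<bar> \<le> y powr (\<alpha> - 1) * (C0 * y powr (-al))"
        using up[OF y] mult_left_mono[OF min.cobounded2 C, of y "y powr (-al)"] by (intro mult_left_mono) auto
      also have "\<dots> = C0 * y powr (-1 - (al - \<alpha>))" by (simp add: powr_add[symmetric] algebra_simps)
      finally show ?thesis using y False by (simp add: h)
    qed
  qed
  have hi: "integrable lborel h" by (rule Bochner_Integration.integrable_bound[OF int1 hm])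
      (intro AE_I2, simp only: real_norm_def, rule order_trans[OF bd abs_ge_self])
  have low: "c0 * (indicator {1..} y * y powr (-1 - (au - \<alpha>))) \<le> - h y" for y
  proof (cases "1 \<le> y")
    case False
    have "0 \<le> - h y" using neg[of y] by (cases "y = 0") (auto simp: h_def mult_le_0_iff split: split_indicator)
    then show ?thesis using False by simp
  next
    case y: True
    then have "y powr (-au) \<le> y powr 1" using a by (intro powr_mono) auto
    then have "c0 * y powr (-au) \<le> - W y" using lo[of y] neg[of y] y by simp
    then have "y powr (\<alpha> - 1) * (c0 * y powr (-au)) \<le> y powr (\<alpha> - 1) * - W y" by (intro mult_left_mono) auto
    moreover have "y powr (\<alpha> - 1) * (c0 * y powr (-au)) = c0 * y powr (-1 - (au - \<alpha>))" by (simp add: powr_add[symmetric] algebra_simps)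
    ultimately show ?thesis using y by (simp add: h_def)
  qed
  have t: "has_bochner_integral lborel (\<lambda>y. c0 * (indicator {1..} y * y powr (-1 - (au - \<alpha>)))) (c0 * (1 / (au - \<alpha>)))"
    using a by (intro has_bochner_integral_mult_right has_bochner_integral_powr_tail) auto
  have "c0 * (1 / (au - \<alpha>)) \<le> (\<integral>y. - h y \<partial>lborel)"
    unfolding has_bochner_integral_integral_eq[OF t, symmetric]
    by (rule integral_mono[OF _ _ low]) (use t hi in \<open>auto simp: has_bochner_integral_iff\<close>)
  then show ?thesis by (simp add: set_lebesgue_integral_def h_def)
qed

text \<open>Origin of the constants: 22176 = 7 * 3168 bounds the profile strain. The perturbation
  strain enters 1 + 2 = 3 times, once at the point and twice at the origin through
  \<open>c_l\<close>, so 774144 = 3 * 7 * 36864 with 36864 = 2 * 3 * 6144. On the other side, 4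
  \<alpha> \<ge> 12/10 and \<open>alpha_u\<close> - \<alpha> \<le> 2 \<epsilon> give 6/10
  c0/\<epsilon>.\<close>

lemma velocity_strain_flow:
  fixes W W13 :: "real \<Rightarrow> real" and \<omega> :: "real \<times> real \<Rightarrow> real"
  assumes e: "0 < \<epsilon>" "\<epsilon> \<le> 1/30" "\<alpha> = 1/3 - \<epsilon>" and b: "b \<le> 0"
    and cW: "0 < cW" "cW * \<epsilon> powr (1 - kappa) \<le> kappa1" and C13: "0 \<le> C13" and c0: "0 < c0"
    and W13: "\<And>y. 0 \<le> y \<Longrightarrow> \<bar>W13 y\<bar> \<le> C13 * min y (jap y powr (-1/3))"
    and small: "774144 * (1 + 2 * C13) * \<epsilon> powr ((1 - kappa) / 2) + 22176 * C0 * \<epsilon> < 6/10 * c0"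
    and sm: "smooth1 W" and W_odd: "\<And>x. W (- x) = - W x" and neg: "\<And>x. 0 < x \<Longrightarrow> W x < 0"
    and lo: "\<And>x. 0 < x \<Longrightarrow> c0 * min x (x powr (- alpha_u cW \<epsilon>)) \<le> \<bar>W x\<bar>"
    and up: "\<And>x. 0 < x \<Longrightarrow> \<bar>W x\<bar> \<le> C0 * min x (x powr (- alpha_l cW \<epsilon>))"
    and W_bd: "\<And>x. \<bar>W x\<bar> \<le> C1 * jap x powr (- alpha_l cW \<epsilon>)" "\<And>x. \<bar>deriv W x\<bar> \<le> C2"
    and odd: "\<forall>r\<ge>0. \<forall>z. \<omega> (r, - z) = - \<omega> (r, z)"
    and norms: "norm_Linf_Gamma \<alpha> b cW W13 \<omega> + norm_W1r_Gamma \<alpha> b cW W13 \<omega> + norm_W1z_Gamma \<alpha> b cW W13 \<omega>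
        \<le> ereal (\<epsilon> powr ((1 + kappa) / 2))"
    and flow: "is_flow (\<lambda>p. (Qr \<alpha> W \<omega> p, Qz \<alpha> W \<omega> p)) X"
  shows "\<exists>a. strain_flow a (Qr \<alpha> W \<omega>) (Qz \<alpha> W \<omega>) X"
proof -
  define c where "c = (9/8 - kappa1) * \<epsilon>"
  define \<delta> where "\<delta> = \<epsilon> powr ((1 + kappa) / 2)"
  define B where "B = 2 * \<delta> * ((1 + 2 * C13) / \<epsilon>) powr kappa"
  note kb = kappa_bounds
  \<comment> \<open>Here 9/8 - kappa1 \<ge> 1, so the factor 1/c of the strain estimate is at most
    1/\<epsilon>.\<close>
  have ce: "\<epsilon> \<le> c" unfolding c_def using mult_right_mono[of 1 "9/8 - kappa1" \<epsilon>] kb e by simp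
  have "c \<le> 9/8 * (1/30)" unfolding c_def using kb e by (intro mult_mono) auto
  then have c: "0 < c" "c \<le> 1" using ce e by auto
  have ep: "cW * \<epsilon> powr (2 - kappa) \<le> kappa1 * \<epsilon>" "0 \<le> cW * \<epsilon> powr (2 - kappa)"
  proof -
    have "\<epsilon> powr (2 - kappa) = \<epsilon> powr (1 - kappa) * \<epsilon>"
      using e powr_add[of \<epsilon> "1 - kappa" 1] by simp
    then show "cW * \<epsilon> powr (2 - kappa) \<le> kappa1 * \<epsilon>"
      using mult_right_mono[OF cW(2), of \<epsilon>] e by (simp add: mult.assoc)
  qed (use cW in simp)
  have e2: "0 \<le> eps2 cW \<epsilon>" "kappa_ag + eps2 cW \<epsilon> \<le> 1/10"
  proof -
    have "kappa1 * \<epsilon> \<le> 1/1000 * 1" using kb e by (intro mult_mono) auto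
    then show "0 \<le> eps2 cW \<epsilon>" "kappa_ag + eps2 cW \<epsilon> \<le> 1/10" using ep by (auto simp: eps2_def kappa_ag_def)
  qed
  have al: "\<alpha> + c \<le> alpha_l cW \<epsilon>" using decay_exponent[of cW \<epsilon>] e2 e by (simp add: c_def)
  have au: "\<alpha> < alpha_u cW \<epsilon>" "alpha_u cW \<epsilon> - \<alpha> \<le> 2 * \<epsilon>"
  proof -
    have "kappa1 * \<epsilon> \<le> 1/1000 * \<epsilon>" using kb e by (intro mult_right_mono) auto
    then show "\<alpha> < alpha_u cW \<epsilon>" "alpha_u cW \<epsilon> - \<alpha> \<le> 2 * \<epsilon>" using ep e unfolding alpha_u_def by linarith+
  qed
  have a: "3/10 \<le> \<alpha>" "\<alpha> \<le> 1/2" using e by auto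
  have C0: "0 \<le> C0" using up[of 1] by simp
  have C1: "0 \<le> C1" using W_bd(1)[of 0] by (simp add: jap_def)
  obtain \<Omega> \<eta> where dens: "density \<alpha> (kappa_ag + eps2 cW \<epsilon>) c B \<Omega> \<eta>" and ae: "AE q in lborel. 0 < fst q \<longrightarrow> \<omega> q = \<Omega> q"
    using omega_density[OF W13 C13 e b e2 odd norms] by (auto simp: c_def B_def \<delta>_def)
  interpret w: density \<alpha> "kappa_ag + eps2 cW \<epsilon>" c B \<Omega> \<eta> by (rule dens)
  interpret W: density \<alpha> 0 c C1 "\<lambda>q. W (snd q)" "\<lambda>q. deriv W (snd q)"
    by (rule profile_density[OF sm W_odd W_bd a c al C1])
  define K where "K = 2 * kappa_psi1 \<alpha> / pi"
  have K: "0 \<le> K" "K \<le> 7" using kappa_psi1_bounds[of \<alpha>] a by (auto simp: K_def)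
  define F where "F p = K * (W.\<Phi> p + w.\<Phi> p)" for p
  define G where "G = Psi_total \<alpha> W \<omega>"
  have BSw: "BS \<alpha> \<omega> (r,z) = K * w.\<Psi> (r,z)" if "0 \<le> r" for r z using w.BS_eq[OF that ae] by (simp add: K_def)
  have BSW: "BS \<alpha> (\<lambda>q. W (snd q)) (r,z) = K * W.\<Psi> (r,z)" if "0 \<le> r" for r z using W.BS_eq[OF that] by (simp add: K_def)
  have Geq: "G (r,z) = K * (W.\<Psi> (r,z) + w.\<Psi> (r,z))" if "0 \<le> r" for r z
    unfolding G_def Psi_total_def BSw[OF that] BSW[OF that] by (simp add: distrib_left)
  have G: "G (r,0) = 0" "((\<lambda>z. G (r,z)) has_real_derivative F (r,z)) (at z)" if "0 \<le> r" for r z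
    using Geq[OF that] w.Psi_0[OF that] W.Psi_0[OF that] DERIV_cmult[OF DERIV_add[OF W.Psi_deriv[OF that] w.Psi_deriv[OF that]], of K z]
    by (simp_all add: F_def)
  have dF: "((\<lambda>r. F (r,z)) has_real_derivative K * (dr W.\<Phi> (r,z) + dr w.\<Phi> (r,z))) (at r within {0..})"
    "((\<lambda>z. F (r,z)) has_real_derivative K * (dz W.\<Phi> (r,z) + dz w.\<Phi> (r,z))) (at z)" if "0 \<le> r" for r z
    unfolding F_def by (intro DERIV_cmult DERIV_add W.Phi_C1 w.Phi_C1 that)+
  have drF: "dr F p = K * (dr W.\<Phi> p + dr w.\<Phi> p)" "dz F p = K * (dz W.\<Phi> p + dz w.\<Phi> p)" if "p \<in> half_plane" for p
    using dr_eqI[OF _ dF(1), of "fst p" "snd p"] dz_eqI[OF dF(2), of "fst p" "snd p"] that by (simp_all add: half_plane_def)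
  have cF: "continuous_on half_plane F" "continuous_on half_plane (dr F)" "continuous_on half_plane (dz F)"
  proof -
    show "continuous_on half_plane F" unfolding F_def by (intro continuous_intros W.Phi_C1 w.Phi_C1)
    have "continuous_on half_plane (\<lambda>p. K * (dr W.\<Phi> p + dr w.\<Phi> p))" "continuous_on half_plane (\<lambda>p. K * (dz W.\<Phi> p + dz w.\<Phi> p))"
      by (intro continuous_intros W.Phi_C1 w.Phi_C1)+
    then show "continuous_on half_plane (dr F)" "continuous_on half_plane (dz F)"
      by (auto intro: continuous_on_eq simp: drF)
  qed
  have "((\<lambda>z. BS \<alpha> \<omega> (0,z)) has_real_derivative K * w.\<Phi> (0,0)) (at 0)"
    using DERIV_cmult[OF w.Psi_deriv[of 0 0], of K] BSw[of 0] by simp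
  then have cl: "c_l \<alpha> W \<omega> = 2 - 4 * \<alpha> * (LBINT y:{0..}. y powr (\<alpha> - 1) * W y) - 2 * (K * w.\<Phi> (0,0))"
    unfolding c_l_def by (simp add: dz_eqI)
  define M where "M = w.\<Phi>b"
  have M: "M * \<epsilon> \<le> 36864 * (1 + 2 * C13) * \<epsilon> powr ((1 - kappa) / 2)" "0 \<le> M"
  proof -
    have "(1 + 2 * C13) powr kappa \<le> (1 + 2 * C13) powr 1" using C13 kb by (intro powr_mono) auto
    then have "B \<le> 2 * \<delta> * ((1 + 2 * C13) / \<epsilon> powr kappa)"
      unfolding B_def using C13 e by (intro mult_left_mono) (auto simp: powr_divide \<delta>_def intro!: divide_right_mono)
    also have "\<dots> = 2 * (1 + 2 * C13) * (\<delta> / \<epsilon> powr kappa)" by simp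
    also have "\<delta> / \<epsilon> powr kappa = \<epsilon> powr ((1 - kappa) / 2)"
      unfolding \<delta>_def using e powr_diff[of \<epsilon> "(1 + kappa) / 2" kappa] by (simp add: field_simps)
    finally have B: "B \<le> 2 * (1 + 2 * C13) * \<epsilon> powr ((1 - kappa) / 2)" .
    have "M * \<epsilon> = 18432 * B * (\<epsilon> / c)" by (simp add: M_def w.\<Phi>b_def)
    also have "\<dots> \<le> 18432 * B * 1" using ce c w.B by (intro mult_left_mono) auto
    finally show "M * \<epsilon> \<le> 36864 * (1 + 2 * C13) * \<epsilon> powr ((1 - kappa) / 2)"
      using mult_left_mono[OF B, of 18432] by (simp add: algebra_simps)
    show "0 \<le> M" using w.B c by (simp add: M_def w.\<Phi>b_def)
  qed
  have W0: "W 0 = 0" using W_odd[of 0] by simp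
  have PhiW: "W.\<Phi> p \<le> 3168 * C0" if "p \<in> half_plane" for p
  proof -
    have pw: "\<bar>W x\<bar> \<le> C0 * x powr (-\<alpha>)" if x: "0 < x" for x
    proof -
      have "min x (x powr (- alpha_l cW \<epsilon>)) \<le> x powr (-\<alpha>)"
      proof (cases "x \<le> 1")
        case True
        then have "1 \<le> x powr (-\<alpha>)" using x a powr_mono'[of "-\<alpha>" 0 x] by simp
        then show ?thesis using True by simp
      next
        case False
        then have "x powr (- alpha_l cW \<epsilon>) \<le> x powr (-\<alpha>)" using al c by (intro powr_mono) auto
        then show ?thesis by simp
      qed
      then show ?thesis using up[OF x] mult_left_mono[OF _ C0] order_trans by blast
    qed
    have "\<bar>W x\<bar> \<le> C0 * \<bar>x\<bar> powr (-\<alpha>)" if "x \<noteq> 0" for x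
      using pw[of x] pw[of "-x"] W_odd[of x] that by (cases "0 < x") auto
    moreover have "W x \<le> 0" if "0 \<le> x" for x using neg[of x] W0 that by (cases "x = 0") auto
    ultimately have "W.\<Phi> (fst p, snd p) \<le> 3168 * C0"
      using that C0 by (intro W.Phi_le_of_sign[where W=W]) (auto simp: half_plane_def)
    then show ?thesis by simp
  qed
  have Phiw: "\<bar>w.\<Phi> p\<bar> \<le> M" if "p \<in> half_plane" for p
    unfolding M_def using that by (intro w.Phi_bound) (simp add: half_plane_def)
  have cont_W: "W \<in> borel_measurable borel"
    using sm[unfolded smooth1_def, rule_format, of 0]
    by (intro borel_measurable_continuous_onI continuous_at_imp_continuous_on)
       (auto intro: field_differentiable_imp_continuous_at)
  define I where "I = (LBINT y:{0..}. y powr (\<alpha> - 1) * W y)"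
  have "I \<le> - (c0 / (alpha_u cW \<epsilon> - \<alpha>))"
    unfolding I_def using a al c au C0 by (intro profile_moment[OF cont_W neg lo up]) auto
  also have "\<dots> \<le> - (c0 / (2 * \<epsilon>))" using au c0 e by (simp add: frac_le)
  finally have "\<alpha> * I \<le> \<alpha> * - (c0 / (2 * \<epsilon>))" using a by (intro mult_left_mono) auto
  also have "\<dots> \<le> 3/10 * - (c0 / (2 * \<epsilon>))" using a c0 e by (intro mult_right_mono_neg) auto
  finally have I: "6/10 * (c0 / \<epsilon>) \<le> - 4 * (\<alpha> * I)" by simp
  have pos: "F p < c_l \<alpha> W \<omega>" if p: "p \<in> half_plane" for p
  proof -
    have "K * W.\<Phi> p \<le> K * (3168 * C0)" by (rule mult_left_mono[OF PhiW[OF p] K(1)])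
    also have "\<dots> \<le> 7 * (3168 * C0)" using K C0 by (intro mult_right_mono) auto
    finally have 1: "K * W.\<Phi> p \<le> 22176 * C0" by simp
    have 2: "\<bar>K * w.\<Phi> q\<bar> \<le> 7 * M" if "q \<in> half_plane" for q
      unfolding abs_mult using Phiw[OF that] K M by (intro mult_mono) auto
    have "(21 * M + 22176 * C0) * \<epsilon> = 21 * (M * \<epsilon>) + 22176 * C0 * \<epsilon>" by (simp add: algebra_simps)
    also have "\<dots> < 6/10 * c0" using small M(1) unfolding mult.assoc by linarith
    finally have "(21 * M + 22176 * C0) * \<epsilon> < 6/10 * c0" .
    then have 3: "21 * M + 22176 * C0 < 6/10 * (c0 / \<epsilon>)" using e by (simp add: field_simps)
    have "F p = K * W.\<Phi> p + K * w.\<Phi> p" by (simp add: F_def distrib_left)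
    moreover have "c_l \<alpha> W \<omega> = 2 + - 4 * (\<alpha> * I) - 2 * (K * w.\<Phi> (0,0))" by (simp add: cl I_def)
    moreover have "(0,0) \<in> half_plane" by (simp add: half_plane_def)
    ultimately show ?thesis using 1 abs_le_D1[OF 2[OF p]] abs_le_D1[OF 2[of "(0,0)"]] 3 I by linarith
  qed
  have "strain_flow (\<lambda>p. c_l \<alpha> W \<omega> - F p) (Qr \<alpha> W \<omega>) (Qz \<alpha> W \<omega>) X"
    by (rule strain_flow_of_stream_function[OF cF _ _ G(1) G(2) pos _ _ flow])
       (use dF drF in \<open>simp_all add: Qr_def Qz_def G_def half_plane_def\<close>)
  then show ?thesis by blast
qed

section \<open>The threshold on \<epsilon> and the identity for the given flow\<close>

theorem lemma5p2:
  fixes W13 \<beta> :: "real \<Rightarrow> real" and cW :: real and Wb :: "real \<Rightarrow> real \<Rightarrow> real"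
  assumes "profile_family W13 \<beta> cW Wb"
  shows "\<exists>\<epsilon>7>0. \<forall>\<epsilon> \<alpha>. 0 < \<epsilon> \<and> \<epsilon> = 1/3 - \<alpha> \<and> \<epsilon> \<le> \<epsilon>7 \<longrightarrow>
    (\<forall>(\<omega> :: real \<times> real \<Rightarrow> real) (Q\<^sub>r :: real \<times> real \<Rightarrow> real) (Q\<^sub>z :: real \<times> real \<Rightarrow> real)
       (X :: real \<Rightarrow> real \<times> real \<Rightarrow> real \<times> real)
       (f :: real \<times> real \<Rightarrow> real) (g :: real \<times> real \<Rightarrow> real).
      (\<forall>r\<ge>0. \<forall>z. \<omega> (r, - z) = - \<omega> (r, z)) \<and>
      norm_Linf_Gamma \<alpha> (\<beta> \<alpha>) cW W13 \<omega> + norm_W1r_Gamma \<alpha> (\<beta> \<alpha>) cW W13 \<omega>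
        + norm_W1z_Gamma \<alpha> (\<beta> \<alpha>) cW W13 \<omega> \<le> ereal (\<epsilon> powr ((1 + kappa) / 2)) \<and>
      Q\<^sub>r = Qr \<alpha> (Wb \<alpha>) \<omega> \<and> Q\<^sub>z = Qz \<alpha> (Wb \<alpha>) \<omega> \<and>
      is_flow (\<lambda>p. (Q\<^sub>r p, Q\<^sub>z p)) X \<and>
      (\<forall>D T. compact D \<and> D \<subseteq> off_axis \<and> 0 < T \<longrightarrow>
         Ck_on 1 D g \<and>
         continuous_on D f \<and>
         C0_upto_boundary D (\<lambda>p. g p / fst p) \<and>
         C0_upto_boundary D (\<lambda>p. snd p * dz g p / fst p) \<and>
         (\<forall>s\<in>{-T..T}. \<forall>x\<in>D. (\<lambda>s. f (X s x)) field_differentiable (at s)) \<and>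
         continuous_on ({-T..T} \<times> D) (\<lambda>(s, x). deriv (\<lambda>s. f (X s x)) s)) \<and>
      (\<forall>z. z \<noteq> 0 \<longrightarrow> g (0, z) = 0)
      \<longrightarrow>
      (\<forall>x\<in>off_axis. \<forall>\<tau>>0.
         let lhs = (\<lambda>s. dr g (X s x) * f (X s x));
             rhs = (\<lambda>s. bdry_value (\<lambda>y. Q\<^sub>z (X s y) / Q\<^sub>r (X s y) * dz g (X s y) * f (X s y)) x
                      + bdry_value (\<lambda>y. g (X s y) * deriv (\<lambda>t. f (X t y) / Q\<^sub>r (X t y)) s) x);
             bdry = (\<lambda>s. bdry_value (\<lambda>y. f (X s y) * g (X s y) / Q\<^sub>r (X s y)) x)
         in set_integrable lborel {-\<tau>..0} lhs \<and>
            set_integrable lborel {-\<tau>..0} rhs \<and>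
            (LBINT s:{-\<tau>..0}. lhs s) = - (LBINT s:{-\<tau>..0}. rhs s) + (bdry 0 - bdry (- \<tau>))))"
proof -
  note pf2 = assms[unfolded profile_family_def, THEN conjunct2, THEN conjunct2]
  note pf4 = pf2[THEN conjunct2, THEN conjunct2]
  obtain C13 where W13: "\<And>x. 0 \<le> x \<Longrightarrow> \<bar>W13 x\<bar> \<le> C13 * min x (jap x powr (-1/3))"
    using pf2[THEN conjunct1] by blast
  have C13: "0 \<le> C13"
  proof -
    have "0 \<le> C13 * min 1 (jap 1 powr (-1/3))" using W13[of 1] by simp
    moreover have "0 < min 1 (jap 1 powr (-1/3))" using jap_pos[of 1] by simp
    ultimately show ?thesis by (meson linorder_not_le mult_neg_pos)
  qed
  have cW: "0 < cW" by (rule pf2[THEN conjunct2, THEN conjunct1])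
  obtain \<epsilon>0 c0 C0 C' where e0: "0 < \<epsilon>0" and c0: "0 < c0" and
    fam: "\<forall>\<epsilon> \<alpha>. 0 < \<epsilon> \<and> \<epsilon> \<le> \<epsilon>0 \<and> \<alpha> = 1/3 - \<epsilon> \<longrightarrow>
        \<bar>\<beta> \<alpha> + \<epsilon>/8\<bar> \<le> C0 * \<epsilon> powr (4/3) \<and> - \<epsilon>/2 \<le> \<beta> \<alpha> \<and> \<beta> \<alpha> \<le> 0 \<and>
        is_profile \<alpha> (Wb \<alpha>) \<and>
        (\<forall>x>0. Wb \<alpha> x < 0) \<and>
        deriv (Wb \<alpha>) 0 = deriv W13 0 \<and>
        (\<forall>x>0. c0 * min x (x powr (- alpha_u cW \<epsilon>)) \<le> \<bar>Wb \<alpha> x\<bar> \<and>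
               \<bar>Wb \<alpha> x\<bar> \<le> C0 * min x (x powr (- alpha_l cW \<epsilon>))) \<and>
        (\<forall>k x. \<bar>(deriv ^^ k) (Wb \<alpha>) x\<bar> \<le> C' k * jap x powr (- real k - alpha_l cW \<epsilon>)) \<and>
        (\<forall>x>0. \<bar>(Wb \<alpha> x - jap x powr \<beta> \<alpha> * W13 x) *
                (x powr (-12/10) + x powr (1/3 - \<beta> \<alpha> - kappa1 * \<epsilon>)
                                   * jap (Jfun \<alpha> (\<beta> \<alpha>) W13 x) powr (- kappa))\<bar> \<le> C0 * \<epsilon>)"
    using pf4 by (elim conjE exE) (rule that)
  \<comment> \<open>The left side of the smallness condition in \<open>velocity_strain_flow\<close>.
    It tends to 0 with \<epsilon> because kappa < 1, while c0 is fixed.\<close>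
  define N where "N \<epsilon> = 774144 * (1 + 2 * C13) * \<epsilon> powr ((1 - kappa) / 2) + 22176 * C0 * \<epsilon>" for \<epsilon>
  have p0: "((\<lambda>\<epsilon>::real. \<epsilon> powr s) \<longlongrightarrow> 0) (at_right 0)" if "0 < s" for s
    by (rule tendsto_zero_powrI[OF _ tendsto_const _ that]) (auto intro: tendsto_ident_at simp: eventually_at_filter)
  have "(N \<longlongrightarrow> 774144 * (1 + 2 * C13) * 0 + 22176 * C0 * 0) (at_right 0)"
    unfolding N_def using kappa_bounds by (intro tendsto_intros p0) auto
  then have ev1: "\<forall>\<^sub>F \<epsilon> in at_right 0. N \<epsilon> < 6/10 * c0" using c0 by (intro order_tendstoD(2)) auto
  have "((\<lambda>\<epsilon>. cW * \<epsilon> powr (1 - kappa)) \<longlongrightarrow> cW * 0) (at_right 0)" using kappa_bounds by (intro tendsto_intros p0) auto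
  then have ev2: "\<forall>\<^sub>F \<epsilon> in at_right 0. cW * \<epsilon> powr (1 - kappa) < kappa1" using kappa_bounds by (intro order_tendstoD(2)) auto
  obtain d where d: "0 < d" "\<And>\<epsilon>. 0 < \<epsilon> \<Longrightarrow> \<epsilon> < d \<Longrightarrow> N \<epsilon> < 6/10 * c0 \<and> cW * \<epsilon> powr (1 - kappa) < kappa1"
    using eventually_conj[OF ev1 ev2] unfolding eventually_at_right_field by blast
  \<comment> \<open>d/2 turns the strict condition \<epsilon> < d into a closed one, and 1/30 keeps
    \<alpha> \<ge> 3/10.\<close>
  define \<epsilon>7 where "\<epsilon>7 = Min {d / 2, \<epsilon>0, 1/30}"
  have e7: "0 < \<epsilon>7" "\<epsilon>7 < d" "\<epsilon>7 \<le> \<epsilon>0" "\<epsilon>7 \<le> 1/30" using d(1) e0 by (auto simp: \<epsilon>7_def)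
  show ?thesis
  proof (intro exI[of _ \<epsilon>7] conjI e7(1) allI impI ballI, elim conjE)
    fix \<epsilon> \<alpha> \<tau> :: real and \<omega> Q\<^sub>r Q\<^sub>z f g :: "real \<times> real \<Rightarrow> real" and X :: "real \<Rightarrow> real \<times> real \<Rightarrow> real \<times> real" and x :: "real \<times> real"
    assume e: "0 < \<epsilon>" "\<epsilon> = 1/3 - \<alpha>" "\<epsilon> \<le> \<epsilon>7" and x: "x \<in> off_axis" and \<tau>: "0 < \<tau>"
      and odd: "\<forall>r\<ge>0. \<forall>z. \<omega> (r, - z) = - \<omega> (r, z)"
      and norms: "norm_Linf_Gamma \<alpha> (\<beta> \<alpha>) cW W13 \<omega> + norm_W1r_Gamma \<alpha> (\<beta> \<alpha>) cW W13 \<omega>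
        + norm_W1z_Gamma \<alpha> (\<beta> \<alpha>) cW W13 \<omega> \<le> ereal (\<epsilon> powr ((1 + kappa) / 2))"
      and Q: "Q\<^sub>r = Qr \<alpha> (Wb \<alpha>) \<omega>" "Q\<^sub>z = Qz \<alpha> (Wb \<alpha>) \<omega>"
      and flow: "is_flow (\<lambda>p. (Q\<^sub>r p, Q\<^sub>z p)) X"
      and reg: "\<forall>D T. compact D \<and> D \<subseteq> off_axis \<and> 0 < T \<longrightarrow>
         Ck_on 1 D g \<and>
         continuous_on D f \<and>
         C0_upto_boundary D (\<lambda>p. g p / fst p) \<and>
         C0_upto_boundary D (\<lambda>p. snd p * dz g p / fst p) \<and>
         (\<forall>s\<in>{-T..T}. \<forall>x\<in>D. (\<lambda>s. f (X s x)) field_differentiable (at s)) \<and>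
         continuous_on ({-T..T} \<times> D) (\<lambda>(s, x). deriv (\<lambda>s. f (X s x)) s)"
    have ee: "\<epsilon> \<le> \<epsilon>0" "\<epsilon> \<le> 1/30" "\<epsilon> < d" "\<alpha> = 1/3 - \<epsilon>" using e e7 by auto
    note fm = fam[THEN spec, THEN spec, THEN mp, OF conjI[OF e(1) conjI[OF ee(1) ee(4)]], THEN conjunct2, THEN conjunct2]
    have \<beta>: "\<beta> \<alpha> \<le> 0" using fm by (elim conjE)
    have pr: "smooth1 (Wb \<alpha>)" "\<And>x. Wb \<alpha> (- x) = - Wb \<alpha> x"
      using fm[THEN conjunct2, THEN conjunct1] by (auto simp: is_profile_def)
    note fm4 = fm[THEN conjunct2, THEN conjunct2]
    have neg: "\<And>x. 0 < x \<Longrightarrow> Wb \<alpha> x < 0" using fm4[THEN conjunct1] by blast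
    note fm6 = fm4[THEN conjunct2, THEN conjunct2]
    have lo: "\<And>x. 0 < x \<Longrightarrow> c0 * min x (x powr (- alpha_u cW \<epsilon>)) \<le> \<bar>Wb \<alpha> x\<bar>"
      and up: "\<And>x. 0 < x \<Longrightarrow> \<bar>Wb \<alpha> x\<bar> \<le> C0 * min x (x powr (- alpha_l cW \<epsilon>))"
      using fm6[THEN conjunct1] by blast+
    have der: "\<bar>(deriv ^^ k) (Wb \<alpha>) x\<bar> \<le> C' k * jap x powr (- real k - alpha_l cW \<epsilon>)" for k x
      by (rule fm6[THEN conjunct2, THEN conjunct1, THEN spec, THEN spec])
    have W0: "\<bar>Wb \<alpha> x\<bar> \<le> C' 0 * jap x powr (- alpha_l cW \<epsilon>)" for x using der[of 0 x] by simp
    have al0: "0 \<le> alpha_l cW \<epsilon>"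
    proof -
      have "cW * \<epsilon> powr (2 - kappa) = cW * \<epsilon> powr (1 - kappa) * \<epsilon>"
        using e powr_add[of \<epsilon> "1 - kappa" 1] by simp
      also have "\<dots> \<le> 1 * (1/30)" using d(2)[OF e(1) ee(3)] kappa_bounds e(1) ee(2) cW by (intro mult_mono) auto
      finally show ?thesis using e(1) by (simp add: alpha_l_def)
    qed
    have W1: "\<bar>deriv (Wb \<alpha>) x\<bar> \<le> C' 1" for x
    proof -
      have "0 \<le> C' 1" using der[of 1 0] by (simp add: jap_def)
      moreover have "jap x powr (- 1 - alpha_l cW \<epsilon>) \<le> jap x powr 0" using jap_ge(1)[of x] al0 by (intro powr_mono) auto
      ultimately have "C' 1 * jap x powr (- 1 - alpha_l cW \<epsilon>) \<le> C' 1 * 1" using jap_pos[of x] by (intro mult_left_mono) auto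
      then show ?thesis using der[of 1 x] by simp
    qed
    have "\<exists>a. strain_flow a (Qr \<alpha> (Wb \<alpha>) \<omega>) (Qz \<alpha> (Wb \<alpha>) \<omega>) X"
      using d(2)[OF e(1) ee(3)]
      by (intro velocity_strain_flow[OF e(1) ee(2,4) \<beta> cW _ C13 c0 W13 _ pr neg lo up W0 W1 odd norms flow[unfolded Q]])
         (auto simp: N_def)
    then obtain a where sf: "strain_flow a Q\<^sub>r Q\<^sub>z X" unfolding Q by blast
    interpret ibp_flow a Q\<^sub>r Q\<^sub>z X f g
      by (intro ibp_flow.intro sf ibp_flow_axioms.intro) (rule reg[THEN spec, THEN spec, THEN mp], intro conjI)
    show "let lhs = (\<lambda>s. dr g (X s x) * f (X s x));
             rhs = (\<lambda>s. bdry_value (\<lambda>y. Q\<^sub>z (X s y) / Q\<^sub>r (X s y) * dz g (X s y) * f (X s y)) x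
                      + bdry_value (\<lambda>y. g (X s y) * deriv (\<lambda>t. f (X t y) / Q\<^sub>r (X t y)) s) x);
             bdry = (\<lambda>s. bdry_value (\<lambda>y. f (X s y) * g (X s y) / Q\<^sub>r (X s y)) x)
         in set_integrable lborel {-\<tau>..0} lhs \<and>
            set_integrable lborel {-\<tau>..0} rhs \<and>
            (LBINT s:{-\<tau>..0}. lhs s) = - (LBINT s:{-\<tau>..0}. rhs s) + (bdry 0 - bdry (- \<tau>))"
      using ibp[OF x \<tau>] unfolding I1_def[abs_def] I2_def[abs_def] Bd_def[abs_def] Let_def by (intro conjI)
  qed
qed

end
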